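(* Let $k$ be a field of characteristic zero, $A$ an associative unital $k$-algebra, $V$ a nonzero finite-dimensional $k$-vector space and $\varrho:A\to\mathrm{End}\,V$ a representation. There are canonical isomorphisms $$\mathrm T_\varrho\mathrm{DRep}_V(A)_n\cong\begin{cases}\mathrm{Der}(A,\mathrm{End}\,V)&\text{if } n=0,\\ \mathrm{HH}^{n+1}(A,\mathrm{End}\,V)&\text{if } n\ge1,\end{cases}$$ where $\mathrm{HH}^\bullet(A,\mathrm{End}\,V)$ denotes the Hochschild cohomology of $A$ with coefficients in the bimodule $\mathrm{End}\,V$ (via $\varrho$).
   Context: Differentials have degree $-1$. Let $R\to A$ be a cofibrant resolution of $A$ in the model category of DG $k$-algebras (weak equivalences: quasi-isomorphisms; fibrations: surjections). $R_V$ is the commutative DG algebra with $\mathrm{Hom}(R_V,C)\cong\mathrm{Hom}(R,\mathrm{End}\,V\otimes C)$ for all commutative DG algebras $C$; it represents $\mathrm{DRep}_V(A)$ in the homotopy category of commutative DG algebras. Let $\varrho_V:R_V\to k$ be the DG algebra map corresponding to $R\to A\xrightarrow{\varrho}\mathrm{End}\,V$, and view $k$ as a DG $R_V$-module via $\varrho_V$. Let $\underline{\mathrm{Der}}(R_V,k)$ be the complex of $k$-linear graded derivations $R_V\to k$ with differential the commutator with the differentials. The derived tangent space at $\varrho$ is the homology of this complex, and $\mathrm T_\varrho\mathrm{DRep}_V(A)_n$ is the homology of $\underline{\mathrm{Der}}(R_V,k)$ in cohomological degree $n$, i.e. represented by derivations lowering homological degree by $n$ (so derivations of homological degree $-n$).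 $\mathrm{Der}(A,\mathrm{End}\,V)$ is the space of all $k$-linear derivations $A\to\mathrm{End}\,V$. *)

theory Defs
  imports Complex_Main "HOL-Algebra.Module" "HOL-Algebra.AbelCoset"
begin

section \<open>Vector spaces and algebras over the ground field\<close>

text \<open>
  The ground field, the algebra \<open>A\<close> and the vector space \<open>V\<close> are whole types. Everything that varies
  (DG algebras, tensor products, complexes of derivations, cohomology) is a HOL-Algebra record with
  a carrier. A vector space is a \<open>module\<close> record whose ring multiplication is irrelevant.
\<close>

definition alg_of :: "('k \<Rightarrow> 'a \<Rightarrow> 'a::ring_1) \<Rightarrow> ('k, 'a) module" where
  "alg_of s = \<lparr>carrier = UNIV, mult = (*), one = 1, zero = 0, add = (+), smult = s\<rparr>"

text \<open>The field \<open>k\<close>, used both as the ring of scalars and as a one-dimensional algebra.\<close>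

definition ground :: "('k::field, 'k) module" where
  "ground = alg_of (*)"

definition k_algebra :: "('k::field \<Rightarrow> 'a \<Rightarrow> 'a::ring_1) \<Rightarrow> bool" where
  "k_algebra s \<longleftrightarrow> vector_space s \<and>
     (\<forall>c x y. s c x * y = s c (x * y) \<and> x * s c y = s c (x * y))"

definition End_alg :: "('k::field \<Rightarrow> 'v \<Rightarrow> 'v::ab_group_add) \<Rightarrow> ('k, 'v \<Rightarrow> 'v) module" where
  "End_alg s = \<lparr>carrier = {f. Vector_Spaces.linear s s f}, mult = (\<lambda>f g. f \<circ> g), one = id,
     zero = (\<lambda>_. 0), add = (\<lambda>f g v. f v + g v), smult = (\<lambda>c f v. s c (f v))\<rparr>"

definition representation ::
  "('k::field \<Rightarrow> 'a \<Rightarrow> 'a::ring_1) \<Rightarrow> ('k \<Rightarrow> 'v \<Rightarrow> 'v::ab_group_add) \<Rightarrow> ('a \<Rightarrow> 'v \<Rightarrow> 'v) \<Rightarrow> bool" where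
  "representation sA sV \<rho> \<longleftrightarrow> \<rho> \<in> ring_hom (alg_of sA) (End_alg sV) \<and>
     (\<forall>c a. \<rho> (sA c a) = c \<odot>\<^bsub>End_alg sV\<^esub> \<rho> a)"

definition linear_iso ::
  "('k, 'x, 'm) module_scheme \<Rightarrow> ('k, 'y, 'n) module_scheme \<Rightarrow> ('x \<Rightarrow> 'y) \<Rightarrow> bool" where
  "linear_iso M N h \<longleftrightarrow> bij_betw h (carrier M) (carrier N) \<and>
     (\<forall>x\<in>carrier M. \<forall>y\<in>carrier M. h (x \<oplus>\<^bsub>M\<^esub> y) = h x \<oplus>\<^bsub>N\<^esub> h y) \<and>
     (\<forall>c. \<forall>x\<in>carrier M. h (c \<odot>\<^bsub>M\<^esub> x) = c \<odot>\<^bsub>N\<^esub> h x)"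

text \<open>The space \<open>Z\<close> of functions with values in \<open>M\<close>, under pointwise operations.\<close>

definition fun_module ::
  "('k, 'm, 'z) module_scheme \<Rightarrow> ('i \<Rightarrow> 'm) set \<Rightarrow> ('k, 'i \<Rightarrow> 'm) module" where
  "fun_module M Z = \<lparr>carrier = Z, mult = undefined, one = undefined, zero = (\<lambda>_. \<zero>\<^bsub>M\<^esub>),
     add = (\<lambda>f g i. f i \<oplus>\<^bsub>M\<^esub> g i), smult = (\<lambda>c f i. c \<odot>\<^bsub>M\<^esub> f i)\<rparr>"

definition quot_module :: "('k, 'x, 'm) module_scheme \<Rightarrow> 'x set \<Rightarrow> ('k, 'x set) module" where
  "quot_module M B = \<lparr>carrier = a_rcosets\<^bsub>M\<^esub> B, mult = undefined, one = undefined, zero = B,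
     add = (\<lambda>X Y. X <+>\<^bsub>M\<^esub> Y), smult = (\<lambda>c X. B <+>\<^bsub>M\<^esub> ((\<odot>\<^bsub>M\<^esub>) c ` X))\<rparr>"


section \<open>DG algebras\<close>

text \<open>Differentials have degree -1, gradings are by \<open>\<int>\<close>.\<close>

record ('k, 'x) dga = "('k, 'x) module" +
  gr :: "int \<Rightarrow> 'x set"
  diff :: "'x \<Rightarrow> 'x"

definition dg_algebra :: "('k::field, 'x) dga \<Rightarrow> bool" where
  "dg_algebra R \<longleftrightarrow> ring R \<and> module ground R \<and>
     (\<forall>c. \<forall>x\<in>carrier R. \<forall>y\<in>carrier R.
        (c \<odot>\<^bsub>R\<^esub> x) \<otimes>\<^bsub>R\<^esub> y = c \<odot>\<^bsub>R\<^esub> (x \<otimes>\<^bsub>R\<^esub> y) \<and> x \<otimes>\<^bsub>R\<^esub> (c \<odot>\<^bsub>R\<^esub> y) = c \<odot>\<^bsub>R\<^esub> (x \<otimes>\<^bsub>R\<^esub> y)) \<and>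
     (\<forall>i. submodule (gr R i) ground R) \<and>
     (\<forall>x\<in>carrier R. \<exists>!f. (\<forall>i. f i \<in> gr R i) \<and> finite {i. f i \<noteq> \<zero>\<^bsub>R\<^esub>} \<and>
        x = finsum R f {i. f i \<noteq> \<zero>\<^bsub>R\<^esub>}) \<and>
     \<one>\<^bsub>R\<^esub> \<in> gr R 0 \<and>
     (\<forall>i j. \<forall>x\<in>gr R i. \<forall>y\<in>gr R j. x \<otimes>\<^bsub>R\<^esub> y \<in> gr R (i + j)) \<and>
     (\<forall>x\<in>carrier R. \<forall>y\<in>carrier R. diff R (x \<oplus>\<^bsub>R\<^esub> y) = diff R x \<oplus>\<^bsub>R\<^esub> diff R y) \<and>
     (\<forall>c. \<forall>x\<in>carrier R. diff R (c \<odot>\<^bsub>R\<^esub> x) = c \<odot>\<^bsub>R\<^esub> diff R x) \<and>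
     (\<forall>i. \<forall>x\<in>gr R i. diff R x \<in> gr R (i - 1)) \<and>
     (\<forall>x\<in>carrier R. diff R (diff R x) = \<zero>\<^bsub>R\<^esub>) \<and>
     (\<forall>i. \<forall>x\<in>gr R i. \<forall>y\<in>carrier R.
        diff R (x \<otimes>\<^bsub>R\<^esub> y) = diff R x \<otimes>\<^bsub>R\<^esub> y \<oplus>\<^bsub>R\<^esub> ((-1) powi i) \<odot>\<^bsub>R\<^esub> (x \<otimes>\<^bsub>R\<^esub> diff R y))"

definition dg_commutative :: "('k::field, 'x) dga \<Rightarrow> bool" where
  "dg_commutative R \<longleftrightarrow>
     (\<forall>i j. \<forall>x\<in>gr R i. \<forall>y\<in>gr R j. x \<otimes>\<^bsub>R\<^esub> y = ((-1) powi (i * j)) \<odot>\<^bsub>R\<^esub> (y \<otimes>\<^bsub>R\<^esub> x))"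

definition dg_hom :: "('k::field, 'x) dga \<Rightarrow> ('k, 'y) dga \<Rightarrow> ('x \<Rightarrow> 'y) set" where
  "dg_hom R S = {f \<in> ring_hom R S \<inter> extensional (carrier R).
     (\<forall>c. \<forall>x\<in>carrier R. f (c \<odot>\<^bsub>R\<^esub> x) = c \<odot>\<^bsub>S\<^esub> f x) \<and>
     (\<forall>i. f ` gr R i \<subseteq> gr S i) \<and>
     (\<forall>x\<in>carrier R. f (diff R x) = diff S (f x))}"

definition in_degree_0 :: "('k, 'x) module \<Rightarrow> ('k, 'x) dga" where
  "in_degree_0 M = module.extend M
     \<lparr>gr = (\<lambda>i. if i = 0 then carrier M else {\<zero>\<^bsub>M\<^esub>}), diff = (\<lambda>_. \<zero>\<^bsub>M\<^esub>)\<rparr>"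

definition dg_boundaries :: "('k, 'x) dga \<Rightarrow> int \<Rightarrow> 'x set" where
  "dg_boundaries R i = diff R ` gr R (i + 1)"

definition dg_homology :: "('k, 'x) dga \<Rightarrow> int \<Rightarrow> ('k, 'x set) module" where
  "dg_homology R i =
     quot_module (R\<lparr>carrier := {x \<in> gr R i. diff R x = \<zero>\<^bsub>R\<^esub>}\<rparr>) (dg_boundaries R i)"

definition quasi_iso :: "('k::field, 'x) dga \<Rightarrow> ('k, 'y) dga \<Rightarrow> ('x \<Rightarrow> 'y) \<Rightarrow> bool" where
  "quasi_iso R S f \<longleftrightarrow> f \<in> dg_hom R S \<and>
     (\<forall>i. bij_betw (\<lambda>X. dg_boundaries S i <+>\<^bsub>S\<^esub> f ` X)
        (carrier (dg_homology R i)) (carrier (dg_homology S i)))"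

text \<open>
  Cofibrant objects: the left lifting property against all surjective quasi-isomorphisms. HOL cannot
  quantify over types inside a formula, so the test objects are the DG algebras whose carriers are
  subsets of the type \<open>'u\<close> that also contains the carrier of \<open>R\<close>. If \<open>R\<close> is nonzero and \<open>k\<close> has
  characteristic zero, this loses nothing: \<open>'u\<close> is infinite and at least as large as \<open>k\<close>, so a
  semi-free DG algebra \<open>F\<close> with a surjective quasi-isomorphism onto \<open>R\<close> can be found on a subset of \<open>'u\<close>,
  and lifting the identity of \<open>R\<close> exhibits \<open>R\<close> as a retract of \<open>F\<close>. A resolution of a nonzero algebra is
  nonzero.
\<close>

definition cofibrant :: "('k::field, 'u) dga \<Rightarrow> bool" where
  "cofibrant R \<longleftrightarrow> dg_algebra R \<and>
     (\<forall>(E :: ('k, 'u) dga) (B :: ('k, 'u) dga) p f.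
        dg_algebra E \<and> dg_algebra B \<and> quasi_iso E B p \<and> p ` carrier E = carrier B \<and> f \<in> dg_hom R B
        \<longrightarrow> (\<exists>g\<in>dg_hom R E. \<forall>x\<in>carrier R. p (g x) = f x))"

definition cofibrant_resolution ::
  "('k::field, 'u) dga \<Rightarrow> ('k, 'a) module \<Rightarrow> ('u \<Rightarrow> 'a) \<Rightarrow> bool" where
  "cofibrant_resolution R A \<epsilon> \<longleftrightarrow> cofibrant R \<and> quasi_iso R (in_degree_0 A) \<epsilon>"


section \<open>Tensor products\<close>

text \<open>
  The tensor product over \<open>k\<close> of an algebra \<open>E\<close> and a DG algebra \<open>C\<close> is the free vector space on
  \<open>E \<times> C\<close>, realised as finitely supported functions, modulo the bilinearity relations. As \<open>E\<close> sits in
  degree 0, no Koszul signs occur.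
\<close>

definition supp :: "('p \<Rightarrow> 'k::zero) \<Rightarrow> 'p set" where
  "supp f = {p. f p \<noteq> 0}"

definition single :: "'p \<Rightarrow> 'p \<Rightarrow> 'k::field" where
  "single p = (\<lambda>q. if q = p then 1 else 0)"

definition free_space :: "'p set \<Rightarrow> ('k::field, 'p \<Rightarrow> 'k) module" where
  "free_space P = fun_module ground {f. finite (supp f) \<and> supp f \<subseteq> P}"

definition bilinear_gens ::
  "('k::field, 'e, 'm) module_scheme \<Rightarrow> ('k, 'c, 'n) module_scheme \<Rightarrow> ('e \<times> 'c \<Rightarrow> 'k) set" where
  "bilinear_gens E C =
     {(\<lambda>q. single (e \<oplus>\<^bsub>E\<^esub> e', c) q - single (e, c) q - single (e', c) q) | e e' c.
        e \<in> carrier E \<and> e' \<in> carrier E \<and> c \<in> carrier C} \<union>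
     {(\<lambda>q. single (e, c \<oplus>\<^bsub>C\<^esub> c') q - single (e, c) q - single (e, c') q) | e c c'.
        e \<in> carrier E \<and> c \<in> carrier C \<and> c' \<in> carrier C} \<union>
     {(\<lambda>q. single (t \<odot>\<^bsub>E\<^esub> e, c) q - t * single (e, c) q) | t e c. e \<in> carrier E \<and> c \<in> carrier C} \<union>
     {(\<lambda>q. single (e, t \<odot>\<^bsub>C\<^esub> c) q - t * single (e, c) q) | t e c. e \<in> carrier E \<and> c \<in> carrier C}"

definition tensor_rel ::
  "('k::field, 'e, 'm) module_scheme \<Rightarrow> ('k, 'c, 'n) module_scheme \<Rightarrow> ('e \<times> 'c \<Rightarrow> 'k) set" where
  "tensor_rel E C = \<Inter>{H. submodule H ground (free_space (carrier E \<times> carrier C)) \<and> bilinear_gens E C \<subseteq> H}"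

definition tensor_class ::
  "('k::field, 'e, 'm) module_scheme \<Rightarrow> ('k, 'c, 'n) module_scheme \<Rightarrow> ('e \<times> 'c \<Rightarrow> 'k) \<Rightarrow> ('e \<times> 'c \<Rightarrow> 'k) set"
  where
  "tensor_class E C f = tensor_rel E C +>\<^bsub>free_space (carrier E \<times> carrier C)\<^esub> f"

definition pure_tensor ::
  "('k::field, 'e, 'm) module_scheme \<Rightarrow> ('k, 'c, 'n) module_scheme \<Rightarrow> 'e \<Rightarrow> 'c \<Rightarrow> ('e \<times> 'c \<Rightarrow> 'k) set" where
  "pure_tensor E C e c = tensor_class E C (single (e, c))"

text \<open>Linear extensions of \<open>p \<mapsto> h p\<close> and \<open>(p, q) \<mapsto> h p q\<close> to free vector spaces.\<close>

definition push :: "('p \<Rightarrow> 'q) \<Rightarrow> ('p \<Rightarrow> 'k::field) \<Rightarrow> 'q \<Rightarrow> 'k" where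
  "push h f = (\<lambda>r. \<Sum>p\<in>{p \<in> supp f. h p = r}. f p)"

definition push2 :: "('p \<Rightarrow> 'q \<Rightarrow> 'r) \<Rightarrow> ('p \<Rightarrow> 'k::field) \<Rightarrow> ('q \<Rightarrow> 'k) \<Rightarrow> 'r \<Rightarrow> 'k" where
  "push2 h f g = (\<lambda>r. \<Sum>(p, q)\<in>{(p, q). p \<in> supp f \<and> q \<in> supp g \<and> h p q = r}. f p * g q)"

text \<open>
  Below, the unions over representatives are unions of equal cosets: \<open>mult\<close>, \<open>diff\<close> and
  \<open>tensor_map\<close> are the operations induced on classes by \<open>(e \<otimes> c) (e' \<otimes> c') = e e' \<otimes> c c'\<close>,
  \<open>d (e \<otimes> c) = e \<otimes> d c\<close> and \<open>e \<otimes> c \<mapsto> e \<otimes> g c\<close> (for linear \<open>g\<close>).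
\<close>

definition tensor_dga :: "('k::field, 'e) module \<Rightarrow> ('k, 'c) dga \<Rightarrow> ('k, ('e \<times> 'c \<Rightarrow> 'k) set) dga" where
  "tensor_dga E C =
     module.extend
       ((quot_module (free_space (carrier E \<times> carrier C)) (tensor_rel E C))
         \<lparr>mult := (\<lambda>X Y. \<Union>f\<in>X. \<Union>g\<in>Y. tensor_class E C
                     (push2 (\<lambda>(e, c) (e', c'). (e \<otimes>\<^bsub>E\<^esub> e', c \<otimes>\<^bsub>C\<^esub> c')) f g)),
          one := pure_tensor E C \<one>\<^bsub>E\<^esub> \<one>\<^bsub>C\<^esub>\<rparr>)
       \<lparr>gr = (\<lambda>i. tensor_class E C ` carrier (free_space (carrier E \<times> gr C i))),
        diff = (\<lambda>X. \<Union>f\<in>X. tensor_class E C (push (map_prod id (diff C)) f))\<rparr>"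

definition tensor_map ::
  "('k::field, 'e) module \<Rightarrow> ('k, 'c) dga \<Rightarrow> ('d \<Rightarrow> 'c) \<Rightarrow> ('e \<times> 'd \<Rightarrow> 'k) set \<Rightarrow> ('e \<times> 'c \<Rightarrow> 'k) set" where
  "tensor_map E C g X = (\<Union>f\<in>X. tensor_class E C (push (map_prod id g) f))"


section \<open>The derived representation algebra\<close>

text \<open>
  \<open>RV\<close> represents \<open>C \<mapsto> Hom (R, E \<otimes> C)\<close> on commutative DG algebras, with universal element
  \<open>\<pi> : R \<rightarrow> E \<otimes> RV\<close>; by the Yoneda lemma this is the same as a natural bijection
  \<open>Hom (RV, C) \<cong> Hom (R, E \<otimes> C)\<close>. The test objects \<open>C\<close> again live on the type \<open>'u\<close>. For nonzero \<open>R\<close>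
  and finite-dimensional \<open>E\<close> this is no restriction: the representing object is generated by
  finitely many copies of \<open>R\<close>, so a copy of it lives on a subset of \<open>'u\<close>.
\<close>

definition represents ::
  "('k::field, 'u) dga \<Rightarrow> ('k, 'e) module \<Rightarrow> ('k, 'u) dga \<Rightarrow> ('u \<Rightarrow> ('e \<times> 'u \<Rightarrow> 'k) set) \<Rightarrow> bool" where
  "represents R E RV \<pi> \<longleftrightarrow> dg_algebra RV \<and> dg_commutative RV \<and> \<pi> \<in> dg_hom R (tensor_dga E RV) \<and>
     (\<forall>C :: ('k, 'u) dga. dg_algebra C \<and> dg_commutative C \<longrightarrow>
        bij_betw (\<lambda>g. restrict (tensor_map E C g \<circ> \<pi>) (carrier R))
          (dg_hom RV C) (dg_hom R (tensor_dga E C)))"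

text \<open>The map \<open>\<rho>V : RV \<rightarrow> k\<close> corresponding to \<open>R \<rightarrow> A \<rightarrow> E = E \<otimes> k\<close>.\<close>

definition corresponds ::
  "('k::field, 'u) dga \<Rightarrow> ('k, 'e) module \<Rightarrow> ('k, 'u) dga \<Rightarrow> ('u \<Rightarrow> ('e \<times> 'u \<Rightarrow> 'k) set) \<Rightarrow>
   ('u \<Rightarrow> 'e) \<Rightarrow> ('u \<Rightarrow> 'k) \<Rightarrow> bool" where
  "corresponds R E RV \<pi> f \<rho>V \<longleftrightarrow> \<rho>V \<in> dg_hom RV (in_degree_0 ground) \<and>
     (\<forall>x\<in>carrier R. tensor_map E (in_degree_0 ground) \<rho>V (\<pi> x) =
        pure_tensor E (in_degree_0 ground) (f x) 1)"


section \<open>Derivations and the derived tangent space\<close>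

text \<open>
  Derivations \<open>S \<rightarrow> T\<close> of homological degree \<open>m\<close>, where \<open>T\<close> is a DG bimodule over \<open>S\<close> via the DG
  algebra map \<open>\<chi> : S \<rightarrow> T\<close>. They are normalised to vanish outside the carrier of \<open>S\<close>.
\<close>

definition dg_derivations ::
  "('k::field, 'x) dga \<Rightarrow> ('x \<Rightarrow> 'y) \<Rightarrow> ('k, 'y) dga \<Rightarrow> int \<Rightarrow> ('x \<Rightarrow> 'y) set" where
  "dg_derivations S \<chi> T m = {D.
     D \<in> carrier S \<rightarrow> carrier T \<and> (\<forall>x. x \<notin> carrier S \<longrightarrow> D x = \<zero>\<^bsub>T\<^esub>) \<and>
     (\<forall>x\<in>carrier S. \<forall>y\<in>carrier S. D (x \<oplus>\<^bsub>S\<^esub> y) = D x \<oplus>\<^bsub>T\<^esub> D y) \<and>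
     (\<forall>c. \<forall>x\<in>carrier S. D (c \<odot>\<^bsub>S\<^esub> x) = c \<odot>\<^bsub>T\<^esub> D x) \<and>
     (\<forall>i. D ` gr S i \<subseteq> gr T (i + m)) \<and>
     (\<forall>i. \<forall>x\<in>gr S i. \<forall>y\<in>carrier S.
        D (x \<otimes>\<^bsub>S\<^esub> y) = D x \<otimes>\<^bsub>T\<^esub> \<chi> y \<oplus>\<^bsub>T\<^esub> ((-1) powi (m * i)) \<odot>\<^bsub>T\<^esub> (\<chi> x \<otimes>\<^bsub>T\<^esub> D y))}"

definition dg_der_diff ::
  "('k::field, 'x) dga \<Rightarrow> ('k, 'y) dga \<Rightarrow> int \<Rightarrow> ('x \<Rightarrow> 'y) \<Rightarrow> 'x \<Rightarrow> 'y" where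
  "dg_der_diff S T m D = (\<lambda>x. if x \<in> carrier S
     then diff T (D x) \<ominus>\<^bsub>T\<^esub> ((-1) powi m) \<odot>\<^bsub>T\<^esub> D (diff S x) else \<zero>\<^bsub>T\<^esub>)"

definition dg_der_cycles ::
  "('k::field, 'x) dga \<Rightarrow> ('x \<Rightarrow> 'y) \<Rightarrow> ('k, 'y) dga \<Rightarrow> int \<Rightarrow> ('x \<Rightarrow> 'y) set" where
  "dg_der_cycles S \<chi> T m = {D \<in> dg_derivations S \<chi> T m. dg_der_diff S T m D = (\<lambda>_. \<zero>\<^bsub>T\<^esub>)}"

definition dg_der_boundaries ::
  "('k::field, 'x) dga \<Rightarrow> ('x \<Rightarrow> 'y) \<Rightarrow> ('k, 'y) dga \<Rightarrow> int \<Rightarrow> ('x \<Rightarrow> 'y) set" where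
  "dg_der_boundaries S \<chi> T m = dg_der_diff S T (m + 1) ` dg_derivations S \<chi> T (m + 1)"

text \<open>
  \<open>T\<^sub>\<rho> DRep\<^sub>V(A)\<^sub>n\<close> is the homology of the complex of derivations \<open>RV \<rightarrow> k\<close> at the
  derivations lowering the homological degree by \<open>n\<close>; \<open>tangent_class\<close> is the class of a cycle.
\<close>

definition tangent_class ::
  "('k::field, 'u) dga \<Rightarrow> ('u \<Rightarrow> 'k) \<Rightarrow> nat \<Rightarrow> ('u \<Rightarrow> 'k) \<Rightarrow> ('u \<Rightarrow> 'k) set" where
  "tangent_class RV \<rho>V n D =
     dg_der_boundaries RV \<rho>V (in_degree_0 ground) (- int n)
       +>\<^bsub>fun_module ground (dg_der_cycles RV \<rho>V (in_degree_0 ground) (- int n))\<^esub> D"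

definition tangent_space ::
  "('k::field, 'u) dga \<Rightarrow> ('u \<Rightarrow> 'k) \<Rightarrow> nat \<Rightarrow> ('k, ('u \<Rightarrow> 'k) set) module" where
  "tangent_space RV \<rho>V n =
     quot_module (fun_module ground (dg_der_cycles RV \<rho>V (in_degree_0 ground) (- int n)))
       (dg_der_boundaries RV \<rho>V (in_degree_0 ground) (- int n))"


section \<open>Hochschild cohomology\<close>

text \<open>
  \<open>M\<close> is a bimodule over the algebra \<open>A\<close> (the type \<open>'a\<close> with scalar multiplication \<open>sA\<close>) with left
  action \<open>l\<close> and right action \<open>r\<close>. Cochains \<open>A\<^sup>m \<rightarrow> M\<close> are functions on lists, normalised to vanish
  on lists whose length is not \<open>m\<close>.
\<close>

definition multilinear ::
  "('k \<Rightarrow> 'a \<Rightarrow> 'a::ring_1) \<Rightarrow> ('k, 'm, 'z) module_scheme \<Rightarrow> nat \<Rightarrow> ('a list \<Rightarrow> 'm) \<Rightarrow> bool" where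
  "multilinear sA M m \<phi> \<longleftrightarrow> (\<forall>xs ys. length xs + length ys + 1 = m \<longrightarrow>
     (\<forall>a b. \<phi> (xs @ (a + b) # ys) = \<phi> (xs @ a # ys) \<oplus>\<^bsub>M\<^esub> \<phi> (xs @ b # ys)) \<and>
     (\<forall>c a. \<phi> (xs @ sA c a # ys) = c \<odot>\<^bsub>M\<^esub> \<phi> (xs @ a # ys)))"

definition cochains ::
  "('k \<Rightarrow> 'a \<Rightarrow> 'a::ring_1) \<Rightarrow> ('k, 'm, 'z) module_scheme \<Rightarrow> nat \<Rightarrow> ('a list \<Rightarrow> 'm) set" where
  "cochains sA M m = {\<phi>. (\<forall>as. length as = m \<longrightarrow> \<phi> as \<in> carrier M) \<and>
     (\<forall>as. length as \<noteq> m \<longrightarrow> \<phi> as = \<zero>\<^bsub>M\<^esub>) \<and> multilinear sA M m \<phi>}"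

text \<open>Multiply the neighbouring entries at the (0-based) positions \<open>i\<close> and \<open>i + 1\<close>.\<close>

definition contract :: "nat \<Rightarrow> 'a::times list \<Rightarrow> 'a list" where
  "contract i as = take i as @ (as ! i * as ! Suc i) # drop (i + 2) as"

definition hochschild_diff ::
  "('k::field, 'm, 'z) module_scheme \<Rightarrow> ('a::ring_1 \<Rightarrow> 'm \<Rightarrow> 'm) \<Rightarrow> ('m \<Rightarrow> 'a \<Rightarrow> 'm) \<Rightarrow> nat \<Rightarrow>
   ('a list \<Rightarrow> 'm) \<Rightarrow> 'a list \<Rightarrow> 'm" where
  "hochschild_diff M l r m \<phi> = (\<lambda>as. if length as = Suc m
     then l (hd as) (\<phi> (tl as))
       \<oplus>\<^bsub>M\<^esub> finsum M (\<lambda>i. ((-1) ^ Suc i) \<odot>\<^bsub>M\<^esub> \<phi> (contract i as)) {..<m}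
       \<oplus>\<^bsub>M\<^esub> ((-1) ^ Suc m) \<odot>\<^bsub>M\<^esub> r (\<phi> (butlast as)) (last as)
     else \<zero>\<^bsub>M\<^esub>)"

definition cocycles where
  "cocycles sA M l r m = {\<phi> \<in> cochains sA M m. hochschild_diff M l r m \<phi> = (\<lambda>_. \<zero>\<^bsub>M\<^esub>)}"

definition coboundaries where
  "coboundaries sA M l r m = (if m = 0 then {\<lambda>_. \<zero>\<^bsub>M\<^esub>}
     else hochschild_diff M l r (m - 1) ` cochains sA M (m - 1))"

definition HH_class where
  "HH_class sA M l r m \<phi> = coboundaries sA M l r m +>\<^bsub>fun_module M (cocycles sA M l r m)\<^esub> \<phi>"

definition HH where
  "HH sA M l r m = quot_module (fun_module M (cocycles sA M l r m)) (coboundaries sA M l r m)"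

text \<open>The bimodule structure of \<open>End V\<close> given by a representation.\<close>

definition lact :: "('a \<Rightarrow> 'v \<Rightarrow> 'v) \<Rightarrow> 'a \<Rightarrow> ('v \<Rightarrow> 'v) \<Rightarrow> 'v \<Rightarrow> 'v" where
  "lact \<rho> a f = \<rho> a \<circ> f"

definition ract :: "('a \<Rightarrow> 'v \<Rightarrow> 'v) \<Rightarrow> ('v \<Rightarrow> 'v) \<Rightarrow> 'a \<Rightarrow> 'v \<Rightarrow> 'v" where
  "ract \<rho> f a = f \<circ> \<rho> a"

definition Der ::
  "('k \<Rightarrow> 'a \<Rightarrow> 'a::ring_1) \<Rightarrow> ('k, 'm, 'z) module_scheme \<Rightarrow> ('a \<Rightarrow> 'm \<Rightarrow> 'm) \<Rightarrow> ('m \<Rightarrow> 'a \<Rightarrow> 'm) \<Rightarrow>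
   ('k, 'a \<Rightarrow> 'm) module" where
  "Der sA M l r = fun_module M {\<theta>. range \<theta> \<subseteq> carrier M \<and>
     (\<forall>a b. \<theta> (a + b) = \<theta> a \<oplus>\<^bsub>M\<^esub> \<theta> b) \<and> (\<forall>c a. \<theta> (sA c a) = c \<odot>\<^bsub>M\<^esub> \<theta> a) \<and>
     (\<forall>a b. \<theta> (a * b) = l a (\<theta> b) \<oplus>\<^bsub>M\<^esub> r (\<theta> a) b)}"


section \<open>The canonical maps\<close>

text \<open>
  A section of \<open>\<epsilon> : R \<rightarrow> A\<close> that is multiplicative up to coherent homotopy (an A-infinity section):
  multilinear maps \<open>s\<^sub>m : A\<^sup>m \<rightarrow> R\<close> of degree \<open>m - 1\<close> (\<open>m \<ge> 1\<close>; all of them are packed into one function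
  on lists) with \<open>\<epsilon> (s\<^sub>1 a) = a\<close> and
  \<open>d s\<^sub>m(a\<^sub>1,\<dots>,a\<^sub>m) = (\<Sum>i=1..m-1. (-1)^(i-1) (s\<^bsub>m-1\<^esub>(\<dots>,a\<^sub>i a\<^bsub>i+1\<^esub>,\<dots>) - s\<^sub>i(a\<^sub>1,\<dots>,a\<^sub>i) s\<^bsub>m-i\<^esub>(a\<^bsub>i+1\<^esub>,\<dots>,a\<^sub>m)))\<close>.
  The sum below is indexed from 0. Such sections exist when \<open>\<epsilon>\<close> is a surjective quasi-isomorphism.
\<close>

definition homotopy_section ::
  "('k::field \<Rightarrow> 'a \<Rightarrow> 'a::ring_1) \<Rightarrow> ('k, 'u) dga \<Rightarrow> ('u \<Rightarrow> 'a) \<Rightarrow> ('a list \<Rightarrow> 'u) \<Rightarrow> bool" where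
  "homotopy_section sA R \<epsilon> s \<longleftrightarrow>
     (\<forall>as. as \<noteq> [] \<longrightarrow> s as \<in> gr R (int (length as) - 1)) \<and>
     (\<forall>m\<ge>1. multilinear sA R m s) \<and>
     (\<forall>a. \<epsilon> (s [a]) = a) \<and>
     (\<forall>as. as \<noteq> [] \<longrightarrow> diff R (s as) =
        finsum R (\<lambda>i. ((-1) ^ i) \<odot>\<^bsub>R\<^esub>
            (s (contract i as) \<ominus>\<^bsub>R\<^esub> s (take (Suc i) as) \<otimes>\<^bsub>R\<^esub> s (drop (Suc i) as)))
          {..<length as - 1})"

text \<open>
  A derivation \<open>D : RV \<rightarrow> k\<close> lowering degrees by \<open>n\<close> yields the derivation
  \<open>D' : R \<rightarrow> E \<otimes> RV \<rightarrow> E \<otimes> k = E\<close>, and restricting \<open>D'\<close> along \<open>s\<close> gives the cochain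
  \<open>\<phi> = D' \<circ> s\<^bsub>n+1\<^esub> : A\<^bsup>n+1\<^esup> \<rightarrow> E\<close>. The canonical isomorphisms send the class of \<open>D\<close> to that of \<open>\<phi>\<close>.
\<close>

definition restricts_to ::
  "('k::field, 'e) module \<Rightarrow> ('u \<Rightarrow> ('e \<times> 'u \<Rightarrow> 'k) set) \<Rightarrow> ('a list \<Rightarrow> 'u) \<Rightarrow> nat \<Rightarrow> ('u \<Rightarrow> 'k) \<Rightarrow>
   ('a list \<Rightarrow> 'e) \<Rightarrow> bool" where
  "restricts_to E \<pi> s n D \<phi> \<longleftrightarrow> (\<forall>as. length as = Suc n \<longrightarrow>
     tensor_map E (in_degree_0 ground) D (\<pi> (s as)) = pure_tensor E (in_degree_0 ground) (\<phi> as) 1)"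

end

theory Submission
  imports Defs "HOL-Library.Function_Algebras"
begin

text \<open>
  Write \<open>E\<close> for \<open>End V\<close>. By the universal property of \<open>R\<^sub>V\<close> a derivation \<open>R\<^sub>V \<rightarrow> k\<close> over \<open>\<rho>\<^sub>V\<close> is the same
  as a derivation \<open>R \<rightarrow> E\<close> over \<open>\<rho> \<epsilon>\<close>: both are homomorphisms into the square-zero extension \<open>C\<close> of \<open>k\<close> by
  \<open>k b\<^sub>1 \<oplus> k b\<^sub>2\<close> with \<open>d b\<^sub>2 = b\<^sub>1\<close>, respectively into \<open>E \<otimes> C\<close> (\<open>rep_inj\<close>, \<open>rep_surj\<close>). Acyclicity of the
  extension means that such homomorphisms put no cycle condition on the derivation. The derived
  tangent space is therefore the homology of the complex of derivations \<open>R \<rightarrow> E\<close>, and it remains to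
  compare this homology with derivations of \<open>A\<close> and Hochschild cohomology. Since \<open>E\<close> sits in degree 0,
  no Koszul signs occur.

  The comparison is by dimension shifting in the coefficients. Let \<open>Q\<^sub>p\<close> be the bimodule of \<open>p\<close>-cochains of
  \<open>A\<close> with values in \<open>E\<close>; its right action is chosen such that the derivations \<open>A \<rightarrow> Q\<^sub>p\<close> are the
  Hochschild \<open>(p+1)\<close>-cocycles and the inner ones are the coboundaries. Two statements about \<open>R\<close> carry the
  argument.

  \<^item> In degree 0 a cycle \<open>R \<rightarrow> Q\<^sub>p\<close> is homologous to \<open>\<theta> \<epsilon>\<close> for a unique derivation \<open>\<theta> : A \<rightarrow> Q\<^sub>p\<close>
  (\<open>degree_0_cycle_bdr\<close>).

  \<^item> A cycle \<open>D : R \<rightarrow> Q\<^sub>p\<close> of degree \<open>n + 1\<close> is the obstruction to untwisting a cycle \<open>G : R \<rightarrow> Q\<^sub>p\<^sub>+\<^sub>1\<close> of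
  degree \<open>n\<close>: there is a map \<open>h\<close> with \<open>h d = D\<close> that satisfies the Leibniz rule up to the term \<open>G\<close> (the relation
  \<open>stp\<close>). Up to boundaries \<open>D\<close> and \<open>G\<close> determine each other, except that for \<open>n = 0\<close> inner derivations
  of \<open>A\<close> are lost (\<open>stp_exists\<close>, \<open>stp_lift\<close>, \<open>stp_bdr\<close>, \<open>stp_of_bdr\<close>).

  After \<open>n\<close> shifts a cycle \<open>R \<rightarrow> E\<close> of degree \<open>n\<close> has become a derivation \<open>A \<rightarrow> Q\<^sub>n\<close>, modulo inner ones if
  \<open>n \<ge> 1\<close>. This is \<open>Der(A, E)\<close> for \<open>n = 0\<close> and \<open>HH\<^sup>n\<^sup>+\<^sup>1(A, E)\<close> for \<open>n \<ge> 1\<close>; the relation \<open>rel\<close> is the resulting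
  correspondence. Evaluating \<open>h\<close> on an A-infinity section of \<open>\<epsilon>\<close> shows that each shift removes, up to a
  coboundary and a sign, one argument of the section (\<open>stp_restrict\<close>), and so identifies the isomorphism
  with restriction along the section.

  Both statements are instances of one principle (\<open>null_homotopic\<close>): over a cofibrant algebra a
  derivation into an acyclic bimodule is null-homotopic, because it twists the differential of a
  square-zero extension whose projection has a section. It is applied to the kernel of \<open>\<epsilon>\<close>
  (\<open>homotopy_to_truncation\<close>), to linear maps \<open>A \<rightarrow> ker \<epsilon>\<close> (\<open>linear_up_to_homotopy\<close>), and to the
  complex \<open>Q\<^sub>p \<rightarrow> Q\<^sub>p \<oplus> Q\<^sub>p\<^sub>+\<^sub>1 \<rightarrow> Q\<^sub>p\<^sub>+\<^sub>1\<close> (\<open>LL_null_homotopic\<close>). The algebras that arise can exceed the type on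
  which the lifting property is postulated; \<open>cofibrant_section\<close> cuts them down by a
  Loewenheim-Skolem argument.
\<close>

section \<open>Graded complexes and DG algebras\<close>

abbreviation sg :: "int \<Rightarrow> 'k::field" where
  "sg i \<equiv> (-1) powi i"

lemma sg_add: "sg (i + j) = (sg i * sg j :: 'k::field)"
  by (simp add: power_int_add)

lemma sg_diff1: "sg (i - 1) = - (sg i :: 'k::field)"
  by (simp add: power_int_diff)

lemma sg_sq: "sg i * sg i = (1 :: 'k::field)"
  by (simp flip: power_int_mult_distrib)

lemma cring_ground: "cring (ground :: ('k::field, 'k) module)"
proof -
  have "\<exists>y. x + y = 0 \<and> y + x = (0::'k)" for x by (intro exI[of _ "-x"]) simp
  then show ?thesis
    by unfold_locales (auto simp: ground_def alg_of_def Units_def algebra_simps)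
qed

lemma ground_simps [simp]:
  "carrier ground = UNIV" "a \<oplus>\<^bsub>ground\<^esub> b = a + b" "a \<otimes>\<^bsub>ground\<^esub> b = a * b" "\<zero>\<^bsub>ground\<^esub> = 0" "\<one>\<^bsub>ground\<^esub> = 1"
  "a \<odot>\<^bsub>ground\<^esub> b = a * b"
  by (simp_all add: ground_def alg_of_def)

lemma module_groundI:
  fixes M :: "('k::field, 'x, 'z) module_scheme"
  assumes "\<zero>\<^bsub>M\<^esub> \<in> carrier M"
    and "\<And>x y. x \<in> carrier M \<Longrightarrow> y \<in> carrier M \<Longrightarrow> x \<oplus>\<^bsub>M\<^esub> y \<in> carrier M"
    and "\<And>c x. x \<in> carrier M \<Longrightarrow> c \<odot>\<^bsub>M\<^esub> x \<in> carrier M"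
    and "\<And>x y z. x \<in> carrier M \<Longrightarrow> y \<in> carrier M \<Longrightarrow> z \<in> carrier M \<Longrightarrow>
          (x \<oplus>\<^bsub>M\<^esub> y) \<oplus>\<^bsub>M\<^esub> z = x \<oplus>\<^bsub>M\<^esub> (y \<oplus>\<^bsub>M\<^esub> z)"
    and "\<And>x y. x \<in> carrier M \<Longrightarrow> y \<in> carrier M \<Longrightarrow> x \<oplus>\<^bsub>M\<^esub> y = y \<oplus>\<^bsub>M\<^esub> x"
    and "\<And>x. x \<in> carrier M \<Longrightarrow> \<zero>\<^bsub>M\<^esub> \<oplus>\<^bsub>M\<^esub> x = x"
    and "\<And>c x y. x \<in> carrier M \<Longrightarrow> y \<in> carrier M \<Longrightarrow> c \<odot>\<^bsub>M\<^esub> (x \<oplus>\<^bsub>M\<^esub> y) = c \<odot>\<^bsub>M\<^esub> x \<oplus>\<^bsub>M\<^esub> c \<odot>\<^bsub>M\<^esub> y"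
    and "\<And>c d x. x \<in> carrier M \<Longrightarrow> (c + d) \<odot>\<^bsub>M\<^esub> x = c \<odot>\<^bsub>M\<^esub> x \<oplus>\<^bsub>M\<^esub> d \<odot>\<^bsub>M\<^esub> x"
    and "\<And>c d x. x \<in> carrier M \<Longrightarrow> (c * d) \<odot>\<^bsub>M\<^esub> x = c \<odot>\<^bsub>M\<^esub> (d \<odot>\<^bsub>M\<^esub> x)"
    and "\<And>x. x \<in> carrier M \<Longrightarrow> 1 \<odot>\<^bsub>M\<^esub> x = x"
    and "\<And>x. x \<in> carrier M \<Longrightarrow> 0 \<odot>\<^bsub>M\<^esub> x = \<zero>\<^bsub>M\<^esub>"
  shows "module ground M"
proof (intro moduleI abelian_groupI)
  show "\<exists>y\<in>carrier M. y \<oplus>\<^bsub>M\<^esub> x = \<zero>\<^bsub>M\<^esub>" if "x \<in> carrier M" for x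
    using that assms(3)[of x "-1"] assms(8)[of x "-1" 1] assms(10,11) by (intro bexI[of _ "(-1) \<odot>\<^bsub>M\<^esub> x"]) auto
qed (use assms cring_ground in auto)

lemma submodule_groundI:
  fixes M :: "('k::field, 'x, 'z) module_scheme"
  assumes "module ground M" "H \<subseteq> carrier M" "\<zero>\<^bsub>M\<^esub> \<in> H"
    "\<And>x y. x \<in> H \<Longrightarrow> y \<in> H \<Longrightarrow> x \<oplus>\<^bsub>M\<^esub> y \<in> H" "\<And>c x. x \<in> H \<Longrightarrow> c \<odot>\<^bsub>M\<^esub> x \<in> H"
  shows "submodule H ground M"
proof -
  interpret module ground M by fact
  show ?thesis
  proof (rule submoduleI)
    show "\<ominus>\<^bsub>M\<^esub> a \<in> H" if "a \<in> H" for a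
    proof -
      have "\<ominus>\<^bsub>M\<^esub> a = (-1) \<odot>\<^bsub>M\<^esub> a"
      proof (rule M.minus_equality)
        show "(-1) \<odot>\<^bsub>M\<^esub> a \<oplus>\<^bsub>M\<^esub> a = \<zero>\<^bsub>M\<^esub>"
          using smult_l_distr[of "-1" 1 a] smult_l_null[of a] smult_one[of a] that assms(2) by auto
      qed (use that assms in auto)
      then show ?thesis using assms(5)[OF that] by simp
    qed
  qed (use assms in auto)
qed

text \<open>
  The part of \<open>dg_algebra\<close> that does not involve the product. It also covers complexes of bimodules,
  whose records carry an undefined multiplication.
\<close>

definition dg_space :: "('k::field, 'x) dga \<Rightarrow> bool" where
  "dg_space M \<longleftrightarrow> module ground M \<and> (\<forall>i. submodule (gr M i) ground M) \<and>
     (\<forall>x\<in>carrier M. \<exists>!f. (\<forall>i. f i \<in> gr M i) \<and> finite {i. f i \<noteq> \<zero>\<^bsub>M\<^esub>} \<and>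
        x = finsum M f {i. f i \<noteq> \<zero>\<^bsub>M\<^esub>}) \<and>
     (\<forall>x\<in>carrier M. \<forall>y\<in>carrier M. diff M (x \<oplus>\<^bsub>M\<^esub> y) = diff M x \<oplus>\<^bsub>M\<^esub> diff M y) \<and>
     (\<forall>c. \<forall>x\<in>carrier M. diff M (c \<odot>\<^bsub>M\<^esub> x) = c \<odot>\<^bsub>M\<^esub> diff M x) \<and>
     (\<forall>i. \<forall>x\<in>gr M i. diff M x \<in> gr M (i - 1)) \<and>
     (\<forall>x\<in>carrier M. diff M (diff M x) = \<zero>\<^bsub>M\<^esub>)"

lemma dg_algebra_iff:
  "dg_algebra R \<longleftrightarrow> dg_space R \<and> ring R \<and>
     (\<forall>c. \<forall>x\<in>carrier R. \<forall>y\<in>carrier R.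
        (c \<odot>\<^bsub>R\<^esub> x) \<otimes>\<^bsub>R\<^esub> y = c \<odot>\<^bsub>R\<^esub> (x \<otimes>\<^bsub>R\<^esub> y) \<and> x \<otimes>\<^bsub>R\<^esub> (c \<odot>\<^bsub>R\<^esub> y) = c \<odot>\<^bsub>R\<^esub> (x \<otimes>\<^bsub>R\<^esub> y)) \<and>
     \<one>\<^bsub>R\<^esub> \<in> gr R 0 \<and>
     (\<forall>i j. \<forall>x\<in>gr R i. \<forall>y\<in>gr R j. x \<otimes>\<^bsub>R\<^esub> y \<in> gr R (i + j)) \<and>
     (\<forall>i. \<forall>x\<in>gr R i. \<forall>y\<in>carrier R.
        diff R (x \<otimes>\<^bsub>R\<^esub> y) = diff R x \<otimes>\<^bsub>R\<^esub> y \<oplus>\<^bsub>R\<^esub> sg i \<odot>\<^bsub>R\<^esub> (x \<otimes>\<^bsub>R\<^esub> diff R y))"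
  unfolding dg_algebra_def dg_space_def
  by (rule iffI; elim conjE; intro conjI; assumption)

text \<open>
  The homogeneous component of degree \<open>i\<close>; the grading axiom makes the family of components unique.
\<close>

definition comp :: "('k::field, 'x) dga \<Rightarrow> int \<Rightarrow> 'x \<Rightarrow> 'x" where
  "comp M i x = (THE f. (\<forall>i. f i \<in> gr M i) \<and> finite {i. f i \<noteq> \<zero>\<^bsub>M\<^esub>} \<and>
        x = finsum M f {i. f i \<noteq> \<zero>\<^bsub>M\<^esub>}) i"

locale dgs =
  fixes M :: "('k::field, 'x) dga" (structure)
  assumes dgs: "dg_space M"
begin

sublocale module ground M
  using dgs by (simp add: dg_space_def)

lemma gr_sub: "submodule (gr M i) ground M"
  using dgs by (simp add: dg_space_def)

lemma smult_cl [simp]: "x \<in> carrier M \<Longrightarrow> c \<odot> x \<in> carrier M"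
  using smult_closed[of c x] by simp

lemma gr_carrier [simp]: "x \<in> gr M i \<Longrightarrow> x \<in> carrier M"
  using submoduleE(1)[OF gr_sub] by blast

lemma gr_zero [simp]: "\<zero> \<in> gr M i"
  using gr_sub submodule.axioms(1) subgroup.one_closed by fastforce

lemma gr_add [simp]: "x \<in> gr M i \<Longrightarrow> y \<in> gr M i \<Longrightarrow> x \<oplus> y \<in> gr M i"
  using submoduleE(5)[OF gr_sub] by blast

lemma gr_smult [simp]: "x \<in> gr M i \<Longrightarrow> c \<odot> x \<in> gr M i"
  using submoduleE(4)[OF gr_sub, of c x] by simp

lemma gr_neg [simp]: "x \<in> gr M i \<Longrightarrow> \<ominus> x \<in> gr M i"
  using submoduleE(3)[OF gr_sub] by blast

lemma gr_minus [simp]: "x \<in> gr M i \<Longrightarrow> y \<in> gr M i \<Longrightarrow> x \<ominus> y \<in> gr M i"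
  by (simp add: a_minus_def)

lemma gr_diff [simp]: "x \<in> gr M i \<Longrightarrow> diff M x \<in> gr M (i - 1)"
  using dgs by (simp add: dg_space_def)

lemma diff_add: "x \<in> carrier M \<Longrightarrow> y \<in> carrier M \<Longrightarrow> diff M (x \<oplus> y) = diff M x \<oplus> diff M y"
  using dgs by (simp add: dg_space_def)

lemma diff_smult: "x \<in> carrier M \<Longrightarrow> diff M (c \<odot> x) = c \<odot> diff M x"
  using dgs by (simp add: dg_space_def)

lemma diff_diff [simp]: "x \<in> carrier M \<Longrightarrow> diff M (diff M x) = \<zero>"
  using dgs by (simp add: dg_space_def)

lemma sm_distr: "x \<in> carrier M \<Longrightarrow> y \<in> carrier M \<Longrightarrow> c \<odot> (x \<oplus> y) = c \<odot> x \<oplus> c \<odot> y"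
  using smult_r_distr[of c x y] by simp

lemma sm_add: "x \<in> carrier M \<Longrightarrow> (c + d) \<odot> x = c \<odot> x \<oplus> d \<odot> x"
  using smult_l_distr[of c d x] by simp

lemma sm_mult: "x \<in> carrier M \<Longrightarrow> c \<odot> (d \<odot> x) = (c * d) \<odot> x"
  using smult_assoc1[of c d x] by simp

lemma sm_one [simp]: "x \<in> carrier M \<Longrightarrow> 1 \<odot> x = x"
  using smult_one[of x] by simp

lemma sm_zero [simp]: "x \<in> carrier M \<Longrightarrow> 0 \<odot> x = \<zero>"
  using smult_l_null[of x] by simp

lemma sm_null [simp]: "c \<odot> \<zero> = \<zero>"
  using smult_r_null[of c] by simp

lemma neg_eq: "x \<in> carrier M \<Longrightarrow> \<ominus> x = (-1) \<odot> x"
  using smult_l_minus[of 1 x] R.minus_equality[of "-1" 1] by simp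

lemma minus_eq': "x \<in> carrier M \<Longrightarrow> y \<in> carrier M \<Longrightarrow> x \<ominus> y = x \<oplus> (-1) \<odot> y"
  by (simp add: a_minus_def neg_eq)

lemma comp_unique:
  assumes "x \<in> carrier M" "\<And>i. f i \<in> gr M i" "finite F" "\<And>i. i \<notin> F \<Longrightarrow> f i = \<zero>" "x = finsum M f F"
  shows "comp M i x = f i"
proof -
  let ?P = "\<lambda>f. (\<forall>i. f i \<in> gr M i) \<and> finite {i. f i \<noteq> \<zero>} \<and> x = finsum M f {i. f i \<noteq> \<zero>}"
  have sub: "{i. f i \<noteq> \<zero>} \<subseteq> F" using assms(4) by blast
  have "finsum M f {i. f i \<noteq> \<zero>} = finsum M f F"
    by (rule M.add.finprod_mono_neutral_cong_left) (use assms(3) sub gr_carrier[OF assms(2)] in auto)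
  then have "?P f" using assms sub finite_subset by auto
  moreover have "\<exists>!f. ?P f" using dgs assms(1) by (simp add: dg_space_def)
  ultimately have "(THE f. ?P f) = f" by (simp add: the1_equality)
  then show ?thesis by (simp add: comp_def)
qed

lemma comp_ex:
  assumes "x \<in> carrier M"
  shows "comp M i x \<in> gr M i" "finite {i. comp M i x \<noteq> \<zero>}"
    "x = finsum M (\<lambda>i. comp M i x) {i. comp M i x \<noteq> \<zero>}"
proof -
  let ?P = "\<lambda>f. (\<forall>i. f i \<in> gr M i) \<and> finite {i. f i \<noteq> \<zero>} \<and> x = finsum M f {i. f i \<noteq> \<zero>}"
  have "\<exists>!f. ?P f" using dgs assms(1) by (simp add: dg_space_def)
  then have "?P (THE f. ?P f)" by (rule theI')
  then have "?P (\<lambda>i. comp M i x)" by (simp add: comp_def)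
  then show "comp M i x \<in> gr M i" "finite {i. comp M i x \<noteq> \<zero>}"
    "x = finsum M (\<lambda>i. comp M i x) {i. comp M i x \<noteq> \<zero>}" by auto
qed

lemma comp_carrier [simp]: "x \<in> carrier M \<Longrightarrow> comp M i x \<in> carrier M"
  using comp_ex(1) gr_carrier by blast

lemma comp_hom: "x \<in> gr M j \<Longrightarrow> comp M i x = (if i = j then x else \<zero>)"
  by (rule comp_unique[where F = "{j}"]) auto

lemma comp_sum:
  assumes "x \<in> carrier M" "finite F" "{i. comp M i x \<noteq> \<zero>} \<subseteq> F"
  shows "x = finsum M (\<lambda>i. comp M i x) F"
proof -
  have "finsum M (\<lambda>i. comp M i x) {i. comp M i x \<noteq> \<zero>} = finsum M (\<lambda>i. comp M i x) F"
    by (rule M.add.finprod_mono_neutral_cong_left) (use assms in auto)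
  then show ?thesis using comp_ex(3)[OF assms(1)] by simp
qed

lemma comp_add:
  assumes "x \<in> carrier M" "y \<in> carrier M"
  shows "comp M i (x \<oplus> y) = comp M i x \<oplus> comp M i y"
proof -
  let ?F = "{i. comp M i x \<noteq> \<zero>} \<union> {i. comp M i y \<noteq> \<zero>}"
  have fin: "finite ?F" using comp_ex(2) assms by blast
  show ?thesis
  proof (rule comp_unique[OF _ _ fin])
    have "finsum M (\<lambda>i. comp M i x \<oplus> comp M i y) ?F = finsum M (\<lambda>i. comp M i x) ?F \<oplus> finsum M (\<lambda>i. comp M i y) ?F"
      by (rule M.finsum_addf) (use assms in auto)
    also have "\<dots> = x \<oplus> y" using comp_sum[OF assms(1) fin] comp_sum[OF assms(2) fin] by auto
    finally show "x \<oplus> y = finsum M (\<lambda>i. comp M i x \<oplus> comp M i y) ?F" by simp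
  qed (use assms comp_ex in auto)
qed

lemma finsum_closed_set:
  assumes "finite F" "\<And>i. i \<in> F \<Longrightarrow> f i \<in> Y" "\<zero> \<in> Y" "Y \<subseteq> carrier M" "\<And>x y. x \<in> Y \<Longrightarrow> y \<in> Y \<Longrightarrow> x \<oplus> y \<in> Y"
  shows "finsum M f F \<in> Y"
  using assms(1,2)
proof (induction F)
  case empty
  then show ?case using assms(3) by simp
next
  case (insert i F)
  have "finsum M f (insert i F) = f i \<oplus> finsum M f F"
    by (rule M.finsum_insert) (use insert assms(4) in auto)
  then show ?case using insert assms(5) by simp
qed

lemma hom_induct [consumes 1, case_names hom add]:
  assumes "x \<in> carrier M" and hom: "\<And>i y. y \<in> gr M i \<Longrightarrow> P y"
    and add: "\<And>y z. y \<in> carrier M \<Longrightarrow> z \<in> carrier M \<Longrightarrow> P y \<Longrightarrow> P z \<Longrightarrow> P (y \<oplus> z)"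
  shows "P x"
proof -
  have "finsum M (\<lambda>i. comp M i x) {i. comp M i x \<noteq> \<zero>} \<in> {y \<in> carrier M. P y}"
    by (rule finsum_closed_set) (use assms(1) add comp_ex(2) hom[OF gr_zero] hom[OF comp_ex(1)] in auto)
  then show ?thesis using comp_ex(3)[OF assms(1)] by simp
qed

lemma diff_carrier [simp]: "x \<in> carrier M \<Longrightarrow> diff M x \<in> carrier M"
proof (induction x rule: hom_induct)
  case (hom i y)
  then show ?case using gr_diff gr_carrier by blast
qed (simp add: diff_add)

lemma diff_zero [simp]: "diff M \<zero> = \<zero>"
  using diff_smult[of "\<zero>" 0] by simp

lemma comp_zero [simp]: "comp M i \<zero> = \<zero>"
  using comp_hom[OF gr_zero[of i], of i] by simp

lemma comp_smult: "x \<in> carrier M \<Longrightarrow> comp M i (c \<odot> x) = c \<odot> comp M i x"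
proof (induction x rule: hom_induct)
  case (hom j y)
  then show ?case by (simp add: comp_hom[of _ j])
qed (simp add: sm_distr comp_add)

lemma comp_diff: "x \<in> carrier M \<Longrightarrow> comp M i (diff M x) = diff M (comp M (i + 1) x)"
proof (induction x rule: hom_induct)
  case (hom j y)
  then show ?case by (auto simp: comp_hom[of y j] comp_hom[OF gr_diff[OF hom]])
qed (simp add: diff_add comp_add)

lemma gr_disj: "x \<in> gr M i \<Longrightarrow> x \<in> gr M j \<Longrightarrow> i \<noteq> j \<Longrightarrow> x = \<zero>"
  using comp_hom[of x i i] comp_hom[of x j i] by auto

end

lemma finsum_additive:
  fixes M :: "('k::field, 'x, 'z) module_scheme" and N :: "('k::field, 'y, 'w) module_scheme"
  assumes M: "module ground M" and N: "module ground N" and fin: "finite F"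
    and f: "\<And>i. i \<in> F \<Longrightarrow> f i \<in> carrier M"
    and h: "\<And>x. x \<in> carrier M \<Longrightarrow> h x \<in> carrier N" "h \<zero>\<^bsub>M\<^esub> = \<zero>\<^bsub>N\<^esub>"
      "\<And>x y. x \<in> carrier M \<Longrightarrow> y \<in> carrier M \<Longrightarrow> h (x \<oplus>\<^bsub>M\<^esub> y) = h x \<oplus>\<^bsub>N\<^esub> h y"
  shows "h (finsum M f F) = finsum N (\<lambda>i. h (f i)) F"
proof -
  interpret M: module ground M by fact
  interpret N: module ground N by fact
  show ?thesis using fin f
  proof (induction F)
    case empty
    then show ?case using h by simp
  next
    case (insert i F)
    have "finsum M f (insert i F) = f i \<oplus>\<^bsub>M\<^esub> finsum M f F"
      by (rule M.finsum_insert) (use insert in auto)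
    moreover have "finsum N (\<lambda>i. h (f i)) (insert i F) = h (f i) \<oplus>\<^bsub>N\<^esub> finsum N (\<lambda>i. h (f i)) F"
      by (rule N.finsum_insert) (use insert h in auto)
    moreover have "finsum M f F \<in> carrier M" using insert by (intro M.finsum_closed) auto
    ultimately show ?case using insert h by simp
  qed
qed

text \<open>
  To exhibit a complex it is enough to give additive projections to the homogeneous parts and to
  know that these parts generate; then the decomposition into components is unique.
\<close>

lemma dg_spaceI:
  fixes M :: "('k::field, 'x) dga"
  assumes mod: "module ground M" and gr: "\<And>i. submodule (gr M i) ground M"
    and pr: "\<And>i x. x \<in> carrier M \<Longrightarrow> pr i x \<in> carrier M"
      "\<And>i x y. x \<in> carrier M \<Longrightarrow> y \<in> carrier M \<Longrightarrow> pr i (x \<oplus>\<^bsub>M\<^esub> y) = pr i x \<oplus>\<^bsub>M\<^esub> pr i y"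
      "\<And>i j x. x \<in> gr M j \<Longrightarrow> pr i x = (if i = j then x else \<zero>\<^bsub>M\<^esub>)"
    and gen: "\<And>Y. (\<And>i. gr M i \<subseteq> Y) \<Longrightarrow> (\<And>x y. x \<in> Y \<Longrightarrow> y \<in> Y \<Longrightarrow> x \<in> carrier M \<Longrightarrow> y \<in> carrier M \<Longrightarrow> x \<oplus>\<^bsub>M\<^esub> y \<in> Y) \<Longrightarrow> carrier M \<subseteq> Y"
    and d: "\<And>x y. x \<in> carrier M \<Longrightarrow> y \<in> carrier M \<Longrightarrow> diff M (x \<oplus>\<^bsub>M\<^esub> y) = diff M x \<oplus>\<^bsub>M\<^esub> diff M y"
     "\<And>c x. x \<in> carrier M \<Longrightarrow> diff M (c \<odot>\<^bsub>M\<^esub> x) = c \<odot>\<^bsub>M\<^esub> diff M x"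
     "\<And>i x. x \<in> gr M i \<Longrightarrow> diff M x \<in> gr M (i - 1)"
     "\<And>x. x \<in> carrier M \<Longrightarrow> diff M (diff M x) = \<zero>\<^bsub>M\<^esub>"
  shows "dg_space M"
proof -
  interpret module ground M by fact
  have grc: "x \<in> carrier M" if "x \<in> gr M i" for x i using submoduleE(1)[OF gr] that by blast
  have gr0: "\<zero>\<^bsub>M\<^esub> \<in> gr M i" for i using gr[of i] submodule.axioms(1) subgroup.one_closed by fastforce
  have gra: "x \<oplus>\<^bsub>M\<^esub> y \<in> gr M i" if "x \<in> gr M i" "y \<in> gr M i" for x y i using submoduleE(5)[OF gr] that by blast
  let ?P = "\<lambda>x f. (\<forall>i. f i \<in> gr M i) \<and> finite {i. f i \<noteq> \<zero>\<^bsub>M\<^esub>} \<and> x = finsum M f {i. f i \<noteq> \<zero>\<^bsub>M\<^esub>}"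
  let ?Q = "\<lambda>x f F. (\<forall>i. f i \<in> gr M i) \<and> finite F \<and> (\<forall>i. i \<notin> F \<longrightarrow> f i = \<zero>\<^bsub>M\<^esub>) \<and> x = finsum M f F"
  have PQ: "\<exists>f. ?P x f" if "?Q x f F" for x f F
  proof -
    have "finsum M f {i. f i \<noteq> \<zero>\<^bsub>M\<^esub>} = finsum M f F"
      by (rule M.add.finprod_mono_neutral_cong_left) (use that grc[of "f _"] in blast)+
    moreover have "finite {i. f i \<noteq> \<zero>\<^bsub>M\<^esub>}" using that by (auto intro: finite_subset[of _ F])
    ultimately show ?thesis using that by auto
  qed
  have uni: "f j = pr j x" if "?P x f" for x f j
  proof -
    have pr0: "pr j \<zero>\<^bsub>M\<^esub> = \<zero>\<^bsub>M\<^esub>" using pr(3)[OF gr0[of j], of j] by simp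
    have fc: "f i \<in> carrier M" for i using that grc by blast
    have "pr j x = finsum M (\<lambda>i. pr j (f i)) {i. f i \<noteq> \<zero>\<^bsub>M\<^esub>}"
      using that fc finsum_additive[OF mod mod, of "{i. f i \<noteq> \<zero>\<^bsub>M\<^esub>}" f "pr j"] pr(1,2) pr0 grc by auto
    also have "\<dots> = finsum M (\<lambda>i. if j = i then f i else \<zero>\<^bsub>M\<^esub>) {i. f i \<noteq> \<zero>\<^bsub>M\<^esub>}"
      by (rule M.add.finprod_cong') (use that pr(3) fc in auto)
    also have "\<dots> = f j"
    proof (cases "f j = \<zero>\<^bsub>M\<^esub>")
      case True
      have "finsum M (\<lambda>i. if j = i then f i else \<zero>\<^bsub>M\<^esub>) {i. f i \<noteq> \<zero>\<^bsub>M\<^esub>} = finsum M (\<lambda>i. \<zero>\<^bsub>M\<^esub>) {i. f i \<noteq> \<zero>\<^bsub>M\<^esub>}"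
        by (rule M.add.finprod_cong') (use True in auto)
      then show ?thesis using True by simp
    next
      case False
      show ?thesis by (rule M.add.finprod_singleton) (use that False fc in auto)
    qed
    finally show ?thesis by simp
  qed
  have ex: "\<exists>f. ?P x f" if "x \<in> carrier M" for x
  proof -
    have "carrier M \<subseteq> {x. \<exists>f F. ?Q x f F}"
    proof (rule gen)
      show "gr M i \<subseteq> {x. \<exists>f F. ?Q x f F}" for i
      proof (rule subsetI)
        fix x assume x: "x \<in> gr M i"
        have "?Q x (\<lambda>j. if j = i then x else \<zero>\<^bsub>M\<^esub>) {i}" using x gr0 grc by auto
        then show "x \<in> {x. \<exists>f F. ?Q x f F}" by (intro CollectI exI)
      qed
      fix x y assume "x \<in> {x. \<exists>f F. ?Q x f F}" "y \<in> {x. \<exists>f F. ?Q x f F}"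
      then obtain f F g G where f: "?Q x f F" and g: "?Q y g G" by blast
      have "finsum M f (F \<union> G) = finsum M f F" "finsum M g (F \<union> G) = finsum M g G"
        by (rule M.add.finprod_mono_neutral_cong_right; use f g grc in auto)+
      moreover have "finsum M (\<lambda>i. f i \<oplus>\<^bsub>M\<^esub> g i) (F \<union> G) = finsum M f (F \<union> G) \<oplus>\<^bsub>M\<^esub> finsum M g (F \<union> G)"
        by (rule M.finsum_addf) (use f g grc in auto)
      ultimately have "?Q (x \<oplus>\<^bsub>M\<^esub> y) (\<lambda>i. f i \<oplus>\<^bsub>M\<^esub> g i) (F \<union> G)" using f g gra by auto
      then show "x \<oplus>\<^bsub>M\<^esub> y \<in> {x. \<exists>f F. ?Q x f F}" by (intro CollectI exI)
    qed
    then show ?thesis using that PQ by blast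
  qed
  have "\<exists>!f. ?P x f" if x: "x \<in> carrier M" for x
  proof (rule ex_ex1I[OF ex[OF x]])
    fix f g assume f: "?P x f" and g: "?P x g"
    show "f = g"
    proof (rule ext)
      fix j show "f j = g j" by (rule trans[OF uni[OF f] uni[OF g, symmetric]])
    qed
  qed
  then show ?thesis
    unfolding dg_space_def by (intro conjI allI ballI mod gr d) blast+
qed

lemma coset_eq_iff:
  fixes M :: "('k::field, 'x, 'z) module_scheme"
  assumes M: "module ground M" and B: "submodule B ground M" and x: "x \<in> carrier M" and y: "y \<in> carrier M"
  shows "B +>\<^bsub>M\<^esub> x = B +>\<^bsub>M\<^esub> y \<longleftrightarrow> x \<ominus>\<^bsub>M\<^esub> y \<in> B"
proof -
  interpret module ground M by fact
  have Bc: "b \<in> carrier M" if "b \<in> B" for b using submoduleE(1)[OF B] that by blast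
  have B0: "\<zero>\<^bsub>M\<^esub> \<in> B" using B submodule.axioms(1) subgroup.one_closed by fastforce
  show ?thesis
  proof
    assume "B +>\<^bsub>M\<^esub> x = B +>\<^bsub>M\<^esub> y"
    moreover have "x \<in> B +>\<^bsub>M\<^esub> x"
      using B0 x by (force simp: a_r_coset_def')
    ultimately obtain b where b: "b \<in> B" "x = b \<oplus>\<^bsub>M\<^esub> y" by (auto simp: a_r_coset_def')
    then have "x \<ominus>\<^bsub>M\<^esub> y = b" using y Bc[of b] by (simp add: a_minus_def M.add.m_assoc M.r_neg)
    then show "x \<ominus>\<^bsub>M\<^esub> y \<in> B" using b by simp
  next
    assume d: "x \<ominus>\<^bsub>M\<^esub> y \<in> B"
    have 1: "b \<oplus>\<^bsub>M\<^esub> x = (b \<oplus>\<^bsub>M\<^esub> (x \<ominus>\<^bsub>M\<^esub> y)) \<oplus>\<^bsub>M\<^esub> y" if "b \<in> B" for b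
      using that x y Bc by (simp add: a_minus_def M.add.m_assoc M.l_neg)
    have 2: "b \<oplus>\<^bsub>M\<^esub> y = (b \<oplus>\<^bsub>M\<^esub> (\<ominus>\<^bsub>M\<^esub> (x \<ominus>\<^bsub>M\<^esub> y))) \<oplus>\<^bsub>M\<^esub> x" if "b \<in> B" for b
    proof -
      have "\<ominus>\<^bsub>M\<^esub> (x \<ominus>\<^bsub>M\<^esub> y) = y \<ominus>\<^bsub>M\<^esub> x"
        using x y by (simp add: a_minus_def M.minus_add M.add.m_comm)
      then show ?thesis using that x y Bc by (simp add: a_minus_def M.add.m_assoc M.l_neg)
    qed
    have 3: "b \<oplus>\<^bsub>M\<^esub> (x \<ominus>\<^bsub>M\<^esub> y) \<in> B" "b \<oplus>\<^bsub>M\<^esub> (\<ominus>\<^bsub>M\<^esub> (x \<ominus>\<^bsub>M\<^esub> y)) \<in> B" if "b \<in> B" for b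
      using submoduleE(3,5)[OF B] d that by blast+
    show "B +>\<^bsub>M\<^esub> x = B +>\<^bsub>M\<^esub> y"
    proof (intro Set.set_eqI iffI)
      fix z assume "z \<in> B +>\<^bsub>M\<^esub> x"
      then show "z \<in> B +>\<^bsub>M\<^esub> y" using 1 3 by (auto simp: a_r_coset_def')
    next
      fix z assume "z \<in> B +>\<^bsub>M\<^esub> y"
      then show "z \<in> B +>\<^bsub>M\<^esub> x" using 2 3 by (auto simp: a_r_coset_def')
    qed
  qed
qed

lemma set_add_coset:
  fixes M :: "('k::field, 'x, 'z) module_scheme"
  assumes M: "module ground M" and B: "submodule B ground M"
    and h: "\<And>b. b \<in> B' \<Longrightarrow> h b \<in> B" "B' \<noteq> {}"
    and y: "y \<in> carrier M"
  shows "B <+>\<^bsub>M\<^esub> {h b \<oplus>\<^bsub>M\<^esub> y | b. b \<in> B'} = B +>\<^bsub>M\<^esub> y"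
proof -
  interpret module ground M by fact
  have Bc: "b \<in> carrier M" if "b \<in> B" for b using submoduleE(1)[OF B] that by blast
  have a: "b \<oplus>\<^bsub>M\<^esub> (c \<oplus>\<^bsub>M\<^esub> y) = (b \<oplus>\<^bsub>M\<^esub> c) \<oplus>\<^bsub>M\<^esub> y" "b \<oplus>\<^bsub>M\<^esub> c \<in> B" if "b \<in> B" "c \<in> B" for b c
    using that Bc y submoduleE(5)[OF B] by (auto simp: M.add.m_assoc)
  obtain b0 where b0: "b0 \<in> B'" using h by blast
  have e: "b \<oplus>\<^bsub>M\<^esub> y = (b \<ominus>\<^bsub>M\<^esub> h b0) \<oplus>\<^bsub>M\<^esub> (h b0 \<oplus>\<^bsub>M\<^esub> y)" "b \<ominus>\<^bsub>M\<^esub> h b0 \<in> B" if "b \<in> B" for b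
    using that Bc y h(1)[OF b0] submoduleE(3,5)[OF B]
    by (auto simp: M.add.m_assoc a_minus_def M.r_neg1)
  show ?thesis
  proof (intro Set.set_eqI iffI)
    fix z assume "z \<in> B <+>\<^bsub>M\<^esub> {h b \<oplus>\<^bsub>M\<^esub> y | b. b \<in> B'}"
    then obtain b b' where "b \<in> B" "b' \<in> B'" "z = b \<oplus>\<^bsub>M\<^esub> (h b' \<oplus>\<^bsub>M\<^esub> y)" by (auto simp: set_add_def')
    then show "z \<in> B +>\<^bsub>M\<^esub> y" using a[of b "h b'"] h by (auto simp: a_r_coset_def')
  next
    fix z assume "z \<in> B +>\<^bsub>M\<^esub> y"
    then obtain b where b: "b \<in> B" "z = b \<oplus>\<^bsub>M\<^esub> y" by (auto simp: a_r_coset_def')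
    then have "z = (b \<ominus>\<^bsub>M\<^esub> h b0) \<oplus>\<^bsub>M\<^esub> (h b0 \<oplus>\<^bsub>M\<^esub> y)" "b \<ominus>\<^bsub>M\<^esub> h b0 \<in> B" using e by blast+
    then show "z \<in> B <+>\<^bsub>M\<^esub> {h b \<oplus>\<^bsub>M\<^esub> y | b. b \<in> B'}" using b0 by (auto simp: set_add_def')
  qed
qed

lemma (in dgs) boundaries_sub: "submodule (dg_boundaries M i) ground M"
proof (rule submodule_groundI)
  show "module ground M" by unfold_locales
  show "dg_boundaries M i \<subseteq> carrier M" by (auto simp: dg_boundaries_def)
  show "\<zero>\<^bsub>M\<^esub> \<in> dg_boundaries M i" unfolding dg_boundaries_def by (rule image_eqI[of _ _ "\<zero>\<^bsub>M\<^esub>"]) auto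
  fix x y assume "x \<in> dg_boundaries M i" "y \<in> dg_boundaries M i"
  then obtain u v where "u \<in> gr M (i+1)" "v \<in> gr M (i+1)" "x = diff M u" "y = diff M v"
    by (auto simp: dg_boundaries_def)
  then have "x \<oplus>\<^bsub>M\<^esub> y = diff M (u \<oplus>\<^bsub>M\<^esub> v)" "u \<oplus>\<^bsub>M\<^esub> v \<in> gr M (i+1)" by (auto simp: diff_add)
  then show "x \<oplus>\<^bsub>M\<^esub> y \<in> dg_boundaries M i" by (simp add: dg_boundaries_def)
next
  fix c x assume "x \<in> dg_boundaries M i"
  then obtain u where "u \<in> gr M (i+1)" "x = diff M u" by (auto simp: dg_boundaries_def)
  then have "c \<odot>\<^bsub>M\<^esub> x = diff M (c \<odot>\<^bsub>M\<^esub> u)" "c \<odot>\<^bsub>M\<^esub> u \<in> gr M (i+1)" by (auto simp: diff_smult)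
  then show "c \<odot>\<^bsub>M\<^esub> x \<in> dg_boundaries M i" by (simp add: dg_boundaries_def)
qed

lemma dg_homD:
  assumes "f \<in> dg_hom X S"
  shows "\<And>x. x \<in> carrier X \<Longrightarrow> f x \<in> carrier S"
    "\<And>x y. x \<in> carrier X \<Longrightarrow> y \<in> carrier X \<Longrightarrow> f (x \<oplus>\<^bsub>X\<^esub> y) = f x \<oplus>\<^bsub>S\<^esub> f y"
    "\<And>x y. x \<in> carrier X \<Longrightarrow> y \<in> carrier X \<Longrightarrow> f (x \<otimes>\<^bsub>X\<^esub> y) = f x \<otimes>\<^bsub>S\<^esub> f y"
    "f \<one>\<^bsub>X\<^esub> = \<one>\<^bsub>S\<^esub>"
    "\<And>c x. x \<in> carrier X \<Longrightarrow> f (c \<odot>\<^bsub>X\<^esub> x) = c \<odot>\<^bsub>S\<^esub> f x"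
    "\<And>i x. x \<in> gr X i \<Longrightarrow> f x \<in> gr S i"
    "\<And>x. x \<in> carrier X \<Longrightarrow> f (diff X x) = diff S (f x)"
    "f \<in> extensional (carrier X)"
  using assms by (auto simp: dg_hom_def ring_hom_def image_subset_iff)

lemma dg_homI:
  assumes "\<And>x. x \<in> carrier X \<Longrightarrow> f x \<in> carrier S"
    "\<And>x y. x \<in> carrier X \<Longrightarrow> y \<in> carrier X \<Longrightarrow> f (x \<oplus>\<^bsub>X\<^esub> y) = f x \<oplus>\<^bsub>S\<^esub> f y"
    "\<And>x y. x \<in> carrier X \<Longrightarrow> y \<in> carrier X \<Longrightarrow> f (x \<otimes>\<^bsub>X\<^esub> y) = f x \<otimes>\<^bsub>S\<^esub> f y"
    "f \<one>\<^bsub>X\<^esub> = \<one>\<^bsub>S\<^esub>"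
    "\<And>c x. x \<in> carrier X \<Longrightarrow> f (c \<odot>\<^bsub>X\<^esub> x) = c \<odot>\<^bsub>S\<^esub> f x"
    "\<And>i x. x \<in> gr X i \<Longrightarrow> f x \<in> gr S i"
    "\<And>x. x \<in> carrier X \<Longrightarrow> f (diff X x) = diff S (f x)"
    "f \<in> extensional (carrier X)"
  shows "f \<in> dg_hom X S"
  using assms by (auto simp: dg_hom_def ring_hom_def)

text \<open>
  Injectivity and surjectivity on homology, spelled out on representatives. Quasi-isomorphisms are
  established and used below in this form, which avoids the cosets.
\<close>

lemma quasi_iso_iff:
  fixes X :: "('k::field, 'x) dga" and S :: "('k, 'y) dga"
  assumes X: "dg_space X" and S: "dg_space S" and f: "f \<in> dg_hom X S"
  shows "quasi_iso X S f \<longleftrightarrow>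
    (\<forall>i. (\<forall>x\<in>gr X i. diff X x = \<zero>\<^bsub>X\<^esub> \<and> f x \<in> dg_boundaries S i \<longrightarrow> x \<in> dg_boundaries X i) \<and>
         (\<forall>y\<in>gr S i. diff S y = \<zero>\<^bsub>S\<^esub> \<longrightarrow> (\<exists>x\<in>gr X i. diff X x = \<zero>\<^bsub>X\<^esub> \<and> y \<ominus>\<^bsub>S\<^esub> f x \<in> dg_boundaries S i)))"
proof -
  interpret X: dgs X by unfold_locales fact
  interpret S: dgs S by unfold_locales fact
  have mX: "module ground X" "module ground S" by unfold_locales
  note fD = dg_homD[OF f]
  have f0: "f \<zero>\<^bsub>X\<^esub> = \<zero>\<^bsub>S\<^esub>" using fD(5)[of "\<zero>\<^bsub>X\<^esub>" 0] fD(1)[of "\<zero>\<^bsub>X\<^esub>"] by simp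
  have fm: "f (x \<ominus>\<^bsub>X\<^esub> y) = f x \<ominus>\<^bsub>S\<^esub> f y" if "x \<in> carrier X" "y \<in> carrier X" for x y
    using that fD(1,2,5) by (simp add: X.minus_eq' S.minus_eq')
  have "bij_betw (\<lambda>A. dg_boundaries S i <+>\<^bsub>S\<^esub> f ` A) (carrier (dg_homology X i)) (carrier (dg_homology S i)) \<longleftrightarrow>
    (\<forall>x\<in>gr X i. diff X x = \<zero>\<^bsub>X\<^esub> \<and> f x \<in> dg_boundaries S i \<longrightarrow> x \<in> dg_boundaries X i) \<and>
    (\<forall>y\<in>gr S i. diff S y = \<zero>\<^bsub>S\<^esub> \<longrightarrow> (\<exists>x\<in>gr X i. diff X x = \<zero>\<^bsub>X\<^esub> \<and> y \<ominus>\<^bsub>S\<^esub> f x \<in> dg_boundaries S i))"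
    (is "?L \<longleftrightarrow> ?R1 \<and> ?R2") for i
  proof -
    let ?B = "dg_boundaries X i" and ?C = "dg_boundaries S i"
    define Z where "Z = {x \<in> gr X i. diff X x = \<zero>\<^bsub>X\<^esub>}"
    define W where "W = {x \<in> gr S i. diff S x = \<zero>\<^bsub>S\<^esub>}"
    have fZ: "f x \<in> W" if "x \<in> Z" for x
      using that fD(6)[of x i] fD(7)[of x] f0 by (auto simp: Z_def W_def)
    have Zc: "x \<in> carrier X" if "x \<in> Z" for x using that by (auto simp: Z_def)
    have Wc: "x \<in> carrier S" if "x \<in> W" for x using that by (auto simp: W_def)
    have h1: "carrier (dg_homology X i) = (\<lambda>x. ?B +>\<^bsub>X\<^esub> x) ` Z"

      by (simp add: dg_homology_def quot_module_def A_RCOSETS_def' a_r_coset_def' Z_def UNION_singleton_eq_range)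
    have h2: "carrier (dg_homology S i) = (\<lambda>x. ?C +>\<^bsub>S\<^esub> x) ` W"

      by (simp add: dg_homology_def quot_module_def A_RCOSETS_def' a_r_coset_def' W_def UNION_singleton_eq_range)
    have bC: "f b \<in> ?C" if "b \<in> ?B" for b
    proof -
      from that obtain u where u: "u \<in> gr X (i+1)" "b = diff X u" unfolding dg_boundaries_def by blast
      then have "f b = diff S (f u)" "f u \<in> gr S (i+1)" using fD(6)[of u "i+1"] fD(7)[of u] by auto
      then show ?thesis by (simp add: dg_boundaries_def)
    qed
    have ne: "?B \<noteq> {}" using X.gr_zero[of "i+1"] unfolding dg_boundaries_def by blast
    have Bc: "b \<in> carrier X" if "b \<in> ?B" for b using that X.submoduleE(1)[OF X.boundaries_sub] by blast
    have key: "?C <+>\<^bsub>S\<^esub> f ` (?B +>\<^bsub>X\<^esub> x) = ?C +>\<^bsub>S\<^esub> f x" if "x \<in> Z" for x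
    proof -
      have "f ` (?B +>\<^bsub>X\<^esub> x) = {f b \<oplus>\<^bsub>S\<^esub> f x | b. b \<in> ?B}"
        unfolding a_r_coset_def' using fD(2)[OF Bc Zc[OF that]] by (auto simp: image_UN)
      then show ?thesis
        using set_add_coset[OF mX(2) S.boundaries_sub, of ?B f i "f x"] bC ne fD(1) Zc[OF that] by simp
    qed
    have eqX: "?B +>\<^bsub>X\<^esub> x = ?B +>\<^bsub>X\<^esub> y \<longleftrightarrow> x \<ominus>\<^bsub>X\<^esub> y \<in> ?B" if "x \<in> Z" "y \<in> Z" for x y
      by (rule coset_eq_iff) (use mX X.boundaries_sub that Zc in auto)
    have eqS: "?C +>\<^bsub>S\<^esub> x = ?C +>\<^bsub>S\<^esub> y \<longleftrightarrow> x \<ominus>\<^bsub>S\<^esub> y \<in> ?C" if "x \<in> W" "y \<in> W" for x y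
      by (rule coset_eq_iff) (use mX S.boundaries_sub that Wc in auto)
    have im: "(\<lambda>A. ?C <+>\<^bsub>S\<^esub> f ` A) ` ((\<lambda>x. ?B +>\<^bsub>X\<^esub> x) ` Z) = (\<lambda>x. ?C +>\<^bsub>S\<^esub> f x) ` Z"
      using key by (simp add: image_image)
    have Zm: "x \<ominus>\<^bsub>X\<^esub> y \<in> Z" if "x \<in> Z" "y \<in> Z" for x y
      using that by (auto simp: Z_def X.minus_eq' X.diff_add X.diff_smult)
    have Z0: "\<zero>\<^bsub>X\<^esub> \<in> Z" by (simp add: Z_def)
    have inj: "inj_on (\<lambda>A. ?C <+>\<^bsub>S\<^esub> f ` A) ((\<lambda>x. ?B +>\<^bsub>X\<^esub> x) ` Z) \<longleftrightarrow> ?R1"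
    proof -
      have "inj_on (\<lambda>A. ?C <+>\<^bsub>S\<^esub> f ` A) ((\<lambda>x. ?B +>\<^bsub>X\<^esub> x) ` Z) \<longleftrightarrow>
        (\<forall>x\<in>Z. \<forall>y\<in>Z. ?C +>\<^bsub>S\<^esub> f x = ?C +>\<^bsub>S\<^esub> f y \<longrightarrow> ?B +>\<^bsub>X\<^esub> x = ?B +>\<^bsub>X\<^esub> y)"
        by (simp add: inj_on_def key)
      also have "\<dots> \<longleftrightarrow> (\<forall>x\<in>Z. \<forall>y\<in>Z. f (x \<ominus>\<^bsub>X\<^esub> y) \<in> ?C \<longrightarrow> x \<ominus>\<^bsub>X\<^esub> y \<in> ?B)"
        using eqX eqS fZ fm Zc by (intro ball_cong refl) simp
      also have "\<dots> \<longleftrightarrow> (\<forall>x\<in>Z. f x \<in> ?C \<longrightarrow> x \<in> ?B)"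
      proof -
        have "x \<ominus>\<^bsub>X\<^esub> \<zero>\<^bsub>X\<^esub> = x" if "x \<in> Z" for x using Zc[OF that] by (simp add: X.minus_eq')
        then show ?thesis using Z0 Zm by metis
      qed
      finally show ?thesis by (auto simp: Z_def)
    qed
    have sur: "(\<lambda>x. ?C +>\<^bsub>S\<^esub> f x) ` Z = (\<lambda>x. ?C +>\<^bsub>S\<^esub> x) ` W \<longleftrightarrow> ?R2"
    proof -
      have "(\<lambda>x. ?C +>\<^bsub>S\<^esub> f x) ` Z = (\<lambda>x. ?C +>\<^bsub>S\<^esub> x) ` W \<longleftrightarrow> (\<forall>y\<in>W. \<exists>x\<in>Z. ?C +>\<^bsub>S\<^esub> y = ?C +>\<^bsub>S\<^esub> f x)"
        (is "?S = ?T \<longleftrightarrow> ?U")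
      proof -
        have "?S \<subseteq> ?T" using fZ by auto
        then have "?S = ?T \<longleftrightarrow> ?T \<subseteq> ?S" by (simp only: set_eq_subset) simp
        also have "\<dots> \<longleftrightarrow> ?U" by (simp only: image_subset_iff image_iff)
        finally show ?thesis .
      qed
      also have "\<dots> \<longleftrightarrow> (\<forall>y\<in>W. \<exists>x\<in>Z. y \<ominus>\<^bsub>S\<^esub> f x \<in> ?C)"
        using eqS fZ by (intro ball_cong bex_cong refl) simp
      finally show ?thesis by (auto simp: Z_def W_def)
    qed
    show ?thesis
      unfolding bij_betw_def h1 h2 im inj sur ..
  qed
  then show ?thesis using f by (simp add: quasi_iso_def)
qed

lemma dg_algebraI:
  assumes s: "dg_space R" and "\<one>\<^bsub>R\<^esub> \<in> gr R 0"
    and cl: "\<And>x y. x \<in> carrier R \<Longrightarrow> y \<in> carrier R \<Longrightarrow> x \<otimes>\<^bsub>R\<^esub> y \<in> carrier R"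
    and "\<And>x y z. x \<in> carrier R \<Longrightarrow> y \<in> carrier R \<Longrightarrow> z \<in> carrier R \<Longrightarrow> (x \<otimes>\<^bsub>R\<^esub> y) \<otimes>\<^bsub>R\<^esub> z = x \<otimes>\<^bsub>R\<^esub> (y \<otimes>\<^bsub>R\<^esub> z)"
    and "\<And>x. x \<in> carrier R \<Longrightarrow> \<one>\<^bsub>R\<^esub> \<otimes>\<^bsub>R\<^esub> x = x" "\<And>x. x \<in> carrier R \<Longrightarrow> x \<otimes>\<^bsub>R\<^esub> \<one>\<^bsub>R\<^esub> = x"
    and "\<And>x y z. x \<in> carrier R \<Longrightarrow> y \<in> carrier R \<Longrightarrow> z \<in> carrier R \<Longrightarrow> (x \<oplus>\<^bsub>R\<^esub> y) \<otimes>\<^bsub>R\<^esub> z = x \<otimes>\<^bsub>R\<^esub> z \<oplus>\<^bsub>R\<^esub> y \<otimes>\<^bsub>R\<^esub> z"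
    and "\<And>x y z. x \<in> carrier R \<Longrightarrow> y \<in> carrier R \<Longrightarrow> z \<in> carrier R \<Longrightarrow> z \<otimes>\<^bsub>R\<^esub> (x \<oplus>\<^bsub>R\<^esub> y) = z \<otimes>\<^bsub>R\<^esub> x \<oplus>\<^bsub>R\<^esub> z \<otimes>\<^bsub>R\<^esub> y"
    and sm: "\<And>c x y. x \<in> carrier R \<Longrightarrow> y \<in> carrier R \<Longrightarrow> (c \<odot>\<^bsub>R\<^esub> x) \<otimes>\<^bsub>R\<^esub> y = c \<odot>\<^bsub>R\<^esub> (x \<otimes>\<^bsub>R\<^esub> y)"
      "\<And>c x y. x \<in> carrier R \<Longrightarrow> y \<in> carrier R \<Longrightarrow> x \<otimes>\<^bsub>R\<^esub> (c \<odot>\<^bsub>R\<^esub> y) = c \<odot>\<^bsub>R\<^esub> (x \<otimes>\<^bsub>R\<^esub> y)"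
    and gm: "\<And>i j x y. x \<in> gr R i \<Longrightarrow> y \<in> gr R j \<Longrightarrow> x \<otimes>\<^bsub>R\<^esub> y \<in> gr R (i + j)"
    and lb: "\<And>i x y. x \<in> gr R i \<Longrightarrow> y \<in> carrier R \<Longrightarrow>
        diff R (x \<otimes>\<^bsub>R\<^esub> y) = diff R x \<otimes>\<^bsub>R\<^esub> y \<oplus>\<^bsub>R\<^esub> sg i \<odot>\<^bsub>R\<^esub> (x \<otimes>\<^bsub>R\<^esub> diff R y)"
  shows "dg_algebra R"
proof -
  interpret dgs R by unfold_locales fact
  have "ring R"
    by (intro ringI monoidI) (use assms in \<open>auto intro: M.abelian_group_axioms gr_carrier\<close>)
  then show ?thesis unfolding dg_algebra_iff using assms by auto
qed

locale dga =
  fixes M :: "('k::field, 'x) dga" (structure)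
  assumes dga: "dg_algebra M"
begin

sublocale dgs M
  using dga by unfold_locales (simp add: dg_algebra_iff)

sublocale A?: ring M
  using dga by (simp add: dg_algebra_iff)

lemma mult_sm: "x \<in> carrier M \<Longrightarrow> y \<in> carrier M \<Longrightarrow> (c \<odot> x) \<otimes> y = c \<odot> (x \<otimes> y)"
  "x \<in> carrier M \<Longrightarrow> y \<in> carrier M \<Longrightarrow> x \<otimes> (c \<odot> y) = c \<odot> (x \<otimes> y)"
  using dga by (auto simp: dg_algebra_iff)

lemma one_gr [simp]: "\<one> \<in> gr M 0"
  using dga by (simp add: dg_algebra_iff)

lemma gr_mult [simp]: "x \<in> gr M i \<Longrightarrow> y \<in> gr M j \<Longrightarrow> x \<otimes> y \<in> gr M (i + j)"
  using dga by (simp add: dg_algebra_iff)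

lemma leibniz: "x \<in> gr M i \<Longrightarrow> y \<in> carrier M \<Longrightarrow>
    diff M (x \<otimes> y) = diff M x \<otimes> y \<oplus> sg i \<odot> (x \<otimes> diff M y)"
  using dga by (simp add: dg_algebra_iff)

lemma diff_one: "diff M \<one> = \<zero>"
proof -
  have "diff M \<one> = diff M \<one> \<oplus> diff M \<one>"
    using leibniz[OF one_gr A.one_closed] by simp
  then show ?thesis by (metis M.add.l_cancel_one' A.one_closed diff_carrier)
qed

end

lemma (in dgs) sub_dg_space:
  assumes Y: "Y \<subseteq> carrier M" "\<zero> \<in> Y"
    and cl: "\<And>x y. x \<in> Y \<Longrightarrow> y \<in> Y \<Longrightarrow> x \<oplus> y \<in> Y" "\<And>c x. x \<in> Y \<Longrightarrow> c \<odot> x \<in> Y"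
      "\<And>x. x \<in> Y \<Longrightarrow> diff M x \<in> Y" "\<And>i x. x \<in> Y \<Longrightarrow> comp M i x \<in> Y"
  shows "dg_space (M\<lparr>carrier := Y, gr := \<lambda>i. gr M i \<inter> Y\<rparr>)" (is "dg_space ?N")
proof (rule dg_spaceI[where pr = "comp M"])
  have Yc: "x \<in> carrier M" if "x \<in> Y" for x using Y that by blast
  show mod: "module ground ?N"
    by (rule module_groundI) (use Y cl Yc in \<open>auto simp: M.a_ac sm_distr sm_add sm_mult\<close>)
  show "submodule (gr ?N i) ground ?N" for i
    by (rule submodule_groundI[OF mod]) (use Y cl in auto)
  show "carrier ?N \<subseteq> Z" if gen: "\<And>i. gr ?N i \<subseteq> Z"
    "\<And>x y. x \<in> Z \<Longrightarrow> y \<in> Z \<Longrightarrow> x \<in> carrier ?N \<Longrightarrow> y \<in> carrier ?N \<Longrightarrow> x \<oplus>\<^bsub>?N\<^esub> y \<in> Z" for Z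
  proof
    fix x assume "x \<in> carrier ?N"
    then have x: "x \<in> Y" "x \<in> carrier M" using Y by auto
    have Zi: "y \<in> Z" if "y \<in> gr M i" "y \<in> Y" for y i using gen(1)[of i] that by auto
    have "finsum M (\<lambda>i. comp M i x) {i. comp M i x \<noteq> \<zero>} \<in> Y \<inter> Z"
    proof (rule finsum_closed_set)
      show "comp M i x \<in> Y \<inter> Z" for i
        using Zi[OF comp_ex(1)[OF x(2)] cl(4)[OF x(1)]] cl(4)[OF x(1)] by blast
      show "\<zero> \<in> Y \<inter> Z" using Zi[OF gr_zero] Y by blast
    qed (use comp_ex[OF x(2)] Y gen(2) cl(1) in auto)
    then show "x \<in> Z" using comp_ex(3)[OF x(2)] by simp
  qed
qed (use Y cl in \<open>auto simp: comp_add comp_hom diff_add diff_smult subset_iff\<close>)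

lemma (in dga) sub_dga:
  assumes Y: "Y \<subseteq> carrier M" "\<zero> \<in> Y" "\<one> \<in> Y"
    and cl: "\<And>x y. x \<in> Y \<Longrightarrow> y \<in> Y \<Longrightarrow> x \<oplus> y \<in> Y" "\<And>c x. x \<in> Y \<Longrightarrow> c \<odot> x \<in> Y"
      "\<And>x. x \<in> Y \<Longrightarrow> diff M x \<in> Y" "\<And>i x. x \<in> Y \<Longrightarrow> comp M i x \<in> Y"
      "\<And>x y. x \<in> Y \<Longrightarrow> y \<in> Y \<Longrightarrow> x \<otimes> y \<in> Y"
  shows "dg_algebra (M\<lparr>carrier := Y, gr := \<lambda>i. gr M i \<inter> Y\<rparr>)" (is "dg_algebra ?N")
proof -
  have Yc: "x \<in> carrier M" if "x \<in> Y" for x using Y that by blast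
  show ?thesis
    by (rule dg_algebraI, rule sub_dg_space)
      (use Y cl Yc in \<open>auto simp: A.m_assoc A.l_distr A.r_distr mult_sm leibniz\<close>)
qed

lemma (in dgs) dg_hom_comp:
  assumes "f \<in> dg_hom M S" "dg_space S" "x \<in> carrier M"
  shows "f (comp M i x) = comp S i (f x)"
  using assms(3)
proof (induction x rule: hom_induct)
  case (hom j y)
  interpret S: dgs S by unfold_locales fact
  have "f \<zero> = \<zero>\<^bsub>S\<^esub>" using dg_homD(5)[OF assms(1), of "\<zero>" 0] dg_homD(1)[OF assms(1), of "\<zero>"] by simp
  then show ?case using hom dg_homD(6)[OF assms(1) hom] by (simp add: comp_hom[OF hom] S.comp_hom[of _ j])
next
  case (add y z)
  interpret S: dgs S by unfold_locales fact
  show ?case using add dg_homD(1,2)[OF assms(1)] by (simp add: comp_add S.comp_add)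
qed

text \<open>
  The test objects of the lifting property and of the universal property live on a fixed type;
  algebras built elsewhere are moved there along an injection of the carrier.
\<close>

definition tr :: "('x \<Rightarrow> 'u) \<Rightarrow> ('k, 'x) dga \<Rightarrow> ('k, 'u) dga" where
  "tr \<iota> M = (let j = inv_into (carrier M) \<iota> in
    \<lparr>carrier = \<iota> ` carrier M, mult = (\<lambda>a b. \<iota> (j a \<otimes>\<^bsub>M\<^esub> j b)), one = \<iota> \<one>\<^bsub>M\<^esub>, zero = \<iota> \<zero>\<^bsub>M\<^esub>,
     add = (\<lambda>a b. \<iota> (j a \<oplus>\<^bsub>M\<^esub> j b)), smult = (\<lambda>c a. \<iota> (c \<odot>\<^bsub>M\<^esub> j a)), gr = (\<lambda>i. \<iota> ` gr M i),
     diff = (\<lambda>a. \<iota> (diff M (j a)))\<rparr>)"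

lemma tr_simps:
  assumes "inj_on \<iota> (carrier M)"
  shows "carrier (tr \<iota> M) = \<iota> ` carrier M" "gr (tr \<iota> M) i = \<iota> ` gr M i"
    "\<one>\<^bsub>tr \<iota> M\<^esub> = \<iota> \<one>\<^bsub>M\<^esub>" "\<zero>\<^bsub>tr \<iota> M\<^esub> = \<iota> \<zero>\<^bsub>M\<^esub>"
    "x \<in> carrier M \<Longrightarrow> y \<in> carrier M \<Longrightarrow> \<iota> x \<otimes>\<^bsub>tr \<iota> M\<^esub> \<iota> y = \<iota> (x \<otimes>\<^bsub>M\<^esub> y)"
    "x \<in> carrier M \<Longrightarrow> y \<in> carrier M \<Longrightarrow> \<iota> x \<oplus>\<^bsub>tr \<iota> M\<^esub> \<iota> y = \<iota> (x \<oplus>\<^bsub>M\<^esub> y)"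
    "x \<in> carrier M \<Longrightarrow> c \<odot>\<^bsub>tr \<iota> M\<^esub> \<iota> x = \<iota> (c \<odot>\<^bsub>M\<^esub> x)"
    "x \<in> carrier M \<Longrightarrow> diff (tr \<iota> M) (\<iota> x) = \<iota> (diff M x)"
  using assms by (auto simp: tr_def Let_def)

lemma (in dga) tr_dga:
  assumes inj: "inj_on \<iota> (carrier M)"
  shows "dg_algebra (tr \<iota> M)" (is "dg_algebra ?N")
proof -
  note S = tr_simps[OF inj]
  have inv: "inv_into (carrier M) \<iota> (\<iota> x) = x" if "x \<in> carrier M" for x using inj that by simp
  have "dg_space ?N"
  proof (rule dg_spaceI[where pr = "\<lambda>i a. \<iota> (comp M i (inv_into (carrier M) \<iota> a))"])
    show mod: "module ground ?N"
      by (rule module_groundI) (auto simp: S M.a_ac sm_distr sm_add sm_mult)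
    show "submodule (gr ?N i) ground ?N" for i
      by (rule submodule_groundI[OF mod]) (auto simp: S)
    show "carrier ?N \<subseteq> Z" if gen: "\<And>i. gr ?N i \<subseteq> Z"
      "\<And>x y. x \<in> Z \<Longrightarrow> y \<in> Z \<Longrightarrow> x \<in> carrier ?N \<Longrightarrow> y \<in> carrier ?N \<Longrightarrow> x \<oplus>\<^bsub>?N\<^esub> y \<in> Z" for Z
    proof
      fix a assume "a \<in> carrier ?N"
      then obtain x where x: "a = \<iota> x" "x \<in> carrier M" by (auto simp: S)
      have "\<iota> x \<in> Z" using x(2)
      proof (induction x rule: hom_induct)
        case (hom i y)
        then show ?case using gen(1)[of i] by (auto simp: S)
      next
        case (add y z)
        then show ?case using gen(2)[of "\<iota> y" "\<iota> z"] by (auto simp: S)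
      qed
      then show "a \<in> Z" using x by simp
    qed
  qed (auto simp: S inv comp_add comp_hom diff_add diff_smult)
  then show ?thesis
    by (rule dg_algebraI) (auto simp: S A.m_assoc A.l_distr A.r_distr mult_sm leibniz)
qed

text \<open>The sign automorphism \<open>x \<mapsto> (-1)^|x| x\<close>.\<close>

definition tau :: "('k::field, 'x) dga \<Rightarrow> 'x \<Rightarrow> 'x" where
  "tau M x = finsum M (\<lambda>i. sg i \<odot>\<^bsub>M\<^esub> comp M i x) {i. comp M i x \<noteq> \<zero>\<^bsub>M\<^esub>}"

context dgs
begin

lemma tau_sum:
  assumes "x \<in> carrier M" "finite F" "{i. comp M i x \<noteq> \<zero>} \<subseteq> F"
  shows "tau M x = finsum M (\<lambda>i. sg i \<odot> comp M i x) F"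
  unfolding tau_def by (rule M.add.finprod_mono_neutral_cong_left) (use assms in auto)

lemma tau_carrier [simp]: "x \<in> carrier M \<Longrightarrow> tau M x \<in> carrier M"
  unfolding tau_def by (rule M.finsum_closed) auto

lemma tau_add:
  assumes "x \<in> carrier M" "y \<in> carrier M"
  shows "tau M (x \<oplus> y) = tau M x \<oplus> tau M y"
proof -
  let ?F = "{i. comp M i x \<noteq> \<zero>} \<union> {i. comp M i y \<noteq> \<zero>}"
  have fin: "finite ?F" using comp_ex(2) assms by blast
  have "tau M (x \<oplus> y) = finsum M (\<lambda>i. sg i \<odot> comp M i (x \<oplus> y)) ?F"
    by (rule tau_sum) (use assms fin in \<open>auto simp: comp_add\<close>)
  also have "\<dots> = finsum M (\<lambda>i. sg i \<odot> comp M i x \<oplus> sg i \<odot> comp M i y) ?F"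
    using assms by (simp add: comp_add sm_distr)
  also have "\<dots> = finsum M (\<lambda>i. sg i \<odot> comp M i x) ?F \<oplus> finsum M (\<lambda>i. sg i \<odot> comp M i y) ?F"
    by (rule M.finsum_addf) (use assms in auto)
  also have "\<dots> = tau M x \<oplus> tau M y"
    using tau_sum[OF assms(1) fin] tau_sum[OF assms(2) fin] by simp
  finally show ?thesis .
qed

lemma tau_hom:
  assumes x: "x \<in> gr M i"
  shows "tau M x = sg i \<odot> x"
proof -
  have "tau M x = finsum M (\<lambda>j. sg j \<odot> comp M j x) {i}"
    by (rule tau_sum) (use x in \<open>auto simp: comp_hom[OF x]\<close>)
  also have "\<dots> = sg i \<odot> x" using x by (simp add: comp_hom[OF x])
  finally show ?thesis .
qed

lemma tau_smult: "x \<in> carrier M \<Longrightarrow> tau M (c \<odot> x) = c \<odot> tau M x"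
proof (induction x rule: hom_induct)
  case (hom j y)
  then show ?case by (simp add: tau_hom[of _ j] sm_mult mult.commute)
qed (simp add: sm_distr tau_add)

end

context dga
begin

lemma tau_one: "tau M \<one> = \<one>"
  using tau_hom[OF one_gr] by simp

lemma tau_mult: "x \<in> carrier M \<Longrightarrow> y \<in> carrier M \<Longrightarrow> tau M (x \<otimes> y) = tau M x \<otimes> tau M y"
proof (induction x rule: hom_induct)
  case (hom i x)
  show ?case using \<open>y \<in> carrier M\<close>
  proof (induction y rule: hom_induct)
    case (hom j y)
    with \<open>x \<in> gr M i\<close> show ?case
      using tau_hom[OF gr_mult[of x i y j]] by (simp add: tau_hom[of _ i] tau_hom[of _ j] mult_sm sm_mult sg_add mult.commute)
  next
    case (add y z)
    then show ?case using \<open>x \<in> gr M i\<close> by (simp add: A.r_distr tau_add)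
  qed
next
  case (add x z)
  then show ?case by (simp add: A.l_distr tau_add)
qed

end

text \<open>
  Stages of closing a set under a family of binary operations. If there are at most as many
  operations as elements of an infinite type, then the union of all stages stays within the
  cardinality of that type. Unary operations and constants are binary ones that ignore arguments.
\<close>

primrec clo :: "('i \<Rightarrow> 'x \<Rightarrow> 'x \<Rightarrow> 'x) \<Rightarrow> 'x set \<Rightarrow> nat \<Rightarrow> 'x set" where
  "clo f S 0 = S"
| "clo f S (Suc n) = clo f S n \<union> (\<lambda>(i, x, y). f i x y) ` (UNIV \<times> clo f S n \<times> clo f S n)"

lemma clo_mono: "m \<le> n \<Longrightarrow> clo f S m \<subseteq> clo f S n"
  by (induction n rule: nat_induct) (auto simp: le_Suc_eq)

lemma clo_closed:
  assumes "x \<in> (\<Union>n. clo f S n)" "y \<in> (\<Union>n. clo f S n)"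
  shows "f i x y \<in> (\<Union>n. clo f S n)"
proof -
  obtain m n where "x \<in> clo f S m" "y \<in> clo f S n" using assms by auto
  then have "x \<in> clo f S (max m n)" "y \<in> clo f S (max m n)"
    using clo_mono[of m "max m n" f S] clo_mono[of n "max m n" f S] by auto
  then have "f i x y \<in> clo f S (Suc (max m n))" by force
  then show ?thesis by blast
qed

lemma clo_subset:
  assumes "S \<subseteq> C" "\<And>i x y. x \<in> C \<Longrightarrow> y \<in> C \<Longrightarrow> f i x y \<in> C"
  shows "(\<Union>n. clo f S n) \<subseteq> C"
proof -
  have "clo f S n \<subseteq> C" for n
  proof (induction n)
    case (Suc n)
    then show ?case using assms(2) by (auto intro!: assms(2))
  qed (use assms in simp)
  then show ?thesis by blast
qed

lemma clo_card:
  includes cardinal_syntax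
  fixes f :: "'i \<Rightarrow> 'x \<Rightarrow> 'x \<Rightarrow> 'x"
  assumes inf: "infinite (UNIV :: 'u set)" and I: "|UNIV :: 'i set| \<le>o |UNIV :: 'u set|"
    and S: "|S| \<le>o |UNIV :: 'u set|"
  shows "|\<Union>n. clo f S n| \<le>o |UNIV :: 'u set|"
proof (rule card_of_UNION_ordLeq_infinite[OF inf])
  show "|UNIV :: nat set| \<le>o |UNIV :: 'u set|" using inf infinite_iff_card_of_nat by blast
  have fld: "\<not> finite (Field |UNIV :: 'u set| )" using inf by (simp add: Field_card_of)
  have "|clo f S n| \<le>o |UNIV :: 'u set|" for n
  proof (induction n)
    case (Suc n)
    have "|UNIV \<times> clo f S n \<times> clo f S n :: ('i \<times> 'x \<times> 'x) set| \<le>o |UNIV :: 'u set|"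
      using I Suc by (intro card_of_Times_ordLeq_infinite_Field[OF fld]) (assumption | rule card_of_Card_order)+
    then have "|(\<lambda>(i, x, y). f i x y) ` (UNIV \<times> clo f S n \<times> clo f S n)| \<le>o |UNIV :: 'u set|"
      using card_of_image ordLeq_transitive by blast
    then show ?case using Suc by (auto intro: card_of_Un_ordLeq_infinite_Field[OF fld] card_of_Card_order)
  qed (use S in simp)
  then show "\<forall>n\<in>UNIV. |clo f S n| \<le>o |UNIV :: 'u set|" by blast
qed

lemma index_card:
  includes cardinal_syntax
  assumes inf: "infinite (UNIV :: 'u set)" and j: "inj (j :: 'k \<Rightarrow> 'u)"
  shows "|UNIV :: ('k + int + nat) set| \<le>o |UNIV :: 'u set|"
proof -
  have fld: "\<not> finite (Field |UNIV :: 'u set| )" using inf by (simp add: Field_card_of)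
  have n: "|UNIV :: nat set| \<le>o |UNIV :: 'u set|" using inf infinite_iff_card_of_nat by blast
  have "inj (\<lambda>i::int. if i \<ge> 0 then 2 * nat i else 2 * nat (- i) + 1)"
    by (rule injI) (auto simp: Suc_double_not_eq_double double_not_eq_Suc_double split: if_splits)
  then have "|UNIV :: int set| \<le>o |UNIV :: nat set|"
    using card_of_ordLeq[of "UNIV :: int set" "UNIV :: nat set"] by blast
  then have i: "|UNIV :: int set| \<le>o |UNIV :: 'u set|" using n ordLeq_transitive by blast
  have k: "|UNIV :: 'k set| \<le>o |UNIV :: 'u set|" using j card_of_ordLeq[of "UNIV :: 'k set" "UNIV :: 'u set"] by blast
  have "|(UNIV :: int set) <+> (UNIV :: nat set)| \<le>o |UNIV :: 'u set|"
    by (rule card_of_Plus_ordLeq_infinite_Field[OF fld i n card_of_Card_order])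
  then have "|(UNIV :: 'k set) <+> ((UNIV :: int set) <+> (UNIV :: nat set))| \<le>o |UNIV :: 'u set|"
    by (rule card_of_Plus_ordLeq_infinite_Field[OF fld k _ card_of_Card_order])
  then show ?thesis by (simp add: UNIV_Plus_UNIV)
qed

section \<open>Sections of acyclic surjections\<close>

text \<open>
  The lifting property of a cofibrant algebra is only postulated against algebras living on its own
  type. A surjection \<open>p\<close> with acyclic kernel from an arbitrarily large algebra \<open>X\<close> still has a section:
  inside \<open>X\<close> there is a subalgebra that surjects onto \<open>R\<close>, has acyclic kernel and is no larger than
  the type of \<open>R\<close>. It is obtained by closing a set-theoretic section of \<open>p\<close> under the algebra
  operations and under a choice of primitives of the cycles in the kernel.
\<close>

lemma cofibrant_section:
  fixes R :: "('k::field, 'u) dga" and X :: "('k, 'x) dga" and j :: "'k \<Rightarrow> 'u"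
  assumes cof: "cofibrant R" and inf: "infinite (UNIV :: 'u set)" and j: "inj j"
    and X: "dg_algebra X" and p: "p \<in> dg_hom X R" and surj: "\<And>r. r \<in> carrier R \<Longrightarrow> \<exists>x\<in>carrier X. p x = r"
    and acyc: "\<And>i x. x \<in> gr X i \<Longrightarrow> diff X x = \<zero>\<^bsub>X\<^esub> \<Longrightarrow> p x = \<zero>\<^bsub>R\<^esub> \<Longrightarrow> \<exists>y\<in>gr X (i + 1). p y = \<zero>\<^bsub>R\<^esub> \<and> diff X y = x"
  shows "\<exists>g\<in>dg_hom R X. \<forall>r\<in>carrier R. p (g r) = r"
proof -
  include cardinal_syntax
  have R: "dg_algebra R" using cof by (simp add: cofibrant_def)
  interpret R: dga R by unfold_locales fact
  interpret X: dga X by unfold_locales fact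
  note pD = dg_homD[OF p]
  have pm: "p (x \<ominus>\<^bsub>X\<^esub> y) = p x \<ominus>\<^bsub>R\<^esub> p y" if "x \<in> carrier X" "y \<in> carrier X" for x y
    using that pD(1,2,5) by (simp add: X.minus_eq' R.minus_eq')
  have p0: "p \<zero>\<^bsub>X\<^esub> = \<zero>\<^bsub>R\<^esub>" using pD(5)[of "\<zero>\<^bsub>X\<^esub>" 0] pD(1)[of "\<zero>\<^bsub>X\<^esub>"] by simp
  have pc: "p (comp X i x) = comp R i (p x)" if "x \<in> carrier X" for i x
    using X.dg_hom_comp[OF p R.dgs that] .
  define \<sigma> where "\<sigma> r = (SOME x. x \<in> carrier X \<and> p x = r)" for r
  have \<sigma>: "\<sigma> r \<in> carrier X" "p (\<sigma> r) = r" if "r \<in> carrier R" for r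
    using someI_ex[of "\<lambda>x. x \<in> carrier X \<and> p x = r"] surj[OF that] unfolding \<sigma>_def by blast+
  define P where "P x y \<longleftrightarrow> (\<exists>i. x \<in> gr X i \<and> y \<in> gr X (i + 1) \<and> p y = \<zero>\<^bsub>R\<^esub> \<and> diff X y = x)" for x y
  define \<eta> where "\<eta> x = (if \<exists>y. P x y then SOME y. P x y else \<zero>\<^bsub>X\<^esub>)" for x
  have \<eta>c: "\<eta> x \<in> carrier X" for x
    unfolding \<eta>_def P_def using X.gr_carrier by (auto intro: someI2)
  have \<eta>: "\<eta> x \<in> gr X (i + 1)" "p (\<eta> x) = \<zero>\<^bsub>R\<^esub>" "diff X (\<eta> x) = x"
    if x: "x \<in> gr X i" "diff X x = \<zero>\<^bsub>X\<^esub>" "p x = \<zero>\<^bsub>R\<^esub>" "x \<noteq> \<zero>\<^bsub>X\<^esub>" for x i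
  proof -
    have ex: "\<exists>y. P x y" using acyc[OF x(1-3)] x(1) by (auto simp: P_def)
    then have "P x (\<eta> x)" unfolding \<eta>_def by (simp add: someI_ex)
    then obtain i' where i': "x \<in> gr X i'" "\<eta> x \<in> gr X (i' + 1)" "p (\<eta> x) = \<zero>\<^bsub>R\<^esub>" "diff X (\<eta> x) = x"
      by (auto simp: P_def)
    then have "i' = i" using X.gr_disj[OF i'(1) x(1)] x(4) by blast
    then show "\<eta> x \<in> gr X (i + 1)" "p (\<eta> x) = \<zero>\<^bsub>R\<^esub>" "diff X (\<eta> x) = x" using i' by auto
  qed
  define f :: "'k + int + nat \<Rightarrow> 'x \<Rightarrow> 'x \<Rightarrow> 'x" where
    "f a x y = (case a of Inl c \<Rightarrow> c \<odot>\<^bsub>X\<^esub> x | Inr (Inl i) \<Rightarrow> comp X i x | Inr (Inr n) \<Rightarrow>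
        if n = 0 then x \<oplus>\<^bsub>X\<^esub> y else if n = 1 then x \<otimes>\<^bsub>X\<^esub> y else if n = 2 then diff X x else \<eta> x)" for a x y
  define S where "S = insert \<zero>\<^bsub>X\<^esub> (insert \<one>\<^bsub>X\<^esub> (\<sigma> ` carrier R))"
  define Y where "Y = (\<Union>n. clo f S n)"
  have SY: "S \<subseteq> Y" using UN_upper[of 0 UNIV "clo f S"] by (simp add: Y_def)
  have Yc: "Y \<subseteq> carrier X" unfolding Y_def
    by (rule clo_subset) (use \<sigma> \<eta>c in \<open>auto simp: S_def f_def split: sum.splits\<close>)
  have Yx: "x \<in> carrier X" if "x \<in> Y" for x using Yc that by blast
  have cl: "f a x y \<in> Y" if "x \<in> Y" "y \<in> Y" for a x y
    using that unfolding Y_def by (rule clo_closed)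
  have Yop: "c \<odot>\<^bsub>X\<^esub> x \<in> Y" "comp X i x \<in> Y" "x \<oplus>\<^bsub>X\<^esub> y \<in> Y" "x \<otimes>\<^bsub>X\<^esub> y \<in> Y" "diff X x \<in> Y" "\<eta> x \<in> Y"
    if "x \<in> Y" "y \<in> Y" for x y c i
    using cl[OF that, of "Inl c"] cl[OF that, of "Inr (Inl i)"] cl[OF that, of "Inr (Inr 0)"]
      cl[OF that, of "Inr (Inr 1)"] cl[OF that, of "Inr (Inr 2)"] cl[OF that, of "Inr (Inr 3)"]
    by (auto simp: f_def)
  have Ym: "x \<ominus>\<^bsub>X\<^esub> y \<in> Y" if "x \<in> Y" "y \<in> Y" for x y
    using that Yop Yx by (simp add: X.minus_eq')
  have "|S| \<le>o |UNIV :: 'u set|"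
  proof -
    have fld: "\<not> finite (Field |UNIV :: 'u set| )" using inf by (simp add: Field_card_of)
    have "|\<sigma> ` carrier R| \<le>o |UNIV :: 'u set|"
      using card_of_image[of \<sigma> "carrier R"] card_of_mono1[of "carrier R" UNIV] ordLeq_transitive by blast
    moreover have "|{\<zero>\<^bsub>X\<^esub>, \<one>\<^bsub>X\<^esub>}| \<le>o |UNIV :: 'u set|"
    proof -
      have "{\<zero>\<^bsub>X\<^esub>, \<one>\<^bsub>X\<^esub>} = (\<lambda>n::nat. if n = 0 then \<zero>\<^bsub>X\<^esub> else \<one>\<^bsub>X\<^esub>) ` UNIV"
        by (auto intro: image_eqI[of _ _ 0] image_eqI[of _ _ 1])
      then have "|{\<zero>\<^bsub>X\<^esub>, \<one>\<^bsub>X\<^esub>}| \<le>o |UNIV :: nat set|" using card_of_image by metis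
      moreover have "|UNIV :: nat set| \<le>o |UNIV :: 'u set|" using inf infinite_iff_card_of_nat by blast
      ultimately show ?thesis using ordLeq_transitive by blast
    qed
    ultimately have "|{\<zero>\<^bsub>X\<^esub>, \<one>\<^bsub>X\<^esub>} \<union> \<sigma> ` carrier R| \<le>o |UNIV :: 'u set|"
      using card_of_Un_ordLeq_infinite_Field[OF fld _ _ card_of_Card_order] by blast
    then show ?thesis by (simp add: S_def)
  qed
  then have "|Y| \<le>o |UNIV :: 'u set|"
    unfolding Y_def using clo_card[OF inf index_card[OF inf j]] by blast
  then obtain \<iota> :: "'x \<Rightarrow> 'u" where \<iota>: "inj_on \<iota> Y"
    using card_of_ordLeq[of Y "UNIV :: 'u set"] by blast
  define X0 where "X0 = X\<lparr>carrier := Y, gr := \<lambda>i. gr X i \<inter> Y\<rparr>"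
  have X0: "dg_algebra X0" unfolding X0_def
    by (rule X.sub_dga) (use Yc SY Yop in \<open>auto simp: S_def\<close>)
  interpret X0: dga X0 by unfold_locales fact
  have X0s: "carrier X0 = Y" "gr X0 i = gr X i \<inter> Y" "\<zero>\<^bsub>X0\<^esub> = \<zero>\<^bsub>X\<^esub>" "\<one>\<^bsub>X0\<^esub> = \<one>\<^bsub>X\<^esub>" "x \<oplus>\<^bsub>X0\<^esub> y = x \<oplus>\<^bsub>X\<^esub> y"
    "x \<otimes>\<^bsub>X0\<^esub> y = x \<otimes>\<^bsub>X\<^esub> y" "c \<odot>\<^bsub>X0\<^esub> x = c \<odot>\<^bsub>X\<^esub> x" "diff X0 = diff X" for i x y c
    by (simp_all add: X0_def)
  have \<iota>': "inj_on \<iota> (carrier X0)" using \<iota> by (simp add: X0s)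
  define T where "T = tr \<iota> X0"
  have T: "dg_algebra T" unfolding T_def by (rule X0.tr_dga[OF \<iota>'])
  interpret T: dga T by unfold_locales fact
  define q where "q = inv_into Y \<iota>"
  have q: "q (\<iota> x) = x" if "x \<in> Y" for x using \<iota> that by (simp add: q_def)
  note S = tr_simps[OF \<iota>', folded T_def, unfolded X0s]
  define p' where "p' = restrict (p \<circ> q) (carrier T)"
  have p'\<iota>: "p' (\<iota> x) = p x" if "x \<in> Y" for x using that by (simp add: p'_def S q)
  have Y01: "\<zero>\<^bsub>X\<^esub> \<in> Y" "\<one>\<^bsub>X\<^esub> \<in> Y" "\<sigma> r \<in> Y" if "r \<in> carrier R" for r using SY that by (auto simp: S_def)
  have Y1: "\<one>\<^bsub>X\<^esub> \<in> Y" "\<zero>\<^bsub>X\<^esub> \<in> Y" using SY by (auto simp: S_def)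
  have p': "p' \<in> dg_hom T R"
  proof (rule dg_homI)
    show "p' \<in> extensional (carrier T)" by (simp add: p'_def)
  qed (use pD Yx Yop Y1 in \<open>auto simp: S p'\<iota>\<close>)
  have prim: "\<exists>y\<in>Y. y \<in> gr X (i + 1) \<and> p y = \<zero>\<^bsub>R\<^esub> \<and> diff X y = x"
    if "x \<in> Y" "x \<in> gr X i" "diff X x = \<zero>\<^bsub>X\<^esub>" "p x = \<zero>\<^bsub>R\<^esub>" for x i
  proof (cases "x = \<zero>\<^bsub>X\<^esub>")
    case True
    then show ?thesis using Y1 p0 by (intro bexI[of _ "\<zero>\<^bsub>X\<^esub>"]) auto
  next
    case False
    then show ?thesis using \<eta>[OF that(2-4) False] Yop(6)[OF that(1) that(1)] by blast
  qed
  have lift: "\<exists>w\<in>Y. w \<in> gr X i \<and> p w = r" if "r \<in> gr R i" for r i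
  proof -
    have r: "r \<in> carrier R" using that by simp
    have "comp X i (\<sigma> r) \<in> Y" "comp X i (\<sigma> r) \<in> gr X i" using Yop(2) Y01[OF r] X.comp_ex(1) \<sigma>[OF r] by blast+
    moreover have "p (comp X i (\<sigma> r)) = r"
      using pc[OF \<sigma>(1)[OF r]] \<sigma>[OF r] R.comp_hom[OF that] by simp
    ultimately show ?thesis by blast
  qed
  have qi: "quasi_iso T R p'"
    unfolding quasi_iso_iff[OF T.dgs R.dgs p']
  proof (intro allI conjI ballI impI)
    fix i a assume a: "a \<in> gr T i" "diff T a = \<zero>\<^bsub>T\<^esub> \<and> p' a \<in> dg_boundaries R i"
    then obtain x where x: "a = \<iota> x" "x \<in> Y" "x \<in> gr X i" by (auto simp: S)
    have dx: "diff X x = \<zero>\<^bsub>X\<^esub>"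
      using a x Yop(5)[OF x(2) x(2)] Y1 \<iota> by (auto simp: S dest: inj_onD)
    obtain v where v: "v \<in> gr R (i + 1)" "p x = diff R v"
      using a x by (auto simp: p'\<iota> dg_boundaries_def)
    obtain w where w: "w \<in> Y" "w \<in> gr X (i + 1)" "p w = v" using lift[OF v(1)] by blast
    have dw: "diff X w \<in> gr X i" using X.gr_diff[OF w(2)] by simp
    define z where "z = x \<ominus>\<^bsub>X\<^esub> diff X w"
    have "z \<in> Y" using x w Ym Yop(5) by (simp add: z_def)
    moreover have "z \<in> gr X i" using x dw by (simp add: z_def)
    moreover have "diff X z = \<zero>\<^bsub>X\<^esub>" using x w dx by (simp add: z_def X.minus_eq' X.diff_add X.diff_smult)
    moreover have "p z = \<zero>\<^bsub>R\<^esub>"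
    proof -
      have "p z = p x \<ominus>\<^bsub>R\<^esub> p (diff X w)"
        unfolding z_def by (rule pm) (use x w Yx in auto)
      also have "\<dots> = diff R v \<ominus>\<^bsub>R\<^esub> diff R v" using x w v by (simp add: pD(7))
      finally show ?thesis using v by (simp add: a_minus_def R.M.r_neg)
    qed
    ultimately obtain y where y: "y \<in> Y" "y \<in> gr X (i + 1)" "p y = \<zero>\<^bsub>R\<^esub>" "diff X y = z" using prim by blast
    have "diff X (y \<oplus>\<^bsub>X\<^esub> w) = x"
      using y w x by (simp add: X.diff_add z_def a_minus_def X.M.a_assoc X.M.l_neg)
    moreover have "y \<oplus>\<^bsub>X\<^esub> w \<in> Y" "y \<oplus>\<^bsub>X\<^esub> w \<in> gr X (i + 1)" using y w Yop(3) by auto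
    ultimately have "\<iota> (y \<oplus>\<^bsub>X\<^esub> w) \<in> gr T (i + 1)" "diff T (\<iota> (y \<oplus>\<^bsub>X\<^esub> w)) = a"
      using x(1) by (auto simp: S)
    then show "a \<in> dg_boundaries T i" by (force simp: dg_boundaries_def)
  next
    fix i r assume r: "r \<in> gr R i" "diff R r = \<zero>\<^bsub>R\<^esub>"
    obtain w where w: "w \<in> Y" "w \<in> gr X i" "p w = r" using lift[OF r(1)] by blast
    have "diff X w \<in> gr X (i - 1)" "diff X w \<in> Y" "p (diff X w) = \<zero>\<^bsub>R\<^esub>"
      using w r Yop(5) by (auto simp: pD(7))
    then obtain u where u: "u \<in> Y" "u \<in> gr X i" "p u = \<zero>\<^bsub>R\<^esub>" "diff X u = diff X w"
      using prim[of "diff X w" "i - 1"] w by auto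
    define x where "x = w \<ominus>\<^bsub>X\<^esub> u"
    have x: "x \<in> Y" "x \<in> gr X i" using w u Ym by (auto simp: x_def)
    have dx: "diff X x = \<zero>\<^bsub>X\<^esub>"
    proof -
      have "diff X x = diff X w \<ominus>\<^bsub>X\<^esub> diff X w"
        using u(4) w u(2) by (simp add: x_def X.minus_eq' X.diff_add X.diff_smult)
      then show ?thesis using w by (simp add: a_minus_def X.M.r_neg)
    qed
    have "p x = r" using w u r by (simp add: x_def pm R.minus_eq')
    then have "\<iota> x \<in> gr T i" "diff T (\<iota> x) = \<zero>\<^bsub>T\<^esub>" "r \<ominus>\<^bsub>R\<^esub> p' (\<iota> x) = \<zero>\<^bsub>R\<^esub>"
      using x dx r by (auto simp: S p'\<iota> a_minus_def R.M.r_neg)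
    moreover have "\<zero>\<^bsub>R\<^esub> \<in> dg_boundaries R i"
      unfolding dg_boundaries_def by (rule image_eqI[of _ _ "\<zero>\<^bsub>R\<^esub>"]) auto
    ultimately show "\<exists>x\<in>gr T i. diff T x = \<zero>\<^bsub>T\<^esub> \<and> r \<ominus>\<^bsub>R\<^esub> p' x \<in> dg_boundaries R i" by force
  qed
  have im: "p' ` carrier T = carrier R"
  proof
    show "p' ` carrier T \<subseteq> carrier R" using dg_homD(1)[OF p'] by blast
    show "carrier R \<subseteq> p' ` carrier T"
    proof
      fix r assume r: "r \<in> carrier R"
      then have "p' (\<iota> (\<sigma> r)) = r" "\<iota> (\<sigma> r) \<in> carrier T" using Y01[OF r] \<sigma> by (auto simp: p'\<iota> S)
      then show "r \<in> p' ` carrier T" by force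
    qed
  qed
  have idh: "restrict id (carrier R) \<in> dg_hom R R"
    by (rule dg_homI) auto
  obtain g where g: "g \<in> dg_hom R T" "\<And>x. x \<in> carrier R \<Longrightarrow> p' (g x) = x"
  proof -
    have "\<exists>g\<in>dg_hom R T. \<forall>x\<in>carrier R. p' (g x) = restrict id (carrier R) x"
      using cof T R qi im idh unfolding cofibrant_def by blast
    then show ?thesis using that by auto
  qed
  note gD = dg_homD[OF g(1)]
  define h where "h = restrict (q \<circ> g) (carrier R)"
  have g\<iota>: "\<exists>x\<in>Y. g r = \<iota> x" if "r \<in> carrier R" for r
    using gD(1)[OF that] by (auto simp: S)
  have qg: "q (g r) \<in> Y" "g r = \<iota> (q (g r))" if "r \<in> carrier R" for r
    using g\<iota>[OF that] q by auto
  have \<iota>e: "x = y" if "\<iota> x = \<iota> y" "x \<in> Y" "y \<in> Y" for x y using \<iota> that by (auto dest: inj_onD)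
  have "h \<in> dg_hom R X"
  proof (rule dg_homI)
    show "h \<in> extensional (carrier R)" by (simp add: h_def)
    show "h x \<in> carrier X" if "x \<in> carrier R" for x using that qg Yx by (simp add: h_def)
    show "h x \<in> gr X i" if "x \<in> gr R i" for x i
      using that gD(6)[OF that] qg(1)[of x] q by (auto simp: h_def S)
    show "h \<one>\<^bsub>R\<^esub> = \<one>\<^bsub>X\<^esub>" using gD(4) Y1 q by (simp add: h_def S)
    show "h (x \<oplus>\<^bsub>R\<^esub> y) = h x \<oplus>\<^bsub>X\<^esub> h y" if "x \<in> carrier R" "y \<in> carrier R" for x y
      using that gD(2)[OF that] qg[OF that(1)] qg[OF that(2)] Yop(3)
      by (metis (no_types, lifting) R.M.a_closed S(6) comp_apply h_def q restrict_apply')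
    show "h (x \<otimes>\<^bsub>R\<^esub> y) = h x \<otimes>\<^bsub>X\<^esub> h y" if "x \<in> carrier R" "y \<in> carrier R" for x y
      using that gD(3)[OF that] qg[OF that(1)] qg[OF that(2)] Yop(4)
      by (metis (no_types, lifting) R.A.m_closed S(5) comp_apply h_def q restrict_apply')
    show "h (c \<odot>\<^bsub>R\<^esub> x) = c \<odot>\<^bsub>X\<^esub> h x" if "x \<in> carrier R" for c x
      using that gD(5)[OF that] qg[OF that] Yop(1)
      by (metis (no_types, lifting) R.smult_cl S(7) comp_apply h_def q restrict_apply')
    show "h (diff R x) = diff X (h x)" if "x \<in> carrier R" for x
      using that gD(7)[OF that] qg[OF that] Yop(5)
      by (metis (no_types, lifting) R.diff_carrier S(8) comp_apply h_def q restrict_apply')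
  qed
  moreover have "p (h r) = r" if "r \<in> carrier R" for r
    using g(2)[OF that] qg[OF that] p'\<iota>[of "q (g r)"] that by (simp add: h_def)
  ultimately show ?thesis by blast
qed

section \<open>Square-zero extensions and acyclic bimodules\<close>

text \<open>
  The unit of \<open>B\<close> acts as the identity on the left only: on the right it is an idempotent, as for the
  cochain bimodules below.
\<close>

locale dg_bimod = B: dga B + K: dgs K
  for B :: "('k::field, 'x) dga" and K :: "('k, 'm) dga" +
  fixes l :: "'x \<Rightarrow> 'm \<Rightarrow> 'm" and r :: "'m \<Rightarrow> 'x \<Rightarrow> 'm"
  assumes l_cl [simp]: "x \<in> carrier B \<Longrightarrow> k \<in> carrier K \<Longrightarrow> l x k \<in> carrier K"
    and r_cl [simp]: "x \<in> carrier B \<Longrightarrow> k \<in> carrier K \<Longrightarrow> r k x \<in> carrier K"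
    and l_add1: "x \<in> carrier B \<Longrightarrow> y \<in> carrier B \<Longrightarrow> k \<in> carrier K \<Longrightarrow> l (x \<oplus>\<^bsub>B\<^esub> y) k = l x k \<oplus>\<^bsub>K\<^esub> l y k"
    and l_add2: "x \<in> carrier B \<Longrightarrow> k \<in> carrier K \<Longrightarrow> k' \<in> carrier K \<Longrightarrow> l x (k \<oplus>\<^bsub>K\<^esub> k') = l x k \<oplus>\<^bsub>K\<^esub> l x k'"
    and r_add1: "x \<in> carrier B \<Longrightarrow> y \<in> carrier B \<Longrightarrow> k \<in> carrier K \<Longrightarrow> r k (x \<oplus>\<^bsub>B\<^esub> y) = r k x \<oplus>\<^bsub>K\<^esub> r k y"
    and r_add2: "x \<in> carrier B \<Longrightarrow> k \<in> carrier K \<Longrightarrow> k' \<in> carrier K \<Longrightarrow> r (k \<oplus>\<^bsub>K\<^esub> k') x = r k x \<oplus>\<^bsub>K\<^esub> r k' x"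
    and l_sm1: "x \<in> carrier B \<Longrightarrow> k \<in> carrier K \<Longrightarrow> l (c \<odot>\<^bsub>B\<^esub> x) k = c \<odot>\<^bsub>K\<^esub> l x k"
    and l_sm2: "x \<in> carrier B \<Longrightarrow> k \<in> carrier K \<Longrightarrow> l x (c \<odot>\<^bsub>K\<^esub> k) = c \<odot>\<^bsub>K\<^esub> l x k"
    and r_sm1: "x \<in> carrier B \<Longrightarrow> k \<in> carrier K \<Longrightarrow> r k (c \<odot>\<^bsub>B\<^esub> x) = c \<odot>\<^bsub>K\<^esub> r k x"
    and r_sm2: "x \<in> carrier B \<Longrightarrow> k \<in> carrier K \<Longrightarrow> r (c \<odot>\<^bsub>K\<^esub> k) x = c \<odot>\<^bsub>K\<^esub> r k x"
    and l_mult: "x \<in> carrier B \<Longrightarrow> y \<in> carrier B \<Longrightarrow> k \<in> carrier K \<Longrightarrow> l (x \<otimes>\<^bsub>B\<^esub> y) k = l x (l y k)"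
    and r_mult: "x \<in> carrier B \<Longrightarrow> y \<in> carrier B \<Longrightarrow> k \<in> carrier K \<Longrightarrow> r k (x \<otimes>\<^bsub>B\<^esub> y) = r (r k x) y"
    and l_r: "x \<in> carrier B \<Longrightarrow> y \<in> carrier B \<Longrightarrow> k \<in> carrier K \<Longrightarrow> r (l x k) y = l x (r k y)"
    and l_one: "k \<in> carrier K \<Longrightarrow> l \<one>\<^bsub>B\<^esub> k = k"
    and l_gr [simp]: "x \<in> gr B i \<Longrightarrow> k \<in> gr K j \<Longrightarrow> l x k \<in> gr K (i + j)"
    and r_gr [simp]: "x \<in> gr B i \<Longrightarrow> k \<in> gr K j \<Longrightarrow> r k x \<in> gr K (j + i)"
    and l_diff: "x \<in> gr B i \<Longrightarrow> k \<in> carrier K \<Longrightarrow>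
      diff K (l x k) = l (diff B x) k \<oplus>\<^bsub>K\<^esub> sg i \<odot>\<^bsub>K\<^esub> l x (diff K k)"
    and r_diff: "x \<in> carrier B \<Longrightarrow> k \<in> gr K i \<Longrightarrow>
      diff K (r k x) = r (diff K k) x \<oplus>\<^bsub>K\<^esub> sg i \<odot>\<^bsub>K\<^esub> r k (diff B x)"
begin

definition is_der :: "('x \<Rightarrow> 'm) \<Rightarrow> bool" where
  "is_der D \<longleftrightarrow> (\<forall>x\<in>carrier B. D x \<in> carrier K) \<and>
     (\<forall>x\<in>carrier B. \<forall>y\<in>carrier B. D (x \<oplus>\<^bsub>B\<^esub> y) = D x \<oplus>\<^bsub>K\<^esub> D y) \<and>
     (\<forall>c. \<forall>x\<in>carrier B. D (c \<odot>\<^bsub>B\<^esub> x) = c \<odot>\<^bsub>K\<^esub> D x) \<and>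
     (\<forall>i. \<forall>x\<in>gr B i. D x \<in> gr K i) \<and>
     (\<forall>x\<in>carrier B. \<forall>y\<in>carrier B. D (x \<otimes>\<^bsub>B\<^esub> y) = r (D x) y \<oplus>\<^bsub>K\<^esub> l x (D y)) \<and>
     (\<forall>x\<in>carrier B. D (diff B x) = diff K (D x))"

text \<open>
  A null-homotopy of \<open>D\<close> as a derivation. As \<open>H\<close> has degree 1, it passes \<open>x\<close> with the sign automorphism
  \<open>tau\<close>; equivalently \<open>x \<mapsto> (x, H x)\<close> is a homomorphism into the extension \<open>sqz D\<close> below.
\<close>

definition is_htpy :: "('x \<Rightarrow> 'm) \<Rightarrow> ('x \<Rightarrow> 'm) \<Rightarrow> bool" where
  "is_htpy D H \<longleftrightarrow> (\<forall>x\<in>carrier B. H x \<in> carrier K) \<and>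
     (\<forall>x\<in>carrier B. \<forall>y\<in>carrier B. H (x \<oplus>\<^bsub>B\<^esub> y) = H x \<oplus>\<^bsub>K\<^esub> H y) \<and>
     (\<forall>c. \<forall>x\<in>carrier B. H (c \<odot>\<^bsub>B\<^esub> x) = c \<odot>\<^bsub>K\<^esub> H x) \<and>
     (\<forall>i. \<forall>x\<in>gr B i. H x \<in> gr K (i + 1)) \<and>
     (\<forall>x\<in>carrier B. \<forall>y\<in>carrier B. H (x \<otimes>\<^bsub>B\<^esub> y) = r (H x) y \<oplus>\<^bsub>K\<^esub> l (tau B x) (H y)) \<and>
     (\<forall>x\<in>carrier B. D x = diff K (H x) \<oplus>\<^bsub>K\<^esub> H (diff B x))"

text \<open>
  The square-zero extension of \<open>B\<close> by \<open>K\<close>, shifted by one, with differential twisted by \<open>D\<close>.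
\<close>

definition sqz :: "('x \<Rightarrow> 'm) \<Rightarrow> ('k, 'x \<times> 'm) dga" where
  "sqz D = \<lparr>carrier = carrier B \<times> carrier K,
     mult = (\<lambda>p q. (fst p \<otimes>\<^bsub>B\<^esub> fst q, r (snd p) (fst q) \<oplus>\<^bsub>K\<^esub> l (tau B (fst p)) (snd q))),
     one = (\<one>\<^bsub>B\<^esub>, \<zero>\<^bsub>K\<^esub>), zero = (\<zero>\<^bsub>B\<^esub>, \<zero>\<^bsub>K\<^esub>),
     add = (\<lambda>p q. (fst p \<oplus>\<^bsub>B\<^esub> fst q, snd p \<oplus>\<^bsub>K\<^esub> snd q)), smult = (\<lambda>c p. (c \<odot>\<^bsub>B\<^esub> fst p, c \<odot>\<^bsub>K\<^esub> snd p)),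
     gr = (\<lambda>i. gr B i \<times> gr K (i + 1)),
     diff = (\<lambda>p. (diff B (fst p), D (fst p) \<ominus>\<^bsub>K\<^esub> diff K (snd p)))\<rparr>"

lemma l_null [simp]: "x \<in> carrier B \<Longrightarrow> l x \<zero>\<^bsub>K\<^esub> = \<zero>\<^bsub>K\<^esub>"
  using l_sm2[of x "\<zero>\<^bsub>K\<^esub>" 0] by simp

lemma r_null [simp]: "x \<in> carrier B \<Longrightarrow> r \<zero>\<^bsub>K\<^esub> x = \<zero>\<^bsub>K\<^esub>"
  using r_sm2[of x "\<zero>\<^bsub>K\<^esub>" 0] by simp

lemma r_null2 [simp]: "k \<in> carrier K \<Longrightarrow> r k \<zero>\<^bsub>B\<^esub> = \<zero>\<^bsub>K\<^esub>"
  using r_sm1[of "\<zero>\<^bsub>B\<^esub>" k 0] by simp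

lemma sqz_dg_space:
  assumes D: "is_der D"
  shows "dg_space (sqz D)" (is "dg_space ?X")
proof -
  have D': "D x \<in> carrier K" "D (x \<oplus>\<^bsub>B\<^esub> y) = D x \<oplus>\<^bsub>K\<^esub> D y" "D (c \<odot>\<^bsub>B\<^esub> x) = c \<odot>\<^bsub>K\<^esub> D x"
    "D (diff B x) = diff K (D x)" if "x \<in> carrier B" "y \<in> carrier B" for x y c
    using D that by (auto simp: is_der_def)
  have Dg: "D x \<in> gr K i" if "x \<in> gr B i" for x i using D that by (auto simp: is_der_def)
  show ?thesis
  proof (rule dg_spaceI[where pr = "\<lambda>i p. (comp B i (fst p), comp K (i + 1) (snd p))"])
    show mod: "module ground ?X"
      by (rule module_groundI)
        (auto simp: sqz_def B.M.a_ac K.M.a_ac B.sm_distr K.sm_distr B.sm_add K.sm_add B.sm_mult K.sm_mult)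
    show "submodule (gr ?X i) ground ?X" for i
      by (rule submodule_groundI[OF mod]) (auto simp: sqz_def)
    show "carrier ?X \<subseteq> Z" if gen: "\<And>i. gr ?X i \<subseteq> Z"
      "\<And>x y. x \<in> Z \<Longrightarrow> y \<in> Z \<Longrightarrow> x \<in> carrier ?X \<Longrightarrow> y \<in> carrier ?X \<Longrightarrow> x \<oplus>\<^bsub>?X\<^esub> y \<in> Z" for Z
    proof
      have 1: "(x, \<zero>\<^bsub>K\<^esub>) \<in> Z" if "x \<in> carrier B" for x using that
      proof (induction x rule: B.hom_induct)
        case (hom i y)
        then show ?case using gen(1)[of i] by (auto simp: sqz_def)
      next
        case (add y z)
        then show ?case using gen(2)[of "(y, \<zero>\<^bsub>K\<^esub>)" "(z, \<zero>\<^bsub>K\<^esub>)"] by (auto simp: sqz_def)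
      qed
      have 2: "(\<zero>\<^bsub>B\<^esub>, k) \<in> Z" if "k \<in> carrier K" for k using that
      proof (induction k rule: K.hom_induct)
        case (hom i y)
        then show ?case using gen(1)[of "i - 1"] by (auto simp: sqz_def)
      next
        case (add y z)
        then show ?case using gen(2)[of "(\<zero>\<^bsub>B\<^esub>, y)" "(\<zero>\<^bsub>B\<^esub>, z)"] by (auto simp: sqz_def)
      qed
      fix p assume "p \<in> carrier ?X"
      then obtain x k where p: "p = (x, k)" "x \<in> carrier B" "k \<in> carrier K" by (auto simp: sqz_def)
      then show "p \<in> Z" using gen(2)[OF 1[OF p(2)] 2[OF p(3)]] by (auto simp: sqz_def)
    qed
    show "diff ?X (p \<oplus>\<^bsub>?X\<^esub> q) = diff ?X p \<oplus>\<^bsub>?X\<^esub> diff ?X q" if "p \<in> carrier ?X" "q \<in> carrier ?X" for p q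
      using that D' by (auto simp: sqz_def B.diff_add K.diff_add K.minus_eq' K.sm_distr K.M.a_ac)
    show "diff ?X (c \<odot>\<^bsub>?X\<^esub> p) = c \<odot>\<^bsub>?X\<^esub> diff ?X p" if "p \<in> carrier ?X" for c p
      using that D' by (auto simp: sqz_def B.diff_smult K.diff_smult K.minus_eq' K.sm_distr K.sm_mult)
    show "diff ?X p \<in> gr ?X (i - 1)" if "p \<in> gr ?X i" for p i
      using that Dg K.gr_diff[of _ "i + 1"] by (auto simp: sqz_def)
    show "diff ?X (diff ?X p) = \<zero>\<^bsub>?X\<^esub>" if "p \<in> carrier ?X" for p
      using that D' by (auto simp: sqz_def K.minus_eq' K.diff_add K.diff_smult) (simp add: K.neg_eq[symmetric] K.M.r_neg)
  qed (auto simp: sqz_def B.comp_add K.comp_add B.comp_hom K.comp_hom)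
qed

lemma sqz_dga:
  assumes D: "is_der D" and un: "\<And>k. k \<in> carrier K \<Longrightarrow> r k \<one>\<^bsub>B\<^esub> = k"
  shows "dg_algebra (sqz D)" (is "dg_algebra ?X")
proof (rule dg_algebraI[OF sqz_dg_space[OF D]])
  note T = B.tau_add B.tau_smult B.tau_mult B.tau_one
  show "(p \<otimes>\<^bsub>?X\<^esub> q) \<otimes>\<^bsub>?X\<^esub> s = p \<otimes>\<^bsub>?X\<^esub> (q \<otimes>\<^bsub>?X\<^esub> s)"
    if "p \<in> carrier ?X" "q \<in> carrier ?X" "s \<in> carrier ?X" for p q s
    using that by (auto simp: sqz_def B.A.m_assoc T r_add2 l_add2 r_mult l_mult l_r K.M.a_ac)
  show "(p \<oplus>\<^bsub>?X\<^esub> q) \<otimes>\<^bsub>?X\<^esub> s = p \<otimes>\<^bsub>?X\<^esub> s \<oplus>\<^bsub>?X\<^esub> q \<otimes>\<^bsub>?X\<^esub> s"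
    if "p \<in> carrier ?X" "q \<in> carrier ?X" "s \<in> carrier ?X" for p q s
    using that by (auto simp: sqz_def B.A.l_distr T r_add2 l_add1 K.M.a_ac)
  show "s \<otimes>\<^bsub>?X\<^esub> (p \<oplus>\<^bsub>?X\<^esub> q) = s \<otimes>\<^bsub>?X\<^esub> p \<oplus>\<^bsub>?X\<^esub> s \<otimes>\<^bsub>?X\<^esub> q"
    if "p \<in> carrier ?X" "q \<in> carrier ?X" "s \<in> carrier ?X" for p q s
    using that by (auto simp: sqz_def B.A.r_distr T r_add1 l_add2 K.M.a_ac)
  show "p \<otimes>\<^bsub>?X\<^esub> q \<in> gr ?X (i + j)" if "p \<in> gr ?X i" "q \<in> gr ?X j" for p q i j
  proof -
    from that obtain x k y k' where pq: "p = (x, k)" "q = (y, k')" "x \<in> gr B i" "k \<in> gr K (i + 1)" "y \<in> gr B j" "k' \<in> gr K (j + 1)"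
      by (auto simp: sqz_def)
    have "r k y \<in> gr K (i + j + 1)" using r_gr[OF pq(5,4)] by (simp add: algebra_simps)
    moreover have "l (tau B x) k' \<in> gr K (i + j + 1)"
      using l_gr[OF pq(3,6)] pq by (simp add: B.tau_hom[OF pq(3)] l_sm1 algebra_simps)
    ultimately show ?thesis using pq by (auto simp: sqz_def)
  qed
  show "diff ?X (p \<otimes>\<^bsub>?X\<^esub> q) = diff ?X p \<otimes>\<^bsub>?X\<^esub> q \<oplus>\<^bsub>?X\<^esub> sg i \<odot>\<^bsub>?X\<^esub> (p \<otimes>\<^bsub>?X\<^esub> diff ?X q)"
    if "p \<in> gr ?X i" "q \<in> carrier ?X" for p q i
  proof -
    from that obtain x k y k' where pq: "p = (x, k)" "q = (y, k')" "x \<in> gr B i" "k \<in> gr K (i + 1)" "y \<in> carrier B" "k' \<in> carrier K"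
      by (auto simp: sqz_def)
    have c: "x \<in> carrier B" "k \<in> carrier K" using pq by auto
    have D': "D x \<in> carrier K" "D y \<in> carrier K" "D (x \<otimes>\<^bsub>B\<^esub> y) = r (D x) y \<oplus>\<^bsub>K\<^esub> l x (D y)"
      using D pq c by (auto simp: is_der_def)
    have t: "tau B (diff B x) = (- sg i) \<odot>\<^bsub>B\<^esub> diff B x" "tau B x = sg i \<odot>\<^bsub>B\<^esub> x"
      using B.tau_hom[OF B.gr_diff[OF pq(3)]] B.tau_hom[OF pq(3)] by (auto simp: sg_diff1)
    have dk: "diff K (r k y) = r (diff K k) y \<oplus>\<^bsub>K\<^esub> (- sg i) \<odot>\<^bsub>K\<^esub> r k (diff B y)"
      using r_diff[OF pq(5,4)] by (simp add: power_int_add)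
    show ?thesis
      using pq c D' by (simp add: sqz_def t B.leibniz l_sm1 l_sm2 K.minus_eq' dk K.diff_add K.diff_smult l_diff
          K.sm_distr K.sm_mult sg_sq r_add2 l_add2 r_sm2 K.M.a_ac)
  qed
qed (auto simp: sqz_def B.mult_sm K.sm_distr l_sm1 l_sm2 r_sm1 r_sm2 B.tau_smult un l_one B.tau_one)

text \<open>
  Over a cofibrant algebra an acyclic bimodule has no derivations up to homotopy: a derivation \<open>D\<close>
  twists the differential of the square-zero extension, and a section of the resulting algebra over
  \<open>B\<close> is a null-homotopy of \<open>D\<close>.
\<close>

lemma null_homotopic_unital:
  fixes j :: "'k \<Rightarrow> 'x"
  assumes cof: "cofibrant B" and inf: "infinite (UNIV :: 'x set)" and j: "inj j"
    and un: "\<And>k. k \<in> carrier K \<Longrightarrow> r k \<one>\<^bsub>B\<^esub> = k"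
    and ac: "\<And>i k. k \<in> gr K i \<Longrightarrow> diff K k = \<zero>\<^bsub>K\<^esub> \<Longrightarrow> \<exists>k'\<in>gr K (i + 1). diff K k' = k"
    and D: "is_der D"
  shows "\<exists>H. is_htpy D H"
proof -
  let ?X = "sqz D"
  have X: "dg_algebra ?X" using sqz_dga[OF D un] .
  interpret X: dga ?X by unfold_locales fact
  have D': "D x \<in> carrier K" if "x \<in> carrier B" for x using D that by (auto simp: is_der_def)
  have D0: "D \<zero>\<^bsub>B\<^esub> = \<zero>\<^bsub>K\<^esub>"
  proof -
    have "D (0 \<odot>\<^bsub>B\<^esub> \<zero>\<^bsub>B\<^esub>) = 0 \<odot>\<^bsub>K\<^esub> D \<zero>\<^bsub>B\<^esub>" using D unfolding is_der_def by blast
    then show ?thesis using D'[of "\<zero>\<^bsub>B\<^esub>"] by simp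
  qed
  have p: "restrict fst (carrier ?X) \<in> dg_hom ?X B"
  proof (rule dg_homI)
    show "restrict fst (carrier ?X) (diff ?X x) = diff B (restrict fst (carrier ?X) x)" if "x \<in> carrier ?X" for x
      using that X.diff_carrier[OF that] by (auto simp: sqz_def)
    show "restrict fst (carrier ?X) x \<in> gr B i" if "x \<in> gr ?X i" for x i
      using that X.gr_carrier[OF that] by (auto simp: sqz_def)
  qed (auto simp: sqz_def)
  have "\<exists>g\<in>dg_hom B ?X. \<forall>x\<in>carrier B. restrict fst (carrier ?X) (g x) = x"
  proof (rule cofibrant_section[OF cof inf j X p])
    show "\<exists>x\<in>carrier ?X. restrict fst (carrier ?X) x = b" if "b \<in> carrier B" for b
      using that by (intro bexI[of _ "(b, \<zero>\<^bsub>K\<^esub>)"]) (auto simp: sqz_def)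
    fix i x assume x: "x \<in> gr ?X i" "diff ?X x = \<zero>\<^bsub>?X\<^esub>" "restrict fst (carrier ?X) x = \<zero>\<^bsub>B\<^esub>"
    then obtain k where k: "x = (\<zero>\<^bsub>B\<^esub>, k)" "k \<in> gr K (i + 1)" using X.gr_carrier[OF x(1)] by (auto simp: sqz_def)
    have "diff K k = \<zero>\<^bsub>K\<^esub>"
    proof -
      have "\<zero>\<^bsub>K\<^esub> \<ominus>\<^bsub>K\<^esub> diff K k = \<zero>\<^bsub>K\<^esub>" using x(2) k D0 by (auto simp: sqz_def)
      then have "\<ominus>\<^bsub>K\<^esub> diff K k = \<zero>\<^bsub>K\<^esub>" using k by (simp add: a_minus_def)
      then have "(-1) \<odot>\<^bsub>K\<^esub> ((-1) \<odot>\<^bsub>K\<^esub> diff K k) = \<zero>\<^bsub>K\<^esub>" using k by (simp add: K.neg_eq)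
      then show ?thesis using k by (simp add: K.sm_mult)
    qed
    then obtain k' where k': "k' \<in> gr K (i + 1 + 1)" "diff K k' = k" using ac[OF k(2)] by blast
    have "(\<zero>\<^bsub>B\<^esub>, \<ominus>\<^bsub>K\<^esub> k') \<in> gr ?X (i + 1)" "diff ?X (\<zero>\<^bsub>B\<^esub>, \<ominus>\<^bsub>K\<^esub> k') = x"
      using k k' D0 by (auto simp: sqz_def K.minus_eq' K.neg_eq K.diff_smult K.sm_mult)
    then show "\<exists>y\<in>gr ?X (i + 1). restrict fst (carrier ?X) y = \<zero>\<^bsub>B\<^esub> \<and> diff ?X y = x"
      using X.gr_carrier by (intro bexI[of _ "(\<zero>\<^bsub>B\<^esub>, \<ominus>\<^bsub>K\<^esub> k')"]) auto
  qed
  then obtain g where g: "g \<in> dg_hom B ?X" "\<And>x. x \<in> carrier B \<Longrightarrow> restrict fst (carrier ?X) (g x) = x" by blast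
  note gD = dg_homD[OF g(1)]
  define H where "H = snd \<circ> g"
  have gH: "g x = (x, H x)" if "x \<in> carrier B" for x
    using g(2)[OF that] gD(1)[OF that] by (auto simp: H_def prod_eq_iff)
  have "is_htpy D H"
    unfolding is_htpy_def
  proof (intro conjI ballI allI)
    fix x assume x: "x \<in> carrier B"
    show Hx: "H x \<in> carrier K" using gD(1)[OF x] gH[OF x] by (simp add: sqz_def)
    show "H (c \<odot>\<^bsub>B\<^esub> x) = c \<odot>\<^bsub>K\<^esub> H x" for c
      using gD(5)[OF x, of c] gH[OF x] gH[OF B.smult_cl[OF x]] by (simp add: sqz_def)
    have e: "H (diff B x) = D x \<ominus>\<^bsub>K\<^esub> diff K (H x)"
      using gD(7)[OF x] gH[OF x] gH[OF B.diff_carrier[OF x]] by (simp add: sqz_def)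
    show "D x = diff K (H x) \<oplus>\<^bsub>K\<^esub> H (diff B x)"
      using Hx D'[OF x] unfolding e a_minus_def by (simp add: K.M.a_ac K.M.r_neg2 K.M.r_neg1 K.M.r_neg)
    fix y assume y: "y \<in> carrier B"
    show "H (x \<oplus>\<^bsub>B\<^esub> y) = H x \<oplus>\<^bsub>K\<^esub> H y"
      using gD(2)[OF x y] gH[OF x] gH[OF y] gH[OF B.M.a_closed[OF x y]] by (simp add: sqz_def)
    show "H (x \<otimes>\<^bsub>B\<^esub> y) = r (H x) y \<oplus>\<^bsub>K\<^esub> l (tau B x) (H y)"
      using gD(3)[OF x y] gH[OF x] gH[OF y] gH[OF B.A.m_closed[OF x y]] by (simp add: sqz_def)
  next
    fix i x assume x: "x \<in> gr B i"
    then show "H x \<in> gr K (i + 1)" using gD(6)[OF x] gH[OF B.gr_carrier[OF x]] by (simp add: sqz_def)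
  qed
  then show ?thesis by blast
qed

text \<open>
  The right unit is compatible with the grading and the differential, so its image splits off as a
  sub-bimodule on which it is the identity.
\<close>

lemma K1_bimod:
  fixes K1 defines "K1 \<equiv> K\<lparr>carrier := {k \<in> carrier K. r k \<one>\<^bsub>B\<^esub> = k}, gr := \<lambda>i. gr K i \<inter> {k \<in> carrier K. r k \<one>\<^bsub>B\<^esub> = k}\<rparr>"
  shows "dg_bimod B K1 l r"
proof -
  let ?Y = "{k \<in> carrier K. r k \<one>\<^bsub>B\<^esub> = k}"
  have d1: "diff K (r k \<one>\<^bsub>B\<^esub>) = r (diff K k) \<one>\<^bsub>B\<^esub>" if "k \<in> carrier K" for k
    using that
  proof (induction k rule: K.hom_induct)
    case (hom i k)
    then show ?case using r_diff[of "\<one>\<^bsub>B\<^esub>" k i] by (simp add: B.diff_one)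
  qed (simp add: r_add2 K.diff_add)
  have c1: "comp K i (r k \<one>\<^bsub>B\<^esub>) = r (comp K i k) \<one>\<^bsub>B\<^esub>" if "k \<in> carrier K" for k i
    using that
  proof (induction k rule: K.hom_induct)
    case (hom j k)
    then show ?case using r_gr[of "\<one>\<^bsub>B\<^esub>" 0 k j] by (simp add: K.comp_hom[of _ j])
  qed (simp add: r_add2 K.comp_add)
  have K1: "dg_space K1" unfolding K1_def
    by (rule K.sub_dg_space) (auto simp: r_add2 r_sm2 d1[symmetric] c1[symmetric])
  have s: "carrier K1 = ?Y" "gr K1 = (\<lambda>i. gr K i \<inter> ?Y)" "add K1 = add K" "smult K1 = smult K" "diff K1 = diff K"
    by (simp_all add: K1_def)
  show ?thesis
  proof (rule dg_bimod.intro)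
    show "dga B" by unfold_locales
    show "dgs K1" by unfold_locales fact
    show "dg_bimod_axioms B K1 l r"
      by (rule dg_bimod_axioms.intro)
        (simp_all add: s l_add1 l_add2 r_add1 r_add2 l_sm1 l_sm2 r_sm1 r_sm2 l_mult l_one l_diff r_diff l_r
          r_mult[symmetric] r_mult[of "\<one>\<^bsub>B\<^esub>", symmetric])
  qed
qed

text \<open>
  The same holds when the unit of \<open>B\<close> acts on the right only by an idempotent: on the complement of
  its image every derivation is inner, hence null-homotopic.
\<close>

lemma null_homotopic:
  fixes j :: "'k \<Rightarrow> 'x"
  assumes cof: "cofibrant B" and inf: "infinite (UNIV :: 'x set)" and j: "inj j"
    and ac: "\<And>i k. k \<in> gr K i \<Longrightarrow> diff K k = \<zero>\<^bsub>K\<^esub> \<Longrightarrow> \<exists>k'\<in>gr K (i + 1). diff K k' = k"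
    and D: "is_der D"
  shows "\<exists>H. is_htpy D H"
proof -
  let ?Y = "{k \<in> carrier K. r k \<one>\<^bsub>B\<^esub> = k}"
  define K1 where "K1 = K\<lparr>carrier := ?Y, gr := \<lambda>i. gr K i \<inter> ?Y\<rparr>"
  interpret K1: dg_bimod B K1 l r unfolding K1_def by (rule K1_bimod)
  have s: "carrier K1 = ?Y" "gr K1 = (\<lambda>i. gr K i \<inter> ?Y)" "add K1 = add K" "smult K1 = smult K" "diff K1 = diff K"
    "zero K1 = zero K"
    by (simp_all add: K1_def)
  have D': "D x \<in> carrier K" "D (x \<oplus>\<^bsub>B\<^esub> y) = D x \<oplus>\<^bsub>K\<^esub> D y" "D (c \<odot>\<^bsub>B\<^esub> x) = c \<odot>\<^bsub>K\<^esub> D x"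
    "D (diff B x) = diff K (D x)" "D (x \<otimes>\<^bsub>B\<^esub> y) = r (D x) y \<oplus>\<^bsub>K\<^esub> l x (D y)"
    if "x \<in> carrier B" "y \<in> carrier B" for x y c
    using D that by (auto simp: is_der_def)
  have Dg: "D x \<in> gr K i" if "x \<in> gr B i" for x i using D that by (auto simp: is_der_def)
  have Dc: "D x \<in> carrier K" if "x \<in> carrier B" for x using D'(1) that by blast
  have Dgc: "D x \<in> carrier K" if "x \<in> gr B i" for x i using Dc that by simp
  have r11: "r (r k \<one>\<^bsub>B\<^esub>) \<one>\<^bsub>B\<^esub> = r k \<one>\<^bsub>B\<^esub>" if "k \<in> carrier K" for k
    using that by (simp add: r_mult[symmetric])
  have r1x: "r (r k \<one>\<^bsub>B\<^esub>) x = r k x" "r (r k x) \<one>\<^bsub>B\<^esub> = r k x" if "k \<in> carrier K" "x \<in> carrier B" for k x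
    using that by (simp_all add: r_mult[symmetric])
  have rg: "r k \<one>\<^bsub>B\<^esub> \<in> gr K i" if "k \<in> gr K i" for k i using r_gr[OF B.one_gr that] by simp
  have d1: "diff K (r k \<one>\<^bsub>B\<^esub>) = r (diff K k) \<one>\<^bsub>B\<^esub>" if "k \<in> carrier K" for k
    using that
  proof (induction k rule: K.hom_induct)
    case (hom i k)
    then show ?case using r_diff[of "\<one>\<^bsub>B\<^esub>" k i] by (simp add: B.diff_one)
  qed (simp add: r_add2 K.diff_add)
  define D1 where "D1 x = r (D x) \<one>\<^bsub>B\<^esub>" for x
  have D1: "K1.is_der D1"
    unfolding K1.is_der_def s
    by (auto simp: D1_def Dc Dgc D' r11 r_add2 r_sm2 Dg rg d1 l_r r1x)
  have "\<exists>H. K1.is_htpy D1 H"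
  proof (rule K1.null_homotopic_unital[OF cof inf j _ _ D1])
    show "r k \<one>\<^bsub>B\<^esub> = k" if "k \<in> carrier K1" for k using that by (simp add: s)
    fix i k assume k: "k \<in> gr K1 i" "diff K1 k = \<zero>\<^bsub>K1\<^esub>"
    then obtain k' where k': "k' \<in> gr K (i + 1)" "diff K k' = k" using ac[of k i] by (auto simp: s)
    have "r k' \<one>\<^bsub>B\<^esub> \<in> gr K1 (i + 1)" "diff K1 (r k' \<one>\<^bsub>B\<^esub>) = k"
      using k k' rg[OF k'(1)] by (auto simp: s r11 d1)
    then show "\<exists>k'\<in>gr K1 (i + 1). diff K1 k' = k" by blast
  qed
  then obtain H1 where "K1.is_htpy D1 H1" ..
  then have H1: "\<And>x. x \<in> carrier B \<Longrightarrow> H1 x \<in> carrier K"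
      "\<And>x y. x \<in> carrier B \<Longrightarrow> y \<in> carrier B \<Longrightarrow> H1 (x \<oplus>\<^bsub>B\<^esub> y) = H1 x \<oplus>\<^bsub>K\<^esub> H1 y"
      "\<And>c x. x \<in> carrier B \<Longrightarrow> H1 (c \<odot>\<^bsub>B\<^esub> x) = c \<odot>\<^bsub>K\<^esub> H1 x"
      "\<And>x i. x \<in> gr B i \<Longrightarrow> H1 x \<in> gr K (i + 1)"
      "\<And>x y. x \<in> carrier B \<Longrightarrow> y \<in> carrier B \<Longrightarrow> H1 (x \<otimes>\<^bsub>B\<^esub> y) = r (H1 x) y \<oplus>\<^bsub>K\<^esub> l (tau B x) (H1 y)"
      "\<And>x. x \<in> carrier B \<Longrightarrow> D1 x = diff K (H1 x) \<oplus>\<^bsub>K\<^esub> H1 (diff B x)"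
    unfolding K1.is_htpy_def s by auto
  define w where "w = D \<one>\<^bsub>B\<^esub>"
  have w: "w \<in> gr K 0" using Dg[OF B.one_gr] by (simp add: w_def)
  have wc: "w \<in> carrier K" using w by simp
  have w1: "r w \<one>\<^bsub>B\<^esub> = \<zero>\<^bsub>K\<^esub>"
  proof -
    have "w = r w \<one>\<^bsub>B\<^esub> \<oplus>\<^bsub>K\<^esub> w" using D'(5)[of "\<one>\<^bsub>B\<^esub>" "\<one>\<^bsub>B\<^esub>"] wc by (simp add: w_def l_one)
    then show ?thesis using wc by (metis B.A.one_closed K.M.add.r_cancel_one' r_cl)
  qed
  have "diff K w = \<zero>\<^bsub>K\<^esub>"
    using D'(4)[of "\<one>\<^bsub>B\<^esub>" "\<zero>\<^bsub>B\<^esub>"] D'(3)[of "\<zero>\<^bsub>B\<^esub>" "\<zero>\<^bsub>B\<^esub>" 0] Dc[of "\<zero>\<^bsub>B\<^esub>"]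
    by (simp add: w_def B.diff_one)
  then obtain v where v: "v \<in> gr K 1" "diff K v = w" using ac[OF w] by auto
  define v' where "v' = v \<ominus>\<^bsub>K\<^esub> r v \<one>\<^bsub>B\<^esub>"
  have v': "v' \<in> gr K 1" using v rg by (simp add: v'_def)
  have v'c: "v' \<in> carrier K" "v \<in> carrier K" using v' v by auto
  have dv': "diff K v' = w"
    using v v'c wc by (simp add: v'_def K.minus_eq' K.diff_add K.diff_smult d1 w1)
  have rv': "r v' x = \<zero>\<^bsub>K\<^esub>" if "x \<in> carrier B" for x
    using that v'c by (simp add: v'_def K.minus_eq' r_add2 r_sm2 r1x) (simp add: K.neg_eq[symmetric] K.M.r_neg)
  define H where "H x = H1 x \<oplus>\<^bsub>K\<^esub> l (tau B x) v'" for x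
  have lv: "l x w = diff K (l (tau B x) v') \<oplus>\<^bsub>K\<^esub> l (tau B (diff B x)) v'" if "x \<in> carrier B" for x
    using that
  proof (induction x rule: B.hom_induct)
    case (hom i x)
    then have c: "x \<in> carrier B" by simp
    have t: "tau B (diff B x) = (- sg i) \<odot>\<^bsub>B\<^esub> diff B x" "tau B x = sg i \<odot>\<^bsub>B\<^esub> x"
      using B.tau_hom[OF B.gr_diff[OF hom]] B.tau_hom[OF hom] by (auto simp: sg_diff1)
    have "diff K (l (tau B x) v') = sg i \<odot>\<^bsub>K\<^esub> l (diff B x) v' \<oplus>\<^bsub>K\<^esub> l x w"
      using c v'c wc by (simp add: t l_sm1 K.diff_smult l_diff[OF hom] dv' K.sm_distr K.sm_mult sg_sq)
    moreover have "l (tau B (diff B x)) v' = \<ominus>\<^bsub>K\<^esub> (sg i \<odot>\<^bsub>K\<^esub> l (diff B x) v')"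
      using c v'c by (simp add: t l_sm1 K.neg_eq K.sm_mult)
    ultimately show ?case using c v'c wc by (simp add: K.M.a_ac K.M.r_neg2 K.M.r_neg1 K.M.r_neg)
  next
    case (add x y)
    then show ?case using v'c wc
      by (simp add: l_add1 B.tau_add B.diff_add K.diff_add K.M.a_ac)
  qed
  have "is_htpy D H"
    unfolding is_htpy_def
  proof (intro conjI ballI allI)
    fix x assume x: "x \<in> carrier B"
    show "H x \<in> carrier K" using x H1 v'c by (simp add: H_def)
    show "H (c \<odot>\<^bsub>B\<^esub> x) = c \<odot>\<^bsub>K\<^esub> H x" for c using x H1 v'c by (simp add: H_def B.tau_smult l_sm1 K.sm_distr)
    have "D x = r (D x) \<one>\<^bsub>B\<^esub> \<oplus>\<^bsub>K\<^esub> l x w" using D'(5)[OF x B.A.one_closed] x by (simp add: w_def)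
    also have "\<dots> = (diff K (H1 x) \<oplus>\<^bsub>K\<^esub> H1 (diff B x)) \<oplus>\<^bsub>K\<^esub> (diff K (l (tau B x) v') \<oplus>\<^bsub>K\<^esub> l (tau B (diff B x)) v')"
      using H1(6)[OF x] lv[OF x] by (simp add: D1_def)
    also have "\<dots> = diff K (H x) \<oplus>\<^bsub>K\<^esub> H (diff B x)"
      using x H1(1)[OF x] H1(1)[of "diff B x"] v'c by (simp add: H_def K.diff_add K.M.a_ac)
    finally show "D x = diff K (H x) \<oplus>\<^bsub>K\<^esub> H (diff B x)" .
    fix y assume y: "y \<in> carrier B"
    show "H (x \<oplus>\<^bsub>B\<^esub> y) = H x \<oplus>\<^bsub>K\<^esub> H y"
      using x y H1 v'c by (simp add: H_def B.tau_add l_add1 K.M.a_ac)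
    show "H (x \<otimes>\<^bsub>B\<^esub> y) = r (H x) y \<oplus>\<^bsub>K\<^esub> l (tau B x) (H y)"
      using x y H1 v'c by (simp add: H_def r_add2 l_add2 l_r rv' B.tau_mult l_mult K.M.a_ac)
  next
    fix i x assume x: "x \<in> gr B i"
    then have "l x v' \<in> gr K (i + 1)" using v' by simp
    then show "H x \<in> gr K (i + 1)" using x H1(4)[OF x] v'c by (simp add: H_def B.tau_hom[OF x] l_sm1)
  qed
  then show ?thesis by blast
qed

end

section \<open>Linear choices\<close>

text \<open>
  Values can be chosen freely on a basis through \<open>a\<^sub>0\<close>; as the relation is closed under linear
  combinations, it contains the linear extension of this choice.
\<close>

lemma (in dgs) linear_choice:
  fixes sA :: "'k \<Rightarrow> 'a \<Rightarrow> 'a::ab_group_add"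
  assumes vs: "vector_space sA"
    and P: "\<And>a x. P a x \<Longrightarrow> x \<in> carrier M" "P 0 \<zero>\<^bsub>M\<^esub>"
      "\<And>a b x y. P a x \<Longrightarrow> P b y \<Longrightarrow> P (a + b) (x \<oplus>\<^bsub>M\<^esub> y)" "\<And>c a x. P a x \<Longrightarrow> P (sA c a) (c \<odot>\<^bsub>M\<^esub> x)"
    and ex: "\<And>a. \<exists>x. P a x" and a0: "P a0 x0" "a0 \<noteq> 0"
  shows "\<exists>F. (\<forall>a. P a (F a)) \<and> (\<forall>a b. F (a + b) = F a \<oplus>\<^bsub>M\<^esub> F b) \<and> (\<forall>c a. F (sA c a) = c \<odot>\<^bsub>M\<^esub> F a) \<and> F a0 = x0"
proof -
  interpret V: vector_space sA by fact
  have ind: "V.independent {a0}" using a0 by simp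
  define B where "B = V.extend_basis {a0}"
  have B: "V.independent B" "V.span B = UNIV" "a0 \<in> B"
    using V.independent_extend_basis[OF ind] V.span_extend_basis[OF ind] V.extend_basis_superset[OF ind]
    by (auto simp: B_def)
  define k where "k b = (if b = a0 then x0 else SOME x. P b x)" for b
  have k: "P b (k b)" for b using someI_ex[OF ex[of b]] a0 by (simp add: k_def)
  have kc: "k b \<in> carrier M" for b using k P(1) by blast
  let ?r = "V.representation B"
  define F where "F a = finsum M (\<lambda>b. ?r a b \<odot>\<^bsub>M\<^esub> k b) {b. ?r a b \<noteq> 0}" for a
  have fin: "finite {b. ?r a b \<noteq> 0}" for a by (rule V.finite_representation)
  have F: "F a = finsum M (\<lambda>b. ?r a b \<odot>\<^bsub>M\<^esub> k b) S" if "finite S" "{b. ?r a b \<noteq> 0} \<subseteq> S" for a S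
    unfolding F_def by (rule M.add.finprod_mono_neutral_cong_left) (use that kc in auto)
  have span: "a \<in> V.span B" for a using B by simp
  have "P a (F a)" for a
  proof -
    have "P (\<Sum>b\<in>S. sA (c b) b) (finsum M (\<lambda>b. c b \<odot>\<^bsub>M\<^esub> k b) S)" if "finite S" for S c
      using that
    proof (induction S)
      case empty
      then show ?case using P(2) by simp
    next
      case (insert b S)
      have "finsum M (\<lambda>b. c b \<odot>\<^bsub>M\<^esub> k b) (insert b S) = c b \<odot>\<^bsub>M\<^esub> k b \<oplus>\<^bsub>M\<^esub> finsum M (\<lambda>b. c b \<odot>\<^bsub>M\<^esub> k b) S"
        by (rule M.finsum_insert) (use insert kc in auto)
      then show ?case using insert P(3)[OF P(4)[OF k]] by simp
    qed
    from this[OF fin[of a], of "?r a"] show ?thesis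
      using V.sum_nonzero_representation_eq[OF B(1) span[of a]] by (simp add: F_def)
  qed
  moreover have "F (a + b) = F a \<oplus>\<^bsub>M\<^esub> F b" for a b
  proof -
    let ?S = "{x. ?r a x \<noteq> 0} \<union> {x. ?r b x \<noteq> 0}"
    have S: "finite ?S" using fin by blast
    have ra: "?r (a + b) x = ?r a x + ?r b x" for x
      using V.representation_add[OF B(1) span span, of a b] by simp
    have "F (a + b) = finsum M (\<lambda>x. ?r a x \<odot>\<^bsub>M\<^esub> k x \<oplus>\<^bsub>M\<^esub> ?r b x \<odot>\<^bsub>M\<^esub> k x) ?S"
    proof -
      have "{x. ?r (a + b) x \<noteq> 0} \<subseteq> ?S" by (auto simp: ra)
      from F[OF S this] show ?thesis using kc by (simp add: ra sm_add)
    qed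
    also have "\<dots> = finsum M (\<lambda>x. ?r a x \<odot>\<^bsub>M\<^esub> k x) ?S \<oplus>\<^bsub>M\<^esub> finsum M (\<lambda>x. ?r b x \<odot>\<^bsub>M\<^esub> k x) ?S"
      by (rule M.finsum_addf) (use kc in auto)
    finally show ?thesis using F[OF S, of a] F[OF S, of b] by simp
  qed
  moreover have "F (sA c a) = c \<odot>\<^bsub>M\<^esub> F a" for c a
  proof -
    let ?S = "{x. ?r a x \<noteq> 0}"
    have rs: "?r (sA c a) x = c * ?r a x" for x
      using V.representation_scale[OF B(1) span, of c a] by simp
    have "F (sA c a) = finsum M (\<lambda>x. c \<odot>\<^bsub>M\<^esub> (?r a x \<odot>\<^bsub>M\<^esub> k x)) ?S"
    proof -
      have "{x. ?r (sA c a) x \<noteq> 0} \<subseteq> ?S" by (auto simp: rs)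
      from F[OF fin[of a] this] show ?thesis using kc by (simp add: rs sm_mult)
    qed
    also have "\<dots> = c \<odot>\<^bsub>M\<^esub> finsum M (\<lambda>x. ?r a x \<odot>\<^bsub>M\<^esub> k x) ?S"
      by (rule finsum_additive[OF module_axioms module_axioms fin, symmetric]) (use kc in \<open>auto simp: sm_distr\<close>)
    finally show ?thesis by (simp add: F_def)
  qed
  moreover have "F a0 = x0"
  proof -
    have r0: "?r a0 b = (if b = a0 then 1 else 0)" for b
      using V.representation_basis[OF B(1,3)] by simp
    have "F a0 = finsum M (\<lambda>b. ?r a0 b \<odot>\<^bsub>M\<^esub> k b) {a0}" by (rule F) (auto simp: r0)
    also have "\<dots> = x0" using kc[of a0] by (simp add: r0 k_def)
    finally show ?thesis .
  qed
  ultimately show ?thesis by blast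
qed

section \<open>Cofibrant resolutions\<close>

definition prod_dga :: "('k, 'x) dga \<Rightarrow> ('k, 'y) dga \<Rightarrow> ('k, 'x \<times> 'y) dga" where
  "prod_dga M N = \<lparr>carrier = carrier M \<times> carrier N,
     mult = (\<lambda>p q. (fst p \<otimes>\<^bsub>M\<^esub> fst q, snd p \<otimes>\<^bsub>N\<^esub> snd q)), one = (\<one>\<^bsub>M\<^esub>, \<one>\<^bsub>N\<^esub>), zero = (\<zero>\<^bsub>M\<^esub>, \<zero>\<^bsub>N\<^esub>),
     add = (\<lambda>p q. (fst p \<oplus>\<^bsub>M\<^esub> fst q, snd p \<oplus>\<^bsub>N\<^esub> snd q)), smult = (\<lambda>c p. (c \<odot>\<^bsub>M\<^esub> fst p, c \<odot>\<^bsub>N\<^esub> snd p)),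
     gr = (\<lambda>i. gr M i \<times> gr N i), diff = (\<lambda>p. (diff M (fst p), diff N (snd p)))\<rparr>"

lemma prod_dga:
  assumes "dg_algebra M" "dg_algebra N"
  shows "dg_algebra (prod_dga M N)" (is "dg_algebra ?X")
    "\<And>x y i. x \<in> carrier M \<Longrightarrow> y \<in> carrier N \<Longrightarrow> comp (prod_dga M N) i (x, y) = (comp M i x, comp N i y)"
proof -
  interpret M: dga M by unfold_locales fact
  interpret N: dga N by unfold_locales fact
  have s: "dg_space ?X"
  proof (rule dg_spaceI[where pr = "\<lambda>i p. (comp M i (fst p), comp N i (snd p))"])
    show mod: "module ground ?X"
      by (rule module_groundI)
        (auto simp: prod_dga_def M.M.a_ac N.M.a_ac M.sm_distr N.sm_distr M.sm_add N.sm_add M.sm_mult N.sm_mult)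
    show "submodule (gr ?X i) ground ?X" for i
      by (rule submodule_groundI[OF mod]) (auto simp: prod_dga_def)
    show "carrier ?X \<subseteq> Z" if gen: "\<And>i. gr ?X i \<subseteq> Z"
      "\<And>x y. x \<in> Z \<Longrightarrow> y \<in> Z \<Longrightarrow> x \<in> carrier ?X \<Longrightarrow> y \<in> carrier ?X \<Longrightarrow> x \<oplus>\<^bsub>?X\<^esub> y \<in> Z" for Z
    proof
      have 1: "(x, \<zero>\<^bsub>N\<^esub>) \<in> Z" if "x \<in> carrier M" for x using that
      proof (induction x rule: M.hom_induct)
        case (hom i y)
        then show ?case using gen(1)[of i] by (auto simp: prod_dga_def)
      next
        case (add y z)
        then show ?case using gen(2)[of "(y, \<zero>\<^bsub>N\<^esub>)" "(z, \<zero>\<^bsub>N\<^esub>)"] by (auto simp: prod_dga_def)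
      qed
      have 2: "(\<zero>\<^bsub>M\<^esub>, k) \<in> Z" if "k \<in> carrier N" for k using that
      proof (induction k rule: N.hom_induct)
        case (hom i y)
        then show ?case using gen(1)[of i] by (auto simp: prod_dga_def)
      next
        case (add y z)
        then show ?case using gen(2)[of "(\<zero>\<^bsub>M\<^esub>, y)" "(\<zero>\<^bsub>M\<^esub>, z)"] by (auto simp: prod_dga_def)
      qed
      fix p assume "p \<in> carrier ?X"
      then obtain x k where p: "p = (x, k)" "x \<in> carrier M" "k \<in> carrier N" by (auto simp: prod_dga_def)
      then show "p \<in> Z" using gen(2)[OF 1[OF p(2)] 2[OF p(3)]] by (auto simp: prod_dga_def)
    qed
  qed (auto simp: prod_dga_def M.comp_add N.comp_add M.comp_hom N.comp_hom M.diff_add N.diff_add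
      M.diff_smult N.diff_smult)
  show X: "dg_algebra ?X"
    by (rule dg_algebraI[OF s]) (auto simp: prod_dga_def M.A.m_assoc N.A.m_assoc M.A.l_distr N.A.l_distr
      M.A.r_distr N.A.r_distr M.mult_sm N.mult_sm M.leibniz N.leibniz)
  interpret X: dga ?X by unfold_locales fact
  show "comp ?X i (x, y) = (comp M i x, comp N i y)" if x: "x \<in> carrier M" and y: "y \<in> carrier N" for x y i
  proof -
    have 1: "comp ?X i (x, \<zero>\<^bsub>N\<^esub>) = (comp M i x, \<zero>\<^bsub>N\<^esub>)" using x
    proof (induction x rule: M.hom_induct)
      case (hom j x)
      then have "(x, \<zero>\<^bsub>N\<^esub>) \<in> gr ?X j" by (simp add: prod_dga_def)
      from X.comp_hom[OF this] show ?case using hom by (auto simp: M.comp_hom prod_dga_def)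
    next
      case (add u v)
      have "comp ?X i ((u, \<zero>\<^bsub>N\<^esub>) \<oplus>\<^bsub>?X\<^esub> (v, \<zero>\<^bsub>N\<^esub>)) = comp ?X i (u, \<zero>\<^bsub>N\<^esub>) \<oplus>\<^bsub>?X\<^esub> comp ?X i (v, \<zero>\<^bsub>N\<^esub>)"
        by (rule X.comp_add) (use add in \<open>auto simp: prod_dga_def\<close>)
      then show ?case using add by (simp add: prod_dga_def M.comp_add)
    qed
    have 2: "comp ?X i (\<zero>\<^bsub>M\<^esub>, y) = (\<zero>\<^bsub>M\<^esub>, comp N i y)" using y
    proof (induction y rule: N.hom_induct)
      case (hom j x)
      then have "(\<zero>\<^bsub>M\<^esub>, x) \<in> gr ?X j" by (simp add: prod_dga_def)
      from X.comp_hom[OF this] show ?case using hom by (auto simp: N.comp_hom prod_dga_def)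
    next
      case (add u v)
      have "comp ?X i ((\<zero>\<^bsub>M\<^esub>, u) \<oplus>\<^bsub>?X\<^esub> (\<zero>\<^bsub>M\<^esub>, v)) = comp ?X i (\<zero>\<^bsub>M\<^esub>, u) \<oplus>\<^bsub>?X\<^esub> comp ?X i (\<zero>\<^bsub>M\<^esub>, v)"
        by (rule X.comp_add) (use add in \<open>auto simp: prod_dga_def\<close>)
      then show ?case using add by (simp add: prod_dga_def N.comp_add)
    qed
    have "comp ?X i ((x, \<zero>\<^bsub>N\<^esub>) \<oplus>\<^bsub>?X\<^esub> (\<zero>\<^bsub>M\<^esub>, y)) = comp ?X i (x, \<zero>\<^bsub>N\<^esub>) \<oplus>\<^bsub>?X\<^esub> comp ?X i (\<zero>\<^bsub>M\<^esub>, y)"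
      by (rule X.comp_add) (use x y in \<open>auto simp: prod_dga_def\<close>)
    then show ?thesis unfolding 1 2 using x y by (simp add: prod_dga_def)
  qed
qed

lemma in_degree_0_dg_space:
  assumes "module ground M"
  shows "dg_space (in_degree_0 M)"
proof -
  interpret module ground M by fact
  have d: "carrier (in_degree_0 M) = carrier M" "add (in_degree_0 M) = add M" "zero (in_degree_0 M) = zero M"
    "smult (in_degree_0 M) = smult M" "gr (in_degree_0 M) = (\<lambda>i. if i = 0 then carrier M else {\<zero>\<^bsub>M\<^esub>})"
    "diff (in_degree_0 M) = (\<lambda>_. \<zero>\<^bsub>M\<^esub>)"
    by (simp_all add: in_degree_0_def module.defs)
  have sm: "c \<odot>\<^bsub>M\<^esub> x \<in> carrier M" "c \<odot>\<^bsub>M\<^esub> \<zero>\<^bsub>M\<^esub> = \<zero>\<^bsub>M\<^esub>" "0 \<odot>\<^bsub>M\<^esub> x = \<zero>\<^bsub>M\<^esub>" if "x \<in> carrier M" for c x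
    using smult_closed[of c x] smult_r_null[of c] smult_l_null[of x] that by auto
  have sm': "c \<odot>\<^bsub>M\<^esub> \<zero>\<^bsub>M\<^esub> = \<zero>\<^bsub>M\<^esub>" for c using smult_r_null[of c] by simp
  have ax: "c \<odot>\<^bsub>M\<^esub> (x \<oplus>\<^bsub>M\<^esub> y) = c \<odot>\<^bsub>M\<^esub> x \<oplus>\<^bsub>M\<^esub> c \<odot>\<^bsub>M\<^esub> y" "(c + e) \<odot>\<^bsub>M\<^esub> x = c \<odot>\<^bsub>M\<^esub> x \<oplus>\<^bsub>M\<^esub> e \<odot>\<^bsub>M\<^esub> x"
    "(c * e) \<odot>\<^bsub>M\<^esub> x = c \<odot>\<^bsub>M\<^esub> (e \<odot>\<^bsub>M\<^esub> x)" "1 \<odot>\<^bsub>M\<^esub> x = x" if "x \<in> carrier M" "y \<in> carrier M" for c e x y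
    using smult_r_distr[of c x y] smult_l_distr[of c e x] smult_assoc1[of c e x] smult_one[of x] that by auto
  have mod: "module ground (in_degree_0 M)"
    by (rule module_groundI) (use ax in \<open>auto simp: d sm M.a_ac\<close>)
  show ?thesis
  proof (rule dg_spaceI[OF mod, where pr = "\<lambda>i x. if i = 0 then x else \<zero>\<^bsub>M\<^esub>"])
    show "submodule (gr (in_degree_0 M) i) ground (in_degree_0 M)" for i
      by (rule submodule_groundI[OF mod]) (auto simp: d sm sm')
    show "carrier (in_degree_0 M) \<subseteq> Z" if "\<And>i. gr (in_degree_0 M) i \<subseteq> Z" for Z
      using that[of 0] by (simp add: d)
  qed (auto simp: d sm sm' split: if_splits)
qed

lemma module_alg_of:
  assumes "vector_space s"
  shows "module ground (alg_of s)"
proof -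
  interpret vector_space s by fact
  show ?thesis by (rule module_groundI) (auto simp: alg_of_def algebra_simps scale_left_distrib scale_right_distrib)
qed

locale resolution =
  fixes sA :: "'k::field_char_0 \<Rightarrow> 'a \<Rightarrow> 'a::ring_1" and R :: "('k, 'u) dga" (structure) and \<epsilon> :: "'u \<Rightarrow> 'a"
  assumes alg: "k_algebra sA" and res: "cofibrant_resolution R (alg_of sA) \<epsilon>"
begin

abbreviation "A\<^sub>0 \<equiv> in_degree_0 (alg_of sA)"

lemma cof: "cofibrant R" using res by (simp add: cofibrant_resolution_def)

sublocale R: dga R
  using cof by unfold_locales (simp add: cofibrant_def)

lemma vs: "vector_space sA" using alg by (simp add: k_algebra_def)

sublocale VA: vector_space sA by (rule vs)

lemma sA_mult: "sA c x * y = sA c (x * y)" "x * sA c y = sA c (x * y)"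
  using alg by (auto simp: k_algebra_def)

lemma A_simps: "carrier A\<^sub>0 = UNIV" "add A\<^sub>0 = (+)"
  "zero A\<^sub>0 = 0" "one A\<^sub>0 = 1" "mult A\<^sub>0 = (*)"
    "smult A\<^sub>0 = sA" "gr A\<^sub>0 i = (if i = 0 then UNIV else {0})"
    "diff A\<^sub>0 = (\<lambda>_. 0)"
  by (simp_all add: in_degree_0_def module.defs alg_of_def)

lemma eps_hom: "\<epsilon> \<in> dg_hom R A\<^sub>0"
  using res by (simp add: cofibrant_resolution_def quasi_iso_def)

lemma eps_add: "x \<in> carrier R \<Longrightarrow> y \<in> carrier R \<Longrightarrow> \<epsilon> (x \<oplus> y) = \<epsilon> x + \<epsilon> y"
  using dg_homD(2)[OF eps_hom] by (simp add: A_simps)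

lemma eps_mult: "x \<in> carrier R \<Longrightarrow> y \<in> carrier R \<Longrightarrow> \<epsilon> (x \<otimes> y) = \<epsilon> x * \<epsilon> y"
  using dg_homD(3)[OF eps_hom] by (simp add: A_simps)

lemma eps_one [simp]: "\<epsilon> \<one> = 1"
  using dg_homD(4)[OF eps_hom] by (simp add: A_simps)

lemma eps_sm: "x \<in> carrier R \<Longrightarrow> \<epsilon> (c \<odot> x) = sA c (\<epsilon> x)"
  using dg_homD(5)[OF eps_hom] by (simp add: A_simps)

lemma eps_gr: "x \<in> gr R i \<Longrightarrow> i \<noteq> 0 \<Longrightarrow> \<epsilon> x = 0"
  using dg_homD(6)[OF eps_hom, of x i] by (simp add: A_simps)

lemma eps_diff [simp]: "x \<in> carrier R \<Longrightarrow> \<epsilon> (diff R x) = 0"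
  using dg_homD(7)[OF eps_hom, of x] by (simp add: A_simps)

lemma eps_zero [simp]: "\<epsilon> \<zero> = 0"
  using eps_sm[of "\<zero>" 0] by simp

lemma eps_neg: "x \<in> carrier R \<Longrightarrow> \<epsilon> (\<ominus> x) = - \<epsilon> x"
  by (simp add: R.neg_eq eps_sm)

lemma eps_minus: "x \<in> carrier R \<Longrightarrow> y \<in> carrier R \<Longrightarrow> \<epsilon> (x \<ominus> y) = \<epsilon> x - \<epsilon> y"
  by (simp add: a_minus_def eps_neg eps_add)

lemma eps_comp: "x \<in> carrier R \<Longrightarrow> \<epsilon> (comp R i x) = (if i = 0 then \<epsilon> x else 0)"
proof (induction x rule: R.hom_induct)
  case (hom j x)
  then show ?case by (auto simp: R.comp_hom[OF hom] eps_gr)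
qed (simp add: R.comp_add eps_add)

lemma eps_tau: "x \<in> carrier R \<Longrightarrow> \<epsilon> (tau R x) = \<epsilon> x"
proof (induction x rule: R.hom_induct)
  case (hom i x)
  then show ?case by (cases "i = 0") (auto simp: R.tau_hom[OF hom] eps_sm eps_gr)
qed (simp add: R.tau_add eps_add)

lemma qi: "(\<forall>i. (\<forall>x\<in>gr R i. diff R x = \<zero> \<and> \<epsilon> x \<in> dg_boundaries A\<^sub>0 i \<longrightarrow> x \<in> dg_boundaries R i) \<and>
   (\<forall>y\<in>gr A\<^sub>0 i. diff A\<^sub>0 y = \<zero>\<^bsub>A\<^sub>0\<^esub> \<longrightarrow>
      (\<exists>x\<in>gr R i. diff R x = \<zero> \<and> y \<ominus>\<^bsub>A\<^sub>0\<^esub> \<epsilon> x \<in> dg_boundaries A\<^sub>0 i)))"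
  using quasi_iso_iff[OF R.dgs in_degree_0_dg_space[OF module_alg_of[OF vs]] eps_hom] res
  by (simp add: cofibrant_resolution_def)

lemma bdA: "dg_boundaries A\<^sub>0 i = {0}"
  by (auto simp: dg_boundaries_def A_simps)

lemma exact: "x \<in> gr R i \<Longrightarrow> diff R x = \<zero> \<Longrightarrow> \<epsilon> x = 0 \<Longrightarrow> \<exists>y\<in>gr R (i + 1). diff R y = x"
  using qi unfolding bdA by (auto simp: dg_boundaries_def)

lemma onto: "\<exists>x\<in>gr R 0. diff R x = \<zero> \<and> \<epsilon> x = a"
proof -
  interpret S: dgs "A\<^sub>0"
    by unfold_locales (rule in_degree_0_dg_space[OF module_alg_of[OF vs]])
  obtain x where x: "x \<in> gr R 0" "diff R x = \<zero>" "a \<ominus>\<^bsub>A\<^sub>0\<^esub> \<epsilon> x = 0"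
    using spec[OF qi, of 0] unfolding bdA by (auto simp: A_simps)
  have "a \<ominus>\<^bsub>A\<^sub>0\<^esub> \<epsilon> x = a - \<epsilon> x"
    by (subst S.minus_eq') (auto simp: A_simps)
  then show ?thesis using x by auto
qed

lemma exact_ker:
  assumes x: "x \<in> gr R i" "diff R x = \<zero>" "\<epsilon> x = 0"
  shows "\<exists>y\<in>gr R (i + 1). diff R y = x \<and> \<epsilon> y = 0"
proof -
  obtain y where y: "y \<in> gr R (i + 1)" "diff R y = x" using exact[OF x] by blast
  show ?thesis
  proof (cases "i + 1 = 0")
    case False
    then show ?thesis using y eps_gr by blast
  next
    case True
    obtain z where z: "z \<in> gr R 0" "diff R z = \<zero>" "\<epsilon> z = \<epsilon> y" using onto by blast
    have "y \<ominus> z \<in> gr R (i + 1)" using y z True by simp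
    moreover have "diff R (y \<ominus> z) = x"
      using y z R.gr_carrier[OF y(1)] by (simp add: R.minus_eq' R.diff_add R.diff_smult) (use x in auto)
    moreover have "\<epsilon> (y \<ominus> z) = 0" using y z by (simp add: eps_minus)
    ultimately show ?thesis by blast
  qed
qed

lemma unit_inj: "inj (\<lambda>c. c \<odot> \<one>)"
proof (rule injI)
  fix c d assume cd: "c \<odot> \<one> = d \<odot> \<one>"
  have "sA c 1 = \<epsilon> (c \<odot> \<one>)" for c by (subst eps_sm) auto
  then have "sA c 1 = sA d 1" using cd by metis
  then show "c = d" using VA.scale_right_imp_eq[of "1::'a" c d] by simp
qed

lemma inf: "infinite (UNIV :: 'u set)"
proof
  assume "finite (UNIV :: 'u set)"
  then have "finite (UNIV :: 'k set)" using finite_imageD[OF _ unit_inj] by (meson finite_subset subset_UNIV)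
  then show False using infinite_UNIV_char_0 by blast
qed

lemma section_ex: "\<exists>s. (\<forall>a. s a \<in> gr R 0 \<and> diff R (s a) = \<zero> \<and> \<epsilon> (s a) = a) \<and>
   (\<forall>a b. s (a + b) = s a \<oplus> s b) \<and> (\<forall>c a. s (sA c a) = c \<odot> s a) \<and> s 1 = \<one>"
proof (rule R.linear_choice[OF vs, where P = "\<lambda>a x. x \<in> gr R 0 \<and> diff R x = \<zero> \<and> \<epsilon> x = a"])
  show "\<exists>x. x \<in> gr R 0 \<and> diff R x = \<zero> \<and> \<epsilon> x = a" for a using onto by blast
qed (auto simp: R.diff_add R.diff_smult eps_add eps_sm R.diff_one)

definition sec :: "'a \<Rightarrow> 'u" where
  "sec = (SOME s. (\<forall>a. s a \<in> gr R 0 \<and> diff R (s a) = \<zero> \<and> \<epsilon> (s a) = a) \<and>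
   (\<forall>a b. s (a + b) = s a \<oplus> s b) \<and> (\<forall>c a. s (sA c a) = c \<odot> s a) \<and> s 1 = \<one>)"

lemma sec: "sec a \<in> gr R 0" "diff R (sec a) = \<zero>" "\<epsilon> (sec a) = a"
  "sec (a + b) = sec a \<oplus> sec b" "sec (sA c a) = c \<odot> sec a" "sec 1 = \<one>"
  using someI_ex[OF section_ex, folded sec_def] by blast+

lemma sec_carrier [simp]: "sec a \<in> carrier R"
  using sec(1) R.gr_carrier by blast

lemma sec_zero: "sec 0 = \<zero>"
  using sec(5)[of 0 0] by simp

end

section \<open>Homotopies on a resolution\<close>

context resolution
begin

text \<open>
  The good truncation of \<open>R\<close>: no components of negative degree, and a cycle in degree 0.
\<close>

definition tpos :: "'u set" where
  "tpos = {x \<in> carrier R. (\<forall>i<0. comp R i x = \<zero>) \<and> diff R (comp R 0 x) = \<zero>}"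

lemma tpos_sub:
  "\<zero> \<in> tpos" "\<one> \<in> tpos" "tpos \<subseteq> carrier R"
  "x \<in> tpos \<Longrightarrow> y \<in> tpos \<Longrightarrow> x \<oplus> y \<in> tpos" "x \<in> tpos \<Longrightarrow> c \<odot> x \<in> tpos"
  "x \<in> tpos \<Longrightarrow> diff R x \<in> tpos" "x \<in> tpos \<Longrightarrow> comp R i x \<in> tpos"
proof -
  show "comp R i x \<in> tpos" if "x \<in> tpos"
  proof -
    have x: "x \<in> carrier R" using that by (simp add: tpos_def)
    show ?thesis using that x by (auto simp: tpos_def R.comp_hom[OF R.comp_ex(1)[OF x]])
  qed
  show "diff R x \<in> tpos" if "x \<in> tpos"
  proof -
    have x: "x \<in> carrier R" "\<And>i. i < 0 \<Longrightarrow> comp R i x = \<zero>" "diff R (comp R 0 x) = \<zero>"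
      using that by (auto simp: tpos_def)
    have "comp R i (diff R x) = \<zero>" if "i < 0" for i
    proof (cases "i + 1 = 0")
      case True
      then show ?thesis using x by (simp add: R.comp_diff)
    next
      case False
      then have "i + 1 < 0" using that by simp
      then show ?thesis using x(2)[of "i+1"] x(1) by (simp add: R.comp_diff)
    qed
    then show ?thesis using x(1) by (simp add: tpos_def R.comp_diff)
  qed
qed (auto simp: tpos_def R.comp_add R.comp_smult R.diff_add R.diff_smult R.comp_hom[OF R.one_gr] R.diff_one)

lemma tpos_hom: "x \<in> gr R i \<Longrightarrow> x \<in> tpos \<longleftrightarrow> x = \<zero> \<or> 0 < i \<or> i = 0 \<and> diff R x = \<zero>"
  by (auto simp: tpos_def R.comp_hom)

lemma tpos_mult:
  assumes "x \<in> tpos" "y \<in> tpos"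
  shows "x \<otimes> y \<in> tpos"
proof -
  let ?N = "R\<lparr>carrier := tpos, gr := \<lambda>i. gr R i \<inter> tpos\<rparr>"
  have "dg_space ?N" by (rule R.sub_dg_space) (use tpos_sub in auto)
  then interpret N: dgs ?N by unfold_locales
  have tc: "x \<in> carrier R" if "x \<in> tpos" for x using that tpos_sub(3) by blast
  have hh: "x \<otimes> y \<in> tpos" if x: "x \<in> gr R i" "x \<in> tpos" and y: "y \<in> gr R j" "y \<in> tpos" for x y i j
  proof (cases "x = \<zero> \<or> y = \<zero>")
    case True
    then show ?thesis using x y tpos_sub(1) by auto
  next
    case False
    then have ij: "0 < i \<or> i = 0 \<and> diff R x = \<zero>" "0 < j \<or> j = 0 \<and> diff R y = \<zero>"
      using tpos_hom[OF x(1)] tpos_hom[OF y(1)] x y by auto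
    show ?thesis
    proof (cases "i = 0 \<and> j = 0")
      case True
      then have "diff R (x \<otimes> y) = \<zero>" using R.leibniz[OF x(1) tc[OF y(2)]] ij x y by simp
      then show ?thesis using tpos_hom[OF R.gr_mult[OF x(1) y(1)]] True by simp
    next
      case False
      then have "0 < i + j" using ij by auto
      then show ?thesis using tpos_hom[OF R.gr_mult[OF x(1) y(1)]] by simp
    qed
  qed
  have 1: "x \<otimes> y \<in> tpos" if x: "x \<in> gr R i" "x \<in> tpos" and y: "y \<in> tpos" for x y i
  proof -
    have "y \<in> carrier ?N" using y by simp
    then show ?thesis
    proof (induction y rule: N.hom_induct)
      case (hom j y)
      then show ?case using hh[OF x, of y j] by auto
    next
      case (add y z)
      then show ?case using tpos_sub(4) tc[OF x(2)] tc by (simp add: R.A.r_distr)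
    qed
  qed
  have "x \<in> carrier ?N" using assms by simp
  then show ?thesis
  proof (induction x rule: N.hom_induct)
    case (hom j x)
    then show ?case using 1[of x j y] assms by auto
  next
    case (add x z)
    then show ?case using tpos_sub(4) tc[OF assms(2)] tc by (simp add: R.A.l_distr)
  qed
qed

text \<open>
  The resolution \<open>R\<close> may be unbounded, but it is a retract up to homotopy of its non-negative
  truncation: \<open>\<epsilon>\<close> lifts to an endomorphism \<open>g\<close> of \<open>R\<close> with values in the truncation.
\<close>

lemma truncation:
  obtains g where "g \<in> dg_hom R R" "\<And>x. x \<in> carrier R \<Longrightarrow> \<epsilon> (g x) = \<epsilon> x" "\<And>x. x \<in> carrier R \<Longrightarrow> g x \<in> tpos"
proof -
  let ?P = "prod_dga R R"
  have P: "dg_algebra ?P" using prod_dga(1)[OF R.dga R.dga] .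
  interpret P: dga ?P by unfold_locales fact
  \<comment> \<open>The fibre product of the truncation with R over A. Its projection to R is surjective with acyclic kernel.\<close>
  define Y where "Y = {p. fst p \<in> tpos \<and> snd p \<in> carrier R \<and> \<epsilon> (fst p) = \<epsilon> (snd p)}"
  define X where "X = ?P\<lparr>carrier := Y, gr := \<lambda>i. gr ?P i \<inter> Y\<rparr>"
  have tc: "x \<in> carrier R" if "x \<in> tpos" for x using that tpos_sub(3) by blast
  have Yc: "Y \<subseteq> carrier ?P" using tc by (auto simp: Y_def prod_dga_def)
  have X: "dg_algebra X" unfolding X_def
  proof (rule P.sub_dga[OF Yc])
    show "comp ?P i p \<in> Y" if "p \<in> Y" for i p
    proof -
      from that obtain x y where p: "p = (x, y)" "x \<in> tpos" "y \<in> carrier R" "\<epsilon> x = \<epsilon> y"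
        by (cases p) (auto simp: Y_def)
      then show ?thesis
        using prod_dga(2)[OF R.dga R.dga tc[OF p(2)] p(3), of i] tc[OF p(2)] tpos_sub(7) by (simp add: Y_def eps_comp)
    qed
  qed (auto simp: Y_def prod_dga_def tpos_sub tpos_mult tc eps_add eps_sm eps_mult)
  interpret X: dga X by unfold_locales fact
  have s: "carrier X = Y" "gr X i = (gr R i \<times> gr R i) \<inter> Y" "diff X p = (diff R (fst p), diff R (snd p))"
    "zero X = (\<zero>, \<zero>)" "one X = (\<one>, \<one>)" "mult X = (\<lambda>p q. (fst p \<otimes> fst q, snd p \<otimes> snd q))"
    "add X = (\<lambda>p q. (fst p \<oplus> fst q, snd p \<oplus> snd q))"
    "smult X = (\<lambda>c p. (c \<odot> fst p, c \<odot> snd p))" for i p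
    by (simp_all add: X_def prod_dga_def)
  have mem: "p \<in> Y \<Longrightarrow> snd p \<in> carrier R" for p by (simp add: Y_def)
  have p: "restrict snd Y \<in> dg_hom X R"
  proof (rule dg_homI)
    show "restrict snd Y (diff X x) = diff R (restrict snd Y x)" if "x \<in> carrier X" for x
      using that X.diff_carrier[OF that] by (simp add: s)
    show "restrict snd Y (x \<oplus>\<^bsub>X\<^esub> y) = restrict snd Y x \<oplus> restrict snd Y y" if "x \<in> carrier X" "y \<in> carrier X" for x y
      using that X.M.a_closed[OF that] by (simp add: s)
    show "restrict snd Y (x \<otimes>\<^bsub>X\<^esub> y) = restrict snd Y x \<otimes> restrict snd Y y" if "x \<in> carrier X" "y \<in> carrier X" for x y
      using that X.A.m_closed[OF that] by (simp add: s)
    show "restrict snd Y (c \<odot>\<^bsub>X\<^esub> x) = c \<odot> restrict snd Y x" if "x \<in> carrier X" for c x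
      using that X.smult_cl[OF that] by (simp add: s)
    show "restrict snd Y \<one>\<^bsub>X\<^esub> = \<one>" using X.A.one_closed by (simp add: s)
  qed (auto simp: s mem)
  have "\<exists>g\<in>dg_hom R X. \<forall>x\<in>carrier R. restrict snd Y (g x) = x"
  proof (rule cofibrant_section[OF cof inf unit_inj X p])
    show "\<exists>x\<in>carrier X. restrict snd Y x = r" if "r \<in> carrier R" for r
    proof (rule bexI[of _ "(sec (\<epsilon> r), r)"])
      have "sec (\<epsilon> r) \<in> tpos" using tpos_hom[OF sec(1)] sec(2) by simp
      then show "(sec (\<epsilon> r), r) \<in> carrier X" using that by (simp add: s Y_def sec(3))
      then show "restrict snd Y (sec (\<epsilon> r), r) = r" by (simp add: s)
    qed
    fix i q assume q: "q \<in> gr X i" "diff X q = \<zero>\<^bsub>X\<^esub>" "restrict snd Y q = \<zero>"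
    then obtain x where x: "q = (x, \<zero>)" "x \<in> gr R i" "x \<in> tpos" "\<epsilon> x = 0" "diff R x = \<zero>"
      by (cases q) (auto simp: s Y_def)
    have "\<exists>x'\<in>gr R (i + 1). x' \<in> tpos \<and> diff R x' = x \<and> \<epsilon> x' = 0"
    proof (cases "x = \<zero>")
      case True
      then show ?thesis using tpos_sub(1) by (intro bexI[of _ "\<zero>"]) auto
    next
      case False
      then have "i + 1 > 0" using tpos_hom[OF x(2)] x(3) by auto
      moreover obtain x' where "x' \<in> gr R (i + 1)" "diff R x' = x" "\<epsilon> x' = 0" using exact_ker[OF x(2,5,4)] by blast
      ultimately show ?thesis using tpos_hom by blast
    qed
    then obtain x' where x': "x' \<in> gr R (i + 1)" "x' \<in> tpos" "diff R x' = x" "\<epsilon> x' = 0" by blast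
    show "\<exists>y\<in>gr X (i + 1). restrict snd Y y = \<zero> \<and> diff X y = q"
      by (rule bexI[of _ "(x', \<zero>)"]) (use x x' in \<open>auto simp: s Y_def\<close>)
  qed
  then obtain h where h: "h \<in> dg_hom R X" "\<And>x. x \<in> carrier R \<Longrightarrow> restrict snd Y (h x) = x" by blast
  note hD = dg_homD[OF h(1)]
  have hY: "h x \<in> Y" if "x \<in> carrier R" for x using hD(1)[OF that] by (simp add: s)
  have sn: "snd (h x) = x" if "x \<in> carrier R" for x using h(2)[OF that] hY[OF that] by simp
  have hg: "fst (h x) \<in> gr R i" if "x \<in> gr R i" for x i using hD(6)[OF that] by (auto simp: s)
  show ?thesis
  proof (rule that[of "restrict (fst \<circ> h) (carrier R)"])
    show "restrict (fst \<circ> h) (carrier R) \<in> dg_hom R R"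
      by (rule dg_homI) (use hD hg hY tc in \<open>auto simp: s Y_def\<close>)
    show "\<epsilon> (restrict (fst \<circ> h) (carrier R) x) = \<epsilon> x" "restrict (fst \<circ> h) (carrier R) x \<in> tpos"
      if "x \<in> carrier R" for x
      using hY[OF that] sn[OF that] that by (auto simp: Y_def)
  qed
qed

text \<open>
  The kernel of \<open>\<epsilon>\<close>, an ideal. It is acyclic because \<open>\<epsilon>\<close> is a surjective quasi-isomorphism.
\<close>

definition Kr :: "('k, 'u) dga" where
  "Kr = R\<lparr>carrier := {x \<in> carrier R. \<epsilon> x = 0}, gr := \<lambda>i. gr R i \<inter> {x \<in> carrier R. \<epsilon> x = 0}\<rparr>"

lemma Kr_simps: "carrier Kr = {x \<in> carrier R. \<epsilon> x = 0}" "gr Kr i = gr R i \<inter> {x \<in> carrier R. \<epsilon> x = 0}"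
  "add Kr = add R" "zero Kr = zero R" "smult Kr = smult R" "diff Kr = diff R"
  by (simp_all add: Kr_def)

lemma Kr_dg_space: "dg_space Kr"
  unfolding Kr_def by (rule R.sub_dg_space) (auto simp: eps_add eps_sm eps_comp)

sublocale Kr: dgs Kr
  by unfold_locales (rule Kr_dg_space)

text \<open>
  Two endomorphisms over \<open>A\<close> of the resolution are homotopic by a homotopy with values in the
  acyclic ideal \<open>ker \<epsilon>\<close>; here one of them is the identity.
\<close>

lemma homotopy_to_truncation:
  obtains g h where "\<And>x. x \<in> carrier R \<Longrightarrow> g x \<in> tpos" "\<And>x. x \<in> carrier R \<Longrightarrow> \<epsilon> (g x) = \<epsilon> x"
    "\<And>x. x \<in> carrier R \<Longrightarrow> h x \<in> carrier R \<and> \<epsilon> (h x) = 0"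
    "\<And>x y. x \<in> carrier R \<Longrightarrow> y \<in> carrier R \<Longrightarrow> h (x \<oplus> y) = h x \<oplus> h y"
    "\<And>c x. x \<in> carrier R \<Longrightarrow> h (c \<odot> x) = c \<odot> h x"
    "\<And>i x. x \<in> gr R i \<Longrightarrow> h x \<in> gr R (i + 1) \<and> g x \<in> gr R i"
    "\<And>x y. x \<in> carrier R \<Longrightarrow> y \<in> carrier R \<Longrightarrow> h (x \<otimes> y) = h x \<otimes> y \<oplus> g (tau R x) \<otimes> h y"
    "\<And>x. x \<in> carrier R \<Longrightarrow> x \<ominus> g x = diff R (h x) \<oplus> h (diff R x)"
proof -
  obtain g where g: "g \<in> dg_hom R R" and eg: "\<And>x. x \<in> carrier R \<Longrightarrow> \<epsilon> (g x) = \<epsilon> x"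
    and gt: "\<And>x. x \<in> carrier R \<Longrightarrow> g x \<in> tpos" using truncation by blast
  note gD = dg_homD[OF g]
  let ?l = "\<lambda>x k. g x \<otimes> k" and ?r = "\<lambda>k x. k \<otimes> x"
  interpret B: dg_bimod R Kr ?l ?r
  proof (intro dg_bimod.intro dg_bimod_axioms.intro)
    fix x k i assume "x \<in> gr R i" "k \<in> carrier Kr"
    then show "diff Kr (g x \<otimes> k) = g (diff R x) \<otimes> k \<oplus>\<^bsub>Kr\<^esub> sg i \<odot>\<^bsub>Kr\<^esub> (g x \<otimes> diff Kr k)"
      using R.leibniz[OF gD(6)[of x i], of k] gD(7)[of x] by (simp add: Kr_simps)
  qed (unfold_locales, insert gD(1-6) eg, auto simp: Kr_simps eps_mult R.A.l_distr R.A.r_distr R.mult_sm R.A.m_assoc R.leibniz)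
  let ?D = "\<lambda>x. x \<ominus> g x"
  have D: "B.is_der ?D"
    unfolding B.is_der_def
  proof (intro conjI ballI allI)
    fix x y assume x: "x \<in> carrier R" and y: "y \<in> carrier R"
    show "?D (x \<otimes> y) = ?D x \<otimes> y \<oplus>\<^bsub>Kr\<^esub> g x \<otimes> ?D y"
      using x y gD(1)[OF x] gD(1)[OF y] gD(3)[OF x y]
      by (simp add: Kr_simps R.minus_eq' R.A.l_distr R.A.r_distr R.mult_sm R.M.a_ac)
        (simp add: R.neg_eq[symmetric] R.M.r_neg1 R.M.r_neg2)
  qed (use gD eg in \<open>auto simp: Kr_simps R.minus_eq' eps_add eps_sm R.sm_distr R.sm_mult R.M.a_ac R.diff_add R.diff_smult mult.commute\<close>)
  have "\<exists>H. B.is_htpy ?D H"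
  proof (rule B.null_homotopic[OF cof inf unit_inj _ D])
    show "\<exists>k'\<in>gr Kr (i + 1). diff Kr k' = k" if "k \<in> gr Kr i" "diff Kr k = \<zero>\<^bsub>Kr\<^esub>" for i k
      using that exact_ker[of k i] by (auto simp: Kr_simps)
  qed
  then obtain h where h: "B.is_htpy ?D h" by blast
  show ?thesis
    by (rule that[of g h]) (use h gt eg gD(6) in \<open>auto simp: B.is_htpy_def Kr_simps\<close>)
qed

text \<open>Linear maps from \<open>A\<close> to the kernel of \<open>\<epsilon>\<close>, graded by the degree of their values.\<close>

definition HA_gr :: "int \<Rightarrow> ('a \<Rightarrow> 'u) set" where
  "HA_gr i = {f. (\<forall>a. f a \<in> gr R i \<and> \<epsilon> (f a) = 0) \<and> (\<forall>a b. f (a + b) = f a \<oplus> f b) \<and>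
     (\<forall>c a. f (sA c a) = c \<odot> f a)}"

inductive_set HA_carrier :: "('a \<Rightarrow> 'u) set" where
  hom: "f \<in> HA_gr i \<Longrightarrow> f \<in> HA_carrier"
| add: "f \<in> HA_carrier \<Longrightarrow> g \<in> HA_carrier \<Longrightarrow> (\<lambda>a. f a \<oplus> g a) \<in> HA_carrier"

definition HA :: "('k, 'a \<Rightarrow> 'u) dga" where
  "HA = \<lparr>carrier = HA_carrier, mult = undefined, one = undefined, zero = (\<lambda>_. \<zero>),
     add = (\<lambda>f g a. f a \<oplus> g a), smult = (\<lambda>c f a. c \<odot> f a), gr = HA_gr, diff = (\<lambda>f a. diff R (f a))\<rparr>"

lemma HA_simps: "carrier HA = HA_carrier" "zero HA = (\<lambda>_. \<zero>)" "f \<oplus>\<^bsub>HA\<^esub> g = (\<lambda>a. f a \<oplus> g a)"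
  "c \<odot>\<^bsub>HA\<^esub> f = (\<lambda>a. c \<odot> f a)" "gr HA = HA_gr" "diff HA f = (\<lambda>a. diff R (f a))"
  by (simp_all add: HA_def)

lemma HA_grD: "f \<in> HA_gr i \<Longrightarrow> f a \<in> gr R i" "f \<in> HA_gr i \<Longrightarrow> f a \<in> carrier R" "f \<in> HA_gr i \<Longrightarrow> \<epsilon> (f a) = 0"
  "f \<in> HA_gr i \<Longrightarrow> f (a + b) = f a \<oplus> f b" "f \<in> HA_gr i \<Longrightarrow> f (sA c a) = c \<odot> f a"
proof -
  assume f: "f \<in> HA_gr i"
  then show "f a \<in> gr R i" "\<epsilon> (f a) = 0" "f (a + b) = f a \<oplus> f b" "f (sA c a) = c \<odot> f a"
    by (auto simp: HA_gr_def)
  then show "f a \<in> carrier R" by simp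
qed

lemma HA_grI:
  assumes "\<And>a. f a \<in> gr R i" "\<And>a. \<epsilon> (f a) = 0" "\<And>a b. f (a + b) = f a \<oplus> f b"
    "\<And>c a. f (sA c a) = c \<odot> f a"
  shows "f \<in> HA_gr i"
  using assms by (auto simp: HA_gr_def)

lemma HA_carrierD:
  assumes "f \<in> HA_carrier"
  shows "f a \<in> carrier R" "\<epsilon> (f a) = 0" "f (a + b) = f a \<oplus> f b" "f (sA c a) = c \<odot> f a"
proof -
  have "f a \<in> carrier R \<and> \<epsilon> (f a) = 0 \<and> f (a + b) = f a \<oplus> f b \<and> f (sA c a) = c \<odot> f a" for a b c
    using assms
  proof (induction f arbitrary: a b c rule: HA_carrier.induct)
    case (hom f i)
    then show ?case using HA_grD[OF hom] by auto
  next
    case (add f g)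
    have c: "f a \<in> carrier R" "g a \<in> carrier R" for a using add by auto
    have "f (a + b) = f a \<oplus> f b" "g (a + b) = g a \<oplus> g b" "f (sA c a) = c \<odot> f a" "g (sA c a) = c \<odot> g a"
      "\<epsilon> (f a) = 0" "\<epsilon> (g a) = 0" using add by auto
    then show ?case using c by (simp add: eps_add R.M.a_ac R.sm_distr)
  qed
  then show "f a \<in> carrier R" "\<epsilon> (f a) = 0" "f (a + b) = f a \<oplus> f b" "f (sA c a) = c \<odot> f a" by auto
qed

lemma HA_zero: "f \<in> HA_carrier \<Longrightarrow> f 0 = \<zero>"
  using HA_carrierD(4)[of f 0 0] HA_carrierD(1)[of f 0] by simp

lemma HA_gr_smult: "f \<in> HA_gr i \<Longrightarrow> (\<lambda>a. c \<odot> f a) \<in> HA_gr i"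
  by (rule HA_grI) (simp_all add: HA_grD eps_sm R.sm_distr R.sm_mult mult.commute)

lemma HA_gr_add: "f \<in> HA_gr i \<Longrightarrow> g \<in> HA_gr i \<Longrightarrow> (\<lambda>a. f a \<oplus> g a) \<in> HA_gr i"
  by (rule HA_grI) (simp_all add: HA_grD eps_add R.sm_distr R.M.a_ac)

lemma HA_gr_zero: "(\<lambda>_. \<zero>) \<in> HA_gr i"
  by (auto simp: HA_gr_def)

lemma HA_gr_diff: "f \<in> HA_gr i \<Longrightarrow> (\<lambda>a. diff R (f a)) \<in> HA_gr (i - 1)"
  by (rule HA_grI) (simp_all add: HA_grD R.diff_add R.diff_smult)

lemma HA_closed:
  assumes "f \<in> HA_carrier"
    and "\<And>i f. f \<in> HA_gr i \<Longrightarrow> T f \<in> HA_carrier"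
    and "\<And>f g. f \<in> HA_carrier \<Longrightarrow> g \<in> HA_carrier \<Longrightarrow> T (\<lambda>a. f a \<oplus> g a) = (\<lambda>a. T f a \<oplus> T g a)"
  shows "T f \<in> HA_carrier"
  using assms(1) by (induction rule: HA_carrier.induct) (use assms in \<open>auto intro: HA_carrier.add\<close>)

lemma HA_smult: "f \<in> HA_carrier \<Longrightarrow> (\<lambda>a. c \<odot> f a) \<in> HA_carrier"
  by (rule HA_closed[where T = "\<lambda>f a. c \<odot> f a"])
    (auto simp: R.sm_distr HA_carrierD intro: HA_carrier.hom[OF HA_gr_smult])

lemma HA_dg_space: "dg_space HA"
proof (rule dg_spaceI[where pr = "\<lambda>i f a. comp R i (f a)"])
  have z: "(\<lambda>_. \<zero>) \<in> HA_carrier" using HA_carrier.hom[OF HA_gr_zero[of 0]] .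
  show mod: "module ground HA"
    by (rule module_groundI)
      (auto simp: HA_simps HA_carrierD R.sm_distr R.sm_add R.sm_mult z HA_smult R.M.a_ac intro: HA_carrier.add)
  show "submodule (gr HA i) ground HA" for i
    by (rule submodule_groundI[OF mod])
      (auto simp: HA_simps HA_gr_zero HA_gr_smult HA_gr_add intro: HA_carrier.hom)
  show cg: "(\<lambda>a. comp R i (f a)) = (if i = j then f else \<zero>\<^bsub>HA\<^esub>)" if "f \<in> gr HA j" for i j f
    using that R.comp_hom[OF HA_grD(1)[of f j]] by (auto simp: HA_simps)
  show "(\<lambda>a. comp R i (f a)) \<in> carrier HA" if "f \<in> carrier HA" for f i
    unfolding HA_simps
  proof (rule HA_closed[where T = "\<lambda>f a. comp R i (f a)"])
    show "f \<in> HA_carrier" using that by (simp add: HA_simps)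
    show "(\<lambda>a. comp R i (f a)) \<in> HA_carrier" if "f \<in> HA_gr j" for j f
      using cg[of f j i] that z HA_carrier.hom[OF that] by (auto simp: HA_simps)
  qed (auto simp: R.comp_add HA_carrierD)
  show "carrier HA \<subseteq> Z" if gen: "\<And>i. gr HA i \<subseteq> Z"
      "\<And>x y. x \<in> Z \<Longrightarrow> y \<in> Z \<Longrightarrow> x \<in> carrier HA \<Longrightarrow> y \<in> carrier HA \<Longrightarrow> x \<oplus>\<^bsub>HA\<^esub> y \<in> Z" for Z
  proof
    fix f assume "f \<in> carrier HA"
    then have "f \<in> HA_carrier" by (simp add: HA_simps)
    then show "f \<in> Z"
    proof (induction rule: HA_carrier.induct)
      case (hom f i)
      then show ?case using gen(1)[of i] by (auto simp: HA_simps)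
    next
      case (add f g)
      then show ?case using gen(2)[of f g] by (auto simp: HA_simps)
    qed
  qed
  show "diff HA f \<in> gr HA (i - 1)" if "f \<in> gr HA i" for f i
    using that HA_gr_diff by (simp add: HA_simps)
qed (auto simp: HA_simps HA_carrierD R.comp_add R.diff_add R.diff_smult)

lemma HA_l: "x \<in> gr R i \<Longrightarrow> f \<in> HA_gr j \<Longrightarrow> (\<lambda>a. x \<otimes> f a) \<in> HA_gr (i + j)"
  by (rule HA_grI) (simp_all add: HA_grD eps_mult R.A.r_distr R.mult_sm)

lemma HA_r:
  assumes x: "x \<in> gr R i" and f: "f \<in> HA_gr j"
  shows "(\<lambda>a. f (\<epsilon> x * a)) \<in> HA_gr (j + i)"
proof (cases "i = 0")
  case True
  then show ?thesis using f by (auto simp: HA_gr_def distrib_left sA_mult)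
next
  case False
  then have "(\<lambda>a. f (\<epsilon> x * a)) = (\<lambda>_. \<zero>)" using eps_gr[OF x False] HA_zero[OF HA_carrier.hom[OF f]] by simp
  then show ?thesis using HA_gr_zero by simp
qed

lemma HA_l_carrier:
  assumes "x \<in> carrier R" "f \<in> HA_carrier"
  shows "(\<lambda>a. x \<otimes> f a) \<in> HA_carrier"
  using assms(1)
proof (induction x rule: R.hom_induct)
  case (hom i x)
  show ?case
    by (rule HA_closed[where T = "\<lambda>f a. x \<otimes> f a", OF assms(2)])
      (use hom in \<open>auto simp: HA_carrierD R.A.r_distr intro: HA_carrier.hom[OF HA_l]\<close>)
next
  case (add x y)
  then have "(\<lambda>a. (x \<oplus> y) \<otimes> f a) = (\<lambda>a. x \<otimes> f a \<oplus> y \<otimes> f a)"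
    using assms(2) by (simp add: R.A.l_distr HA_carrierD)
  then show ?case using HA_carrier.add[OF add(3,4)] by simp
qed

lemma HA_r_carrier:
  assumes "x \<in> carrier R" "f \<in> HA_carrier"
  shows "(\<lambda>a. f (\<epsilon> x * a)) \<in> HA_carrier"
  using assms(1)
proof (induction x rule: R.hom_induct)
  case (hom i x)
  show ?case
    by (rule HA_closed[where T = "\<lambda>f a. f (\<epsilon> x * a)", OF assms(2)])
      (use hom in \<open>auto intro: HA_carrier.hom[OF HA_r]\<close>)
next
  case (add x y)
  then have "(\<lambda>a. f (\<epsilon> (x \<oplus> y) * a)) = (\<lambda>a. f (\<epsilon> x * a) \<oplus> f (\<epsilon> y * a))"
    using assms(2) by (simp add: eps_add distrib_right HA_carrierD)
  then show ?case using HA_carrier.add[OF add(3,4)] by simp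
qed

text \<open>
  The section of \<open>\<epsilon>\<close> is a chain map but not \<open>R\<close>-linear. Its failure \<open>x \<mapsto> (a \<mapsto> x s(a) - s(\<epsilon>(x) a))\<close> to be left
  \<open>R\<close>-linear is a derivation into the acyclic bimodule of linear maps \<open>A \<rightarrow> ker \<epsilon>\<close>. A null-homotopy
  \<open>h\<close> of this derivation makes the homotopy equivalence of \<open>R\<close> and \<open>A\<close> coherently left linear.
\<close>

lemma linear_up_to_homotopy:
  obtains h where "\<And>x a. x \<in> carrier R \<Longrightarrow> h x a \<in> carrier R \<and> \<epsilon> (h x a) = 0"
    "\<And>x a b. x \<in> carrier R \<Longrightarrow> h x (a + b) = h x a \<oplus> h x b"
    "\<And>c x a. x \<in> carrier R \<Longrightarrow> h x (sA c a) = c \<odot> h x a"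
    "\<And>x y a. x \<in> carrier R \<Longrightarrow> y \<in> carrier R \<Longrightarrow> h (x \<oplus> y) a = h x a \<oplus> h y a"
    "\<And>c x a. x \<in> carrier R \<Longrightarrow> h (c \<odot> x) a = c \<odot> h x a"
    "\<And>i x a. x \<in> gr R i \<Longrightarrow> h x a \<in> gr R (i + 1)"
    "\<And>x y a. x \<in> carrier R \<Longrightarrow> y \<in> carrier R \<Longrightarrow> h (x \<otimes> y) a = h x (\<epsilon> y * a) \<oplus> tau R x \<otimes> h y a"
    "\<And>x a. x \<in> carrier R \<Longrightarrow> x \<otimes> sec a \<ominus> sec (\<epsilon> x * a) = diff R (h x a) \<oplus> h (diff R x) a"
proof -
  let ?l = "\<lambda>x f a. x \<otimes> f a" and ?r = "\<lambda>f x a. f (\<epsilon> x * a)"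
  interpret HA: dgs HA by unfold_locales (rule HA_dg_space)
  interpret B: dg_bimod R HA ?l ?r
  proof (intro dg_bimod.intro dg_bimod_axioms.intro)
    show "dga R" by unfold_locales
    show "dgs HA" by unfold_locales
  qed (auto simp: HA_simps HA_l_carrier HA_r_carrier HA_l HA_r HA_carrierD R.A.l_distr R.A.r_distr R.mult_sm
      R.A.m_assoc eps_add eps_sm eps_mult R.leibniz HA_zero HA_zero[OF HA_carrier.hom] HA_grD(2) distrib_right sA_mult mult.assoc intro: HA_carrier.hom)
  let ?D = "\<lambda>x a. x \<otimes> sec a \<ominus> sec (\<epsilon> x * a)"
  have neg: "sec (- a) = \<ominus> sec a" for a
    using sec(5)[of "-1" a] by (simp add: R.neg_eq)
  have Dg: "?D x \<in> HA_gr i" if x: "x \<in> gr R i" for x i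
  proof -
    have "sec (\<epsilon> x * a) \<in> gr R i" for a
      using eps_gr[OF x] sec(1)[of "\<epsilon> x * a"] by (cases "i = 0") (auto simp: sec_zero)
    moreover have "x \<otimes> sec a \<in> gr R i" for a using R.gr_mult[OF x sec(1)[of a]] by simp
    ultimately show ?thesis using x
      by (intro HA_grI) (auto simp: eps_add eps_sm eps_mult sec R.minus_eq' distrib_left sA_mult R.A.r_distr R.mult_sm
          R.sm_distr R.sm_mult R.M.a_ac mult.commute)
  qed
  have Dadd: "?D (x \<oplus> y) = (\<lambda>a. ?D x a \<oplus> ?D y a)" if "x \<in> carrier R" "y \<in> carrier R" for x y
    using that by (auto simp: R.minus_eq' eps_add distrib_right sec(4) R.A.l_distr R.sm_distr R.M.a_ac)
  have Dc: "?D x \<in> HA_carrier" if "x \<in> carrier R" for x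
    using that
  proof (induction x rule: R.hom_induct)
    case (hom i x)
    then show ?case using HA_carrier.hom[OF Dg] by blast
  next
    case (add x y)
    then show ?case using HA_carrier.add[OF add(3,4)] Dadd[OF add(1,2)] by simp
  qed
  have D: "B.is_der ?D"
    unfolding B.is_der_def
  proof (intro conjI ballI allI)
    fix x y assume x: "x \<in> carrier R" and y: "y \<in> carrier R"
    show "?D (x \<otimes> y) = ?r (?D x) y \<oplus>\<^bsub>HA\<^esub> ?l x (?D y)"
      using x y by (auto simp: HA_simps R.minus_eq' eps_mult R.A.r_distr R.mult_sm R.A.m_assoc mult.assoc R.M.a_ac)
        (simp add: R.neg_eq[symmetric] R.M.r_neg1 R.M.r_neg2)
  next
    fix x assume x: "x \<in> carrier R"
    show "?D (diff R x) = diff HA (?D x)"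
      using x
    proof (induction x rule: R.hom_induct)
      case (hom i x)
      then show ?case using R.leibniz[OF hom sec_carrier]
        by (auto simp: HA_simps R.minus_eq' R.diff_add R.diff_smult sec sec_zero)
    next
      case (add x y)
      then show ?case using Dadd by (simp add: HA_simps R.diff_add fun_eq_iff)
    qed
  qed (use Dg Dc Dadd in \<open>auto simp: HA_simps R.minus_eq' eps_sm sA_mult sec(5) R.mult_sm R.sm_distr R.sm_mult mult.commute\<close>)
  have "\<exists>H. B.is_htpy ?D H"
  proof (rule B.null_homotopic[OF cof inf unit_inj _ D])
    fix i f assume f: "f \<in> gr HA i" "diff HA f = \<zero>\<^bsub>HA\<^esub>"
    then have f': "f \<in> HA_gr i" "\<And>a. diff R (f a) = \<zero>" by (auto simp: HA_simps fun_eq_iff)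
    note fD = HA_grD[OF f'(1)]
    have ex: "\<exists>x. x \<in> gr R (i + 1) \<and> diff R x = f a \<and> \<epsilon> x = 0" for a
      using exact_ker[OF fD(1) f'(2) fD(3)] by blast
    obtain x1 where x1: "x1 \<in> gr R (i + 1) \<and> diff R x1 = f 1 \<and> \<epsilon> x1 = 0" using ex by blast
    have f0: "f 0 = \<zero>" using HA_zero[OF HA_carrier.hom[OF f'(1)]] .
    have "\<exists>F. (\<forall>a. F a \<in> gr R (i + 1) \<and> diff R (F a) = f a \<and> \<epsilon> (F a) = 0) \<and>
       (\<forall>a b. F (a + b) = F a \<oplus> F b) \<and> (\<forall>c a. F (sA c a) = c \<odot> F a) \<and> F 1 = x1"
      by (rule R.linear_choice[OF vs, where P = "\<lambda>a x. x \<in> gr R (i + 1) \<and> diff R x = f a \<and> \<epsilon> x = 0"])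
        (use ex x1 in \<open>simp_all add: f0\<close>, (use fD in \<open>auto simp: R.diff_add R.diff_smult eps_add eps_sm\<close>)+)
    then obtain F where F: "\<forall>a. F a \<in> gr R (i + 1) \<and> diff R (F a) = f a \<and> \<epsilon> (F a) = 0"
       "\<forall>a b. F (a + b) = F a \<oplus> F b" "\<forall>c a. F (sA c a) = c \<odot> F a" by blast
    have "F \<in> gr HA (i + 1)" using F by (simp add: HA_simps HA_gr_def)
    moreover have "diff HA F = f" using F by (simp add: HA_simps)
    ultimately show "\<exists>k'\<in>gr HA (i + 1). diff HA k' = f" by blast
  qed
  then obtain h where h: "B.is_htpy ?D h" by blast
  show ?thesis
  proof (rule that[of h])
    show "h x a \<in> carrier R \<and> \<epsilon> (h x a) = 0" "h x (a + b) = h x a \<oplus> h x b" "h x (sA c a) = c \<odot> h x a"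
      if "x \<in> carrier R" for x a b c
      using h that HA_carrierD[of "h x"] by (auto simp: B.is_htpy_def HA_simps)
    show "h x a \<in> gr R (i + 1)" if "x \<in> gr R i" for x a i
      using h that HA_grD(1)[of "h x"] by (auto simp: B.is_htpy_def HA_simps)
    show "x \<otimes> sec a \<ominus> sec (\<epsilon> x * a) = diff R (h x a) \<oplus> h (diff R x) a" if "x \<in> carrier R" for x a
      using h that unfolding B.is_htpy_def HA_simps by (metis (no_types, lifting))
  qed (use h in \<open>auto simp: B.is_htpy_def HA_simps\<close>)
qed

end

section \<open>Cochains as a bimodule\<close>

text \<open>
  Cochains with values in a bimodule \<open>E\<close> form a bimodule again: the left action is that of \<open>E\<close>, and the
  right action is determined by \<open>(\<delta> q) (b # xs) = b q(xs) - (q b) xs\<close>. With this convention the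
  coboundary of a cochain is the inner derivation that it defines, so that Hochschild cohomology
  of degree \<open>n + 1\<close> consists of the outer derivations into \<open>n\<close>-cochains. The unit of the algebra acts
  on the right only as an idempotent.
\<close>

fun ra :: "('e \<Rightarrow> 'a \<Rightarrow> 'e) \<Rightarrow> ('a list \<Rightarrow> 'e::ab_group_add) \<Rightarrow> 'a::times \<Rightarrow> 'a list \<Rightarrow> 'e" where
  "ra re q b [] = re (q []) b"
| "ra re q b (x # xs) = q ((b * x) # xs) - ra re (\<lambda>ys. q (b # ys)) x xs"

locale coeff = VA: vector_space sA + VE: vector_space smE
  for sA :: "'k::field \<Rightarrow> 'a \<Rightarrow> 'a::ring_1" and smE :: "'k \<Rightarrow> 'e \<Rightarrow> 'e::ab_group_add" +
  fixes Ec :: "'e set" and le :: "'a \<Rightarrow> 'e \<Rightarrow> 'e" and re :: "'e \<Rightarrow> 'a \<Rightarrow> 'e"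
  assumes sA_mult': "sA c a * b = sA c (a * b)" "a * sA c b = sA c (a * b)"
    and Ec: "0 \<in> Ec" "x \<in> Ec \<Longrightarrow> y \<in> Ec \<Longrightarrow> x + y \<in> Ec" "x \<in> Ec \<Longrightarrow> smE c x \<in> Ec"
      "x \<in> Ec \<Longrightarrow> le a x \<in> Ec" "x \<in> Ec \<Longrightarrow> re x a \<in> Ec"
    and le: "le a (x + y) = le a x + le a y" "le a (smE c x) = smE c (le a x)"
      "le (a + b) x = le a x + le b x" "le (sA c a) x = smE c (le a x)"
      "le (a * b) x = le a (le b x)" "le 1 x = x"
    and re: "re (x + y) a = re x a + re y a" "re (smE c x) a = smE c (re x a)"
      "re x (a * b) = re (re x a) b" "le a (re x b) = re (le a x) b"
      "x \<in> Ec \<Longrightarrow> re x (a + b) = re x a + re x b" "x \<in> Ec \<Longrightarrow> re x (sA c a) = smE c (re x a)"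
begin

lemma le_zero [simp]: "le a 0 = 0" "le 0 x = 0"
  using le(2)[of a 0 0] le(4)[of 0 0 x] by simp_all

lemma re_zero [simp]: "re 0 a = 0"
  using re(2)[of 0 0 a] by simp

lemma le_neg: "le a (- x) = - le a x" "le a (x - y) = le a x - le a y"
  using le(1)[of a x "-x"] le(1)[of a x "-y"] le(1)[of a y "-y"] by (simp_all add: eq_neg_iff_add_eq_0 algebra_simps)

text \<open>
  Cochains are defined by recursion on the number of arguments because dimension shifting needs a
  \<open>(p+1)\<close>-cochain as a linear map from \<open>A\<close> to \<open>p\<close>-cochains.
\<close>

primrec Q :: "nat \<Rightarrow> ('a list \<Rightarrow> 'e) set" where
  "Q 0 = {q. q [] \<in> Ec \<and> (\<forall>x xs. q (x # xs) = 0)}"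
| "Q (Suc p) = {q. q [] = 0 \<and> (\<forall>a. (\<lambda>ys. q (a # ys)) \<in> Q p) \<and>
     (\<forall>a b ys. q ((a + b) # ys) = q (a # ys) + q (b # ys)) \<and> (\<forall>c a ys. q (sA c a # ys) = smE c (q (a # ys)))}"

lemma Q_zero [simp]: "(\<lambda>_. 0) \<in> Q p"
  by (induction p) (auto simp: Ec)

lemma Q_add: "q \<in> Q p \<Longrightarrow> q' \<in> Q p \<Longrightarrow> (\<lambda>xs. q xs + q' xs) \<in> Q p"
  by (induction p arbitrary: q q') (auto simp: Ec VE.scale_right_distrib)

lemma Q_sm: "q \<in> Q p \<Longrightarrow> (\<lambda>xs. smE c (q xs)) \<in> Q p"
  by (induction p arbitrary: q) (auto simp: Ec VE.scale_right_distrib mult.commute)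

lemma Q_neg: "q \<in> Q p \<Longrightarrow> (\<lambda>xs. - q xs) \<in> Q p"
  using Q_sm[of q p "-1"] by simp

lemma Q_diff: "q \<in> Q p \<Longrightarrow> q' \<in> Q p \<Longrightarrow> (\<lambda>xs. q xs - q' xs) \<in> Q p"
  using Q_add[OF _ Q_neg, of q p q'] by simp

lemma Q_la: "q \<in> Q p \<Longrightarrow> (\<lambda>xs. le a (q xs)) \<in> Q p"
  by (induction p arbitrary: q) (auto simp: Ec le)

lemma Q_ev: "q \<in> Q (Suc p) \<Longrightarrow> (\<lambda>xs. q (a # xs)) \<in> Q p"
  by simp

lemma Q_lin: "q \<in> Q (Suc p) \<Longrightarrow> q ((a + b) # xs) = q (a # xs) + q (b # xs)"
  "q \<in> Q (Suc p) \<Longrightarrow> q (sA c a # xs) = smE c (q (a # xs))" "q \<in> Q (Suc p) \<Longrightarrow> q [] = 0"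
  by auto

lemma Q_ev0: "q \<in> Q (Suc p) \<Longrightarrow> q (0 # xs) = 0"
  using Q_lin(2)[of q p 0 0 xs] by simp

lemma ra_add1: "ra re (\<lambda>xs. q xs + q' xs) b xs = ra re q b xs + ra re q' b xs"
  by (induction xs arbitrary: q q' b) (auto simp: re)

lemma ra_sm1: "ra re (\<lambda>xs. smE c (q xs)) b xs = smE c (ra re q b xs)"
  by (induction xs arbitrary: q b) (auto simp: re VE.scale_right_diff_distrib)

lemma ra_zero1 [simp]: "ra re (\<lambda>_. 0) b xs = 0"
  by (induction xs arbitrary: b) auto

lemma ra_neg1: "ra re (\<lambda>xs. - q xs) b xs = - ra re q b xs"
  using ra_sm1[of "-1" q b xs] by simp

lemma ra_diff1: "ra re (\<lambda>xs. q xs - q' xs) b xs = ra re q b xs - ra re q' b xs"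
  using ra_add1[of q "\<lambda>xs. - q' xs" b xs] by (simp add: ra_neg1)

lemma ra_le: "ra re (\<lambda>xs. le a (q xs)) b xs = le a (ra re q b xs)"
  by (induction xs arbitrary: q b) (auto simp: re le_neg)

lemma ra_assoc: "ra re (ra re q b) c xs = ra re q (b * c) xs"
  by (induction xs arbitrary: q b c) (auto simp: re mult.assoc ra_diff1)

lemma ra_Q_aux:
  "q \<in> Q p \<Longrightarrow> ra re q b \<in> Q p \<and> (\<forall>xs. ra re q (b + b') xs = ra re q b xs + ra re q b' xs) \<and>
     (\<forall>xs. ra re q (sA c b) xs = smE c (ra re q b xs))"
proof (induction p arbitrary: q b b' c)
  case 0
  have e: "q (x # xs) = 0" for x xs using 0 by simp
  have r: "ra re q b (x # xs) = 0" for b x xs by (simp add: e)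
  have "ra re q (b + b') xs = ra re q b xs + ra re q b' xs" "ra re q (sA c b) xs = smE c (ra re q b xs)" for xs
    by (cases xs; use 0 re r in \<open>simp del: ra.simps(2)\<close>)+
  then show ?case using 0 r by (auto simp del: ra.simps(2) simp: Ec)
next
  case (Suc p)
  note ev = Q_ev[OF Suc.prems] and lin = Q_lin[OF Suc.prems]
  have IH: "ra re (\<lambda>ys. q (a # ys)) b \<in> Q p"
    "ra re (\<lambda>ys. q (a # ys)) (b + b') xs = ra re (\<lambda>ys. q (a # ys)) b xs + ra re (\<lambda>ys. q (a # ys)) b' xs"
    "ra re (\<lambda>ys. q (a # ys)) (sA c b) xs = smE c (ra re (\<lambda>ys. q (a # ys)) b xs)" for a b b' c xs
    using Suc.IH[OF ev[of a]] by blast+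
  have "ra re q b \<in> Q (Suc p)"
    using Q_diff[OF ev[of "b * _"] IH(1)]
    by (auto simp: lin IH distrib_left sA_mult' VE.scale_right_diff_distrib)
  moreover have "ra re q (b + b') xs = ra re q b xs + ra re q b' xs" for xs
    by (cases xs) (auto simp: lin distrib_right ra_add1)
  moreover have "ra re q (sA c b) xs = smE c (ra re q b xs)" for xs
    by (cases xs) (auto simp: lin sA_mult' ra_sm1 VE.scale_right_diff_distrib)
  ultimately show ?case by blast
qed

lemma ra_Q: "q \<in> Q p \<Longrightarrow> ra re q b \<in> Q p"
  and ra_add2: "q \<in> Q p \<Longrightarrow> ra re q (b + b') xs = ra re q b xs + ra re q b' xs"
  and ra_sm2: "q \<in> Q p \<Longrightarrow> ra re q (sA c b) xs = smE c (ra re q b xs)"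
  using ra_Q_aux[of q p b b' c] by blast+

lemma ra_zero2: "q \<in> Q p \<Longrightarrow> ra re q 0 xs = 0"
  using ra_sm2[of q p 0 0 xs] by simp

lemma ra_zero2': "q \<in> Q p \<Longrightarrow> ra re q 0 = (\<lambda>_. 0)"
  by (intro ext ra_zero2)

lemma ra_fun:
  "ra re (\<lambda>xs. q xs + q' xs) b = (\<lambda>xs. ra re q b xs + ra re q' b xs)"
  "ra re (\<lambda>xs. smE c (q xs)) b = (\<lambda>xs. smE c (ra re q b xs))"
  "ra re (\<lambda>_. 0) b = (\<lambda>_. 0)"
  "ra re (\<lambda>xs. le a (q xs)) b = (\<lambda>xs. le a (ra re q b xs))"
  "ra re (ra re q b) b' = ra re q (b * b')"
  "ra re (\<lambda>xs. q xs - q' xs) b = (\<lambda>xs. ra re q b xs - ra re q' b xs)"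
  "ra re (\<lambda>xs. - q xs) b = (\<lambda>xs. - ra re q b xs)"
  by (intro ext; simp add: ra_add1 ra_sm1 ra_le ra_assoc ra_diff1 ra_neg1)+

text \<open>The inner derivation defined by a cochain.\<close>

definition inn :: "('a list \<Rightarrow> 'e) \<Rightarrow> 'a \<Rightarrow> 'a list \<Rightarrow> 'e" where
  "inn q a xs = le a (q xs) - ra re q a xs"

lemma inn_Q: "q \<in> Q p \<Longrightarrow> inn q a \<in> Q p"
  unfolding inn_def by (intro Q_diff Q_la ra_Q)

end

type_synonym ('y, 'z) quad = "('y list \<Rightarrow> 'z) \<times> ('y list \<Rightarrow> 'z) \<times> ('y list \<Rightarrow> 'z) \<times> ('y list \<Rightarrow> 'z)"

locale tangent = resolution sA R \<epsilon> + coeff sA smE Ec le re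
  for sA :: "'k::field_char_0 \<Rightarrow> 'a \<Rightarrow> 'a::ring_1" and R :: "('k, 'u) dga" (structure) and \<epsilon> :: "'u \<Rightarrow> 'a"
    and smE :: "'k \<Rightarrow> 'e \<Rightarrow> 'e::ab_group_add" and Ec le re
begin

text \<open>
  The acyclic complex \<open>N \<rightarrow> N \<oplus> Hom(A, N) \<rightarrow> Hom(A, N)\<close> of bimodules for the \<open>p\<close>-cochains \<open>N\<close>, with
  \<open>Hom(A, N)\<close> in the degrees \<open>t\<close> and \<open>t + 1\<close>. The middle term is a nontrivial extension of bimodules.
\<close>

definition LL :: "nat \<Rightarrow> int \<Rightarrow> ('k, ('a, 'e) quad) dga" where
  "LL p t = \<lparr>carrier = Q p \<times> Q p \<times> Q (Suc p) \<times> Q (Suc p), mult = undefined, one = undefined,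
     zero = (\<lambda>_. 0, \<lambda>_. 0, \<lambda>_. 0, \<lambda>_. 0),
     add = (\<lambda>(a, b, c, d) (a', b', c', d'). (\<lambda>xs. a xs + a' xs, \<lambda>xs. b xs + b' xs, \<lambda>xs. c xs + c' xs, \<lambda>xs. d xs + d' xs)),
     smult = (\<lambda>k (a, b, c, d). (\<lambda>xs. smE k (a xs), \<lambda>xs. smE k (b xs), \<lambda>xs. smE k (c xs), \<lambda>xs. smE k (d xs))),
     gr = (\<lambda>i. {(a, b, c, d). a \<in> Q p \<and> b \<in> Q p \<and> c \<in> Q (Suc p) \<and> d \<in> Q (Suc p) \<and>
        (i \<noteq> t + 2 \<longrightarrow> a = (\<lambda>_. 0)) \<and> (i \<noteq> t + 1 \<longrightarrow> b = (\<lambda>_. 0) \<and> c = (\<lambda>_. 0)) \<and> (i \<noteq> t \<longrightarrow> d = (\<lambda>_. 0))}),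
     diff = (\<lambda>(a, b, c, d). (\<lambda>_. 0, a, \<lambda>_. 0, c))\<rparr>"

definition Ll :: "'u \<Rightarrow> ('a, 'e) quad \<Rightarrow> ('a, 'e) quad" where
  "Ll x = (\<lambda>(a, b, c, d). (\<lambda>xs. le (\<epsilon> x) (a xs), \<lambda>xs. le (\<epsilon> x) (b xs), \<lambda>xs. le (\<epsilon> x) (c xs), \<lambda>xs. le (\<epsilon> x) (d xs)))"

definition Lr :: "('a, 'e) quad \<Rightarrow> 'u \<Rightarrow> ('a, 'e) quad" where
  "Lr = (\<lambda>(a, b, c, d) x. (ra re a (\<epsilon> x), \<lambda>xs. ra re b (\<epsilon> x) xs + c (\<epsilon> x # xs), ra re c (\<epsilon> x), ra re d (\<epsilon> x)))"

declare Q.simps(2) [simp del]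

lemma LL_dg_space: "dg_space (LL p t)"
proof (rule dg_spaceI[where pr = "\<lambda>i (a, b, c, d). (if i = t + 2 then a else (\<lambda>_. 0), if i = t + 1 then b else (\<lambda>_. 0),
    if i = t + 1 then c else (\<lambda>_. 0), if i = t then d else (\<lambda>_. 0))"])
  show mod: "module ground (LL p t)"
    by (rule module_groundI)
      (auto simp: LL_def Q_add Q_sm VE.scale_right_distrib VE.scale_left_distrib add.commute add.left_commute)
  show "submodule (gr (LL p t) i) ground (LL p t)" for i
    by (rule submodule_groundI[OF mod]) (auto simp: LL_def Q_add Q_sm)
  show "carrier (LL p t) \<subseteq> Z" if gen: "\<And>i. gr (LL p t) i \<subseteq> Z"
      "\<And>x y. x \<in> Z \<Longrightarrow> y \<in> Z \<Longrightarrow> x \<in> carrier (LL p t) \<Longrightarrow> y \<in> carrier (LL p t) \<Longrightarrow> x \<oplus>\<^bsub>LL p t\<^esub> y \<in> Z" for Z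
  proof
    fix x assume "x \<in> carrier (LL p t)"
    then obtain a b c d where x: "x = (a, b, c, d)" "a \<in> Q p" "b \<in> Q p" "c \<in> Q (Suc p)" "d \<in> Q (Suc p)"
      by (auto simp: LL_def)
    let ?z = "\<lambda>_. 0"
    have 1: "(a, ?z, ?z, ?z) \<in> Z" using gen(1)[of "t + 2"] x by (auto simp: LL_def)
    have 2: "(?z, b, c, ?z) \<in> Z" using gen(1)[of "t + 1"] x by (auto simp: LL_def)
    have 3: "(?z, ?z, ?z, d) \<in> Z" using gen(1)[of "t"] x by (auto simp: LL_def)
    have "(a, ?z, ?z, ?z) \<oplus>\<^bsub>LL p t\<^esub> (?z, b, c, ?z) \<in> Z" by (rule gen(2)[OF 1 2]) (use x in \<open>auto simp: LL_def\<close>)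
    then have "(a, b, c, ?z) \<in> Z" by (simp add: LL_def)
    then have "(a, b, c, ?z) \<oplus>\<^bsub>LL p t\<^esub> (?z, ?z, ?z, d) \<in> Z"
      by (rule gen(2)[OF _ 3]) (use x in \<open>auto simp: LL_def\<close>)
    then show "x \<in> Z" using x(1) by (simp add: LL_def)
  qed
qed (auto simp: LL_def)

lemma LL_acyclic:
  assumes "k \<in> gr (LL p t) i" "diff (LL p t) k = \<zero>\<^bsub>LL p t\<^esub>"
  shows "\<exists>k'\<in>gr (LL p t) (i + 1). diff (LL p t) k' = k"
proof -
  obtain a b c d where k: "k = (a, b, c, d)" by (cases k)
  show ?thesis by (rule bexI[of _ "(b, \<lambda>_. 0, d, \<lambda>_. 0)"]) (use assms k in \<open>auto simp: LL_def\<close>)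
qed

lemma LL_bimod: "dg_bimod R (LL p t) Ll Lr"
proof (intro dg_bimod.intro dg_bimod_axioms.intro)
  show "dga R" by unfold_locales
  show "dgs (LL p t)" by unfold_locales (rule LL_dg_space)
  show "Ll x k \<in> gr (LL p t) (i + j)" if "x \<in> gr R i" "k \<in> gr (LL p t) j" for x k i j
    using that eps_gr[OF that(1)] by (cases "i = 0") (auto simp: LL_def Ll_def Q_la)
  show "Lr k x \<in> gr (LL p t) (j + i)" if "x \<in> gr R i" "k \<in> gr (LL p t) j" for x k i j
    using that eps_gr[OF that(1)]
    by (cases "i = 0") (auto simp: LL_def Lr_def ra_Q ra_fun Q_add Q_ev ra_zero2' Q_ev0)
  fix x i k assume x: "x \<in> gr R i" and k: "k \<in> carrier (LL p t)"
  have "smE (sg i) (le (\<epsilon> x) e) = le (\<epsilon> x) e" for e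
    using eps_gr[OF x] by (cases "i = 0") auto
  then show "diff (LL p t) (Ll x k) = Ll (diff R x) k \<oplus>\<^bsub>LL p t\<^esub> sg i \<odot>\<^bsub>LL p t\<^esub> Ll x (diff (LL p t) k)"
    using x k by (auto simp: LL_def Ll_def)
qed (auto simp: LL_def Ll_def Lr_def Q_la ra_Q Q_add Q_ev eps_add eps_sm eps_mult le ra_fun ra_add2 ra_sm2
    VE.scale_right_distrib Q_lin fun_eq_iff ra_zero2 Q_ev0 algebra_simps)

end

section \<open>Derivations of the resolution\<close>

context tangent
begin

text \<open>
  A map that is twisted by \<open>G\<close>, together with \<open>G\<close>, is a derivation into the middle term of the complex
  \<open>LL\<close>. As the coefficients sit in degree 0, no Koszul signs occur.
\<close>

definition tder :: "int \<Rightarrow> nat \<Rightarrow> ('u \<Rightarrow> 'a list \<Rightarrow> 'e) \<Rightarrow> ('u \<Rightarrow> 'a list \<Rightarrow> 'e) \<Rightarrow> bool" where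
  "tder n p h G \<longleftrightarrow> (\<forall>x\<in>carrier R. h x \<in> Q p) \<and>
     (\<forall>x\<in>carrier R. \<forall>y\<in>carrier R. \<forall>xs. h (x \<oplus> y) xs = h x xs + h y xs) \<and>
     (\<forall>c. \<forall>x\<in>carrier R. \<forall>xs. h (c \<odot> x) xs = smE c (h x xs)) \<and>
     (\<forall>i x xs. x \<in> gr R i \<longrightarrow> i \<noteq> n \<longrightarrow> h x xs = 0) \<and>
     (\<forall>x\<in>carrier R. \<forall>y\<in>carrier R. \<forall>xs.
        h (x \<otimes> y) xs = ra re (h x) (\<epsilon> y) xs + le (\<epsilon> x) (h y xs) + G x (\<epsilon> y # xs))"

abbreviation der :: "int \<Rightarrow> nat \<Rightarrow> ('u \<Rightarrow> 'a list \<Rightarrow> 'e) \<Rightarrow> bool" where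
  "der n p D \<equiv> tder n p D (\<lambda>_ _. 0)"

definition cyc :: "int \<Rightarrow> nat \<Rightarrow> ('u \<Rightarrow> 'a list \<Rightarrow> 'e) \<Rightarrow> bool" where
  "cyc n p D \<longleftrightarrow> der n p D \<and> (\<forall>x\<in>carrier R. \<forall>xs. D (diff R x) xs = 0)"

definition bdr :: "int \<Rightarrow> nat \<Rightarrow> ('u \<Rightarrow> 'a list \<Rightarrow> 'e) \<Rightarrow> bool" where
  "bdr n p D \<longleftrightarrow> (\<exists>g. der (n - 1) p g \<and> (\<forall>x\<in>carrier R. \<forall>xs. D x xs = g (diff R x) xs))"

text \<open>
  The dimension shift: \<open>D\<close> is the boundary of a map \<open>h\<close> of one degree less that fails the Leibniz rule
  by \<open>G\<close>. The degree drops by one while the cochains gain an argument.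
\<close>

definition stp :: "int \<Rightarrow> nat \<Rightarrow> ('u \<Rightarrow> 'a list \<Rightarrow> 'e) \<Rightarrow> ('u \<Rightarrow> 'a list \<Rightarrow> 'e) \<Rightarrow> bool" where
  "stp n p G D \<longleftrightarrow> cyc n (Suc p) G \<and> cyc (n + 1) p D \<and>
     (\<exists>h. tder n p h G \<and> (\<forall>x\<in>carrier R. \<forall>xs. h (diff R x) xs = D x xs))"

lemma tderD:
  assumes "tder n p h G"
  shows "x \<in> carrier R \<Longrightarrow> h x \<in> Q p"
    "x \<in> carrier R \<Longrightarrow> y \<in> carrier R \<Longrightarrow> h (x \<oplus> y) xs = h x xs + h y xs"
    "x \<in> carrier R \<Longrightarrow> h (c \<odot> x) xs = smE c (h x xs)"
    "x \<in> gr R i \<Longrightarrow> i \<noteq> n \<Longrightarrow> h x xs = 0"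
    "x \<in> carrier R \<Longrightarrow> y \<in> carrier R \<Longrightarrow> h (x \<otimes> y) xs = ra re (h x) (\<epsilon> y) xs + le (\<epsilon> x) (h y xs) + G x (\<epsilon> y # xs)"
  using assms by (auto simp: tder_def)

lemma tder_zero: "tder n p h G \<Longrightarrow> h \<zero> xs = 0"
  using tderD(3)[of n p h G "\<zero>" 0 xs] by simp

lemma tder_neg: "tder n p h G \<Longrightarrow> x \<in> carrier R \<Longrightarrow> h (\<ominus> x) xs = - h x xs"
  using tderD(3)[of n p h G x "-1" xs] by (simp add: R.neg_eq)

lemma tder_minus: "tder n p h G \<Longrightarrow> x \<in> carrier R \<Longrightarrow> y \<in> carrier R \<Longrightarrow> h (x \<ominus> y) xs = h x xs - h y xs"
  using tderD(2)[of n p h G x "\<ominus> y" xs] by (simp add: a_minus_def tder_neg)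

lemma ra_cong: "(\<And>ys. q ys = q' ys) \<Longrightarrow> ra re q b xs = ra re q' b xs"
  by (rule arg_cong[where f = "\<lambda>q. ra re q b xs"]) (rule ext)

lemma tder_cong:
  assumes "tder n p h G" "\<And>x xs. x \<in> carrier R \<Longrightarrow> h' x xs = h x xs" "\<And>x xs. x \<in> carrier R \<Longrightarrow> G' x xs = G x xs"
  shows "tder n p h' G'"
proof -
  have e: "h' x = h x" if "x \<in> carrier R" for x using assms(2)[OF that] by (rule ext)
  have "h' x xs = 0" if "x \<in> gr R i" "i \<noteq> n" for x i xs
    using tderD(4)[OF assms(1) that] e[OF R.gr_carrier[OF that(1)]] by simp
  then show ?thesis using assms(1) unfolding tder_def by (auto simp: e assms(3))
qed

lemma tder_add: "tder n p h G \<Longrightarrow> tder n p h' G' \<Longrightarrow> tder n p (\<lambda>x xs. h x xs + h' x xs) (\<lambda>x xs. G x xs + G' x xs)"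
  unfolding tder_def by (auto simp: Q_add VE.scale_right_distrib ra_add1 le)

lemma tder_sm: "tder n p h G \<Longrightarrow> tder n p (\<lambda>x xs. smE c (h x xs)) (\<lambda>x xs. smE c (G x xs))"
  unfolding tder_def by (auto simp: Q_sm VE.scale_right_distrib ra_sm1 le mult.commute)

lemma tder_neg': "tder n p h G \<Longrightarrow> tder n p (\<lambda>x xs. - h x xs) (\<lambda>x xs. - G x xs)"
  using tder_sm[of n p h G "-1"] by simp

lemma tder_diff: "tder n p h G \<Longrightarrow> tder n p h' G' \<Longrightarrow> tder n p (\<lambda>x xs. h x xs - h' x xs) (\<lambda>x xs. G x xs - G' x xs)"
  using tder_add[OF _ tder_neg', of n p h G h' G'] by simp

lemma der_0 [simp]: "der n p (\<lambda>_ _. 0)"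
  by (simp add: tder_def)

lemma der_add: "der n p D \<Longrightarrow> der n p D' \<Longrightarrow> der n p (\<lambda>x xs. D x xs + D' x xs)"
  using tder_add[of n p D "\<lambda>_ _. 0" D' "\<lambda>_ _. 0"] by simp

lemma der_sm: "der n p D \<Longrightarrow> der n p (\<lambda>x xs. smE c (D x xs))"
  using tder_sm[of n p D "\<lambda>_ _. 0" c] by simp

lemma der_neg: "der n p D \<Longrightarrow> der n p (\<lambda>x xs. - D x xs)"
  using tder_neg'[of n p D "\<lambda>_ _. 0"] by simp

lemma cyc_0 [simp]: "cyc n p (\<lambda>_ _. 0)"
  by (simp add: cyc_def)

lemma cyc_add: "cyc n p D \<Longrightarrow> cyc n p D' \<Longrightarrow> cyc n p (\<lambda>x xs. D x xs + D' x xs)"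
  unfolding cyc_def using der_add by auto

lemma cyc_sm: "cyc n p D \<Longrightarrow> cyc n p (\<lambda>x xs. smE c (D x xs))"
  unfolding cyc_def using der_sm by auto

lemma cyc_neg: "cyc n p D \<Longrightarrow> cyc n p (\<lambda>x xs. - D x xs)"
  unfolding cyc_def using der_neg by auto

lemma cyc_cong: "cyc n p D \<Longrightarrow> (\<And>x xs. x \<in> carrier R \<Longrightarrow> D' x xs = D x xs) \<Longrightarrow> cyc n p D'"
  unfolding cyc_def using tder_cong[of n p D "\<lambda>_ _. 0" D' "\<lambda>_ _. 0"] by auto

lemma bdr_add:
  assumes "bdr n p D" "bdr n p D'"
  shows "bdr n p (\<lambda>x xs. D x xs + D' x xs)"
proof -
  obtain g g' where "der (n - 1) p g" "der (n - 1) p g'" "\<forall>x\<in>carrier R. \<forall>xs. D x xs = g (diff R x) xs"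
     "\<forall>x\<in>carrier R. \<forall>xs. D' x xs = g' (diff R x) xs" using assms unfolding bdr_def by blast
  then show ?thesis unfolding bdr_def by (intro exI[of _ "\<lambda>x xs. g x xs + g' x xs"]) (simp add: der_add)
qed

lemma bdr_sm:
  assumes "bdr n p D"
  shows "bdr n p (\<lambda>x xs. smE c (D x xs))"
proof -
  obtain g where "der (n - 1) p g" "\<forall>x\<in>carrier R. \<forall>xs. D x xs = g (diff R x) xs" using assms unfolding bdr_def by blast
  then show ?thesis unfolding bdr_def by (intro exI[of _ "\<lambda>x xs. smE c (g x xs)"]) (simp add: der_sm)
qed

lemma bdr_0 [simp]: "bdr n p (\<lambda>_ _. 0)"
  unfolding bdr_def by (intro exI[of _ "\<lambda>_ _. 0"]) simp

lemma der_diff_der: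
  assumes g: "der (n - 1) p g"
  shows "der n p (\<lambda>x. g (diff R x))"
  unfolding tder_def
proof (intro conjI ballI allI impI)
  fix x y xs assume x: "x \<in> carrier R" and y: "y \<in> carrier R"
  show "g (diff R (x \<otimes> y)) xs = ra re (g (diff R x)) (\<epsilon> y) xs + le (\<epsilon> x) (g (diff R y) xs) + 0"
    using x
  proof (induction x rule: R.hom_induct)
    case (hom i x)
    have gx: "g x \<in> Q p" using tderD(1)[OF g] hom by simp
    have "sg i = (1::'k) \<or> \<epsilon> x = 0" using eps_gr[OF hom] by (cases "i = 0") auto
    moreover have "g (diff R (x \<otimes> y)) xs = ra re (g (diff R x)) (\<epsilon> y) xs + smE (sg i) (le (\<epsilon> x) (g (diff R y) xs))"
      using hom y by (simp add: R.leibniz[OF hom y] tderD[OF g] ra_zero2[OF gx])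
    ultimately show ?case by auto
  next
    case (add u v)
    have "ra re (g (diff R (u \<oplus> v))) (\<epsilon> y) xs = ra re (\<lambda>xs. g (diff R u) xs + g (diff R v) xs) (\<epsilon> y) xs"
      by (rule ra_cong) (use add in \<open>simp add: R.diff_add tderD[OF g]\<close>)
    then show ?case using add y by (simp add: R.A.l_distr R.diff_add tderD[OF g] ra_add1 eps_add le)
  qed
next
  fix i x xs assume "x \<in> gr R i" "i \<noteq> n"
  then show "g (diff R x) xs = 0" using tderD(4)[OF g, of "diff R x" "i - 1"] by simp
qed (use g in \<open>auto simp: tderD[OF g] R.diff_add R.diff_smult\<close>)

lemma bdr_cyc: "bdr n p D \<Longrightarrow> cyc n p D"
proof -
  assume "bdr n p D"
  then obtain g where g: "der (n - 1) p g" "\<forall>x\<in>carrier R. \<forall>xs. D x xs = g (diff R x) xs" unfolding bdr_def by blast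
  have "cyc n p (\<lambda>x. g (diff R x))" unfolding cyc_def using der_diff_der[OF g(1)] tder_zero[OF g(1)] by simp
  then show ?thesis by (rule cyc_cong) (use g in simp)
qed

text \<open>
  The components of a null-homotopy of a derivation into \<open>LL\<close>, which exists because \<open>LL\<close> is
  acyclic and \<open>R\<close> is cofibrant.
\<close>

lemma LL_null_homotopic:
  assumes D1: "der (t + 2) p D1" and D2: "tder (t + 1) p D2 D3" and D3: "der (t + 1) (Suc p) D3"
    and D4: "der t (Suc p) D4"
    and d: "\<And>x xs. x \<in> carrier R \<Longrightarrow> D1 (diff R x) xs = 0" "\<And>x xs. x \<in> carrier R \<Longrightarrow> D2 (diff R x) xs = D1 x xs"
      "\<And>x xs. x \<in> carrier R \<Longrightarrow> D3 (diff R x) xs = 0" "\<And>x xs. x \<in> carrier R \<Longrightarrow> D4 (diff R x) xs = D3 x xs"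
  obtains H1 H2 H3 H4 where "der (t + 1) p H1" "tder t p H2 H3" "der t (Suc p) H3" "der (t - 1) (Suc p) H4"
    "\<And>x xs. x \<in> carrier R \<Longrightarrow> D1 x xs = H1 (diff R x) xs"
    "\<And>x xs. x \<in> carrier R \<Longrightarrow> D2 x xs = H1 x xs + H2 (diff R x) xs"
    "\<And>x xs. x \<in> carrier R \<Longrightarrow> D3 x xs = H3 (diff R x) xs"
    "\<And>x xs. x \<in> carrier R \<Longrightarrow> D4 x xs = H3 x xs + H4 (diff R x) xs"
proof -
  interpret L: dg_bimod R "LL p t" Ll Lr by (rule LL_bimod)
  let ?D = "\<lambda>x. (D1 x, D2 x, D3 x, D4 x)"
  note T = tderD[OF D1] tderD[OF D2] tderD[OF D3] tderD[OF D4]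
  have "L.is_der ?D"
    unfolding L.is_der_def
  proof (intro conjI allI ballI)
    show "?D x \<in> gr (LL p t) i" if x: "x \<in> gr R i" for x i
    proof -
      have "D1 x = (\<lambda>_. 0)" if "i \<noteq> t + 2" using tderD(4)[OF D1 x that] by (intro ext)
      moreover have "D2 x = (\<lambda>_. 0)" "D3 x = (\<lambda>_. 0)" if "i \<noteq> t + 1"
        using tderD(4)[OF D2 x that] tderD(4)[OF D3 x that] by (auto intro!: ext)
      moreover have "D4 x = (\<lambda>_. 0)" if "i \<noteq> t" using tderD(4)[OF D4 x that] by (intro ext)
      ultimately show ?thesis using x T(1,6,11,16)[of x] by (auto simp: LL_def)
    qed
  qed (auto simp: LL_def Ll_def Lr_def T d fun_eq_iff)
  then have "\<exists>H. L.is_htpy ?D H"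
    using L.null_homotopic[OF cof inf unit_inj LL_acyclic] by blast
  then obtain H where H: "L.is_htpy ?D H" by blast
  define H1 where "H1 x = fst (H x)" for x
  define H2 where "H2 x = fst (snd (H x))" for x
  define H3 where "H3 x = fst (snd (snd (H x)))" for x
  define H4 where "H4 x = snd (snd (snd (H x)))" for x
  have He: "H x = (H1 x, H2 x, H3 x, H4 x)" for x by (simp add: H1_def H2_def H3_def H4_def)
  have Hc: "H1 x \<in> Q p" "H2 x \<in> Q p" "H3 x \<in> Q (Suc p)" "H4 x \<in> Q (Suc p)" if "x \<in> carrier R" for x
  proof -
    have "H x \<in> carrier (LL p t)" using H that by (auto simp: L.is_htpy_def)
    then show "H1 x \<in> Q p" "H2 x \<in> Q p" "H3 x \<in> Q (Suc p)" "H4 x \<in> Q (Suc p)" by (auto simp: He LL_def)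
  qed
  have Ha: "H1 (x \<oplus> y) xs = H1 x xs + H1 y xs" "H2 (x \<oplus> y) xs = H2 x xs + H2 y xs"
    "H3 (x \<oplus> y) xs = H3 x xs + H3 y xs" "H4 (x \<oplus> y) xs = H4 x xs + H4 y xs"
    if "x \<in> carrier R" "y \<in> carrier R" for x y xs
  proof -
    have "H (x \<oplus> y) = H x \<oplus>\<^bsub>LL p t\<^esub> H y" using H that by (auto simp: L.is_htpy_def)
    then show "H1 (x \<oplus> y) xs = H1 x xs + H1 y xs" "H2 (x \<oplus> y) xs = H2 x xs + H2 y xs"
      "H3 (x \<oplus> y) xs = H3 x xs + H3 y xs" "H4 (x \<oplus> y) xs = H4 x xs + H4 y xs"
      by (auto simp: He LL_def)
  qed
  have Hs: "H1 (c \<odot> x) xs = smE c (H1 x xs)" "H2 (c \<odot> x) xs = smE c (H2 x xs)"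
    "H3 (c \<odot> x) xs = smE c (H3 x xs)" "H4 (c \<odot> x) xs = smE c (H4 x xs)"
    if "x \<in> carrier R" for x c xs
  proof -
    have "H (c \<odot> x) = c \<odot>\<^bsub>LL p t\<^esub> H x" using H that by (auto simp: L.is_htpy_def)
    then show "H1 (c \<odot> x) xs = smE c (H1 x xs)" "H2 (c \<odot> x) xs = smE c (H2 x xs)"
      "H3 (c \<odot> x) xs = smE c (H3 x xs)" "H4 (c \<odot> x) xs = smE c (H4 x xs)"
      by (auto simp: He LL_def)
  qed
  have Hg: "i \<noteq> t + 1 \<longrightarrow> H1 x xs = 0" "i \<noteq> t \<longrightarrow> H2 x xs = 0" "i \<noteq> t \<longrightarrow> H3 x xs = 0" "i \<noteq> t - 1 \<longrightarrow> H4 x xs = 0"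
    if "x \<in> gr R i" for x i xs
  proof -
    have "H x \<in> gr (LL p t) (i + 1)" using H that by (auto simp: L.is_htpy_def)
    then show "i \<noteq> t + 1 \<longrightarrow> H1 x xs = 0" "i \<noteq> t \<longrightarrow> H2 x xs = 0" "i \<noteq> t \<longrightarrow> H3 x xs = 0" "i \<noteq> t - 1 \<longrightarrow> H4 x xs = 0"
      by (auto simp: He LL_def)
  qed
  have "H (x \<otimes> y) = Lr (H x) y \<oplus>\<^bsub>LL p t\<^esub> Ll (tau R x) (H y)" if "x \<in> carrier R" "y \<in> carrier R" for x y
    using H that by (auto simp: L.is_htpy_def)
  then have Hm: "H1 (x \<otimes> y) xs = ra re (H1 x) (\<epsilon> y) xs + le (\<epsilon> x) (H1 y xs)"
    "H2 (x \<otimes> y) xs = ra re (H2 x) (\<epsilon> y) xs + H3 x (\<epsilon> y # xs) + le (\<epsilon> x) (H2 y xs)"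
    "H3 (x \<otimes> y) xs = ra re (H3 x) (\<epsilon> y) xs + le (\<epsilon> x) (H3 y xs)"
    "H4 (x \<otimes> y) xs = ra re (H4 x) (\<epsilon> y) xs + le (\<epsilon> x) (H4 y xs)"
    if "x \<in> carrier R" "y \<in> carrier R" for x y xs
    using that by (auto simp: He LL_def Ll_def Lr_def eps_tau)
  have "?D x = diff (LL p t) (H x) \<oplus>\<^bsub>LL p t\<^esub> H (diff R x)" if "x \<in> carrier R" for x
    using H that unfolding L.is_htpy_def by blast
  then have Hd: "D1 x xs = H1 (diff R x) xs" "D2 x xs = H1 x xs + H2 (diff R x) xs"
    "D3 x xs = H3 (diff R x) xs" "D4 x xs = H3 x xs + H4 (diff R x) xs"
    if "x \<in> carrier R" for x xs
    using that by (auto simp: He LL_def)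
  show ?thesis
    by (rule that[of H1 H2 H3 H4]) (use Hc Ha Hs Hg Hm Hd in \<open>auto simp: tder_def algebra_simps\<close>)
qed

text \<open>
  View \<open>G\<close> as the last component of a derivation into \<open>LL\<close>. Its null-homotopy replaces \<open>G\<close> by the
  homologous \<open>H\<^sub>3\<close> and supplies the twisted map \<open>H\<^sub>2\<close> with boundary \<open>- H\<^sub>1\<close>.
\<close>

lemma stp_lift:
  assumes G: "cyc n (Suc p) G"
  shows "\<exists>b D. bdr n (Suc p) b \<and> stp n p (\<lambda>x xs. G x xs - b x xs) D"
proof -
  have G': "der n (Suc p) G" "\<And>x xs. x \<in> carrier R \<Longrightarrow> G (diff R x) xs = 0" using G by (auto simp: cyc_def)
  obtain H1 H2 H3 H4 where H: "der (n + 1) p H1" "tder n p H2 H3" "der n (Suc p) H3" "der (n - 1) (Suc p) H4"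
    "\<And>x xs. x \<in> carrier R \<Longrightarrow> 0 = H1 (diff R x) xs"
    "\<And>x xs. x \<in> carrier R \<Longrightarrow> 0 = H1 x xs + H2 (diff R x) xs"
    "\<And>x xs. x \<in> carrier R \<Longrightarrow> 0 = H3 (diff R x) xs"
    "\<And>x xs. x \<in> carrier R \<Longrightarrow> G x xs = H3 x xs + H4 (diff R x) xs"
    by (rule LL_null_homotopic[of n p "\<lambda>_ _. 0" "\<lambda>_ _. 0" "\<lambda>_ _. 0" G]) (use G' in auto)
  define b where "b x = H4 (diff R x)" for x
  have b: "bdr n (Suc p) b" using H(4) unfolding bdr_def b_def by blast
  have e: "G x xs - b x xs = H3 x xs" if "x \<in> carrier R" for x xs using H(8)[OF that] by (simp add: b_def)
  have "stp n p (\<lambda>x xs. G x xs - b x xs) (\<lambda>x xs. - H1 x xs)"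
    unfolding stp_def
  proof (intro conjI exI ballI allI)
    have "cyc n (Suc p) H3" using H(3,7) by (simp add: cyc_def)
    then show "cyc n (Suc p) (\<lambda>x xs. G x xs - b x xs)" by (rule cyc_cong) (rule e)
    show "cyc (n + 1) p (\<lambda>x xs. - H1 x xs)" using H(1,5) der_neg by (simp add: cyc_def)
    show "tder n p H2 (\<lambda>x xs. G x xs - b x xs)" by (rule tder_cong[OF H(2)]) (use e in auto)
    show "H2 (diff R x) xs = - H1 x xs" if "x \<in> carrier R" for x xs
      using H(6)[OF that, of xs] by (simp add: eq_neg_iff_add_eq_0 add.commute)
  qed
  then show ?thesis using b by blast
qed

text \<open>
  A primitive \<open>k\<close> of \<open>G\<close> completes \<open>D\<close>, \<open>h\<close> and \<open>G\<close> to a derivation into \<open>LL\<close>; the first component of its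
  null-homotopy is a primitive of \<open>D\<close>.
\<close>

lemma stp_bdr:
  assumes S: "stp n p G D" and G: "bdr n (Suc p) G"
  shows "bdr (n + 1) p D"
proof -
  obtain h where h: "tder n p h G" "\<forall>x\<in>carrier R. \<forall>xs. h (diff R x) xs = D x xs"
    and c: "cyc n (Suc p) G" "cyc (n + 1) p D" using S unfolding stp_def by blast
  obtain k where k: "der (n - 1) (Suc p) k" "\<forall>x\<in>carrier R. \<forall>xs. G x xs = k (diff R x) xs"
    using G unfolding bdr_def by blast
  obtain H1 H2 H3 H4 where "der (n - 1 + 1) p H1" "\<And>x xs. x \<in> carrier R \<Longrightarrow> D x xs = H1 (diff R x) xs"
  proof (rule LL_null_homotopic[of "n - 1" p D h G k])
    have e: "n - 1 + 2 = n + 1" "n - 1 + 1 = n" by simp_all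
    show "der (n - 1 + 2) p D" "tder (n - 1 + 1) p h G" "der (n - 1 + 1) (Suc p) G" "der (n - 1) (Suc p) k"
      unfolding e using h c k by (auto simp: cyc_def)
  qed (use h c k in \<open>auto simp: cyc_def\<close>)
  then show ?thesis unfolding bdr_def by auto
qed

end

section \<open>Dimension shifting\<close>

context tangent
begin

text \<open>
  A twisted cycle of nonzero degree is a boundary: evaluate it on the homotopy that makes the
  section of \<open>\<epsilon>\<close> left linear. The result is twisted again, because twisted maps are left linear on
  \<open>ker \<epsilon>\<close>.
\<close>

lemma twisted_cycle_bdr:
  assumes f: "tder m p f G" and G: "\<And>x. x \<in> carrier R \<Longrightarrow> G x \<in> Q (Suc p)"
    and fd: "\<And>x xs. x \<in> carrier R \<Longrightarrow> f (diff R x) xs = 0" and m: "m \<noteq> 0"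
  obtains f1 G1 where "tder (m - 1) p f1 G1" "der (m - 1) (Suc p) G1"
    "\<And>x xs. x \<in> carrier R \<Longrightarrow> f1 (diff R x) xs = f x xs" "\<And>x xs. x \<in> carrier R \<Longrightarrow> G1 (diff R x) xs = G x xs"
proof -
  obtain h where h: "\<And>x a. x \<in> carrier R \<Longrightarrow> h x a \<in> carrier R \<and> \<epsilon> (h x a) = 0"
    "\<And>x a b. x \<in> carrier R \<Longrightarrow> h x (a + b) = h x a \<oplus> h x b"
    "\<And>c x a. x \<in> carrier R \<Longrightarrow> h x (sA c a) = c \<odot> h x a"
    "\<And>x y a. x \<in> carrier R \<Longrightarrow> y \<in> carrier R \<Longrightarrow> h (x \<oplus> y) a = h x a \<oplus> h y a"
    "\<And>c x a. x \<in> carrier R \<Longrightarrow> h (c \<odot> x) a = c \<odot> h x a"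
    "\<And>i x a. x \<in> gr R i \<Longrightarrow> h x a \<in> gr R (i + 1)"
    "\<And>x y a. x \<in> carrier R \<Longrightarrow> y \<in> carrier R \<Longrightarrow> h (x \<otimes> y) a = h x (\<epsilon> y * a) \<oplus> tau R x \<otimes> h y a"
    "\<And>x a. x \<in> carrier R \<Longrightarrow> x \<otimes> sec a \<ominus> sec (\<epsilon> x * a) = diff R (h x a) \<oplus> h (diff R x) a"
    using linear_up_to_homotopy by blast
  note fD = tderD[OF f]
  have hc: "h x a \<in> carrier R" "\<epsilon> (h x a) = 0" if "x \<in> carrier R" for x a using h(1)[OF that] by auto
  have lin: "f (x \<otimes> k) xs = le (\<epsilon> x) (f k xs)" if "x \<in> carrier R" "k \<in> carrier R" "\<epsilon> k = 0" for x k xs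
    using that fD(5)[OF that(1,2), of xs] ra_zero2[OF fD(1)[OF that(1)]] Q_ev0[OF G[OF that(1)]] by simp
  have fs: "f (sec a) xs = 0" for a xs using fD(4)[OF sec(1)] m by simp
  have fh: "f (h (diff R x) a) xs = f (x \<otimes> sec a) xs" if "x \<in> carrier R" for x a xs
  proof -
    have "f (x \<otimes> sec a \<ominus> sec (\<epsilon> x * a)) xs = f (diff R (h x a) \<oplus> h (diff R x) a) xs"
      using h(8)[OF that] by simp
    then show ?thesis using that hc fd by (simp add: tder_minus[OF f] fD(2) fs)
  qed
  \<comment> \<open>Solves f1 d = f; the defect of f1 from being a derivation is recorded in G1.\<close>
  define f1 where "f1 x = f (h x 1)" for x
  define G1 where "G1 x ys = (case ys of [] \<Rightarrow> 0 | a # xs \<Rightarrow> f (h x a) xs - ra re (f1 x) a xs)" for x ys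
  have f1Q: "f1 x \<in> Q p" if "x \<in> carrier R" for x unfolding f1_def using fD(1) hc[OF that] by blast
  have fhm: "f (h (x \<otimes> y) a) xs = f (h x (\<epsilon> y * a)) xs + le (\<epsilon> x) (f (h y a) xs)"
    if "x \<in> carrier R" "y \<in> carrier R" for x y a xs
    using that hc by (simp add: h(7) fD(2) lin eps_tau)
  have f1: "tder (m - 1) p f1 G1"
    unfolding tder_def
  proof (intro conjI ballI allI impI)
    fix x y xs assume "x \<in> carrier R" "y \<in> carrier R"
    then show "f1 (x \<otimes> y) xs = ra re (f1 x) (\<epsilon> y) xs + le (\<epsilon> x) (f1 y xs) + G1 x (\<epsilon> y # xs)"
      using fhm[of x y 1 xs] by (simp add: f1_def G1_def)
  next
    fix i x xs assume "x \<in> gr R i" "i \<noteq> m - 1"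
    then show "f1 x xs = 0" using fD(4)[OF h(6)[of x i 1]] by (simp add: f1_def)
  qed (use f1Q hc in \<open>auto simp: f1_def h fD\<close>)
  have G1Q: "G1 x \<in> Q (Suc p)" if x: "x \<in> carrier R" for x
    unfolding Q.simps
    using Q_diff[OF fD(1)[OF hc(1)[OF x]] ra_Q[OF f1Q[OF x]]] x hc
    by (auto simp: G1_def h fD ra_add2[OF f1Q[OF x]] ra_sm2[OF f1Q[OF x]] VE.scale_right_diff_distrib)
  have f1a: "ra re (f1 (x \<oplus> y)) a xs = ra re (f1 x) a xs + ra re (f1 y) a xs"
    if "x \<in> carrier R" "y \<in> carrier R" for x y a xs
    using tderD(2)[OF f1 that] by (simp add: ra_add1[symmetric] cong: ra_cong)
  have f1s: "ra re (f1 (c \<odot> x)) a xs = smE c (ra re (f1 x) a xs)"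
    if "x \<in> carrier R" for x c a xs
    unfolding ra_sm1[symmetric] by (rule ra_cong) (use tderD(3)[OF f1 that] in simp)
  have G1: "der (m - 1) (Suc p) G1"
    unfolding tder_def
  proof (intro conjI ballI allI impI)
    fix x assume x: "x \<in> carrier R"
    show "G1 x \<in> Q (Suc p)" using G1Q[OF x] .
    show "G1 (c \<odot> x) xs = smE c (G1 x xs)" for c xs
      using x hc by (cases xs) (auto simp: G1_def h fD f1s VE.scale_right_diff_distrib)
    fix y xs assume y: "y \<in> carrier R"
    show "G1 (x \<oplus> y) xs = G1 x xs + G1 y xs"
      using x y hc by (cases xs) (auto simp: G1_def h fD f1a)
    show "G1 (x \<otimes> y) xs = ra re (G1 x) (\<epsilon> y) xs + le (\<epsilon> x) (G1 y xs) + 0"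
    proof (cases xs)
      case Nil
      then show ?thesis by (simp add: G1_def)
    next
      case (Cons a zs)
      have "f1 (x \<otimes> y) ys = f (h x (\<epsilon> y)) ys + le (\<epsilon> x) (f1 y ys)" for ys
        using fhm[OF x y, of 1 ys] by (simp add: f1_def)
      then have "ra re (f1 (x \<otimes> y)) a zs = ra re (f (h x (\<epsilon> y))) a zs + le (\<epsilon> x) (ra re (f1 y) a zs)"
        unfolding ra_le[symmetric] ra_add1[symmetric] by (rule ra_cong)
      moreover have "ra re (\<lambda>ys. G1 x (\<epsilon> y # ys)) a zs = ra re (f (h x (\<epsilon> y))) a zs - ra re (f1 x) (\<epsilon> y * a) zs"
        by (simp add: G1_def ra_diff1 ra_assoc)
      ultimately show ?thesis using Cons fhm[OF x y, of a zs] by (simp add: G1_def le_neg)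
    qed
  next
    fix i x xs assume x: "x \<in> gr R i" "i \<noteq> m - 1"
    have "f1 x = (\<lambda>_. 0)" using tderD(4)[OF f1 x] by (intro ext)
    moreover have "f (h x a) ys = 0" for a ys using fD(4)[OF h(6)[OF x(1)]] x by simp
    ultimately show "G1 x xs = 0" by (cases xs) (auto simp: G1_def)
  qed
  have f1d: "f1 (diff R x) xs = f x xs" if "x \<in> carrier R" for x xs
    using fh[OF that, of 1 xs] that by (simp add: f1_def sec(6))
  have G1d: "G1 (diff R x) xs = G x xs" if x: "x \<in> carrier R" for x xs
  proof (cases xs)
    case Nil
    then show ?thesis using Q_lin(3)[OF G[OF x]] by (simp add: G1_def)
  next
    case (Cons a zs)
    have "ra re (f1 (diff R x)) a zs = ra re (f x) a zs" by (rule ra_cong) (rule f1d[OF x])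
    then show ?thesis using Cons fh[OF x, of a zs] fD(5)[OF x sec_carrier, of a zs] by (simp add: G1_def fs sec)
  qed
  show ?thesis by (rule that[OF f1 G1 f1d G1d])
qed

text \<open>
  Untwisted cycles of positive degree are in particular twisted ones, with twist \<open>0\<close>.
\<close>

lemma stp_exists:
  assumes D: "cyc (n + 1) p D" and n: "n \<ge> 0"
  shows "\<exists>G. stp n p G D"
proof -
  have D': "der (n + 1) p D" "\<And>x xs. x \<in> carrier R \<Longrightarrow> D (diff R x) xs = 0" using D by (auto simp: cyc_def)
  obtain f1 G1 where "tder (n + 1 - 1) p f1 G1" "der (n + 1 - 1) (Suc p) G1"
    "\<And>x xs. x \<in> carrier R \<Longrightarrow> f1 (diff R x) xs = D x xs" "\<And>x xs. x \<in> carrier R \<Longrightarrow> G1 (diff R x) xs = 0"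
    by (rule twisted_cycle_bdr[OF D'(1) _ D'(2)]) (use n in auto)
  then have "stp n p G1 D" unfolding stp_def using D by (auto simp: cyc_def)
  then show ?thesis by blast
qed

text \<open>
  A degree-0 cycle \<open>y\<close> of \<open>R\<close> differs from \<open>sec (\<epsilon> y)\<close> by a boundary, so \<open>D\<close> vanishes on it and hence on the
  truncation. The homotopy \<open>h\<close> from the identity to a map into the truncation then gives \<open>D = D h d\<close>.
\<close>

lemma degree_0_cycle_bdr:
  assumes D: "cyc 0 p D" and s: "\<And>a xs. D (sec a) xs = 0"
  shows "bdr 0 p D"
proof -
  obtain g h where g: "\<And>x. x \<in> carrier R \<Longrightarrow> g x \<in> tpos" "\<And>x. x \<in> carrier R \<Longrightarrow> \<epsilon> (g x) = \<epsilon> x"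
    and h: "\<And>x. x \<in> carrier R \<Longrightarrow> h x \<in> carrier R \<and> \<epsilon> (h x) = 0"
    "\<And>x y. x \<in> carrier R \<Longrightarrow> y \<in> carrier R \<Longrightarrow> h (x \<oplus> y) = h x \<oplus> h y"
    "\<And>c x. x \<in> carrier R \<Longrightarrow> h (c \<odot> x) = c \<odot> h x"
    "\<And>i x. x \<in> gr R i \<Longrightarrow> h x \<in> gr R (i + 1) \<and> g x \<in> gr R i"
    "\<And>x y. x \<in> carrier R \<Longrightarrow> y \<in> carrier R \<Longrightarrow> h (x \<otimes> y) = h x \<otimes> y \<oplus> g (tau R x) \<otimes> h y"
    "\<And>x. x \<in> carrier R \<Longrightarrow> x \<ominus> g x = diff R (h x) \<oplus> h (diff R x)"
    using homotopy_to_truncation by blast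
  have D': "der 0 p D" and Dd: "\<And>x xs. x \<in> carrier R \<Longrightarrow> D (diff R x) xs = 0" using D by (auto simp: cyc_def)
  note T = tderD[OF D']
  have gc: "g x \<in> carrier R" if "x \<in> carrier R" for x using g(1)[OF that] tpos_sub(3) by blast
  have z0: "D y xs = 0" if y: "y \<in> gr R 0" "diff R y = \<zero>" for y xs
  proof -
    have "\<exists>u\<in>gr R (0 + 1). diff R u = y \<ominus> sec (\<epsilon> y)"
      by (rule exact) (use y in \<open>auto simp: sec eps_minus R.minus_eq' R.diff_add R.diff_smult eps_add eps_sm\<close>)
    then obtain u where u: "u \<in> gr R 1" "diff R u = y \<ominus> sec (\<epsilon> y)" by auto
    have "D (y \<ominus> sec (\<epsilon> y)) xs = 0" using Dd[of u xs] u by simp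
    then show ?thesis using y by (simp add: tder_minus[OF D'] s)
  qed
  have dc: "D y xs = D (comp R 0 y) xs" if "y \<in> carrier R" for y xs
    using that
  proof (induction y rule: R.hom_induct)
    case (hom i y)
    then show ?case using T(4)[OF hom] by (auto simp: R.comp_hom[OF hom] tder_zero[OF D'])
  qed (simp add: R.comp_add T)
  have Dg: "D (g x) xs = 0" if "x \<in> carrier R" for x xs
    using dc[OF gc[OF that]] z0[OF R.comp_ex(1)[OF gc[OF that]]] g(1)[OF that] by (simp add: tpos_def)
  have "der (-1) p (\<lambda>x. D (h x))"
    unfolding tder_def
  proof (intro conjI ballI allI impI)
    fix x y xs assume x: "x \<in> carrier R" and y: "y \<in> carrier R"
    have gt: "g (tau R x) \<in> carrier R" "\<epsilon> (g (tau R x)) = \<epsilon> x" using x g gc by (auto simp: eps_tau)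
    have hx: "h x \<in> carrier R" "\<epsilon> (h x) = 0" "h y \<in> carrier R" "\<epsilon> (h y) = 0" using h(1)[OF x] h(1)[OF y] by auto
    show "D (h (x \<otimes> y)) xs = ra re (D (h x)) (\<epsilon> y) xs + le (\<epsilon> x) (D (h y) xs) + 0"
      using x y gt hx by (simp add: h(5) T(2,5) ra_zero2[OF T(1)])
  next
    fix i x xs assume "x \<in> gr R i" "i \<noteq> - 1"
    then show "D (h x) xs = 0" using T(4)[of "h x" "i + 1"] h(4)[of x i] by simp
  qed (use h in \<open>auto simp: T\<close>)
  moreover have "D x xs = D (h (diff R x)) xs" if "x \<in> carrier R" for x xs
  proof -
    have "D (x \<ominus> g x) xs = D (diff R (h x) \<oplus> h (diff R x)) xs" using h(6)[OF that] by simp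
    then show ?thesis using that h(1) gc Dd by (simp add: tder_minus[OF D'] T(2) Dg)
  qed
  ultimately show ?thesis unfolding bdr_def by (intro exI[of _ "\<lambda>x. D (h x)"]) simp
qed

lemma bdr_sec: "bdr 0 p D \<Longrightarrow> D (sec a) xs = 0"
  unfolding bdr_def using sec(2)[of a] tder_zero by fastforce

lemma inn_cyc:
  assumes u: "u \<in> Q p"
  shows "cyc 0 p (\<lambda>x. inn u (\<epsilon> x))"
  unfolding cyc_def tder_def
proof (intro conjI ballI allI impI)
  fix x y xs assume x: "x \<in> carrier R" and y: "y \<in> carrier R"
  have "ra re (inn u (\<epsilon> x)) (\<epsilon> y) xs = le (\<epsilon> x) (ra re u (\<epsilon> y) xs) - ra re u (\<epsilon> x * \<epsilon> y) xs"
    using ra_diff1[of "\<lambda>xs. le (\<epsilon> x) (u xs)" "ra re u (\<epsilon> x)" "\<epsilon> y" xs]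
    by (simp add: ra_le ra_assoc inn_def[abs_def])
  then show "inn u (\<epsilon> (x \<otimes> y)) xs = ra re (inn u (\<epsilon> x)) (\<epsilon> y) xs + le (\<epsilon> x) (inn u (\<epsilon> y) xs) + 0"
    using x y by (simp add: inn_def eps_mult le le_neg)
next
  fix i x xs assume "x \<in> gr R i" "i \<noteq> 0"
  then show "inn u (\<epsilon> x) xs = 0" by (simp add: inn_def eps_gr ra_zero2[OF u])
qed (use u in \<open>auto simp: inn_Q inn_def eps_add eps_sm le ra_add2 ra_sm2 ra_zero2 VE.scale_right_diff_distrib\<close>)

text \<open>
  Inner derivations are invisible to the first dimension shift: the cochain itself is an untwisting.
\<close>

lemma inn_stp:
  assumes u: "u \<in> Q (Suc p)"
  shows "stp 0 p (\<lambda>x. inn u (\<epsilon> x)) (\<lambda>_ _. 0)"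
  unfolding stp_def
proof (intro conjI exI ballI allI)
  show "cyc 0 (Suc p) (\<lambda>x. inn u (\<epsilon> x))" by (rule inn_cyc[OF u])
  show "cyc (0 + 1) p (\<lambda>_ _. 0)" by simp
  show "- u (\<epsilon> (diff R x) # xs) = 0" if "x \<in> carrier R" for x xs using that Q_ev0[OF u] by simp
  show "tder 0 p (\<lambda>x xs. - u (\<epsilon> x # xs)) (\<lambda>x. inn u (\<epsilon> x))"
    unfolding tder_def
  proof (intro conjI ballI allI impI)
    fix i x xs assume "x \<in> gr R i" "i \<noteq> 0"
    then show "- u (\<epsilon> x # xs) = 0" by (simp add: eps_gr Q_ev0[OF u])
  qed (use u Q_neg[OF Q_ev[OF u]] in \<open>auto simp: eps_add eps_sm eps_mult Q_lin[OF u] inn_def le_neg ra_neg1\<close>)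
qed

text \<open>
  If \<open>D = g d\<close>, then \<open>f = h - g\<close> is a twisted cycle. For \<open>n \<noteq> 0\<close> its primitive is twisted by a primitive
  of \<open>G\<close>. For \<open>n = 0\<close> the restriction of \<open>f\<close> to the section of \<open>\<epsilon>\<close> is a cochain \<open>u\<close> with \<open>G\<close> homologous to its inner derivation.
\<close>

lemma stp_of_bdr:
  assumes S: "stp n p G D" and D: "bdr (n + 1) p D"
  shows "n \<noteq> 0 \<Longrightarrow> bdr n (Suc p) G"
    and "n = 0 \<Longrightarrow> \<exists>u\<in>Q (Suc p). bdr 0 (Suc p) (\<lambda>x xs. G x xs - inn u (\<epsilon> x) xs)"
proof -
  obtain h where h: "tder n p h G" "\<forall>x\<in>carrier R. \<forall>xs. h (diff R x) xs = D x xs"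
    and c: "cyc n (Suc p) G" "cyc (n + 1) p D" using S unfolding stp_def by blast
  obtain g where g: "der n p g" "\<forall>x\<in>carrier R. \<forall>xs. D x xs = g (diff R x) xs"
    using D unfolding bdr_def by auto
  define f where "f x xs = h x xs - g x xs" for x xs
  have f: "tder n p f G" using tder_diff[OF h(1) g(1)] by (simp add: f_def[abs_def])
  have fd: "f (diff R x) xs = 0" if "x \<in> carrier R" for x xs using that h g by (simp add: f_def)
  have GQ: "G x \<in> Q (Suc p)" if "x \<in> carrier R" for x using c(1) that tderD(1) by (auto simp: cyc_def)
  note fD = tderD[OF f]
  show "bdr n (Suc p) G" if nz: "n \<noteq> 0"
  proof -
    obtain f1 G1 where "der (n - 1) (Suc p) G1" "\<And>x xs. x \<in> carrier R \<Longrightarrow> G1 (diff R x) xs = G x xs"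
      by (rule twisted_cycle_bdr[OF f GQ fd nz]) auto
    then show ?thesis unfolding bdr_def by auto
  qed
  show "\<exists>u\<in>Q (Suc p). bdr 0 (Suc p) (\<lambda>x xs. G x xs - inn u (\<epsilon> x) xs)" if n: "n = 0"
  proof -
    \<comment> \<open>Restriction of f to the section; the sign matches the convention for inn.\<close>
    define u where "u ys = (case ys of [] \<Rightarrow> 0 | a # xs \<Rightarrow> - f (sec a) xs)" for ys
    have u: "u \<in> Q (Suc p)" unfolding Q.simps using Q_neg[OF fD(1)[OF sec_carrier]]
      by (auto simp: u_def sec fD)
    have ss: "f (sec b \<otimes> sec a) xs = f (sec (b * a)) xs" for a b xs
    proof -
      have g0: "sec b \<otimes> sec a \<in> gr R 0" using R.gr_mult[OF sec(1)[of b] sec(1)[of a]] by simp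
      have d0: "diff R (sec b \<otimes> sec a) = \<zero>" using R.leibniz[OF sec(1) sec_carrier, of b a] by (simp add: sec)
      have "\<exists>u\<in>gr R (0 + 1). diff R u = sec b \<otimes> sec a \<ominus> sec (b * a)"
        by (rule exact) (use g0 d0 in \<open>auto simp: sec eps_mult eps_add eps_sm R.minus_eq' R.diff_add R.diff_smult\<close>)
      then obtain u where u: "u \<in> gr R 1" "diff R u = sec b \<otimes> sec a \<ominus> sec (b * a)" by auto
      have "f (sec b \<otimes> sec a \<ominus> sec (b * a)) xs = 0" using fd[of u xs] u by simp
      then show ?thesis by (simp add: tder_minus[OF f])
    qed
    have Gs: "G (sec b) ys = inn u b ys" for b ys
    proof (cases ys)
      case Nil
      then show ?thesis using Q_lin(3)[OF GQ[OF sec_carrier]] Q_lin(3)[OF u] by (simp add: inn_def)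
    next
      case (Cons a xs)
      have "ra re (\<lambda>ys. u (b # ys)) a xs = - ra re (f (sec b)) a xs"
        unfolding ra_neg1[symmetric] by (rule ra_cong) (simp add: u_def)
      then show ?thesis using Cons fD(5)[OF sec_carrier sec_carrier, of b a xs]
        by (simp add: inn_def sec ss le_neg u_def algebra_simps)
    qed
    have "bdr 0 (Suc p) (\<lambda>x xs. G x xs - inn u (\<epsilon> x) xs)"
    proof (rule degree_0_cycle_bdr)
      show "cyc 0 (Suc p) (\<lambda>x xs. G x xs - inn u (\<epsilon> x) xs)"
        using cyc_add[OF c(1)[unfolded n] cyc_neg[OF inn_cyc[OF u]]] by simp
      show "G (sec a) xs - inn u (\<epsilon> (sec a)) xs = 0" for a xs by (simp add: Gs sec)
    qed
    then show ?thesis using u by blast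
  qed
qed

end

section \<open>Comparison with derivations of the algebra\<close>

context coeff
begin

definition derA :: "nat \<Rightarrow> ('a \<Rightarrow> 'a list \<Rightarrow> 'e) \<Rightarrow> bool" where
  "derA p \<theta> \<longleftrightarrow> (\<forall>a. \<theta> a \<in> Q p) \<and> (\<forall>a b xs. \<theta> (a + b) xs = \<theta> a xs + \<theta> b xs) \<and>
     (\<forall>c a xs. \<theta> (sA c a) xs = smE c (\<theta> a xs)) \<and>
     (\<forall>a b xs. \<theta> (a * b) xs = ra re (\<theta> a) b xs + le a (\<theta> b xs))"

lemma derA_0: "derA p (\<lambda>_ _. 0)"
  by (simp add: derA_def)

lemma derA_add: "derA p \<theta> \<Longrightarrow> derA p \<theta>' \<Longrightarrow> derA p (\<lambda>a xs. \<theta> a xs + \<theta>' a xs)"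
  by (auto simp: derA_def Q_add VE.scale_right_distrib ra_add1 le)

lemma derA_sm: "derA p \<theta> \<Longrightarrow> derA p (\<lambda>a xs. smE c (\<theta> a xs))"
  by (auto simp: derA_def Q_sm VE.scale_right_distrib ra_sm1 le mult.commute)

text \<open>
  Moving a factor from the right through a list: the right action on cochains is the part of the
  Hochschild coboundary without its first term.
\<close>

lemma ra_append:
  "ra re q b (ys @ xs) = (\<Sum>i<length ys. smE ((-1) ^ i) (q (contract i (b # ys) @ xs))) +
     smE ((-1) ^ length ys) (ra re (\<lambda>zs. q (butlast (b # ys) @ zs)) (last (b # ys)) xs)"
proof (induction ys arbitrary: q b)
  case (Cons y ys)
  have c0: "contract 0 (b # y # ys) = (b * y) # ys" by (simp add: contract_def)
  have cS: "contract (Suc i) (b # y # ys) = b # contract i (y # ys)" for i by (simp add: contract_def)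
  have "(\<Sum>i<length (y # ys). smE ((-1) ^ i) (q (contract i (b # y # ys) @ xs))) =
     q ((b * y) # ys @ xs) - (\<Sum>i<length ys. smE ((-1) ^ i) (q (b # contract i (y # ys) @ xs)))"
    by (simp only: length_Cons sum.lessThan_Suc_shift c0 cS) (simp add: sum_negf)
  then show ?case using Cons.IH[of "\<lambda>ys. q (b # ys)" y] by (simp add: algebra_simps)
qed simp

end

context tangent
begin

text \<open>
  Cycles of degree \<open>n\<close> with values in \<open>p\<close>-cochains correspond to derivations of \<open>A\<close> into \<open>(p+n)\<close>-cochains
  by \<open>n\<close> dimension shifts, after which \<open>D\<close> is homologous to \<open>\<theta> \<epsilon>\<close>.
\<close>

primrec rel :: "nat \<Rightarrow> nat \<Rightarrow> ('u \<Rightarrow> 'a list \<Rightarrow> 'e) \<Rightarrow> ('a \<Rightarrow> 'a list \<Rightarrow> 'e) \<Rightarrow> bool" where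
  "rel 0 p D \<theta> \<longleftrightarrow> cyc 0 p D \<and> derA p \<theta> \<and> bdr 0 p (\<lambda>x xs. D x xs - \<theta> (\<epsilon> x) xs)"
| "rel (Suc n) p D \<theta> \<longleftrightarrow> (\<exists>G. stp (int n) p G D \<and> rel n (Suc p) G \<theta>)"

lemma derA_cyc:
  assumes "derA p \<theta>"
  shows "cyc 0 p (\<lambda>x. \<theta> (\<epsilon> x))"
proof -
  have z: "\<theta> 0 xs = 0" for xs using assms VE.scale_zero_left unfolding derA_def by (metis VA.scale_zero_left)
  show ?thesis unfolding cyc_def tder_def
    using assms z by (auto simp: derA_def eps_add eps_sm eps_mult eps_gr)
qed

lemma rel_cyc: "rel n p D \<theta> \<Longrightarrow> cyc (int n) p D"
  by (cases n) (auto simp: stp_def add.commute)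

lemma rel_derA: "rel n p D \<theta> \<Longrightarrow> derA (p + n) \<theta>"
proof (induction n arbitrary: p D)
  case (Suc n)
  then obtain G where "rel n (Suc p) G \<theta>" by auto
  from Suc.IH[OF this] show ?case by simp
qed simp

lemma stp_add: "stp n p G D \<Longrightarrow> stp n p G' D' \<Longrightarrow> stp n p (\<lambda>x xs. G x xs + G' x xs) (\<lambda>x xs. D x xs + D' x xs)"
  unfolding stp_def
proof (elim conjE exE, intro conjI cyc_add; assumption?)
  fix h h' assume h: "tder n p h G" "\<forall>x\<in>carrier R. \<forall>xs. h (diff R x) xs = D x xs"
    "tder n p h' G'" "\<forall>x\<in>carrier R. \<forall>xs. h' (diff R x) xs = D' x xs"
  show "\<exists>h. tder n p h (\<lambda>x xs. G x xs + G' x xs) \<and> (\<forall>x\<in>carrier R. \<forall>xs. h (diff R x) xs = D x xs + D' x xs)"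
    using tder_add[OF h(1,3)] h(2,4) by (intro exI[of _ "\<lambda>x xs. h x xs + h' x xs"]) simp
qed

lemma stp_sm: "stp n p G D \<Longrightarrow> stp n p (\<lambda>x xs. smE c (G x xs)) (\<lambda>x xs. smE c (D x xs))"
  unfolding stp_def
proof (elim conjE exE, intro conjI cyc_sm; assumption?)
  fix h assume h: "tder n p h G" "\<forall>x\<in>carrier R. \<forall>xs. h (diff R x) xs = D x xs"
  show "\<exists>h. tder n p h (\<lambda>x xs. smE c (G x xs)) \<and> (\<forall>x\<in>carrier R. \<forall>xs. h (diff R x) xs = smE c (D x xs))"
    using tder_sm[OF h(1)] h(2) by (intro exI[of _ "\<lambda>x xs. smE c (h x xs)"]) simp
qed

lemma rel_add: "rel n p D \<theta> \<Longrightarrow> rel n p D' \<theta>' \<Longrightarrow> rel n p (\<lambda>x xs. D x xs + D' x xs) (\<lambda>a xs. \<theta> a xs + \<theta>' a xs)"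
proof (induction n arbitrary: p D D')
  case 0
  then show ?case using bdr_add[of 0 p "\<lambda>x xs. D x xs - \<theta> (\<epsilon> x) xs" "\<lambda>x xs. D' x xs - \<theta>' (\<epsilon> x) xs"]
    by (simp add: cyc_add derA_add algebra_simps)
next
  case (Suc n)
  obtain G G' where G: "stp (int n) p G D" "rel n (Suc p) G \<theta>" "stp (int n) p G' D'" "rel n (Suc p) G' \<theta>'"
    using Suc.prems by auto
  have "stp (int n) p (\<lambda>x xs. G x xs + G' x xs) (\<lambda>x xs. D x xs + D' x xs)"
    "rel n (Suc p) (\<lambda>x xs. G x xs + G' x xs) (\<lambda>a xs. \<theta> a xs + \<theta>' a xs)"
    using stp_add[OF G(1,3)] Suc.IH[OF G(2,4)] by simp_all
  then show ?case by auto
qed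

lemma rel_sm: "rel n p D \<theta> \<Longrightarrow> rel n p (\<lambda>x xs. smE c (D x xs)) (\<lambda>a xs. smE c (\<theta> a xs))"
proof (induction n arbitrary: p D)
  case 0
  then show ?case using bdr_sm[of 0 p "\<lambda>x xs. D x xs - \<theta> (\<epsilon> x) xs" c]
    by (simp add: cyc_sm derA_sm VE.scale_right_diff_distrib)
next
  case (Suc n)
  obtain G where G: "stp (int n) p G D" "rel n (Suc p) G \<theta>"
    using Suc.prems by auto
  have "stp (int n) p (\<lambda>x xs. smE c (G x xs)) (\<lambda>x xs. smE c (D x xs))"
    "rel n (Suc p) (\<lambda>x xs. smE c (G x xs)) (\<lambda>a xs. smE c (\<theta> a xs))"
    using stp_sm[OF G(1)] Suc.IH[OF G(2)] by simp_all
  then show ?case by auto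
qed

lemma rel_diff: "rel n p D \<theta> \<Longrightarrow> rel n p D' \<theta>' \<Longrightarrow> rel n p (\<lambda>x xs. D x xs - D' x xs) (\<lambda>a xs. \<theta> a xs - \<theta>' a xs)"
  using rel_add[of n p D \<theta>, OF _ rel_sm[of n p D' \<theta>' "-1"]] by simp

lemma rel_0: "rel n p (\<lambda>_ _. 0) (\<lambda>_ _. 0)"
proof (induction n arbitrary: p)
  case (Suc n)
  have "stp (int n) p (\<lambda>_ _. 0) (\<lambda>_ _. 0)"
    unfolding stp_def by (intro conjI exI[of _ "\<lambda>_ _. 0"]) auto
  then show ?case using Suc by auto
qed (simp add: derA_0)

lemma rel_of_bdr:
  assumes b: "bdr (int n) p b"
  shows "rel n p b (\<lambda>_ _. 0)"
proof (cases n)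
  case 0
  then show ?thesis using b bdr_cyc[OF b] by (simp add: derA_0)
next
  case (Suc k)
  obtain g where g: "der (int n - 1) p g" "\<forall>x\<in>carrier R. \<forall>xs. b x xs = g (diff R x) xs" using b unfolding bdr_def by blast
  have "cyc (int k + 1) p b" using bdr_cyc[OF b] Suc by (simp add: add.commute)
  then have "stp (int k) p (\<lambda>_ _. 0) b"
    unfolding stp_def using g Suc by auto
  then show ?thesis using Suc rel_0 by auto
qed

lemma rel_total_left:
  assumes "cyc (int n) p D"
  shows "\<exists>\<theta>. rel n p D \<theta>"
  using assms
proof (induction n arbitrary: p D)
  case 0
  have D: "der 0 p D" "\<And>x xs. x \<in> carrier R \<Longrightarrow> D (diff R x) xs = 0" using 0 by (auto simp: cyc_def)
  note T = tderD[OF D(1)]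
  define \<theta> where "\<theta> a = D (sec a)" for a
  have ss: "D (sec b \<otimes> sec a) xs = D (sec (b * a)) xs" for a b xs
  proof -
    have g0: "sec b \<otimes> sec a \<in> gr R 0" using R.gr_mult[OF sec(1)[of b] sec(1)[of a]] by simp
    have d0: "diff R (sec b \<otimes> sec a) = \<zero>" using R.leibniz[OF sec(1) sec_carrier, of b a] by (simp add: sec)
    have "\<exists>u\<in>gr R (0 + 1). diff R u = sec b \<otimes> sec a \<ominus> sec (b * a)"
      by (rule exact) (use g0 d0 in \<open>auto simp: sec eps_mult eps_add eps_sm R.minus_eq' R.diff_add R.diff_smult\<close>)
    then obtain u where u: "u \<in> gr R 1" "diff R u = sec b \<otimes> sec a \<ominus> sec (b * a)" by auto
    have "D (sec b \<otimes> sec a \<ominus> sec (b * a)) xs = 0" using D(2)[of u xs] u by simp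
    then show ?thesis by (simp add: tder_minus[OF D(1)])
  qed
  have th: "derA p \<theta>" unfolding derA_def \<theta>_def
    using T(5)[OF sec_carrier sec_carrier] by (simp add: T sec ss[symmetric])
  have "bdr 0 p (\<lambda>x xs. D x xs - \<theta> (\<epsilon> x) xs)"
  proof (rule degree_0_cycle_bdr)
    show "cyc 0 p (\<lambda>x xs. D x xs - \<theta> (\<epsilon> x) xs)" using cyc_add[OF _ cyc_neg[OF derA_cyc[OF th]]] 0 by fastforce
  qed (simp add: \<theta>_def sec)
  then show ?case using 0 th by auto
next
  case (Suc n)
  then have "cyc (int n + 1) p D" by (simp add: add.commute)
  then obtain G where G: "stp (int n) p G D" using stp_exists by fastforce
  then have "cyc (int n) (Suc p) G" by (simp add: stp_def)
  from Suc.IH[OF this] show ?case using G by auto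
qed

lemma rel_total_right:
  assumes "derA (p + n) \<theta>"
  shows "\<exists>D. rel n p D \<theta>"
  using assms
proof (induction n arbitrary: p)
  case 0
  then show ?case by (intro exI[of _ "\<lambda>x. \<theta> (\<epsilon> x)"]) (auto simp: derA_cyc)
next
  case (Suc n)
  have "\<exists>G. rel n (Suc p) G \<theta>" by (rule Suc.IH) (use Suc.prems in simp)
  then obtain G where G: "rel n (Suc p) G \<theta>" by blast
  obtain b D where b: "bdr (int n) (Suc p) b" "stp (int n) p (\<lambda>x xs. G x xs - b x xs) D"
    using stp_lift[OF rel_cyc[OF G]] by blast
  have "rel n (Suc p) (\<lambda>x xs. G x xs - b x xs) \<theta>" using rel_diff[OF G rel_of_bdr[OF b(1)]] by simp
  then show ?case using b(2) by auto
qed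

text \<open>
  A boundary of degree 0 vanishes on the section of \<open>\<epsilon>\<close>, where \<open>\<theta> \<epsilon>\<close> has the value \<open>\<theta>\<close>. The shift
  from degree 1 to degree 0 loses the inner derivations; all further shifts preserve and reflect
  boundaries.
\<close>

lemma rel_bdr_iff_0: "rel 0 p D \<theta> \<Longrightarrow> bdr 0 p D \<longleftrightarrow> \<theta> = (\<lambda>_ _. 0)"
proof
  assume r: "rel 0 p D \<theta>" and b: "bdr 0 p D"
  have "\<theta> a xs = 0" for a xs
    using bdr_sec[of p "\<lambda>x xs. D x xs - \<theta> (\<epsilon> x) xs" a xs] bdr_sec[OF b, of a xs] r by (simp add: sec)
  then show "\<theta> = (\<lambda>_ _. 0)" by (intro ext)
next
  assume "rel 0 p D \<theta>" "\<theta> = (\<lambda>_ _. 0)"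
  then show "bdr 0 p D" by simp
qed

lemma rel_bdr_iff_Suc: "rel (Suc n) p D \<theta> \<Longrightarrow> bdr (int (Suc n)) p D \<longleftrightarrow> (\<exists>u\<in>Q (Suc (p + n)). \<theta> = inn u)"
proof (induction n arbitrary: p D)
  case 0
  then obtain G where G: "stp 0 p G D" "cyc 0 (Suc p) G" "derA (Suc p) \<theta>" "bdr 0 (Suc p) (\<lambda>x xs. G x xs - \<theta> (\<epsilon> x) xs)" by auto
  show ?case
  proof
    assume "bdr (int (Suc 0)) p D"
    then obtain u where u: "u \<in> Q (Suc p)" "bdr 0 (Suc p) (\<lambda>x xs. G x xs - inn u (\<epsilon> x) xs)"
      using stp_of_bdr(2)[OF G(1)] by auto
    have "\<theta> a xs = inn u a xs" for a xs
      using bdr_sec[OF G(4), of a xs] bdr_sec[OF u(2), of a xs] by (simp add: sec)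
    then have "\<theta> = inn u" by (intro ext)
    then show "\<exists>u\<in>Q (Suc (p + 0)). \<theta> = inn u" using u by auto
  next
    assume "\<exists>u\<in>Q (Suc (p + 0)). \<theta> = inn u"
    then obtain u where u: "u \<in> Q (Suc p)" "\<theta> = inn u" by auto
    have "stp 0 p (\<lambda>x xs. G x xs + smE (-1) (inn u (\<epsilon> x) xs)) (\<lambda>x xs. D x xs + smE (-1) 0)"
      using stp_add[OF G(1) stp_sm[OF inn_stp[OF u(1)], of "-1"]] by simp
    then have "stp 0 p (\<lambda>x xs. G x xs - inn u (\<epsilon> x) xs) D" by simp
    from stp_bdr[OF this] G(4) u(2) show "bdr (int (Suc 0)) p D" by simp
  qed
next
  case (Suc n)
  then obtain G where G: "stp (int (Suc n)) p G D" "rel (Suc n) (Suc p) G \<theta>" by auto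
  have "bdr (int (Suc (Suc n))) p D \<longleftrightarrow> bdr (int (Suc n)) (Suc p) G"
    using stp_bdr[OF G(1)] stp_of_bdr(1)[OF G(1)] by (auto simp: add.commute add.left_commute)
  then show ?case using Suc.IH[OF G(2)] by simp
qed

text \<open>
  The sign that accumulates when \<open>stp_restrict\<close> is iterated; shift number \<open>n\<close> contributes \<open>- (-1)\<^sup>n\<close>.
\<close>

primrec csgn :: "nat \<Rightarrow> 'k" where
  "csgn 0 = 1"
| "csgn (Suc n) = - ((-1) ^ n) * csgn n"

lemma csgn_sq: "csgn n * csgn n = 1"
proof (induction n)
  case (Suc n)
  have "((-1) ^ n * (-1) ^ n :: 'k) = 1" by (simp flip: power_mult_distrib)
  then show ?case using Suc by (simp add: algebra_simps)
qed simp

lemma tder_finsum: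
  assumes h: "tder n p h G" and "finite F" "\<And>i. i \<in> F \<Longrightarrow> f i \<in> carrier R"
  shows "h (finsum R f F) xs = (\<Sum>i\<in>F. h (f i) xs)"
  using assms(2,3)
proof (induction F)
  case (insert i F)
  have "finsum R f (insert i F) = f i \<oplus> finsum R f F"
    by (rule R.M.finsum_insert) (use insert in auto)
  moreover have "finsum R f F \<in> carrier R" using insert by (intro R.M.finsum_closed) auto
  ultimately show ?case using insert tderD(2)[OF h] by simp
qed (simp add: tder_zero[OF h])

lemma Q_uncurry:
  assumes "\<And>as. length as = m \<Longrightarrow> F as \<in> Q p"
    and "\<And>as bs a b xs. length as + length bs + 1 = m \<Longrightarrow> F (as @ (a + b) # bs) xs = F (as @ a # bs) xs + F (as @ b # bs) xs"
    and "\<And>as bs a c xs. length as + length bs + 1 = m \<Longrightarrow> F (as @ sA c a # bs) xs = smE c (F (as @ a # bs) xs)"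
  shows "(\<lambda>zs. if m \<le> length zs then F (take m zs) (drop m zs) else 0) \<in> Q (m + p)"
  using assms
proof (induction m arbitrary: F)
  case 0
  then show ?case by simp
next
  case (Suc m)
  have "(\<lambda>zs. if m \<le> length zs then F (a # take m zs) (drop m zs) else 0) \<in> Q (m + p)" for a
  proof (rule Suc.IH[of "\<lambda>as. F (a # as)"])
    show "F (a # as) \<in> Q p" if "length as = m" for as using Suc.prems(1) that by simp
    show "F (a # as @ (b + b') # bs) xs = F (a # as @ b # bs) xs + F (a # as @ b' # bs) xs"
      if "length as + length bs + 1 = m" for as bs b b' xs
      using Suc.prems(2)[of "a # as" bs b b' xs] that by simp
    show "F (a # as @ sA c b # bs) xs = smE c (F (a # as @ b # bs) xs)"
      if "length as + length bs + 1 = m" for as bs b c xs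
      using Suc.prems(3)[of "a # as" bs c b xs] that by simp
  qed
  moreover have "F ((a + b) # take m ys) xs = F (a # take m ys) xs + F (b # take m ys) xs"
    "F (sA c a # take m ys) xs = smE c (F (a # take m ys) xs)" if "m \<le> length ys" for a b c ys xs
    using Suc.prems(2)[of "[]" "take m ys" a b xs] Suc.prems(3)[of "[]" "take m ys" c a xs] that by auto
  ultimately show ?case by (simp add: Q.simps(2) cong: if_cong)
qed

lemma hs_facts:
  assumes s: "homotopy_section sA R \<epsilon> s"
  shows "as \<noteq> [] \<Longrightarrow> s as \<in> gr R (int (length as) - 1)"
    "s (xs @ (a + b) # ys) = s (xs @ a # ys) \<oplus> s (xs @ b # ys)"
    "s (xs @ sA c a # ys) = c \<odot> s (xs @ a # ys)"
    "\<epsilon> (s [a]) = a"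
    "as \<noteq> [] \<Longrightarrow> diff R (s as) = finsum R (\<lambda>i. ((-1) ^ i) \<odot>
            (s (contract i as) \<ominus> s (take (Suc i) as) \<otimes> s (drop (Suc i) as))) {..<length as - 1}"
proof -
  have "multilinear sA R (length xs + length ys + 1) s"
    using s unfolding homotopy_section_def by (metis le_add2)
  then show "s (xs @ (a + b) # ys) = s (xs @ a # ys) \<oplus> s (xs @ b # ys)"
    "s (xs @ sA c a # ys) = c \<odot> s (xs @ a # ys)" unfolding multilinear_def by blast+
qed (use s in \<open>auto simp: homotopy_section_def\<close>)

text \<open>
  Apply \<open>h\<close> to the equation for \<open>d (s as)\<close>. The contracted terms assemble to the coboundary of the cochain
  \<open>\<psi> = h s\<close>. By degree reasons only the first and the last product survive: the first gives the remaining
  term of the coboundary, the last one in addition the twist \<open>G\<close>.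
\<close>

lemma stp_restrict:
  assumes S: "stp (int n) p G D" and s: "homotopy_section sA R \<epsilon> s"
  shows "\<exists>\<psi>\<in>Q (Suc n + p). \<forall>as xs. length as = Suc (Suc n) \<longrightarrow> D (s as) xs =
     - inn \<psi> (hd as) (tl as @ xs) - smE ((-1) ^ n) (G (s (butlast as)) (last as # xs))"
proof -
  obtain h where h: "tder (int n) p h G" "\<forall>x\<in>carrier R. \<forall>xs. h (diff R x) xs = D x xs"
    and c: "cyc (int n) (Suc p) G" using S unfolding stp_def by blast
  have GQ: "G x \<in> Q (Suc p)" if "x \<in> carrier R" for x using c that tderD(1) by (auto simp: cyc_def)
  note H = tderD[OF h(1)] and sf = hs_facts[OF s]
  have sg: "s as \<in> gr R (int (length as) - 1)" "s as \<in> carrier R" if "as \<noteq> []" for as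
    using sf(1)[OF that] by auto
  have es: "\<epsilon> (s as) = (if length as = 1 then hd as else 0)" if "as \<noteq> []" for as
  proof (cases "length as = 1")
    case True
    then obtain a where "as = [a]" by (metis One_nat_def length_0_conv length_Suc_conv)
    then show ?thesis using sf(4) by simp
  next
    case False
    then show ?thesis using eps_gr[OF sg(1)[OF that]] that by (cases as) auto
  qed
  have hz: "h (s as) = (\<lambda>_. 0)" if "as \<noteq> []" "length as \<noteq> Suc n" for as
    using H(4)[OF sg(1)[OF that(1)]] that by (intro ext) auto
  define F where "F as xs = h (s as) xs" for as xs
  define \<psi> where "\<psi> zs = (if Suc n \<le> length zs then F (take (Suc n) zs) (drop (Suc n) zs) else 0)" for zs
  have sc: "s (as @ a # bs) \<in> carrier R" for as a bs using sg(2) by simp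
  have "\<psi> \<in> Q (Suc n + p)" unfolding \<psi>_def
  proof (rule Q_uncurry)
    show "F as \<in> Q p" if "length as = Suc n" for as
    proof -
      have "as \<noteq> []" using that by auto
      then have "h (s as) \<in> Q p" using H(1) sg(2) by blast
      then show ?thesis by (simp add: F_def[abs_def])
    qed
  qed (simp_all add: F_def sf(2,3) H(2,3) sc)
  moreover have "D (s as) xs = - inn \<psi> (hd as) (tl as @ xs) - smE ((-1) ^ n) (G (s (butlast as)) (last as # xs))"
    if len: "length as = Suc (Suc n)" for as xs
  proof -
    have ne: "as \<noteq> []" using len by auto
    let ?t = "\<lambda>i. s (take (Suc i) as)" and ?d = "\<lambda>i. s (drop (Suc i) as)"
    have tg: "?t i \<in> carrier R" "?d i \<in> carrier R" "s (contract i as) \<in> carrier R" if "i < Suc n" for i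
      using len that ne by (auto intro!: sg(2) simp: contract_def)
    let ?X = "ra re (h (s (butlast as))) (last as) xs + G (s (butlast as)) (last as # xs)"
    let ?Y = "le (hd as) (h (s (tl as)) xs)"
    have trm: "h (?t i \<otimes> ?d i) xs = (if i = n then ?X else 0) + (if i = 0 then ?Y else 0)" if i: "i < Suc n" for i
    proof -
      have l: "length (take (Suc i) as) = Suc i" "length (drop (Suc i) as) = Suc n - i" "take (Suc i) as \<noteq> []" "drop (Suc i) as \<noteq> []"
        using i len ne by auto
      have 1: "ra re (h (?t i)) (\<epsilon> (?d i)) xs + G (?t i) (\<epsilon> (?d i) # xs) = (if i = n then ?X else 0)"
      proof (cases "i = n")
        case True
        then have "take (Suc i) as = butlast as" "drop (Suc i) as = [last as]" using len ne
          by (auto simp: butlast_conv_take) (metis append_butlast_last_id append_eq_conv_conj length_butlast diff_Suc_1)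
        then show ?thesis using True by (simp add: sf(4))
      next
        case False
        then have "\<epsilon> (?d i) = 0" using es[OF l(4)] l(2) i by auto
        then show ?thesis using False ra_zero2[OF H(1)[OF tg(1)[OF i]]] Q_ev0[OF GQ[OF tg(1)[OF i]]] by simp
      qed
      have 2: "le (\<epsilon> (?t i)) (h (?d i) xs) = (if i = 0 then ?Y else 0)"
      proof (cases "i = 0")
        case True
        have "drop (Suc 0) as = tl as" "take (Suc 0) as = [hd as]" using ne by (cases as; simp)+
        then show ?thesis using True by (simp add: sf(4))
      next
        case False
        then show ?thesis using es[OF l(3)] l(1) by simp
      qed
      show ?thesis using H(5)[OF tg(1)[OF i] tg(2)[OF i], of xs] 1 2 by (simp add: algebra_simps)
    qed
    have "D (s as) xs = h (diff R (s as)) xs" using h(2) sg(2)[OF ne] by simp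
    also have "\<dots> = (\<Sum>i<Suc n. h (((-1) ^ i) \<odot> (s (contract i as) \<ominus> ?t i \<otimes> ?d i)) xs)"
      using sf(5)[OF ne] len tg by (subst sf(5)[OF ne], subst tder_finsum[OF h(1)]) auto
    also have "\<dots> = (\<Sum>i<Suc n. smE ((-1) ^ i) (h (s (contract i as)) xs)
        - smE ((-1) ^ i) ((if i = n then ?X else 0) + (if i = 0 then ?Y else 0)))"
      by (rule sum.cong) (use tg trm in \<open>auto simp: H(3) tder_minus[OF h(1)] VE.scale_right_diff_distrib simp del: sum.lessThan_Suc\<close>)
    also have "\<dots> = (\<Sum>i<Suc n. smE ((-1) ^ i) (h (s (contract i as)) xs))
        - (\<Sum>i<Suc n. (if i = n then smE ((-1) ^ n) ?X else 0)) - (\<Sum>i<Suc n. (if i = 0 then ?Y else 0))"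
      unfolding sum_subtractf[symmetric] by (rule sum.cong) (auto simp: VE.scale_right_distrib)
    also have "\<dots> = (\<Sum>i<Suc n. smE ((-1) ^ i) (h (s (contract i as)) xs)) - smE ((-1) ^ n) ?X - ?Y"
      by (simp del: sum.lessThan_Suc add: sum.delta)
    finally have D: "D (s as) xs = (\<Sum>i<Suc n. smE ((-1) ^ i) (h (s (contract i as)) xs)) - smE ((-1) ^ n) ?X - ?Y" .
    have lt: "length (tl as) = Suc n" using len by simp
    have ht: "hd as # tl as = as" using ne by simp
    have pc: "\<psi> (contract i as @ xs) = h (s (contract i as)) xs" if "i < Suc n" for i
    proof -
      have "length (contract i as) = Suc n" using len that by (auto simp: contract_def)
      then show ?thesis by (simp add: \<psi>_def F_def)
    qed
    have pb: "\<psi> (butlast as @ zs) = h (s (butlast as)) zs" for zs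
      using len by (simp add: \<psi>_def F_def)
    have "inn \<psi> (hd as) (tl as @ xs) = ?Y - ra re \<psi> (hd as) (tl as @ xs)"
      using lt by (simp add: inn_def \<psi>_def F_def)
    also have "ra re \<psi> (hd as) (tl as @ xs) = (\<Sum>i<Suc n. smE ((-1) ^ i) (h (s (contract i as)) xs))
        + smE ((-1) ^ Suc n) (ra re (h (s (butlast as))) (last as) xs)"
      unfolding ra_append[of \<psi> "hd as" "tl as" xs] lt ht pb using pc by (auto intro!: arg_cong2[where f = "(+)"] sum.cong)
    finally show ?thesis unfolding D by (simp add: VE.scale_right_distrib algebra_simps)
  qed
  ultimately show ?thesis by blast
qed

lemma rel_restrict_0:
  assumes "rel 0 p D \<theta>" and s: "homotopy_section sA R \<epsilon> s"
  shows "D (s [a]) xs = \<theta> a xs"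
proof -
  note sf = hs_facts[OF s]
  have g: "s [a] \<in> gr R 0" using sf(1)[of "[a]"] by simp
  have "bdr 0 p (\<lambda>x xs. D x xs - \<theta> (\<epsilon> x) xs)" using assms by simp
  then obtain g where g': "der (0 - 1) p g" "\<forall>x\<in>carrier R. \<forall>xs. D x xs - \<theta> (\<epsilon> x) xs = g (diff R x) xs" unfolding bdr_def by blast
  have "diff R (s [a]) = \<zero>" using sf(5)[of "[a]"] by simp
  then show ?thesis using g'(2)[rule_format, OF R.gr_carrier[OF g], of xs] tder_zero[OF g'(1)] by (simp add: sf(4))
qed

lemma rel_restrict_Suc:
  assumes "rel (Suc n) p D \<theta>" and s: "homotopy_section sA R \<epsilon> s"
  shows "\<exists>\<psi>\<in>Q (Suc n + p). \<forall>as xs. length as = Suc (Suc n) \<longrightarrow>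
     D (s as) xs = smE (csgn (Suc n)) (\<theta> (hd as) (tl as @ xs)) + inn \<psi> (hd as) (tl as @ xs)"
  using assms(1)
proof (induction n arbitrary: p D)
  case 0
  then obtain G where G: "stp (int 0) p G D" "rel 0 (Suc p) G \<theta>" by auto
  obtain \<psi> where \<psi>: "\<psi> \<in> Q (Suc 0 + p)" "\<forall>as xs. length as = Suc (Suc 0) \<longrightarrow> D (s as) xs =
     - inn \<psi> (hd as) (tl as @ xs) - smE ((-1) ^ 0) (G (s (butlast as)) (last as # xs))"
    using stp_restrict[OF G(1) s] by blast
  have "D (s as) xs = smE (csgn (Suc 0)) (\<theta> (hd as) (tl as @ xs)) + inn (\<lambda>xs. - \<psi> xs) (hd as) (tl as @ xs)"
    if len: "length as = Suc (Suc 0)" for as xs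
  proof -
    obtain a b where as: "as = [a, b]" using len by (metis length_0_conv length_Suc_conv)
    show ?thesis using \<psi>(2)[rule_format, OF len, of xs] rel_restrict_0[OF G(2) s]
      by (simp add: as inn_def le_neg ra_neg1)
  qed
  then show ?case using Q_neg[OF \<psi>(1)] by blast
next
  case (Suc n)
  then obtain G where G: "stp (int (Suc n)) p G D" "rel (Suc n) (Suc p) G \<theta>" by auto
  obtain \<psi> where \<psi>: "\<psi> \<in> Q (Suc (Suc n) + p)" "\<forall>as xs. length as = Suc (Suc (Suc n)) \<longrightarrow> D (s as) xs =
     - inn \<psi> (hd as) (tl as @ xs) - smE ((-1) ^ Suc n) (G (s (butlast as)) (last as # xs))"
    using stp_restrict[OF G(1) s] by blast
  obtain \<chi> where \<chi>: "\<chi> \<in> Q (Suc n + Suc p)" "\<forall>as xs. length as = Suc (Suc n) \<longrightarrow>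
     G (s as) xs = smE (csgn (Suc n)) (\<theta> (hd as) (tl as @ xs)) + inn \<chi> (hd as) (tl as @ xs)"
    using Suc.IH[OF G(2)] by blast
  define \<omega> where "\<omega> xs = - \<psi> xs + smE (- ((-1) ^ Suc n)) (\<chi> xs)" for xs
  have "\<omega> \<in> Q (Suc (Suc n) + p)"
    unfolding \<omega>_def using Q_add[OF Q_neg[OF \<psi>(1)] Q_sm[of \<chi>, of "Suc (Suc n) + p"]] \<chi>(1) by simp
  moreover have "D (s as) xs = smE (csgn (Suc (Suc n))) (\<theta> (hd as) (tl as @ xs)) + inn \<omega> (hd as) (tl as @ xs)"
    if len: "length as = Suc (Suc (Suc n))" for as xs
  proof -
    have b: "length (butlast as) = Suc (Suc n)" "hd (butlast as) = hd as" "tl (butlast as) @ last as # xs = tl as @ xs"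
    proof -
      obtain a zs where as: "as = a # zs" "length zs = Suc (Suc n)" using len by (cases as) auto
      then have ne: "zs \<noteq> []" by auto
      then have "(butlast zs @ [last zs]) @ xs = zs @ xs" by simp
      with as ne show "hd (butlast as) = hd as" "tl (butlast as) @ last as # xs = tl as @ xs"
        by simp_all
    qed (use len in simp)
    have innc: "inn (\<lambda>xs. - \<psi> xs + smE c (\<chi> xs)) a ys = - inn \<psi> a ys + smE c (inn \<chi> a ys)" for c a ys
      by (simp add: inn_def ra_diff1 ra_neg1 ra_sm1 le le_neg VE.scale_right_diff_distrib)
    have "inn \<omega> (hd as) (tl as @ xs) = - inn \<psi> (hd as) (tl as @ xs) + smE (- ((-1) ^ Suc n)) (inn \<chi> (hd as) (tl as @ xs))"
      unfolding \<omega>_def[abs_def] by (rule innc)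
    moreover have "G (s (butlast as)) (last as # xs) = smE (csgn (Suc n)) (\<theta> (hd as) (tl as @ xs)) + inn \<chi> (hd as) (tl as @ xs)"
      using \<chi>(2)[rule_format, OF b(1), of "last as # xs"] b by simp
    moreover have "- P - smE c (smE k T + X) = smE (- c * k) T + (- P + smE (- c) X)" for c k P T X
      by (simp add: VE.scale_right_distrib)
    ultimately show ?thesis using \<psi>(2)[rule_format, OF len, of xs] unfolding csgn.simps(2)[of "Suc n"] by metis
  qed
  ultimately show ?case by blast
qed

end

section \<open>Tensor products\<close>

definition lin :: "('k::field \<Rightarrow> 'e \<Rightarrow> 'e::ab_group_add) \<Rightarrow> ('p \<Rightarrow> 'e) \<Rightarrow> ('p \<Rightarrow> 'k) \<Rightarrow> 'e" where
  "lin sm \<phi> f = (\<Sum>p\<in>supp f. sm (f p) (\<phi> p))"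

lemma supp_single [simp]: "supp (single p :: 'p \<Rightarrow> 'k::field) = {p}"
  by (auto simp: supp_def single_def)

lemma finite_supp [simp]:
  "finite (supp f) \<Longrightarrow> finite (supp g) \<Longrightarrow> finite (supp (\<lambda>p. f p + g p :: 'k::field))"
  "finite (supp f) \<Longrightarrow> finite (supp (\<lambda>p. c * f p :: 'k::field))"
  "finite (supp f) \<Longrightarrow> finite (supp g) \<Longrightarrow> finite (supp (\<lambda>p. f p - g p :: 'k::field))"
  "finite (supp (\<lambda>p. 0 :: 'k::field))" "finite (supp f) \<Longrightarrow> finite (supp (\<lambda>p. - f p :: 'k::field))"
  by (auto simp: supp_def intro: finite_subset[of _ "{p. f p \<noteq> 0} \<union> {p. g p \<noteq> 0}"] finite_subset[of _ "{p. f p \<noteq> 0}"])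

lemma supp_push: "supp (push h f) \<subseteq> h ` supp (f :: 'p \<Rightarrow> 'k::field)"
proof
  fix x assume "x \<in> supp (push h f)"
  then have "(\<Sum>p\<in>{p \<in> supp f. h p = x}. f p) \<noteq> 0" by (simp add: supp_def push_def)
  then have "{p \<in> supp f. h p = x} \<noteq> {}" by (metis sum.empty)
  then show "x \<in> h ` supp f" by blast
qed

context vector_space
begin

lemma lin_sup: "finite S \<Longrightarrow> supp f \<subseteq> S \<Longrightarrow> lin scale \<phi> f = (\<Sum>p\<in>S. scale (f p) (\<phi> p))"
  unfolding lin_def by (rule sum.mono_neutral_left) (auto simp: supp_def)

lemma lin_add:
  assumes "finite (supp f)" "finite (supp g)"
  shows "lin scale \<phi> (\<lambda>p. f p + g p) = lin scale \<phi> f + lin scale \<phi> g"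
proof -
  let ?S = "supp f \<union> supp g"
  have "finite ?S" "supp (\<lambda>p. f p + g p) \<subseteq> ?S" using assms by (auto simp: supp_def)
  then show ?thesis
    using lin_sup[of ?S f \<phi>] lin_sup[of ?S g \<phi>] lin_sup[of ?S "\<lambda>p. f p + g p" \<phi>]
    by (simp add: scale_left_distrib sum.distrib)
qed

lemma lin_cmul: "lin scale \<phi> (\<lambda>p. c * f p) = scale c (lin scale \<phi> f)"
proof (cases "c = 0")
  case True
  then show ?thesis by (simp add: lin_def supp_def)
next
  case False
  then have "supp (\<lambda>p. c * f p) = supp f" by (auto simp: supp_def)
  then show ?thesis by (simp add: lin_def scale_sum_right)
qed

lemma lin_single [simp]: "lin scale \<phi> (single p) = \<phi> p"
  unfolding lin_def supp_single by (simp add: single_def)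

lemma lin_zero [simp]: "lin scale \<phi> (\<lambda>_. 0) = 0"
  by (simp add: lin_def supp_def)

lemma lin_push:
  assumes "finite (supp f)"
  shows "lin scale \<phi> (push h f) = lin scale (\<phi> \<circ> h) f"
proof -
  have "lin scale \<phi> (push h f) = (\<Sum>r\<in>h ` supp f. scale (push h f r) (\<phi> r))"
    by (rule lin_sup) (use assms in \<open>simp_all add: supp_push\<close>)
  also have "\<dots> = (\<Sum>r\<in>h ` supp f. \<Sum>p\<in>{p \<in> supp f. h p = r}. scale (f p) (\<phi> (h p)))"
    by (simp add: push_def scale_sum_left)
  also have "\<dots> = (\<Sum>p\<in>supp f. scale (f p) (\<phi> (h p)))"
    by (rule sum.group) (use assms in auto)
  finally show ?thesis by (simp add: lin_def)
qed

end

lemma vector_space_mult: "vector_space ((*) :: 'k::field \<Rightarrow> 'k \<Rightarrow> 'k)"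
  by unfold_locales (auto simp: algebra_simps)

lemma push_lin: "finite (supp f) \<Longrightarrow> push h f r = lin (*) (\<lambda>p. single (h p) r) f"
  unfolding push_def lin_def single_def by (simp add: sum.inter_filter) (rule sum.cong; simp add: eq_commute)

lemma finite_supp_push [simp]: "finite (supp f) \<Longrightarrow> finite (supp (push h f))"
  by (rule finite_subset[OF supp_push finite_imageI])

lemma push_add: "finite (supp f) \<Longrightarrow> finite (supp g) \<Longrightarrow> push h (\<lambda>p. f p + g p) = (\<lambda>r. push h f r + push h g r)"
  by (intro ext) (simp add: push_lin vector_space.lin_add[OF vector_space_mult])

lemma push_cmul: "push h (\<lambda>p. c * f p) = (\<lambda>r. c * push h f r)"
proof (cases "c = 0")
  case False
  then have "supp (\<lambda>p. c * f p) = supp f" by (auto simp: supp_def)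
  then show ?thesis by (simp add: push_def sum_distrib_left)
qed (simp add: push_def supp_def)

lemma push_single: "push h (single p) = single (h p)"
  by (intro ext) (simp add: push_lin vector_space.lin_single[OF vector_space_mult])

lemma push_zero: "push h (\<lambda>_. 0) = (\<lambda>_. 0)"
  by (simp add: push_def supp_def)

definition tens :: "('p \<Rightarrow> 'k::field) \<Rightarrow> ('q \<Rightarrow> 'k) \<Rightarrow> 'p \<times> 'q \<Rightarrow> 'k" where
  "tens f g = (\<lambda>(p, q). f p * g q)"

lemma supp_tens: "supp (tens f g) = supp f \<times> supp g"
  by (auto simp: supp_def tens_def)

lemma push2_push: "push2 h f g = push (\<lambda>(p, q). h p q) (tens f g)"
  unfolding push2_def push_def supp_tens
  by (intro ext sum.cong) (auto simp: tens_def)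

lemma finite_supp_push2 [simp]: "finite (supp f) \<Longrightarrow> finite (supp g) \<Longrightarrow> finite (supp (push2 h f g))"
  by (simp add: push2_push supp_tens)

lemma push2_linear:
  assumes "finite (supp f)" "finite (supp f')" "finite (supp g)" "finite (supp g')"
  shows "push2 h (\<lambda>p. f p + f' p) g = (\<lambda>r. push2 h f g r + push2 h f' g r)"
    "push2 h f (\<lambda>p. g p + g' p) = (\<lambda>r. push2 h f g r + push2 h f g' r)"
    "push2 h (\<lambda>p. c * f p) g = (\<lambda>r. c * push2 h f g r)"
    "push2 h f (\<lambda>p. c * g p) = (\<lambda>r. c * push2 h f g r)"
proof -
  have t: "tens (\<lambda>p. f p + f' p) g = (\<lambda>p. tens f g p + tens f' g p)" "tens f (\<lambda>p. g p + g' p) = (\<lambda>p. tens f g p + tens f g' p)"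
    "tens (\<lambda>p. c * f p) g = (\<lambda>p. c * tens f g p)" "tens f (\<lambda>p. c * g p) = (\<lambda>p. c * tens f g p)"
    unfolding tens_def by (intro ext; simp add: case_prod_unfold algebra_simps)+
  have fin: "finite (supp (tens f g))" "finite (supp (tens f' g))" "finite (supp (tens f g'))"
    unfolding supp_tens using assms by blast+
  show "push2 h (\<lambda>p. f p + f' p) g = (\<lambda>r. push2 h f g r + push2 h f' g r)"
    unfolding push2_push t by (rule push_add) (rule fin)+
  show "push2 h f (\<lambda>p. g p + g' p) = (\<lambda>r. push2 h f g r + push2 h f g' r)"
    unfolding push2_push t by (rule push_add) (rule fin)+
  show "push2 h (\<lambda>p. c * f p) g = (\<lambda>r. c * push2 h f g r)"
    "push2 h f (\<lambda>p. c * g p) = (\<lambda>r. c * push2 h f g r)"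
    unfolding push2_push t by (rule push_cmul)+
qed

lemma tens_single: "tens (single p) (single q) = single (p, q)"
  by (auto simp: tens_def single_def)

lemma push2_single: "push2 h (single p) (single q) = single (h p q)"
  by (simp add: push2_push tens_single push_single)

lemma push2_zero: "push2 h (\<lambda>_. 0) g = (\<lambda>_. 0)" "push2 h f (\<lambda>_. 0) = (\<lambda>_. 0)"
  by (simp_all add: push2_push tens_def push_zero case_prod_unfold)

lemma finite_supp_induct [consumes 2, case_names zero add]:
  fixes f :: "'p \<Rightarrow> 'k::field"
  assumes "finite (supp f)" "supp f \<subseteq> A" and "P (\<lambda>_. 0)"
    and "\<And>f p c. finite (supp f) \<Longrightarrow> supp f \<subseteq> A \<Longrightarrow> p \<in> A \<Longrightarrow> P f \<Longrightarrow> P (\<lambda>q. f q + c * single p q)"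
  shows "P f"
proof -
  have "P f" if "finite S" "supp f \<subseteq> S" "S \<subseteq> A" for S f
    using that
  proof (induction S arbitrary: f)
    case empty
    then have "f = (\<lambda>_. 0)" by (auto simp: supp_def)
    then show ?case using assms(3) by simp
  next
    case (insert p S)
    define g where "g = (\<lambda>q. if q = p then 0 else f q)"
    have g: "supp g \<subseteq> S" using insert.prems by (auto simp: g_def supp_def)
    then have "P g" using insert by auto
    moreover have "f = (\<lambda>q. g q + f p * single p q)" by (auto simp: g_def single_def)
    ultimately show ?case using assms(4)[of g p "f p"] g insert.prems finite_subset[OF g insert.hyps(1)] by auto
  qed
  then show ?thesis using assms(1,2) by blast
qed

locale coeff_alg = VE: vector_space smE
  for smE :: "'k::field \<Rightarrow> 'e \<Rightarrow> 'e::ab_group_add" +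
  fixes E :: "('k, 'e) module"
  assumes E_ops: "x \<oplus>\<^bsub>E\<^esub> y = x + y" "\<zero>\<^bsub>E\<^esub> = 0" "smult E = smE"
    and E_cl: "0 \<in> carrier E" "x \<in> carrier E \<Longrightarrow> y \<in> carrier E \<Longrightarrow> x + y \<in> carrier E" "x \<in> carrier E \<Longrightarrow> smE c x \<in> carrier E"
      "x \<in> carrier E \<Longrightarrow> y \<in> carrier E \<Longrightarrow> x \<otimes>\<^bsub>E\<^esub> y \<in> carrier E" "\<one>\<^bsub>E\<^esub> \<in> carrier E"
    and E_mult: "x \<in> carrier E \<Longrightarrow> y \<in> carrier E \<Longrightarrow> z \<in> carrier E \<Longrightarrow> (x + y) \<otimes>\<^bsub>E\<^esub> z = x \<otimes>\<^bsub>E\<^esub> z + y \<otimes>\<^bsub>E\<^esub> z"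
      "x \<in> carrier E \<Longrightarrow> y \<in> carrier E \<Longrightarrow> z \<in> carrier E \<Longrightarrow> z \<otimes>\<^bsub>E\<^esub> (x + y) = z \<otimes>\<^bsub>E\<^esub> x + z \<otimes>\<^bsub>E\<^esub> y"
      "x \<in> carrier E \<Longrightarrow> y \<in> carrier E \<Longrightarrow> (smE c x) \<otimes>\<^bsub>E\<^esub> y = smE c (x \<otimes>\<^bsub>E\<^esub> y)"
      "x \<in> carrier E \<Longrightarrow> y \<in> carrier E \<Longrightarrow> x \<otimes>\<^bsub>E\<^esub> (smE c y) = smE c (x \<otimes>\<^bsub>E\<^esub> y)"

definition linf :: "('k::field, 'c) dga \<Rightarrow> ('c \<Rightarrow> 'k) \<Rightarrow> bool" where
  "linf C l \<longleftrightarrow> (\<forall>x\<in>carrier C. \<forall>y\<in>carrier C. l (x \<oplus>\<^bsub>C\<^esub> y) = l x + l y) \<and> (\<forall>c. \<forall>x\<in>carrier C. l (c \<odot>\<^bsub>C\<^esub> x) = c * l x)"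

locale tensor = coeff_alg smE E + C: dga C
  for smE :: "'k::field \<Rightarrow> 'e \<Rightarrow> 'e::ab_group_add" and E :: "('k, 'e) module" and C :: "('k, 'c) dga"
begin

abbreviation "FM \<equiv> (free_space (carrier E \<times> carrier C) :: ('k, 'e \<times> 'c \<Rightarrow> 'k) module)"
abbreviation "rel \<equiv> tensor_rel E C"
abbreviation "cls \<equiv> tensor_class E C"
abbreviation "TC \<equiv> tensor_dga E C"

lemma FM_simps: "f \<in> carrier FM \<longleftrightarrow> finite (supp f) \<and> supp f \<subseteq> carrier E \<times> carrier C"
  "f \<oplus>\<^bsub>FM\<^esub> g = (\<lambda>q. f q + g q)" "c \<odot>\<^bsub>FM\<^esub> f = (\<lambda>q. c * f q)" "\<zero>\<^bsub>FM\<^esub> = (\<lambda>_. 0)"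
  by (simp_all add: free_space_def fun_module_def)

lemma FM_cl: "(\<lambda>_. 0) \<in> carrier FM" "f \<in> carrier FM \<Longrightarrow> g \<in> carrier FM \<Longrightarrow> (\<lambda>q. f q + g q) \<in> carrier FM"
  "f \<in> carrier FM \<Longrightarrow> (\<lambda>q. c * f q) \<in> carrier FM" "f \<in> carrier FM \<Longrightarrow> g \<in> carrier FM \<Longrightarrow> (\<lambda>q. f q - g q) \<in> carrier FM"
  "e \<in> carrier E \<Longrightarrow> y \<in> carrier C \<Longrightarrow> single (e, y) \<in> carrier FM"
proof -
  show "(\<lambda>q. f q + g q) \<in> carrier FM" "(\<lambda>q. f q - g q) \<in> carrier FM" if "f \<in> carrier FM" "g \<in> carrier FM" for f g
  proof -
    have "supp (\<lambda>q. f q + g q) \<subseteq> supp f \<union> supp g" "supp (\<lambda>q. f q - g q) \<subseteq> supp f \<union> supp g" by (auto simp: supp_def)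
    then show "(\<lambda>q. f q + g q) \<in> carrier FM" "(\<lambda>q. f q - g q) \<in> carrier FM" using that unfolding FM_simps(1) by auto
  qed
  show "(\<lambda>q. c * f q) \<in> carrier FM" if "f \<in> carrier FM" for f c
  proof -
    have "supp (\<lambda>q. c * f q) \<subseteq> supp f" by (auto simp: supp_def)
    then show ?thesis using that unfolding FM_simps(1) by auto
  qed
qed (auto simp: FM_simps(1) supp_def[of "\<lambda>_. 0"])

lemma FM_module: "module ground FM"
  by (rule module_groundI) (use FM_cl in \<open>auto simp: FM_simps(2-4) algebra_simps\<close>)

sublocale FM: module ground FM
  by (rule FM_module)

lemma FM_minus: "f \<in> carrier FM \<Longrightarrow> g \<in> carrier FM \<Longrightarrow> f \<ominus>\<^bsub>FM\<^esub> g = (\<lambda>q. f q - g q)"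
proof -
  assume f: "f \<in> carrier FM" "g \<in> carrier FM"
  have "\<ominus>\<^bsub>FM\<^esub> g = (\<lambda>q. - 1 * g q)"
    by (rule FM.M.minus_equality) (use f FM_cl(3)[of g "-1"] in \<open>auto simp: FM_simps(2-4)\<close>)
  then show ?thesis by (simp add: a_minus_def FM_simps(2))
qed

lemma gens_sub: "bilinear_gens E C \<subseteq> carrier FM"
  unfolding bilinear_gens_def by (auto intro!: FM_cl simp: E_ops E_cl)

lemma rel_sub: "submodule rel ground FM"
proof (rule submodule_groundI[OF FM_module])
  have top: "submodule (carrier FM) ground FM" by (rule FM.carrier_is_submodule)
  show "rel \<subseteq> carrier FM" unfolding tensor_rel_def using top gens_sub by blast
  show "\<zero>\<^bsub>FM\<^esub> \<in> rel" unfolding tensor_rel_def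
    using submodule.axioms(1) subgroup.one_closed by fastforce
  show "x \<oplus>\<^bsub>FM\<^esub> y \<in> rel" if "x \<in> rel" "y \<in> rel" for x y
    using that FM.submoduleE(5) unfolding tensor_rel_def by blast
  show "c \<odot>\<^bsub>FM\<^esub> x \<in> rel" if "x \<in> rel" for c x
    using that FM.submoduleE(4)[of _ c x] unfolding tensor_rel_def by auto
qed

lemma rel_cl: "(\<lambda>_. 0) \<in> rel" "f \<in> rel \<Longrightarrow> g \<in> rel \<Longrightarrow> (\<lambda>q. f q + g q) \<in> rel" "f \<in> rel \<Longrightarrow> (\<lambda>q. c * f q) \<in> rel"
  "f \<in> rel \<Longrightarrow> g \<in> rel \<Longrightarrow> (\<lambda>q. f q - g q) \<in> rel" "f \<in> rel \<Longrightarrow> f \<in> carrier FM"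
proof -
  show z: "(\<lambda>_. 0) \<in> rel" using rel_sub submodule.axioms(1) subgroup.one_closed FM_simps(4) by fastforce
  show a: "(\<lambda>q. f q + g q) \<in> rel" if "f \<in> rel" "g \<in> rel" for f g
    using FM.submoduleE(5)[OF rel_sub that] by (simp add: FM_simps)
  show s: "(\<lambda>q. c * f q) \<in> rel" if "f \<in> rel" for c f
    using FM.submoduleE(4)[OF rel_sub _ that, of c] by (simp add: FM_simps)
  show "(\<lambda>q. f q - g q) \<in> rel" if "f \<in> rel" "g \<in> rel" for f g
    using a[OF that(1) s[OF that(2), of "-1"]] by simp
  show "f \<in> carrier FM" if "f \<in> rel" using FM.submoduleE(1)[OF rel_sub] that by blast
qed

lemma rel_gens:
  "e \<in> carrier E \<Longrightarrow> e' \<in> carrier E \<Longrightarrow> y \<in> carrier C \<Longrightarrow>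
    (\<lambda>q. single (e + e', y) q - single (e, y) q - single (e', y) q) \<in> rel"
  "e \<in> carrier E \<Longrightarrow> y \<in> carrier C \<Longrightarrow> y' \<in> carrier C \<Longrightarrow>
    (\<lambda>q. single (e, y \<oplus>\<^bsub>C\<^esub> y') q - single (e, y) q - single (e, y') q) \<in> rel"
  "e \<in> carrier E \<Longrightarrow> y \<in> carrier C \<Longrightarrow> (\<lambda>q. single (smE t e, y) q - t * single (e, y) q) \<in> rel"
  "e \<in> carrier E \<Longrightarrow> y \<in> carrier C \<Longrightarrow> (\<lambda>q. single (e, t \<odot>\<^bsub>C\<^esub> y) q - t * single (e, y) q) \<in> rel"
proof -
  have sub: "bilinear_gens E C \<subseteq> rel" unfolding tensor_rel_def by blast
  show "(\<lambda>q. single (e + e', y) q - single (e, y) q - single (e', y) q) \<in> rel"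
    if "e \<in> carrier E" "e' \<in> carrier E" "y \<in> carrier C"
    by (rule subsetD[OF sub], unfold bilinear_gens_def E_ops, rule UnI1, rule UnI1, rule UnI1)
      (rule CollectI, rule exI[of _ e], rule exI[of _ e'], rule exI[of _ y], simp add: that)
  show "(\<lambda>q. single (e, y \<oplus>\<^bsub>C\<^esub> y') q - single (e, y) q - single (e, y') q) \<in> rel"
    if "e \<in> carrier E" "y \<in> carrier C" "y' \<in> carrier C"
    by (rule subsetD[OF sub], unfold bilinear_gens_def E_ops, rule UnI1, rule UnI1, rule UnI2)
      (rule CollectI, rule exI[of _ e], rule exI[of _ y], rule exI[of _ y'], simp add: that)
  show "(\<lambda>q. single (smE t e, y) q - t * single (e, y) q) \<in> rel" if "e \<in> carrier E" "y \<in> carrier C"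
    by (rule subsetD[OF sub], unfold bilinear_gens_def E_ops, rule UnI1, rule UnI2)
      (rule CollectI, rule exI[of _ t], rule exI[of _ e], rule exI[of _ y], simp add: that)
  show "(\<lambda>q. single (e, t \<odot>\<^bsub>C\<^esub> y) q - t * single (e, y) q) \<in> rel" if "e \<in> carrier E" "y \<in> carrier C"
    by (rule subsetD[OF sub], unfold bilinear_gens_def E_ops, rule UnI2)
      (rule CollectI, rule exI[of _ t], rule exI[of _ e], rule exI[of _ y], simp add: that)
qed

lemma rel_induct [consumes 1, case_names e_add c_add e_smult c_smult zero add smult]:
  assumes "f \<in> rel"
    and g1: "\<And>e e' y. e \<in> carrier E \<Longrightarrow> e' \<in> carrier E \<Longrightarrow> y \<in> carrier C \<Longrightarrow>
      P (\<lambda>q. single (e + e', y) q - single (e, y) q - single (e', y) q)"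
    and g2: "\<And>e y y'. e \<in> carrier E \<Longrightarrow> y \<in> carrier C \<Longrightarrow> y' \<in> carrier C \<Longrightarrow>
      P (\<lambda>q. single (e, y \<oplus>\<^bsub>C\<^esub> y') q - single (e, y) q - single (e, y') q)"
    and g3: "\<And>t e y. e \<in> carrier E \<Longrightarrow> y \<in> carrier C \<Longrightarrow> P (\<lambda>q. single (smE t e, y) q - t * single (e, y) q)"
    and g4: "\<And>t e y. e \<in> carrier E \<Longrightarrow> y \<in> carrier C \<Longrightarrow> P (\<lambda>q. single (e, t \<odot>\<^bsub>C\<^esub> y) q - t * single (e, y) q)"
    and z: "P (\<lambda>_. 0)" and a: "\<And>f g. f \<in> carrier FM \<Longrightarrow> g \<in> carrier FM \<Longrightarrow> P f \<Longrightarrow> P g \<Longrightarrow> P (\<lambda>q. f q + g q)"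
    and s: "\<And>c f. f \<in> carrier FM \<Longrightarrow> P f \<Longrightarrow> P (\<lambda>q. c * f q)"
  shows "P f"
proof -
  let ?H = "{f \<in> carrier FM. P f}"
  have "submodule ?H ground FM"
    by (rule submodule_groundI[OF FM_module]) (use FM_cl z a s in \<open>auto simp: FM_simps(2-4)\<close>)
  moreover have "bilinear_gens E C \<subseteq> ?H"
  proof
    fix u assume u: "u \<in> bilinear_gens E C"
    then have "P u" unfolding bilinear_gens_def E_ops
      by (elim UnE CollectE exE conjE) (simp_all add: g1 g2 g3 g4)
    then show "u \<in> ?H" using u gens_sub by blast
  qed
  ultimately show ?thesis using assms(1) unfolding tensor_rel_def by blast
qed

lemma cls_eq: "f \<in> carrier FM \<Longrightarrow> g \<in> carrier FM \<Longrightarrow> cls f = cls g \<longleftrightarrow> (\<lambda>q. f q - g q) \<in> rel"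
  unfolding tensor_class_def using coset_eq_iff[OF FM_module rel_sub, of f g] by (simp add: FM_minus)

lemma cls_mem: "g \<in> cls f \<longleftrightarrow> (\<exists>h\<in>rel. g = (\<lambda>q. h q + f q))"
  by (auto simp: tensor_class_def a_r_coset_def' FM_simps)

lemma cls_self: "f \<in> cls f"
  unfolding cls_mem using rel_cl(1) by (intro bexI[of _ "\<lambda>_. 0"]) auto

lemma cls_memD: "g \<in> cls f \<Longrightarrow> f \<in> carrier FM \<Longrightarrow> g \<in> carrier FM \<and> (\<lambda>q. g q - f q) \<in> rel"
  unfolding cls_mem using rel_cl(5) FM_cl(2) by auto

lemma TC_carrier: "carrier TC = cls ` carrier FM"
  by (auto simp: tensor_dga_def module.defs quot_module_def A_RCOSETS_def' tensor_class_def a_r_coset_def')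

lemma TC_gr: "gr TC i = cls ` {f. finite (supp f) \<and> supp f \<subseteq> carrier E \<times> gr C i}"
  by (simp add: tensor_dga_def module.defs free_space_def fun_module_def)

lemma TC_add:
  assumes f: "f \<in> carrier FM" and g: "g \<in> carrier FM"
  shows "cls f \<oplus>\<^bsub>TC\<^esub> cls g = cls (\<lambda>q. f q + g q)"
proof -
  have "cls f \<oplus>\<^bsub>TC\<^esub> cls g = {(\<lambda>q. a q + b q) | a b. a \<in> cls f \<and> b \<in> cls g}"
    by (auto simp: tensor_dga_def module.defs quot_module_def set_add_def' FM_simps)
  also have "\<dots> = cls (\<lambda>q. f q + g q)"
  proof (intro Set.set_eqI iffI)
    fix z assume "z \<in> {(\<lambda>q. a q + b q) | a b. a \<in> cls f \<and> b \<in> cls g}"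
    then obtain h k where "h \<in> rel" "k \<in> rel" "z = (\<lambda>q. (h q + f q) + (k q + g q))" by (auto simp: cls_mem)
    then show "z \<in> cls (\<lambda>q. f q + g q)" unfolding cls_mem
      using rel_cl(2)[of h k] by (intro bexI[of _ "\<lambda>q. h q + k q"]) (auto simp: algebra_simps)
  next
    fix z assume "z \<in> cls (\<lambda>q. f q + g q)"
    then obtain h where "h \<in> rel" "z = (\<lambda>q. h q + (f q + g q))" by (auto simp: cls_mem)
    then have "(\<lambda>q. h q + f q) \<in> cls f" "z = (\<lambda>q. (h q + f q) + g q)" by (auto simp: cls_mem algebra_simps)
    then show "z \<in> {(\<lambda>q. a q + b q) | a b. a \<in> cls f \<and> b \<in> cls g}" using cls_self[of g]
      by (intro CollectI exI[of _ "\<lambda>q. h q + f q"] exI[of _ g] conjI)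
  qed
  finally show ?thesis .
qed

lemma TC_smult:
  assumes f: "f \<in> carrier FM"
  shows "c \<odot>\<^bsub>TC\<^esub> cls f = cls (\<lambda>q. c * f q)"
proof -
  have "c \<odot>\<^bsub>TC\<^esub> cls f = rel <+>\<^bsub>FM\<^esub> ((\<odot>\<^bsub>FM\<^esub>) c ` (rel +>\<^bsub>FM\<^esub> f))"
    by (simp add: tensor_dga_def module.defs quot_module_def tensor_class_def)
  also have "(\<odot>\<^bsub>FM\<^esub>) c ` (rel +>\<^bsub>FM\<^esub> f) = {(\<lambda>q. c * b q) \<oplus>\<^bsub>FM\<^esub> (\<lambda>q. c * f q) | b. b \<in> rel}"
    by (auto simp: a_r_coset_def' FM_simps algebra_simps image_UN)
  also have "rel <+>\<^bsub>FM\<^esub> \<dots> = rel +>\<^bsub>FM\<^esub> (\<lambda>q. c * f q)"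
    by (rule set_add_coset[OF FM_module rel_sub]) (use rel_cl FM_cl(3)[OF f] in auto)
  finally show ?thesis by (simp add: tensor_class_def)
qed

definition emul :: "'e \<times> 'c \<Rightarrow> 'e \<times> 'c \<Rightarrow> 'e \<times> 'c" where
  "emul = (\<lambda>(e, c) (e', c'). (e \<otimes>\<^bsub>E\<^esub> e', c \<otimes>\<^bsub>C\<^esub> c'))"

lemma emul_mem: "p \<in> carrier E \<times> carrier C \<Longrightarrow> q \<in> carrier E \<times> carrier C \<Longrightarrow> emul p q \<in> carrier E \<times> carrier C"
  by (auto simp: emul_def E_cl)

lemma push2_FM:
  assumes "f \<in> carrier FM" "g \<in> carrier FM"
  shows "push2 emul f g \<in> carrier FM"
proof -
  have F: "finite (supp f)" "supp f \<subseteq> carrier E \<times> carrier C" "finite (supp g)" "supp g \<subseteq> carrier E \<times> carrier C"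
    using assms unfolding FM_simps(1) by blast+
  have "supp (push2 emul f g) \<subseteq> (\<lambda>(p, q). emul p q) ` (supp f \<times> supp g)"
    unfolding push2_push by (rule subset_trans[OF supp_push]) (rule eq_refl, rule arg_cong[OF supp_tens])
  moreover have "(\<lambda>(p, q). emul p q) ` (supp f \<times> supp g) \<subseteq> carrier E \<times> carrier C"
  proof
    fix r assume "r \<in> (\<lambda>(p, q). emul p q) ` (supp f \<times> supp g)"
    then obtain p q where "r = emul p q" "p \<in> supp f" "q \<in> supp g" by (elim imageE SigmaE) simp
    then show "r \<in> carrier E \<times> carrier C" using emul_mem[OF subsetD[OF F(2)] subsetD[OF F(4)]] by simp
  qed
  ultimately show ?thesis
    unfolding FM_simps(1) using finite_supp_push2[OF F(1,3)] by blast
qed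

lemma push2_sub:
  assumes "finite (supp f)" "finite (supp f')" "finite (supp g)"
  shows "push2 h (\<lambda>p. f p - f' p) g = (\<lambda>r. push2 h f g r - push2 h f' g r)"
    "push2 h g (\<lambda>p. f p - f' p) = (\<lambda>r. push2 h g f r - push2 h g f' r)"
proof -
  have e: "(\<lambda>p. f p - f' p) = (\<lambda>p. f p + -1 * f' p)" by (rule ext) simp
  have fin: "finite (supp (\<lambda>p. -1 * f' p))" by (rule finite_supp(2)[OF assms(2)])
  show "push2 h (\<lambda>p. f p - f' p) g = (\<lambda>r. push2 h f g r - push2 h f' g r)"
    unfolding e push2_linear(1)[OF assms(1) fin assms(3,3)] push2_linear(3)[OF assms(2,2,3,3)] by simp
  show "push2 h g (\<lambda>p. f p - f' p) = (\<lambda>r. push2 h g f r - push2 h g f' r)"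
    unfolding e push2_linear(2)[OF assms(3,3,1) fin] push2_linear(4)[OF assms(3,3,2,2)] by simp
qed

lemma push2_rel1:
  assumes f: "f \<in> rel" and g: "g \<in> carrier FM"
  shows "push2 emul f g \<in> rel"
proof -
  have "finite (supp g)" "supp g \<subseteq> carrier E \<times> carrier C" using g by (auto simp: FM_simps(1))
  then show ?thesis
  proof (induction g rule: finite_supp_induct)
    case zero
    then show ?case by (simp add: push2_zero rel_cl)
  next
    case (add g p c)
    obtain e1 y1 where p: "p = (e1, y1)" "e1 \<in> carrier E" "y1 \<in> carrier C" using add by auto
    have ff: "finite (supp f)" using rel_cl(5)[OF f] by (simp add: FM_simps)
    have "push2 emul f (single p) \<in> rel"
      using f
    proof (induction f rule: rel_induct)
      case (e_add e e' y)
      then show ?case using rel_gens(1)[of "e \<otimes>\<^bsub>E\<^esub> e1" "e' \<otimes>\<^bsub>E\<^esub> e1" "y \<otimes>\<^bsub>C\<^esub> y1"] p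
        by (simp add: push2_sub push2_single emul_def E_mult E_cl)
    next
      case (c_add e y y')
      then show ?case using rel_gens(2)[of "e \<otimes>\<^bsub>E\<^esub> e1" "y \<otimes>\<^bsub>C\<^esub> y1" "y' \<otimes>\<^bsub>C\<^esub> y1"] p
        by (simp add: push2_sub push2_single emul_def E_mult E_cl C.A.l_distr)
    next
      case (e_smult t e y)
      then show ?case using rel_gens(3)[of "e \<otimes>\<^bsub>E\<^esub> e1" "y \<otimes>\<^bsub>C\<^esub> y1" t] p
        by (simp add: push2_sub push2_linear(3)[of _ "\<lambda>_. 0" _ "\<lambda>_. 0"] push2_single emul_def E_mult E_cl)
    next
      case (c_smult t e y)
      then show ?case using rel_gens(4)[of "e \<otimes>\<^bsub>E\<^esub> e1" "y \<otimes>\<^bsub>C\<^esub> y1" t] p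
        by (simp add: push2_sub push2_linear(3)[of _ "\<lambda>_. 0" _ "\<lambda>_. 0"] push2_single emul_def E_cl C.mult_sm)
    next
      case zero
      then show ?case by (simp add: push2_zero rel_cl)
    next
      case (add f g)
      then show ?case using rel_cl(2) by (simp add: push2_linear(1)[of _ _ _ "\<lambda>_. 0"] FM_simps(1))
    next
      case (smult c f)
      then show ?case using rel_cl(3) by (simp add: push2_linear(3)[of _ "\<lambda>_. 0" _ "\<lambda>_. 0"] FM_simps(1))
    qed
    then show ?case using add ff rel_cl(2,3)
      by (simp add: push2_linear(2)[of _ "\<lambda>_. 0"] push2_linear(4)[of _ "\<lambda>_. 0" _ "\<lambda>_. 0"])
  qed
qed

lemma push2_rel2:
  assumes f: "f \<in> rel" and g: "g \<in> carrier FM"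
  shows "push2 emul g f \<in> rel"
proof -
  have "finite (supp g)" "supp g \<subseteq> carrier E \<times> carrier C" using g by (auto simp: FM_simps(1))
  then show ?thesis
  proof (induction g rule: finite_supp_induct)
    case zero
    then show ?case by (simp add: push2_zero rel_cl)
  next
    case (add g p c)
    obtain e1 y1 where p: "p = (e1, y1)" "e1 \<in> carrier E" "y1 \<in> carrier C" using add by auto
    have ff: "finite (supp f)" using rel_cl(5)[OF f] by (simp add: FM_simps)
    have "push2 emul (single p) f \<in> rel"
      using f
    proof (induction f rule: rel_induct)
      case (e_add e e' y)
      then show ?case using rel_gens(1)[of "e1 \<otimes>\<^bsub>E\<^esub> e" "e1 \<otimes>\<^bsub>E\<^esub> e'" "y1 \<otimes>\<^bsub>C\<^esub> y"] p
        by (simp add: push2_sub push2_single emul_def E_mult E_cl)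
    next
      case (c_add e y y')
      then show ?case using rel_gens(2)[of "e1 \<otimes>\<^bsub>E\<^esub> e" "y1 \<otimes>\<^bsub>C\<^esub> y" "y1 \<otimes>\<^bsub>C\<^esub> y'"] p
        by (simp add: push2_sub push2_single emul_def E_mult E_cl C.A.r_distr)
    next
      case (e_smult t e y)
      then show ?case using rel_gens(3)[of "e1 \<otimes>\<^bsub>E\<^esub> e" "y1 \<otimes>\<^bsub>C\<^esub> y" t] p
        by (simp add: push2_sub push2_linear(4)[of _ "\<lambda>_. 0" _ "\<lambda>_. 0"] push2_single emul_def E_mult E_cl)
    next
      case (c_smult t e y)
      then show ?case using rel_gens(4)[of "e1 \<otimes>\<^bsub>E\<^esub> e" "y1 \<otimes>\<^bsub>C\<^esub> y" t] p
        by (simp add: push2_sub push2_linear(4)[of _ "\<lambda>_. 0" _ "\<lambda>_. 0"] push2_single emul_def E_cl C.mult_sm)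
    next
      case zero
      then show ?case by (simp add: push2_zero rel_cl)
    next
      case (add f g)
      then show ?case using rel_cl(2) by (simp add: push2_linear(2)[of _ "\<lambda>_. 0"] FM_simps(1))
    next
      case (smult c f)
      then show ?case using rel_cl(3) by (simp add: push2_linear(4)[of _ "\<lambda>_. 0" _ "\<lambda>_. 0"] FM_simps(1))
    qed
    then show ?case using add ff rel_cl(2,3)
      by (simp add: push2_linear(1)[of _ _ _ "\<lambda>_. 0"] push2_linear(3)[of _ "\<lambda>_. 0" _ "\<lambda>_. 0"])
  qed
qed

lemma TC_mult:
  assumes f: "f \<in> carrier FM" and g: "g \<in> carrier FM"
  shows "cls f \<otimes>\<^bsub>TC\<^esub> cls g = cls (push2 emul f g)"
proof -
  have e: "cls (push2 emul f' g') = cls (push2 emul f g)" if "f' \<in> cls f" "g' \<in> cls g" for f' g'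
  proof -
    have f': "f' \<in> carrier FM" "(\<lambda>q. f' q - f q) \<in> rel" and g': "g' \<in> carrier FM" "(\<lambda>q. g' q - g q) \<in> rel"
      using cls_memD that f g by auto
    have "push2 emul (\<lambda>q. f' q - f q) g' \<in> rel" "push2 emul f (\<lambda>q. g' q - g q) \<in> rel"
      using push2_rel1[OF f'(2) g'(1)] push2_rel2[OF g'(2) f] by auto
    from rel_cl(2)[OF this] show ?thesis
      unfolding cls_eq[OF push2_FM[OF f'(1) g'(1)] push2_FM[OF f g]]
      using f f' g g' by (simp add: push2_sub FM_simps(1))
  qed
  have "cls f \<otimes>\<^bsub>TC\<^esub> cls g = (\<Union>f'\<in>cls f. \<Union>g'\<in>cls g. cls (push2 emul f' g'))"
    by (simp add: tensor_dga_def module.defs emul_def)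
  also have "\<dots> = cls (push2 emul f g)"
    using e cls_self[of f] cls_self[of g] by blast
  finally show ?thesis .
qed

text \<open>
  Contraction of a tensor with a functional \<open>l\<close> on the second factor. All facts about tensors are
  reduced to contractions, so that no basis of the first factor is chosen.
\<close>

definition ctr :: "('c \<Rightarrow> 'k) \<Rightarrow> ('e \<times> 'c \<Rightarrow> 'k) \<Rightarrow> 'e" where
  "ctr l = lin smE (\<lambda>p. smE (l (snd p)) (fst p))"

lemma ctr_simps: "ctr l (single (e, y)) = smE (l y) e"
  "finite (supp f) \<Longrightarrow> finite (supp g) \<Longrightarrow> ctr l (\<lambda>q. f q + g q) = ctr l f + ctr l g"
  "ctr l (\<lambda>q. c * f q) = smE c (ctr l f)" "ctr l (\<lambda>_. 0) = 0"
  by (simp_all add: ctr_def VE.lin_add VE.lin_cmul)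

lemma ctr_diff: "finite (supp f) \<Longrightarrow> finite (supp g) \<Longrightarrow> ctr l (\<lambda>q. f q - g q) = ctr l f - ctr l g"
  using ctr_simps(2)[of f "\<lambda>q. -1 * g q" l] ctr_simps(3)[of l "-1" g] by simp

lemma ctr_E:
  assumes "f \<in> carrier FM"
  shows "ctr l f \<in> carrier E"
proof -
  have "finite (supp f)" "supp f \<subseteq> carrier E \<times> carrier C" using assms by (auto simp: FM_simps(1))
  then show ?thesis
    by (induction f rule: finite_supp_induct) (auto simp: ctr_simps E_cl)
qed

lemma ctr_rel:
  assumes l: "linf C l" and f: "f \<in> rel"
  shows "ctr l f = 0"
  using f
proof (induction f rule: rel_induct)
  case (add f g)
  then show ?case by (simp add: ctr_simps FM_simps(1))
qed (use l in \<open>simp_all add: linf_def ctr_diff ctr_simps VE.scale_right_distrib VE.scale_left_distrib mult.commute\<close>)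

text \<open>
  Independent of the representative when \<open>l\<close> is linear, since contraction kills the bilinearity relations.
\<close>

definition Ctr :: "('c \<Rightarrow> 'k) \<Rightarrow> ('e \<times> 'c \<Rightarrow> 'k) set \<Rightarrow> 'e" where
  "Ctr l X = ctr l (SOME f. f \<in> X)"

lemma Ctr_cls:
  assumes l: "linf C l" and f: "f \<in> carrier FM"
  shows "Ctr l (cls f) = ctr l f"
proof -
  have "(SOME g. g \<in> cls f) \<in> cls f" using cls_self someI by metis
  then obtain h where h: "h \<in> rel" "(SOME g. g \<in> cls f) = (\<lambda>q. h q + f q)" by (auto simp: cls_mem)
  then show ?thesis using ctr_rel[OF l h(1)] rel_cl(5)[OF h(1)] f by (simp add: Ctr_def ctr_simps FM_simps(1))
qed

lemma ctr_push2:
  assumes f: "f \<in> carrier FM" and g: "g \<in> carrier FM"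
    and m: "\<And>y y'. y \<in> carrier C \<Longrightarrow> y' \<in> carrier C \<Longrightarrow> l (y \<otimes>\<^bsub>C\<^esub> y') = l1 y * l2 y' + l3 y * l4 y'"
  shows "ctr l (push2 emul f g) = ctr l1 f \<otimes>\<^bsub>E\<^esub> ctr l2 g + ctr l3 f \<otimes>\<^bsub>E\<^esub> ctr l4 g"
proof -
  have F: "finite (supp f)" "supp f \<subseteq> carrier E \<times> carrier C" using f by (auto simp: FM_simps(1))
  have G: "finite (supp g)" "supp g \<subseteq> carrier E \<times> carrier C" using g by (auto simp: FM_simps(1))
  have one: "ctr l (push2 emul (single p) g) = ctr l1 (single p) \<otimes>\<^bsub>E\<^esub> ctr l2 g + ctr l3 (single p) \<otimes>\<^bsub>E\<^esub> ctr l4 g"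
    if p: "p \<in> carrier E \<times> carrier C" for p
    using G
  proof (induction g rule: finite_supp_induct)
    case zero
    have "x \<otimes>\<^bsub>E\<^esub> 0 = 0" if "x \<in> carrier E" for x using E_mult(4)[OF that E_cl(1), of 0] by simp
    then show ?case using p by (auto simp: push2_zero ctr_simps E_cl)
  next
    case (add g q c)
    obtain e y e' y' where pq: "p = (e, y)" "q = (e', y')" "e \<in> carrier E" "y \<in> carrier C" "e' \<in> carrier E" "y' \<in> carrier C"
      using p add by auto
    have gE: "ctr l g \<in> carrier E" for l using add by (intro ctr_E) (simp add: FM_simps(1))
    show ?case using add pq gE
      by (simp add: push2_linear(2)[of _ "\<lambda>_. 0"] push2_linear(4)[of _ "\<lambda>_. 0" _ "\<lambda>_. 0"] push2_single emul_def ctr_simps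
          m E_mult E_cl VE.scale_left_distrib VE.scale_right_distrib algebra_simps)
  qed
  show ?thesis using F
  proof (induction f rule: finite_supp_induct)
    case zero
    have "0 \<otimes>\<^bsub>E\<^esub> x = 0" if "x \<in> carrier E" for x using E_mult(3)[OF E_cl(1) that, of 0] by simp
    then show ?case using ctr_E[OF g] by (auto simp: push2_zero ctr_simps)
  next
    case (add f p c)
    have fE: "ctr l f \<in> carrier E" "ctr l (single p) \<in> carrier E" for l
      using add FM_cl(5)[of "fst p" "snd p"] by (auto intro!: ctr_E simp: FM_simps(1))
    show ?case using add G one[OF add(3)] fE ctr_E[OF g]
      by (simp add: push2_linear(1)[of _ _ _ "\<lambda>_. 0"] push2_linear(3)[of _ "\<lambda>_. 0" _ "\<lambda>_. 0"] ctr_simps(2-4)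
          E_mult E_cl VE.scale_right_distrib algebra_simps)
  qed
qed

text \<open>
  Coordinates suffice: the identity \<open>e \<otimes> y = \<Sum> l\<^sub>i(y) e \<otimes> b\<^sub>i\<close> follows from the relations for pure tensors and
  extends linearly.
\<close>

lemma expand:
  assumes l: "linf C l0" "linf C l1" "linf C l2" and b: "b0 \<in> carrier C" "b1 \<in> carrier C" "b2 \<in> carrier C"
    and e: "\<And>y. y \<in> carrier C \<Longrightarrow> y = l0 y \<odot>\<^bsub>C\<^esub> b0 \<oplus>\<^bsub>C\<^esub> (l1 y \<odot>\<^bsub>C\<^esub> b1 \<oplus>\<^bsub>C\<^esub> l2 y \<odot>\<^bsub>C\<^esub> b2)"
    and f: "f \<in> carrier FM"
  shows "(\<lambda>q. f q - (single (ctr l0 f, b0) q + single (ctr l1 f, b1) q + single (ctr l2 f, b2) q)) \<in> rel"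
proof -
  have z: "single (0, b) \<in> rel" if "b \<in> carrier C" for b
    using rel_gens(3)[OF E_cl(1) that, of 0] by (simp add: E_cl)
  have F: "finite (supp f)" "supp f \<subseteq> carrier E \<times> carrier C" using f by (auto simp: FM_simps(1))
  have stp: "(\<lambda>q. c * single (e, y) q - (single (smE c (smE (l0 y) e), b0) q + single (smE c (smE (l1 y) e), b1) q + single (smE c (smE (l2 y) e), b2) q)) \<in> rel"
    if ey: "e \<in> carrier E" "y \<in> carrier C" for e y c
  proof -
    have 1: "(\<lambda>q. single (smE c (smE (l y) e), b) q - c * single (e, l y \<odot>\<^bsub>C\<^esub> b) q) \<in> rel" if "b \<in> carrier C" for l :: "'c \<Rightarrow> 'k" and b
    proof -
      have a: "(\<lambda>q. single (smE (c * l y) e, b) q - (c * l y) * single (e, b) q) \<in> rel" using rel_gens(3)[OF ey(1) that] .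
      have b: "(\<lambda>q. c * (single (e, l y \<odot>\<^bsub>C\<^esub> b) q - l y * single (e, b) q)) \<in> rel"
        by (rule rel_cl(3)) (rule rel_gens(4)[OF ey(1) that])
      show ?thesis using rel_cl(4)[OF a b] by (simp add: algebra_simps)
    qed
    let ?y0 = "l0 y \<odot>\<^bsub>C\<^esub> b0" and ?y1 = "l1 y \<odot>\<^bsub>C\<^esub> b1" and ?y2 = "l2 y \<odot>\<^bsub>C\<^esub> b2"
    have s1: "(\<lambda>q. single (e, ?y0 \<oplus>\<^bsub>C\<^esub> (?y1 \<oplus>\<^bsub>C\<^esub> ?y2)) q - single (e, ?y0) q - single (e, ?y1 \<oplus>\<^bsub>C\<^esub> ?y2) q) \<in> rel"
      by (rule rel_gens(2)) (use ey b in auto)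
    have s2: "(\<lambda>q. single (e, ?y1 \<oplus>\<^bsub>C\<^esub> ?y2) q - single (e, ?y1) q - single (e, ?y2) q) \<in> rel"
      by (rule rel_gens(2)) (use ey b in auto)
    have "(\<lambda>q. single (e, y) q - single (e, ?y0) q - single (e, ?y1) q - single (e, ?y2) q) \<in> rel"
      using rel_cl(2)[OF s1 s2] e[OF ey(2)] by (simp add: algebra_simps)
    from rel_cl(3)[OF this, of c]
    have "(\<lambda>q. c * (single (e, y) q - single (e, ?y0) q - single (e, ?y1) q - single (e, ?y2) q)) \<in> rel" .
    from rel_cl(4)[OF rel_cl(4)[OF rel_cl(4)[OF this 1[OF b(1), of l0]] 1[OF b(2), of l1]] 1[OF b(3), of l2]]
    show ?thesis by (simp add: algebra_simps)
  qed
  show ?thesis using F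
  proof (induction f rule: finite_supp_induct)
    case zero
    have "(\<lambda>q. (\<lambda>_. 0) q - (single (0, b0) q + single (0, b1) q + single (0, b2) q)) \<in> rel"
      using rel_cl(4)[OF rel_cl(4)[OF rel_cl(4)[OF rel_cl(1) z[OF b(1)]] z[OF b(2)]] z[OF b(3)]] by (simp add: algebra_simps)
    then show ?case by (simp add: ctr_simps)
  next
    case (add f p c)
    obtain e y where p: "p = (e, y)" "e \<in> carrier E" "y \<in> carrier C" using add by auto
    have fE: "ctr l f \<in> carrier E" for l using add by (intro ctr_E) (simp add: FM_simps(1))
    have g: "(\<lambda>q. single (ctr l f + smE c (smE (l y) e), b) q - single (ctr l f, b) q - single (smE c (smE (l y) e), b) q) \<in> rel"
      if "b \<in> carrier C" for l b using rel_gens(1) fE p that E_cl by simp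
    have "ctr l (\<lambda>q. f q + c * single p q) = ctr l f + smE c (smE (l y) e)" for l
      using add by (simp add: ctr_simps p)
    then show ?case
      using rel_cl(4)[OF rel_cl(4)[OF rel_cl(4)[OF rel_cl(2)[OF add.IH stp[OF p(2,3), of c]] g[OF b(1), of l0]] g[OF b(2), of l1]] g[OF b(3), of l2]]
      by (simp add: p algebra_simps)
  qed
qed

lemma cls_eq_ctr:
  assumes l: "linf C l0" "linf C l1" "linf C l2" and b: "b0 \<in> carrier C" "b1 \<in> carrier C" "b2 \<in> carrier C"
    and e: "\<And>y. y \<in> carrier C \<Longrightarrow> y = l0 y \<odot>\<^bsub>C\<^esub> b0 \<oplus>\<^bsub>C\<^esub> (l1 y \<odot>\<^bsub>C\<^esub> b1 \<oplus>\<^bsub>C\<^esub> l2 y \<odot>\<^bsub>C\<^esub> b2)"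
    and f: "f \<in> carrier FM" and g: "g \<in> carrier FM" and c: "ctr l0 f = ctr l0 g" "ctr l1 f = ctr l1 g" "ctr l2 f = ctr l2 g"
  shows "cls f = cls g"
  using rel_cl(4)[OF expand[OF l b e f] expand[OF l b e g]] c by (simp add: cls_eq[OF f g] algebra_simps)

end

text \<open>
  A linear map in the second factor sends bilinearity relations to bilinearity relations, so the
  union over representatives in \<open>tensor_map\<close> is a single class.
\<close>

lemma tensor_map_cls:
  fixes smE :: "'k::field \<Rightarrow> 'e \<Rightarrow> 'e::ab_group_add" and C :: "('k, 'c) dga" and D :: "('k, 'd) dga"
  assumes C: "tensor smE E C" and D: "tensor smE E D"
    and g: "\<And>x. x \<in> carrier D \<Longrightarrow> g x \<in> carrier C"
      "\<And>x y. x \<in> carrier D \<Longrightarrow> y \<in> carrier D \<Longrightarrow> g (x \<oplus>\<^bsub>D\<^esub> y) = g x \<oplus>\<^bsub>C\<^esub> g y"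
      "\<And>c x. x \<in> carrier D \<Longrightarrow> g (c \<odot>\<^bsub>D\<^esub> x) = c \<odot>\<^bsub>C\<^esub> g x"
    and f: "f \<in> carrier (free_space (carrier E \<times> carrier D))"
  shows "tensor_map E C g (tensor_class E D f) = tensor_class E C (push (map_prod id g) f)"
    "push (map_prod id g) f \<in> carrier (free_space (carrier E \<times> carrier C))"
    "tensor.ctr smE l (push (map_prod id g) f) = tensor.ctr smE (l \<circ> g) f"
proof -
  interpret C: tensor smE E C by fact
  interpret D: tensor smE E D by fact
  define h where "h = map_prod (id :: 'e \<Rightarrow> 'e) g"
  have hs: "h (e, y) = (e, g y)" for e y by (simp add: h_def)
  let ?p = "push h"
  have pF: "?p f \<in> carrier C.FM" if "f \<in> carrier D.FM" for f
  proof -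
    have F: "finite (supp f)" "supp f \<subseteq> carrier E \<times> carrier D" using that unfolding D.FM_simps(1) by blast+
    have "supp (?p f) \<subseteq> h ` supp f" by (rule supp_push)
    moreover have "h ` supp f \<subseteq> carrier E \<times> carrier C"
    proof
      fix r assume "r \<in> h ` supp f"
      then obtain e y where "r = (e, g y)" "(e, y) \<in> supp f" by (elim imageE) (metis hs surj_pair)
      then show "r \<in> carrier E \<times> carrier C" using subsetD[OF F(2)] g(1) by blast
    qed
    ultimately show ?thesis unfolding C.FM_simps(1) using finite_supp_push[OF F(1)] by blast
  qed
  show "push (map_prod id g) f \<in> carrier C.FM" using pF[OF f] by (simp only: h_def)
  have psub: "?p (\<lambda>q. a q - b q) = (\<lambda>r. ?p a r - ?p b r)" if "finite (supp a)" "finite (supp b)" for a b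
    using push_add[of a "\<lambda>q. -1 * b q" "h"] push_cmul[of "h" "-1" b] that by simp
  have prel: "?p k \<in> C.rel" if "k \<in> D.rel" for k
    using that
  proof (induction k rule: D.rel_induct)
    case (e_add e e' y)
    then show ?case using C.rel_gens(1)[of e e' "g y"] g by (simp add: psub push_single hs)
  next
    case (c_add e y y')
    then show ?case using C.rel_gens(2)[of e "g y" "g y'"] g by (simp add: psub push_single hs)
  next
    case (e_smult t e y)
    then show ?case using C.rel_gens(3)[of e "g y" t] g by (simp add: psub push_cmul push_single hs)
  next
    case (c_smult t e y)
    then show ?case using C.rel_gens(4)[of e "g y" t] g by (simp add: psub push_cmul push_single hs)
  next
    case zero
    then show ?case by (simp add: push_zero C.rel_cl)
  next
    case (add f g)
    then show ?case using C.rel_cl(2) by (simp add: push_add D.FM_simps(1))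
  next
    case (smult c f)
    then show ?case using C.rel_cl(3) by (simp add: push_cmul)
  qed
  have "C.cls (?p f') = C.cls (?p f)" if "f' \<in> D.cls f" for f'
  proof -
    have f': "f' \<in> carrier D.FM" "(\<lambda>q. f' q - f q) \<in> D.rel" using D.cls_memD[OF that f] by auto
    then show ?thesis using prel[OF f'(2)] f
      unfolding C.cls_eq[OF pF[OF f'(1)] pF[OF f]] by (simp add: psub D.FM_simps(1))
  qed
  then show "tensor_map E C g (D.cls f) = C.cls (push (map_prod id g) f)"
    unfolding tensor_map_def h_def using D.cls_self[of f] by blast
  have "(\<lambda>p. smE (l (snd p)) (fst p)) \<circ> h = (\<lambda>p. smE ((l \<circ> g) (snd p)) (fst p))" by (rule ext) (simp add: h_def)
  then show "C.ctr l (push (map_prod id g) f) = D.ctr (l \<circ> g) f"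
    using f unfolding C.ctr_def D.ctr_def h_def[symmetric] by (simp add: C.VE.lin_push D.FM_simps(1))
qed

context tensor
begin

lemma TC_diff:
  assumes f: "f \<in> carrier FM"
  shows "diff TC (cls f) = cls (push (map_prod id (diff C)) f)" "push (map_prod id (diff C)) f \<in> carrier FM"
    "ctr l (push (map_prod id (diff C)) f) = ctr (l \<circ> diff C) f"
proof -
  have C: "tensor smE E C" by unfold_locales
  note t = tensor_map_cls[OF C C, of "diff C", OF C.diff_carrier C.diff_add C.diff_smult f]
  show "diff TC (cls f) = cls (push (map_prod id (diff C)) f)"
    using t(1) by (simp add: tensor_dga_def module.defs tensor_map_def)
  show "push (map_prod id (diff C)) f \<in> carrier FM" "ctr l (push (map_prod id (diff C)) f) = ctr (l \<circ> diff C) f"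
    using t(2,3) by auto
qed

lemma TC_one: "\<one>\<^bsub>TC\<^esub> = cls (single (\<one>\<^bsub>E\<^esub>, \<one>\<^bsub>C\<^esub>))"
  by (simp add: tensor_dga_def module.defs pure_tensor_def)

end

section \<open>Test algebras\<close>

text \<open>
  The extension of \<open>k = k b\<^sub>0\<close> by the acyclic complex \<open>k b\<^sub>2 \<rightarrow> k b\<^sub>1\<close> with product zero, in coordinates \<open>l\<^sub>i\<close>.
  A homomorphism into it consists of a character and a derivation over it: the third coordinate is
  the derivation composed with the differential.
\<close>

locale cone_dga = C: dga C
  for C :: "('k::field, 'c) dga" and n :: int and b0 b1 b2 :: 'c and l0 l1 l2 :: "'c \<Rightarrow> 'k" +
  assumes com: "dg_commutative C"
    and l: "linf C l0" "linf C l1" "linf C l2"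
    and b: "b0 \<in> gr C 0" "b1 \<in> gr C n" "b2 \<in> gr C (n + 1)"
    and lb: "l0 b0 = 1" "l0 b1 = 0" "l0 b2 = 0" "l1 b0 = 0" "l1 b1 = 1" "l1 b2 = 0" "l2 b0 = 0" "l2 b1 = 0" "l2 b2 = 1"
    and expa: "y \<in> carrier C \<Longrightarrow> y = l0 y \<odot>\<^bsub>C\<^esub> b0 \<oplus>\<^bsub>C\<^esub> (l1 y \<odot>\<^bsub>C\<^esub> b1 \<oplus>\<^bsub>C\<^esub> l2 y \<odot>\<^bsub>C\<^esub> b2)"
    and one: "\<one>\<^bsub>C\<^esub> = b0"
    and lm: "x \<in> carrier C \<Longrightarrow> y \<in> carrier C \<Longrightarrow> l0 (x \<otimes>\<^bsub>C\<^esub> y) = l0 x * l0 y"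
      "x \<in> carrier C \<Longrightarrow> y \<in> carrier C \<Longrightarrow> l1 (x \<otimes>\<^bsub>C\<^esub> y) = l1 x * l0 y + l0 x * l1 y"
      "x \<in> carrier C \<Longrightarrow> y \<in> carrier C \<Longrightarrow> l2 (x \<otimes>\<^bsub>C\<^esub> y) = l2 x * l0 y + l0 x * l2 y"
    and ld: "x \<in> carrier C \<Longrightarrow> l0 (diff C x) = 0" "x \<in> carrier C \<Longrightarrow> l1 (diff C x) = l2 x" "x \<in> carrier C \<Longrightarrow> l2 (diff C x) = 0"
    and lg: "x \<in> gr C i \<Longrightarrow> i \<noteq> 0 \<Longrightarrow> l0 x = 0" "x \<in> gr C i \<Longrightarrow> i \<noteq> n \<Longrightarrow> l1 x = 0" "x \<in> gr C i \<Longrightarrow> i \<noteq> n + 1 \<Longrightarrow> l2 x = 0"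

definition cone3 :: "int \<Rightarrow> ('k::field, 'k \<times> 'k \<times> 'k) dga" where
  "cone3 n = \<lparr>carrier = UNIV, mult = (\<lambda>(a, u, v) (a', u', v'). (a * a', u * a' + a * u', v * a' + a * v')),
     one = (1, 0, 0), zero = (0, 0, 0), add = (\<lambda>(a, u, v) (a', u', v'). (a + a', u + u', v + v')),
     smult = (\<lambda>c (a, u, v). (c * a, c * u, c * v)),
     gr = (\<lambda>i. {(a, u, v). (i \<noteq> 0 \<longrightarrow> a = 0) \<and> (i \<noteq> n \<longrightarrow> u = 0) \<and> (i \<noteq> n + 1 \<longrightarrow> v = 0)}),
     diff = (\<lambda>(a, u, v). (0, v, 0))\<rparr>"

lemma cone3_dg_space: "dg_space (cone3 n :: ('k::field, 'k \<times> 'k \<times> 'k) dga)"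
proof (rule dg_spaceI[where pr = "\<lambda>i (a, u, v). (if i = 0 then a else 0, if i = n then u else 0, if i = n + 1 then v else 0)"])
  show mod: "module ground (cone3 n)"
    by (rule module_groundI) (auto simp: cone3_def algebra_simps)
  show "submodule (gr (cone3 n) i) ground (cone3 n)" for i
    by (rule submodule_groundI[OF mod]) (auto simp: cone3_def)
  show "carrier (cone3 n) \<subseteq> Z" if gen: "\<And>i. gr (cone3 n) i \<subseteq> Z"
      "\<And>x y. x \<in> Z \<Longrightarrow> y \<in> Z \<Longrightarrow> x \<in> carrier (cone3 n) \<Longrightarrow> y \<in> carrier (cone3 n) \<Longrightarrow> x \<oplus>\<^bsub>cone3 n\<^esub> y \<in> Z" for Z :: "('k \<times> 'k \<times> 'k) set"
  proof
    fix x :: "'k \<times> 'k \<times> 'k"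
    obtain a u v where x: "x = (a, u, v)" by (cases x)
    have 1: "(a, 0, 0) \<in> Z" using gen(1)[of 0] by (auto simp: cone3_def)
    have 2: "(0, u, 0) \<in> Z" using gen(1)[of n] by (auto simp: cone3_def)
    have 3: "(0, 0, v) \<in> Z" using gen(1)[of "n + 1"] by (auto simp: cone3_def)
    have "(a, 0, 0) \<oplus>\<^bsub>cone3 n\<^esub> (0, u, 0) \<in> Z" by (rule gen(2)[OF 1 2]) (auto simp: cone3_def)
    then have "(a, u, 0) \<in> Z" by (simp add: cone3_def)
    then have "(a, u, 0) \<oplus>\<^bsub>cone3 n\<^esub> (0, 0, v) \<in> Z" by (rule gen(2)[OF _ 3]) (auto simp: cone3_def)
    then show "x \<in> Z" using x by (simp add: cone3_def)
  qed
qed (auto simp: cone3_def)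

lemma cone3_dga: "dg_algebra (cone3 n)"
proof (rule dg_algebraI[OF cone3_dg_space])
  show "x \<otimes>\<^bsub>cone3 n\<^esub> y \<in> gr (cone3 n) (i + j)" if "x \<in> gr (cone3 n) i" "y \<in> gr (cone3 n) j" for i j x y
    using that by (cases "i = 0"; cases "j = 0") (auto simp: cone3_def)
  show "diff (cone3 n) (x \<otimes>\<^bsub>cone3 n\<^esub> y) = diff (cone3 n) x \<otimes>\<^bsub>cone3 n\<^esub> y \<oplus>\<^bsub>cone3 n\<^esub> sg i \<odot>\<^bsub>cone3 n\<^esub> (x \<otimes>\<^bsub>cone3 n\<^esub> diff (cone3 n) y)"
    if "x \<in> gr (cone3 n) i" "y \<in> carrier (cone3 n)" for i x y
    using that by (cases y; cases "i = 0") (auto simp: cone3_def)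
qed (auto simp: cone3_def algebra_simps)

lemma cone3_simps:
  "(a, u, v) \<otimes>\<^bsub>cone3 n\<^esub> (a', u', v') = (a * a', u * a' + a * u', v * a' + a * v')" "\<one>\<^bsub>cone3 n\<^esub> = (1, 0, 0)"
  "(a, u, v) \<oplus>\<^bsub>cone3 n\<^esub> (a', u', v') = (a + a', u + u', v + v')" "c \<odot>\<^bsub>cone3 n\<^esub> (a, u, v) = (c * a, c * u, c * v)"
  "(a, u, v) \<in> gr (cone3 n) i \<longleftrightarrow> (i \<noteq> 0 \<longrightarrow> a = 0) \<and> (i \<noteq> n \<longrightarrow> u = 0) \<and> (i \<noteq> n + 1 \<longrightarrow> v = 0)"
  "diff (cone3 n) (a, u, v) = (0, v, 0)"
  by (simp_all add: cone3_def)

text \<open>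
  The triples \<open>(a, u, v)\<close> fit into every infinite type into which \<open>k\<close> embeds.
\<close>

lemma cone_dga_exists:
  includes cardinal_syntax
  fixes j :: "'k::field \<Rightarrow> 'u"
  assumes inf: "infinite (UNIV :: 'u set)" and j: "inj j"
  shows "\<exists>(C :: ('k, 'u) dga) b0 b1 b2 l0 l1 l2. cone_dga C n b0 b1 b2 l0 l1 l2"
proof -
  have k: "|UNIV :: 'k set| \<le>o |UNIV :: 'u set|" using j card_of_ordLeq[of "UNIV :: 'k set" "UNIV :: 'u set"] by blast
  have fld: "infinite (Field |UNIV :: 'u set| )" using inf by (simp add: Field_card_of)
  have "|(UNIV :: 'k set) \<times> (UNIV :: 'k set) \<times> (UNIV :: 'k set)| \<le>o |UNIV :: 'u set|"
    using k fld by (intro card_of_Times_ordLeq_infinite_Field[OF fld]) (assumption | rule card_of_Card_order)+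
  then obtain \<iota> :: "'k \<times> 'k \<times> 'k \<Rightarrow> 'u" where i: "inj \<iota>"
    using card_of_ordLeq[of "(UNIV :: 'k set) \<times> (UNIV :: 'k set) \<times> (UNIV :: 'k set)" "UNIV :: 'u set"] by auto
  let ?C = "tr \<iota> (cone3 n)"
  interpret D: dga "cone3 n" by unfold_locales (rule cone3_dga)
  have ii: "inj_on \<iota> (carrier (cone3 n))" using i by (rule inj_on_subset) simp
  note t = tr_simps[OF ii]
  have c: "carrier (cone3 n) = UNIV" by (simp add: cone3_def)
  interpret C: dga ?C by unfold_locales (rule D.tr_dga[OF ii])
  have lin: "linf ?C (\<lambda>x. f (inv_into UNIV \<iota> x))" if "\<And>x y. f (x \<oplus>\<^bsub>cone3 n\<^esub> y) = f x + f y" "\<And>c x. f (c \<odot>\<^bsub>cone3 n\<^esub> x) = c * f x" for f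
    unfolding linf_def using that i by (auto simp: t c)
  have "dg_commutative ?C" unfolding dg_commutative_def
  proof (intro allI ballI)
    fix p q x y assume "x \<in> gr ?C p" "y \<in> gr ?C q"
    then obtain x' y' where x: "x = \<iota> x'" "y = \<iota> y'" "x' \<in> gr (cone3 n) p" "y' \<in> gr (cone3 n) q" by (auto simp: t)
    have "x' \<otimes>\<^bsub>cone3 n\<^esub> y' = sg (p * q) \<odot>\<^bsub>cone3 n\<^esub> (y' \<otimes>\<^bsub>cone3 n\<^esub> x')"
      using x(3,4) by (cases "p = 0"; cases "q = 0") (auto simp: cone3_def algebra_simps)
    then show "x \<otimes>\<^bsub>?C\<^esub> y = sg (p * q) \<odot>\<^bsub>?C\<^esub> (y \<otimes>\<^bsub>?C\<^esub> x)" unfolding x by (simp add: t c)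
  qed
  moreover have "linf ?C (\<lambda>x. fst (inv_into UNIV \<iota> x))" "linf ?C (\<lambda>x. fst (snd (inv_into UNIV \<iota> x)))"
    "linf ?C (\<lambda>x. snd (snd (inv_into UNIV \<iota> x)))"
    by (rule lin; auto simp: cone3_simps)+
  ultimately have "cone_dga ?C n (\<iota> (1, 0, 0)) (\<iota> (0, 1, 0)) (\<iota> (0, 0, 1)) (\<lambda>x. fst (inv_into UNIV \<iota> x))
      (\<lambda>x. fst (snd (inv_into UNIV \<iota> x))) (\<lambda>x. snd (snd (inv_into UNIV \<iota> x)))"
    by unfold_locales (use i in \<open>auto simp: t c cone3_simps\<close>)
  then show ?thesis by blast
qed

section \<open>Characters and derivations over them\<close>

text \<open>
  Homomorphisms into an algebra \<open>E\<close> concentrated in degree 0.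
\<close>

definition character :: "('k::field \<Rightarrow> 'e \<Rightarrow> 'e::ab_group_add) \<Rightarrow> ('k, 'e) module \<Rightarrow> ('k, 'x) dga \<Rightarrow> ('x \<Rightarrow> 'e) \<Rightarrow> bool" where
  "character smE E S \<alpha> \<longleftrightarrow> (\<forall>x\<in>carrier S. \<alpha> x \<in> carrier E) \<and>
     (\<forall>x\<in>carrier S. \<forall>y\<in>carrier S. \<alpha> (x \<oplus>\<^bsub>S\<^esub> y) = \<alpha> x + \<alpha> y) \<and> (\<forall>c. \<forall>x\<in>carrier S. \<alpha> (c \<odot>\<^bsub>S\<^esub> x) = smE c (\<alpha> x)) \<and>
     (\<forall>x\<in>carrier S. \<forall>y\<in>carrier S. \<alpha> (x \<otimes>\<^bsub>S\<^esub> y) = \<alpha> x \<otimes>\<^bsub>E\<^esub> \<alpha> y) \<and> \<alpha> \<one>\<^bsub>S\<^esub> = \<one>\<^bsub>E\<^esub> \<and>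
     (\<forall>i. \<forall>x\<in>gr S i. i \<noteq> 0 \<longrightarrow> \<alpha> x = 0) \<and> (\<forall>x\<in>carrier S. \<alpha> (diff S x) = 0)"

text \<open>
  Derivations over a character. The Koszul sign of a derivation of degree \<open>- n\<close> is absent because it is attached
  to \<open>\<alpha> x\<close>, which vanishes unless \<open>x\<close> has degree 0.
\<close>

definition char_der :: "('k::field \<Rightarrow> 'e \<Rightarrow> 'e::ab_group_add) \<Rightarrow> ('k, 'e) module \<Rightarrow> ('k, 'x) dga \<Rightarrow> ('x \<Rightarrow> 'e) \<Rightarrow> int \<Rightarrow> ('x \<Rightarrow> 'e) \<Rightarrow> bool" where
  "char_der smE E S \<alpha> n F \<longleftrightarrow> (\<forall>x\<in>carrier S. F x \<in> carrier E) \<and>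
     (\<forall>x\<in>carrier S. \<forall>y\<in>carrier S. F (x \<oplus>\<^bsub>S\<^esub> y) = F x + F y) \<and> (\<forall>c. \<forall>x\<in>carrier S. F (c \<odot>\<^bsub>S\<^esub> x) = smE c (F x)) \<and>
     (\<forall>i. \<forall>x\<in>gr S i. i \<noteq> n \<longrightarrow> F x = 0) \<and>
     (\<forall>x\<in>carrier S. \<forall>y\<in>carrier S. F (x \<otimes>\<^bsub>S\<^esub> y) = F x \<otimes>\<^bsub>E\<^esub> \<alpha> y + \<alpha> x \<otimes>\<^bsub>E\<^esub> F y)"

lemma characterD:
  assumes "character smE E S \<alpha>"
  shows "x \<in> carrier S \<Longrightarrow> \<alpha> x \<in> carrier E"
    "x \<in> carrier S \<Longrightarrow> y \<in> carrier S \<Longrightarrow> \<alpha> (x \<oplus>\<^bsub>S\<^esub> y) = \<alpha> x + \<alpha> y" "x \<in> carrier S \<Longrightarrow> \<alpha> (c \<odot>\<^bsub>S\<^esub> x) = smE c (\<alpha> x)"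
    "x \<in> carrier S \<Longrightarrow> y \<in> carrier S \<Longrightarrow> \<alpha> (x \<otimes>\<^bsub>S\<^esub> y) = \<alpha> x \<otimes>\<^bsub>E\<^esub> \<alpha> y" "\<alpha> \<one>\<^bsub>S\<^esub> = \<one>\<^bsub>E\<^esub>"
    "x \<in> gr S i \<Longrightarrow> i \<noteq> 0 \<Longrightarrow> \<alpha> x = 0" "x \<in> carrier S \<Longrightarrow> \<alpha> (diff S x) = 0"
  using assms unfolding character_def by blast+

lemma char_derD:
  assumes "char_der smE E S \<alpha> n F"
  shows "x \<in> carrier S \<Longrightarrow> F x \<in> carrier E"
    "x \<in> carrier S \<Longrightarrow> y \<in> carrier S \<Longrightarrow> F (x \<oplus>\<^bsub>S\<^esub> y) = F x + F y" "x \<in> carrier S \<Longrightarrow> F (c \<odot>\<^bsub>S\<^esub> x) = smE c (F x)"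
    "x \<in> gr S i \<Longrightarrow> i \<noteq> n \<Longrightarrow> F x = 0"
    "x \<in> carrier S \<Longrightarrow> y \<in> carrier S \<Longrightarrow> F (x \<otimes>\<^bsub>S\<^esub> y) = F x \<otimes>\<^bsub>E\<^esub> \<alpha> y + \<alpha> x \<otimes>\<^bsub>E\<^esub> F y"
  using assms unfolding char_der_def by blast+

context coeff_alg
begin

lemma E_null: "x \<in> carrier E \<Longrightarrow> x \<otimes>\<^bsub>E\<^esub> 0 = 0" "x \<in> carrier E \<Longrightarrow> 0 \<otimes>\<^bsub>E\<^esub> x = 0"
  using E_mult(3)[OF E_cl(1), of x 0] E_mult(4)[OF _ E_cl(1), of x 0] by simp_all

lemma char_der_diff:
  assumes S: "dga S" and a: "character smE E S \<alpha>" and F: "char_der smE E S \<alpha> n F"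
  shows "char_der smE E S \<alpha> (n + 1) (F \<circ> diff S)"
proof -
  interpret S: dga S by fact
  note a = characterD[OF a]
  note F = char_derD[OF F]
  have p: "F (diff S (x \<otimes>\<^bsub>S\<^esub> y)) = F (diff S x) \<otimes>\<^bsub>E\<^esub> \<alpha> y + \<alpha> x \<otimes>\<^bsub>E\<^esub> F (diff S y)"
    if "x \<in> carrier S" and y: "y \<in> carrier S" for x y
    using that(1)
  proof (induction x rule: S.hom_induct)
    case (hom i x)
    have x: "x \<in> carrier S" using hom by simp
    have "F (diff S (x \<otimes>\<^bsub>S\<^esub> y)) = F (diff S x) \<otimes>\<^bsub>E\<^esub> \<alpha> y + smE (sg i) (\<alpha> x \<otimes>\<^bsub>E\<^esub> F (diff S y))"
      using x y by (simp add: S.leibniz[OF hom y] F(2,3,5) a(7) E_null F(1) a(1))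
    then show ?case using a(6)[OF hom] E_null(2)[OF F(1)[OF S.diff_carrier[OF y]]] by (cases "i = 0") auto
  next
    case (add x z)
    then show ?case using y
      by (simp add: S.A.l_distr S.diff_add F(1,2) a(1,2) E_mult E_cl algebra_simps)
  qed
  show ?thesis unfolding char_der_def
  proof (intro conjI allI ballI impI)
    show "(F \<circ> diff S) x = 0" if "x \<in> gr S i" "i \<noteq> n + 1" for x i
      using F(4)[OF S.gr_diff[OF that(1)]] that(2) by simp
  qed (use p in \<open>simp_all add: F(1-3) S.diff_add S.diff_smult\<close>)
qed

end

lemma coeff_alg_ground: "coeff_alg (*) (ground :: ('k::field, 'k) module)"
  by (intro coeff_alg.intro coeff_alg_axioms.intro vector_space_mult) (auto simp: ground_def alg_of_def algebra_simps)

lemma linf_char: "character (*) ground S \<alpha> \<Longrightarrow> linf S \<alpha>"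
  by (simp add: character_def linf_def)

lemma linf_der: "char_der (*) ground S \<alpha> n D \<Longrightarrow> linf S D"
  by (simp add: char_der_def linf_def)

lemma char_der_zero: "character (*) ground S \<alpha> \<Longrightarrow> char_der (*) ground S \<alpha> n (\<lambda>_. 0)"
  by (simp add: char_der_def)

context cone_dga
begin

lemma C_eqI: "x \<in> carrier C \<Longrightarrow> y \<in> carrier C \<Longrightarrow> l0 x = l0 y \<Longrightarrow> l1 x = l1 y \<Longrightarrow> l2 x = l2 y \<Longrightarrow> x = y"
  using expa[of x] expa[of y] by simp

lemma bc [simp]: "b0 \<in> carrier C" "b1 \<in> carrier C" "b2 \<in> carrier C"
  using b C.gr_carrier by blast+

lemma ll: "x \<in> carrier C \<Longrightarrow> y \<in> carrier C \<Longrightarrow> l0 (x \<oplus>\<^bsub>C\<^esub> y) = l0 x + l0 y" "x \<in> carrier C \<Longrightarrow> l0 (c \<odot>\<^bsub>C\<^esub> x) = c * l0 x"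
  "x \<in> carrier C \<Longrightarrow> y \<in> carrier C \<Longrightarrow> l1 (x \<oplus>\<^bsub>C\<^esub> y) = l1 x + l1 y" "x \<in> carrier C \<Longrightarrow> l1 (c \<odot>\<^bsub>C\<^esub> x) = c * l1 x"
  "x \<in> carrier C \<Longrightarrow> y \<in> carrier C \<Longrightarrow> l2 (x \<oplus>\<^bsub>C\<^esub> y) = l2 x + l2 y" "x \<in> carrier C \<Longrightarrow> l2 (c \<odot>\<^bsub>C\<^esub> x) = c * l2 x"
  using l by (auto simp: linf_def)

definition vec :: "'k \<Rightarrow> 'k \<Rightarrow> 'k \<Rightarrow> 'c" where
  "vec a u v = a \<odot>\<^bsub>C\<^esub> b0 \<oplus>\<^bsub>C\<^esub> (u \<odot>\<^bsub>C\<^esub> b1 \<oplus>\<^bsub>C\<^esub> v \<odot>\<^bsub>C\<^esub> b2)"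

lemma vec [simp]: "vec a u v \<in> carrier C" "l0 (vec a u v) = a" "l1 (vec a u v) = u" "l2 (vec a u v) = v"
  by (simp_all add: vec_def ll lb)

lemma vec_gr: "(i \<noteq> 0 \<Longrightarrow> a = 0) \<Longrightarrow> (i \<noteq> n \<Longrightarrow> u = 0) \<Longrightarrow> (i \<noteq> n + 1 \<Longrightarrow> v = 0) \<Longrightarrow> vec a u v \<in> gr C i"
proof -
  assume a: "i \<noteq> 0 \<Longrightarrow> a = 0" "i \<noteq> n \<Longrightarrow> u = 0" "i \<noteq> n + 1 \<Longrightarrow> v = 0"
  have "a \<odot>\<^bsub>C\<^esub> b0 \<in> gr C i" using a(1) b(1) by (cases "i = 0") auto
  moreover have "u \<odot>\<^bsub>C\<^esub> b1 \<in> gr C i" using a(2) b(2) by (cases "i = n") auto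
  moreover have "v \<odot>\<^bsub>C\<^esub> b2 \<in> gr C i" using a(3) b(3) by (cases "i = n + 1") auto
  ultimately show ?thesis by (simp add: vec_def)
qed

lemma vec_hom:
  assumes S: "dga S" and a: "character (*) ground S \<chi>" and D: "char_der (*) ground S \<chi> n D"
  shows "restrict (\<lambda>x. vec (\<chi> x) (D x) (D (diff S x))) (carrier S) \<in> dg_hom S C"
proof -
  interpret S: dga S by fact
  note D' = char_derD[OF coeff_alg.char_der_diff[OF coeff_alg_ground S a D], unfolded o_apply]
  note a = characterD[OF a]
  note D = char_derD[OF D]
  show ?thesis
  proof (rule dg_homI)
    show "restrict (\<lambda>x. vec (\<chi> x) (D x) (D (diff S x))) (carrier S) x \<in> gr C i" if "x \<in> gr S i" for x i
      using S.gr_carrier[OF that] a(6)[OF that] D(4)[OF that] D'(4)[OF that] by (auto intro!: vec_gr)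
    show "restrict (\<lambda>x. vec (\<chi> x) (D x) (D (diff S x))) (carrier S) \<one>\<^bsub>S\<^esub> = \<one>\<^bsub>C\<^esub>"
    proof -
      have "D \<one>\<^bsub>S\<^esub> = D \<one>\<^bsub>S\<^esub> + D \<one>\<^bsub>S\<^esub>" using D(5)[of "\<one>\<^bsub>S\<^esub>" "\<one>\<^bsub>S\<^esub>"]
        by (simp only: a(5) ground_simps mult_1_left mult_1_right S.A.one_closed S.A.r_one)
      then have "D \<one>\<^bsub>S\<^esub> = 0" by (metis add_cancel_left_right)
      moreover have "D \<zero>\<^bsub>S\<^esub> = 0" using D(3)[of "\<zero>\<^bsub>S\<^esub>" 0] by simp
      ultimately show ?thesis by (intro C_eqI) (simp_all add: a(5) S.diff_one one lb)
    qed
    show "restrict (\<lambda>x. vec (\<chi> x) (D x) (D (diff S x))) (carrier S) (diff S x) =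
        diff C (restrict (\<lambda>x. vec (\<chi> x) (D x) (D (diff S x))) (carrier S) x)" if "x \<in> carrier S" for x
    proof -
      have "D \<zero>\<^bsub>S\<^esub> = 0" using D(3)[of "\<zero>\<^bsub>S\<^esub>" 0] by simp
      then show ?thesis using that by (intro C_eqI) (simp_all add: a(7) ld)
    qed
  qed (auto intro!: C_eqI simp: a D D' ll lm S.diff_add S.diff_smult)
qed

lemma hom_vec:
  assumes S: "dga S" and g: "g \<in> dg_hom S C"
  shows "character (*) ground S (l0 \<circ> g)" "char_der (*) ground S (l0 \<circ> g) n (l1 \<circ> g)"
    "x \<in> carrier S \<Longrightarrow> l2 (g x) = l1 (g (diff S x))"
proof -
  interpret S: dga S by fact
  note g = dg_homD[OF g]
  show "character (*) ground S (l0 \<circ> g)" unfolding character_def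
    by (auto simp: g(1-5,7) ll lm lb one ld intro: lg(1) g(6))
  show "char_der (*) ground S (l0 \<circ> g) n (l1 \<circ> g)" unfolding char_der_def
    by (auto simp: g(1-5,7) ll lm intro: lg(2) g(6))
  show "x \<in> carrier S \<Longrightarrow> l2 (g x) = l1 (g (diff S x))" by (simp add: g ld)
qed

end

section \<open>Contractions of tensors\<close>

context tensor
begin

lemma TC_obtain:
  assumes "X \<in> carrier TC"
  obtains f where "f \<in> carrier FM" "X = cls f"
  using assms unfolding TC_carrier by blast

lemma TC_gr_carrier: "X \<in> gr TC i \<Longrightarrow> X \<in> carrier TC"
proof -
  assume "X \<in> gr TC i"
  then obtain f where f: "finite (supp f)" "supp f \<subseteq> carrier E \<times> gr C i" "X = cls f" unfolding TC_gr by blast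
  have "supp f \<subseteq> carrier E \<times> carrier C" using f(2) C.gr_carrier by blast
  then have "f \<in> carrier FM" using f(1) by (simp add: FM_simps(1))
  then show ?thesis unfolding f(3) TC_carrier by (rule imageI)
qed

lemma linf_diff: "linf C l \<Longrightarrow> linf C (l \<circ> diff C)"
  by (simp add: linf_def C.diff_add C.diff_smult)

lemma Ctr_ops:
  assumes l: "linf C l" and X: "X \<in> carrier TC"
  shows "Y \<in> carrier TC \<Longrightarrow> Ctr l (X \<oplus>\<^bsub>TC\<^esub> Y) = Ctr l X + Ctr l Y" "Ctr l (c \<odot>\<^bsub>TC\<^esub> X) = smE c (Ctr l X)"
    "Ctr l X \<in> carrier E" "Ctr l (diff TC X) = Ctr (l \<circ> diff C) X"
    "Y \<in> carrier TC \<Longrightarrow> X \<oplus>\<^bsub>TC\<^esub> Y \<in> carrier TC" "c \<odot>\<^bsub>TC\<^esub> X \<in> carrier TC" "diff TC X \<in> carrier TC"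
    "Y \<in> carrier TC \<Longrightarrow> X \<otimes>\<^bsub>TC\<^esub> Y \<in> carrier TC"
proof -
  obtain f where f: "f \<in> carrier FM" "X = cls f" using X by (rule TC_obtain)
  note F = FM_cl(3)[OF f(1)]
  show "Ctr l (X \<oplus>\<^bsub>TC\<^esub> Y) = Ctr l X + Ctr l Y" "X \<oplus>\<^bsub>TC\<^esub> Y \<in> carrier TC" "X \<otimes>\<^bsub>TC\<^esub> Y \<in> carrier TC" if Y: "Y \<in> carrier TC"
  proof -
    obtain g where g: "g \<in> carrier FM" "Y = cls g" using Y by (rule TC_obtain)
    show "Ctr l (X \<oplus>\<^bsub>TC\<^esub> Y) = Ctr l X + Ctr l Y"
      unfolding f(2) g(2) TC_add[OF f(1) g(1)] Ctr_cls[OF l FM_cl(2)[OF f(1) g(1)]] Ctr_cls[OF l f(1)] Ctr_cls[OF l g(1)]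
      by (rule ctr_simps(2)) (use f(1) g(1) in \<open>simp_all add: FM_simps(1)\<close>)
    show "X \<oplus>\<^bsub>TC\<^esub> Y \<in> carrier TC" unfolding f(2) g(2) TC_add[OF f(1) g(1)] TC_carrier
      by (rule imageI) (rule FM_cl(2)[OF f(1) g(1)])
    show "X \<otimes>\<^bsub>TC\<^esub> Y \<in> carrier TC" unfolding f(2) g(2) TC_mult[OF f(1) g(1)] TC_carrier
      by (rule imageI) (rule push2_FM[OF f(1) g(1)])
  qed
  show "Ctr l (c \<odot>\<^bsub>TC\<^esub> X) = smE c (Ctr l X)"
    unfolding f(2) TC_smult[OF f(1)] Ctr_cls[OF l F] Ctr_cls[OF l f(1)] by (rule ctr_simps(3))
  show "c \<odot>\<^bsub>TC\<^esub> X \<in> carrier TC" unfolding f(2) TC_smult[OF f(1)] TC_carrier by (rule imageI) (rule F)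
  show "Ctr l X \<in> carrier E" unfolding f(2) Ctr_cls[OF l f(1)] by (rule ctr_E[OF f(1)])
  show "Ctr l (diff TC X) = Ctr (l \<circ> diff C) X"
    unfolding f(2) TC_diff(1)[OF f(1)] Ctr_cls[OF l TC_diff(2)[OF f(1)]] Ctr_cls[OF linf_diff[OF l] f(1)]
    by (rule TC_diff(3)[OF f(1)])
  show "diff TC X \<in> carrier TC" unfolding f(2) TC_diff(1)[OF f(1)] TC_carrier by (rule imageI) (rule TC_diff(2)[OF f(1)])
qed

lemma Ctr_mult:
  assumes l: "linf C l" "linf C l1" "linf C l2" "linf C l3" "linf C l4" and X: "X \<in> carrier TC" and Y: "Y \<in> carrier TC"
    and m: "\<And>y y'. y \<in> carrier C \<Longrightarrow> y' \<in> carrier C \<Longrightarrow> l (y \<otimes>\<^bsub>C\<^esub> y') = l1 y * l2 y' + l3 y * l4 y'"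
  shows "Ctr l (X \<otimes>\<^bsub>TC\<^esub> Y) = Ctr l1 X \<otimes>\<^bsub>E\<^esub> Ctr l2 Y + Ctr l3 X \<otimes>\<^bsub>E\<^esub> Ctr l4 Y"
proof -
  obtain f where f: "f \<in> carrier FM" "X = cls f" using X by (rule TC_obtain)
  obtain g where g: "g \<in> carrier FM" "Y = cls g" using Y by (rule TC_obtain)
  show ?thesis
    unfolding f(2) g(2) TC_mult[OF f(1) g(1)] Ctr_cls[OF l(1) push2_FM[OF f(1) g(1)]]
      Ctr_cls[OF l(2) f(1)] Ctr_cls[OF l(3) g(1)] Ctr_cls[OF l(4) f(1)] Ctr_cls[OF l(5) g(1)]
    by (rule ctr_push2[OF f(1) g(1)]) (rule m)
qed

lemma Ctr_mult1:
  assumes l: "linf C l" and X: "X \<in> carrier TC" and Y: "Y \<in> carrier TC"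
    and m: "\<And>y y'. y \<in> carrier C \<Longrightarrow> y' \<in> carrier C \<Longrightarrow> l (y \<otimes>\<^bsub>C\<^esub> y') = l y * l y'"
  shows "Ctr l (X \<otimes>\<^bsub>TC\<^esub> Y) = Ctr l X \<otimes>\<^bsub>E\<^esub> Ctr l Y"
proof -
  have z: "linf C (\<lambda>_. 0)" by (simp add: linf_def)
  have "Ctr (\<lambda>_. 0) Z = 0" for Z by (simp add: Ctr_def ctr_def lin_def)
  then show ?thesis using Ctr_mult[OF l l l z z X Y, unfolded mult_zero_left add_0_right, OF m] E_null(1)[OF E_cl(1)] by simp
qed

lemma Ctr_one: "linf C l \<Longrightarrow> Ctr l \<one>\<^bsub>TC\<^esub> = smE (l \<one>\<^bsub>C\<^esub>) \<one>\<^bsub>E\<^esub>" "\<one>\<^bsub>TC\<^esub> \<in> carrier TC"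
proof -
  have s: "single (\<one>\<^bsub>E\<^esub>, \<one>\<^bsub>C\<^esub>) \<in> carrier FM" by (rule FM_cl(5)) (simp_all add: E_cl)
  show "linf C l \<Longrightarrow> Ctr l \<one>\<^bsub>TC\<^esub> = smE (l \<one>\<^bsub>C\<^esub>) \<one>\<^bsub>E\<^esub>" unfolding TC_one by (simp add: Ctr_cls[OF _ s] ctr_simps)
  show "\<one>\<^bsub>TC\<^esub> \<in> carrier TC" unfolding TC_one TC_carrier using s by blast
qed

lemma Ctr_gr:
  assumes l: "linf C l" and X: "X \<in> gr TC i" and z: "\<And>y. y \<in> gr C i \<Longrightarrow> l y = 0"
  shows "Ctr l X = 0"
proof -
  obtain f where f: "finite (supp f)" "supp f \<subseteq> carrier E \<times> gr C i" "X = cls f" using X unfolding TC_gr by blast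
  have "supp f \<subseteq> carrier E \<times> carrier C" using f(2) C.gr_carrier by blast
  then have F: "f \<in> carrier FM" using f(1) by (simp add: FM_simps(1))
  have "ctr l f = 0" unfolding ctr_def lin_def
  proof (rule sum.neutral, rule ballI)
    fix p assume "p \<in> supp f"
    then have "snd p \<in> gr C i" using f(2) by auto
    then show "smE (f p) (smE (l (snd p)) (fst p)) = 0" using z by simp
  qed
  then show ?thesis unfolding f(3) Ctr_cls[OF l F] .
qed

lemma Ctr_lin:
  assumes l: "linf C l" "linf C l'" and X: "X \<in> carrier TC"
  shows "(\<And>y. y \<in> carrier C \<Longrightarrow> l y = l' y) \<Longrightarrow> Ctr l X = Ctr l' X"
    "Ctr (\<lambda>y. l y + l' y) X = Ctr l X + Ctr l' X" "Ctr (\<lambda>y. c * l y) X = smE c (Ctr l X)"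
proof -
  obtain f where f: "f \<in> carrier FM" "X = cls f" using X by (rule TC_obtain)
  have s: "linf C (\<lambda>y. l y + l' y)" "linf C (\<lambda>y. c * l y)" using l by (auto simp: linf_def algebra_simps)
  show "Ctr l X = Ctr l' X" if "\<And>y. y \<in> carrier C \<Longrightarrow> l y = l' y"
  proof -
    have "l (snd p) = l' (snd p)" if "p \<in> supp f" for p using f(1) that \<open>\<And>y. y \<in> carrier C \<Longrightarrow> l y = l' y\<close> unfolding FM_simps(1) by auto
    then show ?thesis unfolding f(2) Ctr_cls[OF l(1) f(1)] Ctr_cls[OF l(2) f(1)] ctr_def lin_def by simp
  qed
  show "Ctr (\<lambda>y. l y + l' y) X = Ctr l X + Ctr l' X"
    unfolding f(2) Ctr_cls[OF l(1) f(1)] Ctr_cls[OF l(2) f(1)] Ctr_cls[OF s(1) f(1)] ctr_def lin_def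
    by (simp add: VE.scale_left_distrib VE.scale_right_distrib sum.distrib)
  show "Ctr (\<lambda>y. c * l y) X = smE c (Ctr l X)"
    unfolding f(2) Ctr_cls[OF l(1) f(1)] Ctr_cls[OF s(2) f(1)] ctr_def lin_def VE.scale_sum_right
    by (simp add: mult.commute mult.left_commute)
qed

end

lemma tensor_map_Ctr:
  fixes smE :: "'k::field \<Rightarrow> 'e \<Rightarrow> 'e::ab_group_add" and C :: "('k, 'c) dga" and D :: "('k, 'd) dga"
  assumes C: "tensor smE E C" and D: "tensor smE E D"
    and g: "\<And>x. x \<in> carrier D \<Longrightarrow> g x \<in> carrier C"
      "\<And>x y. x \<in> carrier D \<Longrightarrow> y \<in> carrier D \<Longrightarrow> g (x \<oplus>\<^bsub>D\<^esub> y) = g x \<oplus>\<^bsub>C\<^esub> g y"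
      "\<And>c x. x \<in> carrier D \<Longrightarrow> g (c \<odot>\<^bsub>D\<^esub> x) = c \<odot>\<^bsub>C\<^esub> g x"
    and X: "X \<in> carrier (tensor_dga E D)"
  shows "tensor_map E C g X \<in> carrier (tensor_dga E C)"
    "linf C l \<Longrightarrow> tensor.Ctr smE l (tensor_map E C g X) = tensor.Ctr smE (l \<circ> g) X"
proof -
  interpret C: tensor smE E C by fact
  interpret D: tensor smE E D by fact
  obtain f where f: "f \<in> carrier D.FM" "X = D.cls f" using X by (rule D.TC_obtain)
  have t: "tensor_map E C g (D.cls f) = C.cls (push (map_prod id g) f)" "push (map_prod id g) f \<in> carrier C.FM"
    "C.ctr l (push (map_prod id g) f) = D.ctr (l \<circ> g) f" for l
    by (rule tensor_map_cls[OF C D]; (rule g f(1))?; assumption?)+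
  show "tensor_map E C g X \<in> carrier (tensor_dga E C)" unfolding f(2) t(1) C.TC_carrier by (rule imageI) (rule t(2))
  show "C.Ctr l (tensor_map E C g X) = D.Ctr (l \<circ> g) X" if l: "linf C l"
  proof -
    have l': "linf D (l \<circ> g)" using l g by (simp add: linf_def)
    show ?thesis unfolding f(2) t(1) C.Ctr_cls[OF l t(2)] D.Ctr_cls[OF l' f(1)] by (rule t(3))
  qed
qed

locale tensor_cone = tensor smE E C + cone_dga C n b0 b1 b2 l0 l1 l2
  for smE :: "'k::field \<Rightarrow> 'e \<Rightarrow> 'e::ab_group_add" and E :: "('k, 'e) module" and C :: "('k, 'c) dga" and n b0 b1 b2 l0 l1 l2
begin

lemma TC_eqI:
  assumes X: "X \<in> carrier TC" and Y: "Y \<in> carrier TC" and c: "Ctr l0 X = Ctr l0 Y" "Ctr l1 X = Ctr l1 Y" "Ctr l2 X = Ctr l2 Y"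
  shows "X = Y"
proof -
  obtain f where f: "f \<in> carrier FM" "X = cls f" using X by (rule TC_obtain)
  obtain g where g: "g \<in> carrier FM" "Y = cls g" using Y by (rule TC_obtain)
  note c' = c[unfolded f(2) g(2) Ctr_cls[OF l(1) f(1)] Ctr_cls[OF l(2) f(1)] Ctr_cls[OF l(3) f(1)]
      Ctr_cls[OF l(1) g(1)] Ctr_cls[OF l(2) g(1)] Ctr_cls[OF l(3) g(1)]]
  show ?thesis unfolding f(2) g(2)
    by (rule cls_eq_ctr[where ?l0.0 = l0 and ?l1.0 = l1 and ?l2.0 = l2 and ?b0.0 = b0 and ?b1.0 = b1 and ?b2.0 = b2])
      (rule l bc f(1) g(1) c' | erule expa)+
qed

definition tvec :: "'e \<Rightarrow> 'e \<Rightarrow> 'e \<Rightarrow> ('e \<times> 'c \<Rightarrow> 'k) set" where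
  "tvec e0 e1 e2 = cls (\<lambda>q. single (e0, b0) q + (single (e1, b1) q + single (e2, b2) q))"

lemma tvec:
  assumes "e0 \<in> carrier E" "e1 \<in> carrier E" "e2 \<in> carrier E"
  shows "tvec e0 e1 e2 \<in> carrier TC" "Ctr l0 (tvec e0 e1 e2) = e0" "Ctr l1 (tvec e0 e1 e2) = e1" "Ctr l2 (tvec e0 e1 e2) = e2"
proof -
  have F: "(\<lambda>q. single (e0, b0) q + (single (e1, b1) q + single (e2, b2) q)) \<in> carrier FM"
    by (intro FM_cl(2) FM_cl(5)) (use assms in simp_all)
  then show "tvec e0 e1 e2 \<in> carrier TC" unfolding tvec_def TC_carrier by (rule imageI)
  show "Ctr l0 (tvec e0 e1 e2) = e0" "Ctr l1 (tvec e0 e1 e2) = e1" "Ctr l2 (tvec e0 e1 e2) = e2"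
    unfolding tvec_def Ctr_cls[OF l(1) F] Ctr_cls[OF l(2) F] Ctr_cls[OF l(3) F] by (simp_all add: ctr_simps lb)
qed

lemma tvec_gr:
  assumes e: "e0 \<in> carrier E" "e1 \<in> carrier E" "e2 \<in> carrier E"
    and z: "i \<noteq> 0 \<Longrightarrow> e0 = 0" "i \<noteq> n \<Longrightarrow> e1 = 0" "i \<noteq> n + 1 \<Longrightarrow> e2 = 0"
  shows "tvec e0 e1 e2 \<in> gr TC i"
proof -
  define f where "f = (\<lambda>q. (if i = 0 then 1 else 0) * single (e0, b0) q +
    ((if i = n then 1 else 0) * single (e1, b1) q + (if i = n + 1 then 1 else 0) * single (e2, b2) q) :: 'k)"
  have s: "supp f \<subseteq> {p. (i = 0 \<and> p = (e0, b0)) \<or> (i = n \<and> p = (e1, b1)) \<or> (i = n + 1 \<and> p = (e2, b2))}"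
    by (auto simp: supp_def f_def single_def split: if_splits)
  moreover have "\<dots> \<subseteq> carrier E \<times> gr C i" using e b by auto
  ultimately have s2: "supp f \<subseteq> carrier E \<times> gr C i" by (rule subset_trans)
  have fin: "finite (supp f)" by (rule finite_subset[of _ "{(e0, b0), (e1, b1), (e2, b2)}"]) (use s in auto)
  have mem: "cls f \<in> gr TC i" unfolding TC_gr using s2 fin by blast
  have F: "f \<in> carrier FM" unfolding f_def by (intro FM_cl(2) FM_cl(3) FM_cl(5)) (use e in simp_all)
  have "tvec e0 e1 e2 = cls f"
  proof (rule TC_eqI[OF tvec(1)[OF e] TC_gr_carrier[OF mem]])
    show "Ctr l0 (tvec e0 e1 e2) = Ctr l0 (cls f)" "Ctr l1 (tvec e0 e1 e2) = Ctr l1 (cls f)" "Ctr l2 (tvec e0 e1 e2) = Ctr l2 (cls f)"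
      unfolding tvec[OF e] Ctr_cls[OF l(1) F] Ctr_cls[OF l(2) F] Ctr_cls[OF l(3) F]
      using z by (simp_all add: f_def ctr_simps lb)
  qed
  then show ?thesis using mem by simp
qed

lemma tvec_hom:
  assumes S: "dga S" and a: "character smE E S \<alpha>" and F: "char_der smE E S \<alpha> n F" and one_neutral: "\<one>\<^bsub>E\<^esub> \<otimes>\<^bsub>E\<^esub> F \<one>\<^bsub>S\<^esub> = F \<one>\<^bsub>S\<^esub>" "F \<one>\<^bsub>S\<^esub> \<otimes>\<^bsub>E\<^esub> \<one>\<^bsub>E\<^esub> = F \<one>\<^bsub>S\<^esub>"
  shows "restrict (\<lambda>x. tvec (\<alpha> x) (F x) (F (diff S x))) (carrier S) \<in> dg_hom S TC" (is "?\<Phi> \<in> _")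
proof -
  interpret S: dga S by fact
  note F' = char_derD[OF char_der_diff[OF S a F], unfolded o_apply]
  note a = characterD[OF a]
  note F = char_derD[OF F]
  have t: "tvec (\<alpha> x) (F x) (F (diff S x)) \<in> carrier TC" "Ctr l0 (tvec (\<alpha> x) (F x) (F (diff S x))) = \<alpha> x"
    "Ctr l1 (tvec (\<alpha> x) (F x) (F (diff S x))) = F x" "Ctr l2 (tvec (\<alpha> x) (F x) (F (diff S x))) = F (diff S x)" if "x \<in> carrier S" for x
    by (intro tvec a(1) F(1) F'(1) that)+
  have p: "?\<Phi> x \<in> carrier TC" "Ctr l0 (?\<Phi> x) = \<alpha> x" "Ctr l1 (?\<Phi> x) = F x" "Ctr l2 (?\<Phi> x) = F (diff S x)" if "x \<in> carrier S" for x
    using t[OF that] that by simp_all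
  have F0: "F \<zero>\<^bsub>S\<^esub> = 0" using F(3)[of "\<zero>\<^bsub>S\<^esub>" 0] by simp
  have zl: "linf C (\<lambda>_. 0)" by (simp add: linf_def)
  have z: "Ctr (\<lambda>_. 0) X = 0" for X by (simp add: Ctr_def ctr_def lin_def)
  have dl: "Ctr (l0 \<circ> diff C) X = 0" "Ctr (l1 \<circ> diff C) X = Ctr l2 X" "Ctr (l2 \<circ> diff C) X = 0" if "X \<in> carrier TC" for X
    using Ctr_lin(1)[OF linf_diff[OF l(1)] zl that] Ctr_lin(1)[OF linf_diff[OF l(2)] l(3) that]
      Ctr_lin(1)[OF linf_diff[OF l(3)] zl that] z by (simp_all add: ld)
  show ?thesis
  proof (rule dg_homI)
    fix x assume x: "x \<in> carrier S"
    show "?\<Phi> x \<in> carrier TC" by (rule p[OF x])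
    have dx: "diff S x \<in> carrier S" using x by simp
    show "?\<Phi> (diff S x) = diff TC (?\<Phi> x)"
      by (rule TC_eqI[OF p(1)[OF dx] Ctr_ops(7)[OF l(1) p(1)[OF x]]])
        (simp_all only: Ctr_ops(4)[OF l(1) p(1)[OF x]] Ctr_ops(4)[OF l(2) p(1)[OF x]] Ctr_ops(4)[OF l(3) p(1)[OF x]]
          p[OF dx] p[OF x] dl[OF p(1)[OF x]] a(7)[OF x] S.diff_diff[OF x] F0)
    show "?\<Phi> (c \<odot>\<^bsub>S\<^esub> x) = c \<odot>\<^bsub>TC\<^esub> ?\<Phi> x" for c
    proof -
      have cx: "c \<odot>\<^bsub>S\<^esub> x \<in> carrier S" using x by simp
      show ?thesis
        by (rule TC_eqI[OF p(1)[OF cx] Ctr_ops(6)[OF l(1) p(1)[OF x]]])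
          (simp_all only: Ctr_ops(2)[OF l(1) p(1)[OF x]] Ctr_ops(2)[OF l(2) p(1)[OF x]] Ctr_ops(2)[OF l(3) p(1)[OF x]]
            p[OF cx] p[OF x] a(3)[OF x] F(3)[OF x] F'(3)[OF x])
    qed
    fix y assume y: "y \<in> carrier S"
    have xy: "x \<oplus>\<^bsub>S\<^esub> y \<in> carrier S" "x \<otimes>\<^bsub>S\<^esub> y \<in> carrier S" using x y by simp_all
    show "?\<Phi> (x \<oplus>\<^bsub>S\<^esub> y) = ?\<Phi> x \<oplus>\<^bsub>TC\<^esub> ?\<Phi> y"
      by (rule TC_eqI[OF p(1)[OF xy(1)] Ctr_ops(5)[OF l(1) p(1)[OF x] p(1)[OF y]]])
        (simp_all only: Ctr_ops(1)[OF l(1) p(1)[OF x] p(1)[OF y]] Ctr_ops(1)[OF l(2) p(1)[OF x] p(1)[OF y]]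
          Ctr_ops(1)[OF l(3) p(1)[OF x] p(1)[OF y]] p[OF xy(1)] p[OF x] p[OF y] a(2)[OF x y] F(2)[OF x y] F'(2)[OF x y])
    have m: "Ctr l0 (?\<Phi> x \<otimes>\<^bsub>TC\<^esub> ?\<Phi> y) = \<alpha> x \<otimes>\<^bsub>E\<^esub> \<alpha> y"
      "Ctr l1 (?\<Phi> x \<otimes>\<^bsub>TC\<^esub> ?\<Phi> y) = F x \<otimes>\<^bsub>E\<^esub> \<alpha> y + \<alpha> x \<otimes>\<^bsub>E\<^esub> F y"
      "Ctr l2 (?\<Phi> x \<otimes>\<^bsub>TC\<^esub> ?\<Phi> y) = F (diff S x) \<otimes>\<^bsub>E\<^esub> \<alpha> y + \<alpha> x \<otimes>\<^bsub>E\<^esub> F (diff S y)"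
      using Ctr_mult1[OF l(1) p(1)[OF x] p(1)[OF y] lm(1)] Ctr_mult[OF l(2,2,1,1,2) p(1)[OF x] p(1)[OF y] lm(2)]
        Ctr_mult[OF l(3,3,1,1,3) p(1)[OF x] p(1)[OF y] lm(3)] unfolding p[OF x] p[OF y] by blast+
    show "?\<Phi> (x \<otimes>\<^bsub>S\<^esub> y) = ?\<Phi> x \<otimes>\<^bsub>TC\<^esub> ?\<Phi> y"
      by (rule TC_eqI[OF p(1)[OF xy(2)] Ctr_ops(8)[OF l(1) p(1)[OF x] p(1)[OF y]]])
        (simp_all only: m p[OF xy(2)] a(4)[OF x y] F(5)[OF x y] F'(5)[OF x y])
  next
    have o: "\<one>\<^bsub>S\<^esub> \<in> carrier S" by simp
    have "F \<one>\<^bsub>S\<^esub> = 0" using F(5)[OF o o] a(5) one_neutral by simp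
    then show "?\<Phi> \<one>\<^bsub>S\<^esub> = \<one>\<^bsub>TC\<^esub>"
      by (intro TC_eqI[OF p(1)[OF o] Ctr_one(2)]) (simp_all only: p[OF o] Ctr_one(1)[OF l(1)] Ctr_one(1)[OF l(2)] Ctr_one(1)[OF l(3)]
        a(5) S.diff_one F0 one lb VE.scale_zero_left VE.scale_one)
    show "?\<Phi> x \<in> gr TC i" if x: "x \<in> gr S i" for x i
      using S.gr_carrier[OF x] a(6)[OF x] F(4)[OF x] F'(4)[OF x] a(1) F(1) F'(1) by (auto intro!: tvec_gr)
    show "?\<Phi> \<in> extensional (carrier S)" by simp
  qed
qed

end

section \<open>Derivations of the representing algebra\<close>

abbreviation Kd :: "('k::field, 'k) dga" where
  "Kd \<equiv> in_degree_0 ground"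

lemma Kd_simps:
  "carrier (Kd :: ('k::field, 'k) dga) = UNIV" "x \<oplus>\<^bsub>(Kd :: ('k, 'k) dga)\<^esub> y = x + y" "x \<otimes>\<^bsub>(Kd :: ('k, 'k) dga)\<^esub> y = x * y"
  "\<zero>\<^bsub>(Kd :: ('k, 'k) dga)\<^esub> = 0" "\<one>\<^bsub>(Kd :: ('k, 'k) dga)\<^esub> = 1" "c \<odot>\<^bsub>(Kd :: ('k, 'k) dga)\<^esub> x = c * x"
  "gr (Kd :: ('k, 'k) dga) i = (if i = 0 then UNIV else {0})" "diff (Kd :: ('k, 'k) dga) x = 0"
  by (simp_all add: in_degree_0_def module.defs)

lemma Kd_dg_space: "dg_space (Kd :: ('k::field, 'k) dga)"
  by (rule in_degree_0_dg_space) (use module_alg_of[OF vector_space_mult] in \<open>simp add: ground_def\<close>)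

lemma Kd_dga: "dg_algebra (Kd :: ('k::field, 'k) dga)"
  by (rule dg_algebraI[OF Kd_dg_space]) (auto simp: Kd_simps algebra_simps split: if_splits)

lemma Kd_minus: "x \<ominus>\<^bsub>(Kd :: ('k::field, 'k) dga)\<^esub> y = x - y"
proof -
  interpret Kd: dgs "Kd :: ('k, 'k) dga" by unfold_locales (rule Kd_dg_space)
  show ?thesis by (subst Kd.minus_eq') (simp_all add: Kd_simps)
qed

lemma der_diff_eq: "dg_der_diff S Kd m D = (\<lambda>x. if x \<in> carrier S then - (sg m * D (diff S x)) else 0)"
  by (rule ext) (simp add: dg_der_diff_def Kd_minus Kd_simps(4,6,8))

locale derived_rep = tangent sA R \<epsilon> smE Ec le re + coeff_alg smE E
  for sA :: "'k::field_char_0 \<Rightarrow> 'a \<Rightarrow> 'a::ring_1" and R :: "('k, 'u) dga" (structure) and \<epsilon> :: "'u \<Rightarrow> 'a"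
    and smE :: "'k \<Rightarrow> 'e \<Rightarrow> 'e::ab_group_add" and Ec le re and E :: "('k, 'e) module" +
  fixes r :: "'a \<Rightarrow> 'e" and RV :: "('k, 'u) dga" and \<pi> :: "'u \<Rightarrow> ('e \<times> 'u \<Rightarrow> 'k) set" and \<rho>V :: "'u \<Rightarrow> 'k"
  assumes Ec_E: "Ec = carrier E" and le_r: "le a x = r a \<otimes>\<^bsub>E\<^esub> x" and re_r: "re x a = x \<otimes>\<^bsub>E\<^esub> r a"
    and r: "r a \<in> carrier E" "r (a + b) = r a + r b" "r (sA c a) = smE c (r a)" "r (a * b) = r a \<otimes>\<^bsub>E\<^esub> r b" "r 1 = \<one>\<^bsub>E\<^esub>"
    and E_unit: "x \<in> carrier E \<Longrightarrow> \<one>\<^bsub>E\<^esub> \<otimes>\<^bsub>E\<^esub> x = x" "x \<in> carrier E \<Longrightarrow> x \<otimes>\<^bsub>E\<^esub> \<one>\<^bsub>E\<^esub> = x"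
    and rep: "represents R E RV \<pi>" and cor: "corresponds R E RV \<pi> (r \<circ> \<epsilon>) \<rho>V"
begin

abbreviation "kder \<equiv> char_der (*) ground RV \<rho>V"
abbreviation "cycles n \<equiv> dg_der_cycles RV \<rho>V Kd (- n)"
abbreviation "boundaries n \<equiv> dg_der_boundaries RV \<rho>V Kd (- n)"

sublocale RV: dga RV
  by unfold_locales (use rep in \<open>simp add: represents_def\<close>)

sublocale TV: tensor smE E RV
  by unfold_locales

sublocale TK: tensor smE E Kd
  by (intro tensor.intro dga.intro Kd_dga) unfold_locales

lemma TV: "tensor smE E RV" and TK: "tensor smE E Kd"
  by unfold_locales

lemma pi_hom: "\<pi> \<in> dg_hom R (tensor_dga E RV)"
  using rep by (simp add: represents_def)

lemmas pi = dg_homD[OF pi_hom]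

lemma rhoV_hom: "\<rho>V \<in> dg_hom RV Kd"
  using cor by (simp add: corresponds_def)

lemma char_rhoV: "character (*) ground RV \<rho>V"
proof -
  note h = dg_homD[OF rhoV_hom, unfolded Kd_simps]
  have "\<rho>V x = 0" if "x \<in> gr RV i" "i \<noteq> 0" for x i using h(6)[OF that(1)] that(2) by simp
  then show ?thesis unfolding character_def by (simp add: h)
qed

lemma char_r: "character smE E R (r \<circ> \<epsilon>)"
proof -
  have "r 0 = 0" using r(3)[of 0 0] by simp
  then show ?thesis unfolding character_def by (auto simp: r eps_add eps_sm eps_mult eps_gr)
qed

lemma H_Ctr:
  assumes C: "tensor smE E C" and g: "g \<in> dg_hom RV C" and x: "x \<in> carrier R"
  shows "tensor_map E C g (\<pi> x) \<in> carrier (tensor_dga E C)"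
    "linf C l \<Longrightarrow> tensor.Ctr smE l (tensor_map E C g (\<pi> x)) = TV.Ctr (l \<circ> g) (\<pi> x)"
proof -
  note h = dg_homD(1,2,5)[OF g]
  show "tensor_map E C g (\<pi> x) \<in> carrier (tensor_dga E C)"
    by (rule tensor_map_Ctr(1)[OF C TV]) (rule h pi(1)[OF x] | assumption)+
  show "linf C l \<Longrightarrow> tensor.Ctr smE l (tensor_map E C g (\<pi> x)) = TV.Ctr (l \<circ> g) (\<pi> x)"
    by (rule tensor_map_Ctr(2)[OF C TV]) (rule h pi(1)[OF x] | assumption)+
qed

text \<open>
  Contracting the defining equation of \<open>\<rho>\<^sub>V\<close> with the identity of \<open>k\<close>.
\<close>

lemma Ctr_rhoV: "x \<in> carrier R \<Longrightarrow> TV.Ctr \<rho>V (\<pi> x) = r (\<epsilon> x)"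
proof -
  assume x: "x \<in> carrier R"
  have l: "linf Kd id" by (simp add: linf_def Kd_simps)
  have s: "single (r (\<epsilon> x), 1) \<in> carrier TK.FM" by (rule TK.FM_cl(5)) (simp_all add: r Kd_simps)
  have "TV.Ctr \<rho>V (\<pi> x) = TK.Ctr id (tensor_map E Kd \<rho>V (\<pi> x))"
    by (subst H_Ctr(2)[OF TK rhoV_hom x l]) simp
  also have "\<dots> = TK.Ctr id (TK.cls (single (r (\<epsilon> x), 1)))"
    using cor x by (simp add: corresponds_def pure_tensor_def)
  also have "\<dots> = r (\<epsilon> x)" unfolding TK.Ctr_cls[OF l s] TK.ctr_simps(1) by simp
  finally show ?thesis .
qed

lemma Ctr_der:
  assumes D: "kder n D"
  shows "char_der smE E R (r \<circ> \<epsilon>) n (\<lambda>x. TV.Ctr D (\<pi> x))"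
  unfolding char_der_def
proof (intro conjI ballI allI impI)
  note l = linf_der[OF D] and lr = linf_char[OF char_rhoV]
  fix x assume x: "x \<in> carrier R"
  show "TV.Ctr D (\<pi> x) \<in> carrier E" by (rule TV.Ctr_ops(3)[OF l pi(1)[OF x]])
  show "TV.Ctr D (\<pi> (c \<odot> x)) = smE c (TV.Ctr D (\<pi> x))" for c
    unfolding pi(5)[OF x] by (rule TV.Ctr_ops(2)[OF l pi(1)[OF x]])
  fix y assume y: "y \<in> carrier R"
  show "TV.Ctr D (\<pi> (x \<oplus> y)) = TV.Ctr D (\<pi> x) + TV.Ctr D (\<pi> y)"
    unfolding pi(2)[OF x y] by (rule TV.Ctr_ops(1)[OF l pi(1)[OF x] pi(1)[OF y]])
  show "TV.Ctr D (\<pi> (x \<otimes> y)) = TV.Ctr D (\<pi> x) \<otimes>\<^bsub>E\<^esub> (r \<circ> \<epsilon>) y + (r \<circ> \<epsilon>) x \<otimes>\<^bsub>E\<^esub> TV.Ctr D (\<pi> y)"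
    unfolding pi(3)[OF x y] o_apply Ctr_rhoV[OF x, symmetric] Ctr_rhoV[OF y, symmetric]
    by (rule TV.Ctr_mult[OF l l lr lr l pi(1)[OF x] pi(1)[OF y]]) (simp add: char_derD(5)[OF D])
next
  fix i x assume x: "x \<in> gr R i" "i \<noteq> n"
  show "TV.Ctr D (\<pi> x) = 0"
    by (rule TV.Ctr_gr[OF linf_der[OF D] pi(6)[OF x(1)]]) (rule char_derD(4)[OF D _ x(2)])
qed

lemma Ctr_diff: "linf RV D \<Longrightarrow> x \<in> carrier R \<Longrightarrow> TV.Ctr (D \<circ> diff RV) (\<pi> x) = TV.Ctr D (\<pi> (diff R x))"
  using TV.Ctr_ops(4)[of D "\<pi> x"] pi(1)[of x] pi(7)[of x] by simp

text \<open>
  A character and a derivation form one homomorphism \<open>R\<^sub>V \<rightarrow> C\<close> into the test algebra, and their contractions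
  are the coordinates of the corresponding homomorphism \<open>R \<rightarrow> E \<otimes> C\<close>. The universal property is injective.
\<close>

lemma rep_inj:
  assumes c: "character (*) ground RV \<chi>" "character (*) ground RV \<chi>'"
    and D: "char_der (*) ground RV \<chi> n D" "char_der (*) ground RV \<chi>' n D'"
    and e: "\<And>x. x \<in> carrier R \<Longrightarrow> TV.Ctr \<chi> (\<pi> x) = TV.Ctr \<chi>' (\<pi> x)" "\<And>x. x \<in> carrier R \<Longrightarrow> TV.Ctr D (\<pi> x) = TV.Ctr D' (\<pi> x)"
    and y: "y \<in> carrier RV"
  shows "\<chi> y = \<chi>' y" "D y = D' y"
proof -
  obtain C :: "('k, 'u) dga" and b0 b1 b2 l0 l1 l2 where "cone_dga C n b0 b1 b2 l0 l1 l2"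
    using cone_dga_exists[OF inf unit_inj] by blast
  then interpret C: cone_dga C n b0 b1 b2 l0 l1 l2 .
  interpret TC: tensor_cone smE E C n b0 b1 b2 l0 l1 l2 by unfold_locales
  have T: "tensor smE E C" by unfold_locales
  let ?g = "\<lambda>\<chi> D. restrict (\<lambda>x. C.vec (\<chi> x) (D x) (D (diff RV x))) (carrier RV)"
  have RVd: "dga RV" by unfold_locales
  have g: "?g \<chi> D \<in> dg_hom RV C" "?g \<chi>' D' \<in> dg_hom RV C" by (rule C.vec_hom[OF RVd c(1) D(1)] C.vec_hom[OF RVd c(2) D(2)])+
  have k: "TC.Ctr l0 (tensor_map E C (?g \<chi> D) (\<pi> x)) = TV.Ctr \<chi> (\<pi> x)"
    "TC.Ctr l1 (tensor_map E C (?g \<chi> D) (\<pi> x)) = TV.Ctr D (\<pi> x)"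
    "TC.Ctr l2 (tensor_map E C (?g \<chi> D) (\<pi> x)) = TV.Ctr D (\<pi> (diff R x))"
    if "?g \<chi> D \<in> dg_hom RV C" "character (*) ground RV \<chi>" "char_der (*) ground RV \<chi> n D" "x \<in> carrier R" for \<chi> D x
  proof -
    note l = linf_char[OF that(2)] linf_der[OF that(3)]
    have lg: "linf RV (l0 \<circ> ?g \<chi> D)" "linf RV (l1 \<circ> ?g \<chi> D)" "linf RV (l2 \<circ> ?g \<chi> D)"
      using l TV.linf_diff[OF l(2)] unfolding linf_def by auto
    show "TC.Ctr l0 (tensor_map E C (?g \<chi> D) (\<pi> x)) = TV.Ctr \<chi> (\<pi> x)"
      unfolding H_Ctr(2)[OF T that(1,4) C.l(1)] by (rule TV.Ctr_lin(1)[OF lg(1) l(1) pi(1)[OF that(4)]]) simp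
    show "TC.Ctr l1 (tensor_map E C (?g \<chi> D) (\<pi> x)) = TV.Ctr D (\<pi> x)"
      unfolding H_Ctr(2)[OF T that(1,4) C.l(2)] by (rule TV.Ctr_lin(1)[OF lg(2) l(2) pi(1)[OF that(4)]]) simp
    show "TC.Ctr l2 (tensor_map E C (?g \<chi> D) (\<pi> x)) = TV.Ctr D (\<pi> (diff R x))"
      unfolding H_Ctr(2)[OF T that(1,4) C.l(3)] Ctr_diff[OF l(2) that(4), symmetric]
      by (rule TV.Ctr_lin(1)[OF lg(3) TV.linf_diff[OF l(2)] pi(1)[OF that(4)]]) simp
  qed
  have "tensor_map E C (?g \<chi> D) (\<pi> x) = tensor_map E C (?g \<chi>' D') (\<pi> x)" if x: "x \<in> carrier R" for x
    by (rule TC.TC_eqI[OF H_Ctr(1)[OF T g(1) x] H_Ctr(1)[OF T g(2) x]])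
      (simp_all only: k[OF g(1) c(1) D(1) x] k[OF g(2) c(2) D(2) x] e x R.diff_carrier)
  then have eq: "restrict (tensor_map E C (?g \<chi> D) \<circ> \<pi>) (carrier R) = restrict (tensor_map E C (?g \<chi>' D') \<circ> \<pi>) (carrier R)"
    by (intro restrict_ext) simp
  have "inj_on (\<lambda>g. restrict (tensor_map E C g \<circ> \<pi>) (carrier R)) (dg_hom RV C)"
    using rep C.com C.C.dga unfolding represents_def bij_betw_def by blast
  from inj_onD[OF this eq g] have "?g \<chi> D = ?g \<chi>' D'" .
  then have "?g \<chi> D y = ?g \<chi>' D' y" by (rule fun_cong)
  then have "C.vec (\<chi> y) (D y) (D (diff RV y)) = C.vec (\<chi>' y) (D' y) (D' (diff RV y))" using y by simp
  then show "\<chi> y = \<chi>' y" "D y = D' y" by (metis C.vec(2), metis C.vec(3))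
qed

lemma char_der_cong:
  assumes "char_der (*) ground RV \<chi> n D" "\<And>x. x \<in> carrier RV \<Longrightarrow> \<chi> x = \<chi>' x" "\<And>x. x \<in> carrier RV \<Longrightarrow> D x = D' x"
  shows "char_der (*) ground RV \<chi>' n D'"
  using assms(1) unfolding char_der_def by (simp add: assms(2,3)[symmetric])

text \<open>
  The universal property turns the homomorphism \<open>R \<rightarrow> E \<otimes> C\<close> given by \<open>F\<close> into some \<open>g : R\<^sub>V \<rightarrow> C\<close>. Its
  derivation part is the required \<open>D\<close>, once the character part is known to be \<open>\<rho>\<^sub>V\<close>; that follows from
  injectivity.
\<close>

lemma rep_surj:
  assumes F: "char_der smE E R (r \<circ> \<epsilon>) n F"
  shows "\<exists>D. kder n D \<and> (\<forall>x. x \<notin> carrier RV \<longrightarrow> D x = 0) \<and> (\<forall>x\<in>carrier R. TV.Ctr D (\<pi> x) = F x)"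
proof -
  obtain C :: "('k, 'u) dga" and b0 b1 b2 l0 l1 l2 where "cone_dga C n b0 b1 b2 l0 l1 l2"
    using cone_dga_exists[OF inf unit_inj] by blast
  then interpret C: cone_dga C n b0 b1 b2 l0 l1 l2 .
  interpret TC: tensor_cone smE E C n b0 b1 b2 l0 l1 l2 by unfold_locales
  have T: "tensor smE E C" by unfold_locales
  have RVd: "dga RV" and Rd: "dga R" by unfold_locales
  note F1 = char_derD(1)[OF F]
  let ?\<Phi> = "restrict (\<lambda>x. TC.tvec ((r \<circ> \<epsilon>) x) (F x) (F (diff R x))) (carrier R)"
  have "?\<Phi> \<in> dg_hom R (tensor_dga E C)"
    by (rule TC.tvec_hom[OF Rd char_r F]) (simp_all add: E_unit F1)
  then obtain g where g: "g \<in> dg_hom RV C" "restrict (tensor_map E C g \<circ> \<pi>) (carrier R) = ?\<Phi>"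
    using rep C.com C.C.dga unfolding represents_def bij_betw_def by (metis (no_types, lifting) imageE)
  have g2: "tensor_map E C g (\<pi> x) = TC.tvec (r (\<epsilon> x)) (F x) (F (diff R x))" if "x \<in> carrier R" for x
    using fun_cong[OF g(2), of x] that by simp
  note h = C.hom_vec[OF RVd g(1)]
  have k: "TV.Ctr (l0 \<circ> g) (\<pi> x) = r (\<epsilon> x)" "TV.Ctr (l1 \<circ> g) (\<pi> x) = F x" if x: "x \<in> carrier R" for x
    unfolding H_Ctr(2)[OF T g(1) x C.l(1), symmetric] H_Ctr(2)[OF T g(1) x C.l(2), symmetric] g2[OF x]
    by (rule TC.tvec(2,3)[OF r(1) F1[OF x] F1[OF R.diff_carrier[OF x]]])+
  have c: "(l0 \<circ> g) y = \<rho>V y" if "y \<in> carrier RV" for y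
    by (rule rep_inj(1)[OF h(1) char_rhoV char_der_zero[OF h(1)] char_der_zero[OF char_rhoV] _ _ that])
      (simp_all only: k(1) Ctr_rhoV)
  define D where "D = (\<lambda>y. if y \<in> carrier RV then l1 (g y) else 0)"
  have D: "kder n D"
    by (rule char_der_cong[OF h(2) c]) (simp_all add: D_def)
  have "TV.Ctr D (\<pi> x) = F x" if x: "x \<in> carrier R" for x
    unfolding k(2)[OF x, symmetric]
    by (rule TV.Ctr_lin(1)[OF linf_der[OF D] linf_der[OF h(2)] pi(1)[OF x]]) (simp add: D_def)
  then show ?thesis using D by (intro exI[of _ D]) (auto simp: D_def)
qed

lemma char_der_scale: "char_der (*) ground RV \<chi> n D \<Longrightarrow> char_der (*) ground RV \<chi> n (\<lambda>x. c * D x)"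
  unfolding char_der_def by (simp add: algebra_simps)

lemma char_der_plus:
  "char_der (*) ground RV \<chi> n D \<Longrightarrow> char_der (*) ground RV \<chi> n D' \<Longrightarrow> char_der (*) ground RV \<chi> n (\<lambda>x. D x + D' x)"
  unfolding char_der_def by (simp add: algebra_simps)

lemma der_iff:
  "D \<in> dg_derivations RV \<rho>V Kd (- n) \<longleftrightarrow> kder n D \<and> (\<forall>x. x \<notin> carrier RV \<longrightarrow> D x = 0)"
proof
  assume "D \<in> dg_derivations RV \<rho>V Kd (- n)"
  then have z: "\<forall>x. x \<notin> carrier RV \<longrightarrow> D x = 0"
    and a: "\<And>x y. x \<in> carrier RV \<Longrightarrow> y \<in> carrier RV \<Longrightarrow> D (x \<oplus>\<^bsub>RV\<^esub> y) = D x + D y"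
    and s: "\<And>c x. x \<in> carrier RV \<Longrightarrow> D (c \<odot>\<^bsub>RV\<^esub> x) = c * D x"
    and gr: "\<And>i. D ` gr RV i \<subseteq> gr Kd (i - n)"
    and m: "\<And>i x y. x \<in> gr RV i \<Longrightarrow> y \<in> carrier RV \<Longrightarrow> D (x \<otimes>\<^bsub>RV\<^esub> y) = D x * \<rho>V y + sg (- n * i) * (\<rho>V x * D y)"
    unfolding dg_derivations_def Kd_simps(1-6) by auto
  have g: "D x = 0" if "x \<in> gr RV i" "i \<noteq> n" for x i
    using gr[of i] that by (auto simp: Kd_simps(7))
  have p: "D (x \<otimes>\<^bsub>RV\<^esub> y) = D x * \<rho>V y + \<rho>V x * D y" if "x \<in> carrier RV" and y: "y \<in> carrier RV" for x y
    using that(1)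
  proof (induction x rule: RV.hom_induct)
    case (hom i x)
    then show ?case using m[OF hom y] characterD(6)[OF char_rhoV hom] by (cases "i = 0") auto
  next
    case (add x z)
    then show ?case using y characterD(2)[OF char_rhoV] by (simp add: RV.A.l_distr a algebra_simps)
  qed
  show "kder n D \<and> (\<forall>x. x \<notin> carrier RV \<longrightarrow> D x = 0)"
    unfolding char_der_def using z a s g p by simp
next
  assume A: "kder n D \<and> (\<forall>x. x \<notin> carrier RV \<longrightarrow> D x = 0)"
  note D = char_derD[OF conjunct1[OF A], simplified]
  have "D (x \<otimes>\<^bsub>RV\<^esub> y) = D x * \<rho>V y + sg (- n * i) * (\<rho>V x * D y)" if "x \<in> gr RV i" "y \<in> carrier RV" for i x y
    using D(5)[of x y] that characterD(6)[OF char_rhoV that(1)] by (cases "i = 0") auto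
  moreover have "D ` gr RV i \<subseteq> gr Kd (i + - n)" for i
    using D(4) by (auto simp: Kd_simps(7))
  ultimately show "D \<in> dg_derivations RV \<rho>V Kd (- n)"
    unfolding dg_derivations_def Kd_simps(1-6) using D A by auto
qed

lemma cycles_iff:
  "D \<in> cycles n \<longleftrightarrow> kder n D \<and> (\<forall>x. x \<notin> carrier RV \<longrightarrow> D x = 0) \<and>
     (\<forall>x\<in>carrier RV. D (diff RV x) = 0)"
proof -
  have "dg_der_diff RV Kd (- n) D = (\<lambda>_. 0) \<longleftrightarrow> (\<forall>x\<in>carrier RV. D (diff RV x) = 0)"
    unfolding der_diff_eq fun_eq_iff by auto
  then show ?thesis unfolding dg_der_cycles_def der_iff Kd_simps(4) by blast
qed

lemma boundaries_iff:
  "D \<in> boundaries n \<longleftrightarrow> (\<exists>G. kder (n - 1) G \<and>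
     D = (\<lambda>x. if x \<in> carrier RV then G (diff RV x) else 0))"
proof
  have e: "- n + 1 = - (n - 1)" by simp
  assume "D \<in> boundaries n"
  then obtain G where G0: "G \<in> dg_derivations RV \<rho>V Kd (- n + 1)" and GD: "D = dg_der_diff RV Kd (- n + 1) G"
    unfolding dg_der_boundaries_def by blast
  have G: "kder (n - 1) G" "D = dg_der_diff RV Kd (- n + 1) G"
    using G0 GD unfolding e der_iff by blast+
  have "kder (n - 1) (\<lambda>x. - sg (- n + 1) * G x)"
    by (rule char_der_scale[OF G(1)])
  then show "\<exists>G. kder (n - 1) G \<and> D = (\<lambda>x. if x \<in> carrier RV then G (diff RV x) else 0)"
    unfolding G(2) der_diff_eq by (intro exI[of _ "\<lambda>x. - sg (- n + 1) * G x"]) auto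
next
  have e: "- n + 1 = - (n - 1)" by simp
  assume "\<exists>G. kder (n - 1) G \<and> D = (\<lambda>x. if x \<in> carrier RV then G (diff RV x) else 0)"
  then obtain G where G: "kder (n - 1) G" "D = (\<lambda>x. if x \<in> carrier RV then G (diff RV x) else 0)" by blast
  let ?G = "\<lambda>x. if x \<in> carrier RV then - sg (- n + 1) * G x else 0"
  have "kder (n - 1) (\<lambda>x. - sg (- n + 1) * G x)"
    by (rule char_der_scale[OF G(1)])
  then have "kder (n - 1) ?G" by (rule char_der_cong) simp_all
  then have "?G \<in> dg_derivations RV \<rho>V Kd (- (n - 1))" unfolding der_iff by simp
  moreover have "D = dg_der_diff RV Kd (- n + 1) ?G"
    unfolding G(2) der_diff_eq using sg_sq[where 'k = 'k, of "- n + 1"] by (auto simp: fun_eq_iff simp flip: mult.assoc)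
  ultimately show "D \<in> boundaries n" unfolding dg_der_boundaries_def e by - (rule image_eqI; assumption)
qed

text \<open>
  Maps to \<open>E\<close> as maps to 0-cochains.
\<close>

definition nullary :: "('u \<Rightarrow> 'e) \<Rightarrow> 'u \<Rightarrow> 'a list \<Rightarrow> 'e" where
  "nullary f = (\<lambda>x xs. if xs = [] then f x else 0)"

lemma ra_nullary: "ra re (nullary f x) b xs = (if xs = [] then re (f x) b else 0)"
  by (cases xs) (simp_all add: nullary_def)

lemma der_nullary: "der n 0 (nullary f) \<longleftrightarrow> char_der smE E R (r \<circ> \<epsilon>) n f"
proof -
  have "(\<forall>i x xs. x \<in> gr R i \<longrightarrow> i \<noteq> n \<longrightarrow> nullary f x xs = 0) \<longleftrightarrow> (\<forall>i. \<forall>x\<in>gr R i. i \<noteq> n \<longrightarrow> f x = 0)"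
    by (auto simp: nullary_def)
  moreover have "(\<forall>x\<in>carrier R. nullary f x \<in> Q 0) \<longleftrightarrow> (\<forall>x\<in>carrier R. f x \<in> carrier E)"
    unfolding Q.simps(1) mem_Collect_eq nullary_def by (simp add: Ec_E)
  moreover have "(\<forall>x\<in>carrier R. \<forall>y\<in>carrier R. \<forall>xs. nullary f (x \<oplus> y) xs = nullary f x xs + nullary f y xs) \<longleftrightarrow>
      (\<forall>x\<in>carrier R. \<forall>y\<in>carrier R. f (x \<oplus> y) = f x + f y)"
    by (auto simp: nullary_def)
  moreover have "(\<forall>c. \<forall>x\<in>carrier R. \<forall>xs. nullary f (c \<odot> x) xs = smE c (nullary f x xs)) \<longleftrightarrow>
      (\<forall>c. \<forall>x\<in>carrier R. f (c \<odot> x) = smE c (f x))"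
    by (auto simp: nullary_def)
  moreover have "(\<forall>x\<in>carrier R. \<forall>y\<in>carrier R. \<forall>xs. nullary f (x \<otimes> y) xs =
        ra re (nullary f x) (\<epsilon> y) xs + le (\<epsilon> x) (nullary f y xs) + 0) \<longleftrightarrow>
      (\<forall>x\<in>carrier R. \<forall>y\<in>carrier R. f (x \<otimes> y) = f x \<otimes>\<^bsub>E\<^esub> (r \<circ> \<epsilon>) y + (r \<circ> \<epsilon>) x \<otimes>\<^bsub>E\<^esub> f y)"
    unfolding ra_nullary re_r by (auto simp: nullary_def le_r[symmetric])
  ultimately show ?thesis unfolding tder_def char_der_def by (simp only:)
qed

lemma der_eq_nullary:
  assumes "der n 0 h" "x \<in> carrier R"
  shows "h x xs = nullary (\<lambda>x. h x []) x xs"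
  using tderD(1)[OF assms] by (cases xs) (simp_all add: nullary_def)

text \<open>
  The derivation \<open>R \<rightarrow> E \<otimes> R\<^sub>V \<rightarrow> E \<otimes> k = E\<close> induced by \<open>D\<close>.
\<close>

definition hat :: "('u \<Rightarrow> 'k) \<Rightarrow> 'u \<Rightarrow> 'a list \<Rightarrow> 'e" where
  "hat D = nullary (\<lambda>x. TV.Ctr D (\<pi> x))"

lemma hat_diff: "linf RV D \<Longrightarrow> x \<in> carrier R \<Longrightarrow> hat D (diff R x) xs = hat (D \<circ> diff RV) x xs"
  by (simp add: hat_def nullary_def Ctr_diff)

lemma hat_cong: "linf RV D \<Longrightarrow> linf RV D' \<Longrightarrow> (\<And>y. y \<in> carrier RV \<Longrightarrow> D y = D' y) \<Longrightarrow> x \<in> carrier R \<Longrightarrow> hat D x xs = hat D' x xs"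
  using TV.Ctr_lin(1)[OF _ _ pi(1), of D D' x] by (simp add: hat_def nullary_def)

lemma hat_inj:
  assumes "kder n D" "kder n D'" "\<And>x. x \<in> carrier R \<Longrightarrow> hat D x [] = hat D' x []" "y \<in> carrier RV"
  shows "D y = D' y"
  by (rule rep_inj(2)[OF char_rhoV char_rhoV assms(1,2) _ _ assms(4)]) (use assms(3) in \<open>simp_all add: hat_def nullary_def\<close>)

lemma hat_linear:
  assumes "linf RV D" "linf RV D'" "x \<in> carrier R"
  shows "hat (\<lambda>y. D y + D' y) x xs = hat D x xs + hat D' x xs" "hat (\<lambda>y. c * D y) x xs = smE c (hat D x xs)"
  using TV.Ctr_lin(2,3)[OF assms(1,2) pi(1)[OF assms(3)]] by (simp_all add: hat_def nullary_def)

lemma hat_zero: "x \<in> carrier R \<Longrightarrow> hat (\<lambda>_. 0) x xs = 0"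
  by (simp add: hat_def nullary_def TV.Ctr_def TV.ctr_def lin_def)

lemma cyc_hat:
  assumes "D \<in> cycles n"
  shows "cyc n 0 (hat D)"
proof -
  have D: "kder n D" "\<And>x. x \<in> carrier RV \<Longrightarrow> D (diff RV x) = 0" using assms unfolding cycles_iff by auto
  have z: "linf RV (\<lambda>_. 0)" by (simp add: linf_def)
  have "hat D (diff R x) xs = 0" if "x \<in> carrier R" for x xs
    using hat_diff[OF linf_der[OF D(1)] that, of xs] hat_cong[OF TV.linf_diff[OF linf_der[OF D(1)]] z _ that, of xs] hat_zero[OF that, of xs]
    by (simp add: D(2))
  then show ?thesis unfolding cyc_def hat_def der_nullary using Ctr_der[OF D(1)] by simp
qed

lemma hat_onto:
  assumes "cyc n 0 F"
  shows "\<exists>D\<in>cycles n. \<forall>x\<in>carrier R. \<forall>xs. hat D x xs = F x xs"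
proof -
  have F: "der n 0 F" "\<And>x xs. x \<in> carrier R \<Longrightarrow> F (diff R x) xs = 0" using assms unfolding cyc_def by auto
  have "der n 0 (nullary (\<lambda>x. F x []))" by (rule tder_cong[OF F(1)]) (simp_all only: der_eq_nullary[OF F(1), symmetric])
  then obtain D where D: "kder n D" "\<forall>x. x \<notin> carrier RV \<longrightarrow> D x = 0" "\<forall>x\<in>carrier R. TV.Ctr D (\<pi> x) = F x []"
    using rep_surj unfolding der_nullary by blast
  have h: "hat D x xs = F x xs" if "x \<in> carrier R" for x xs
    using D(3) that der_eq_nullary[OF F(1) that, of xs] by (simp add: hat_def nullary_def)
  have RVd: "dga RV" by unfold_locales
  note Dd = coeff_alg.char_der_diff[OF coeff_alg_ground RVd char_rhoV D(1)]
  have "(D \<circ> diff RV) y = (\<lambda>_. 0) y" if "y \<in> carrier RV" for y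
  proof (rule hat_inj[OF Dd char_der_zero[OF char_rhoV] _ that])
    fix x assume "x \<in> carrier R"
    then show "hat (D \<circ> diff RV) x [] = hat (\<lambda>_. 0) x []"
      using hat_diff[OF linf_der[OF D(1)], of x "[]"] h[of "diff R x" "[]"] F(2)[of x "[]"] hat_zero[of x "[]"] by simp
  qed
  then have "D \<in> cycles n" unfolding cycles_iff using D by simp
  then show ?thesis using h by blast
qed

lemma bdr_hat:
  assumes D: "D \<in> cycles n"
  shows "D \<in> boundaries n \<longleftrightarrow> bdr n 0 (hat D)"
proof
  have RVd: "dga RV" by unfold_locales
  have Dd: "kder n D" "\<forall>x. x \<notin> carrier RV \<longrightarrow> D x = 0" using D unfolding cycles_iff by auto
  {
    assume "D \<in> boundaries n"
    then obtain G where G: "kder (n - 1) G" "D = (\<lambda>x. if x \<in> carrier RV then G (diff RV x) else 0)"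
      unfolding boundaries_iff by blast
    have "der (n - 1) 0 (hat G)" unfolding hat_def der_nullary by (rule Ctr_der[OF G(1)])
    moreover have "hat D x xs = hat G (diff R x) xs" if "x \<in> carrier R" for x xs
      unfolding hat_diff[OF linf_der[OF G(1)] that]
      by (rule hat_cong[OF linf_der[OF Dd(1)] TV.linf_diff[OF linf_der[OF G(1)]] _ that]) (simp add: G(2))
    ultimately show "bdr n 0 (hat D)" unfolding bdr_def by blast
  }
  assume "bdr n 0 (hat D)"
  then obtain g where g: "der (n - 1) 0 g" "\<And>x xs. x \<in> carrier R \<Longrightarrow> hat D x xs = g (diff R x) xs" unfolding bdr_def by blast
  have "der (n - 1) 0 (nullary (\<lambda>x. g x []))" by (rule tder_cong[OF g(1)]) (simp_all only: der_eq_nullary[OF g(1), symmetric])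
  then obtain G where G: "kder (n - 1) G" "\<forall>x\<in>carrier R. TV.Ctr G (\<pi> x) = g x []"
    using rep_surj unfolding der_nullary by blast
  have Gd: "kder n (G \<circ> diff RV)"
    using coeff_alg.char_der_diff[OF coeff_alg_ground RVd char_rhoV G(1)] by simp
  have "D y = (G \<circ> diff RV) y" if "y \<in> carrier RV" for y
  proof (rule hat_inj[OF Dd(1) Gd _ that])
    fix x assume x: "x \<in> carrier R"
    show "hat D x [] = hat (G \<circ> diff RV) x []"
      using g(2)[OF x, of "[]"] hat_diff[OF linf_der[OF G(1)] x, of "[]"] G(2) x by (simp add: hat_def nullary_def)
  qed
  then have "D = (\<lambda>x. if x \<in> carrier RV then G (diff RV x) else 0)" using Dd(2) by auto
  then show "D \<in> boundaries n" unfolding boundaries_iff using G(1) by blast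
qed

lemma tensor_map_eq_pure:
  assumes D: "linf RV D" and x: "x \<in> carrier R" and e: "e \<in> carrier E"
  shows "tensor_map E Kd D (\<pi> x) = pure_tensor E Kd e 1 \<longleftrightarrow> hat D x [] = e"
proof -
  have l: "linf Kd id" "linf Kd (\<lambda>_. 0)" by (simp_all add: linf_def Kd_simps)
  have s: "single (e, 1) \<in> carrier TK.FM" by (rule TK.FM_cl(5)) (simp_all add: e Kd_simps)
  have m: "tensor_map E Kd D (\<pi> x) \<in> carrier TK.TC" "TK.Ctr id (tensor_map E Kd D (\<pi> x)) = TV.Ctr (id \<circ> D) (\<pi> x)"
    by (rule tensor_map_Ctr[OF TK TV]; (use D in \<open>simp add: Kd_simps linf_def\<close>)?; (rule pi(1)[OF x])?; (rule l)?)+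
  obtain f where f: "f \<in> carrier TK.FM" "tensor_map E Kd D (\<pi> x) = TK.cls f" using m(1) by (rule TK.TC_obtain)
  have z: "TK.ctr (\<lambda>_. 0) h = 0" for h by (simp add: TK.ctr_def lin_def)
  have "TK.cls f = TK.cls (single (e, 1)) \<longleftrightarrow> TK.ctr id f = TK.ctr id (single (e, 1))"
  proof
    assume "TK.cls f = TK.cls (single (e, 1))"
    then show "TK.ctr id f = TK.ctr id (single (e, 1))" using TK.Ctr_cls[OF l(1) f(1)] TK.Ctr_cls[OF l(1) s] by simp
  next
    assume "TK.ctr id f = TK.ctr id (single (e, 1))"
    then show "TK.cls f = TK.cls (single (e, 1))"
      by (intro TK.cls_eq_ctr[OF l(1) l(2) l(2), of 1 1 1])
        (rule f(1) s | assumption | (simp add: Kd_simps(1-6) z; fail))+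
  qed
  moreover have "TK.ctr id f = hat D x []"
    using m(2) unfolding f(2) TK.Ctr_cls[OF l(1) f(1)] by (simp add: hat_def nullary_def)
  ultimately show ?thesis unfolding f(2) pure_tensor_def by (simp add: TK.ctr_simps)
qed

end

section \<open>Quotients of spaces of functions\<close>

lemma quot_module_ops:
  fixes M :: "('k::field, 'x, 'z) module_scheme"
  assumes M: "module ground M" and B: "submodule B ground M"
  shows "carrier (quot_module M B) = (\<lambda>x. B +>\<^bsub>M\<^esub> x) ` carrier M"
    "x \<in> carrier M \<Longrightarrow> y \<in> carrier M \<Longrightarrow> (B +>\<^bsub>M\<^esub> x) \<oplus>\<^bsub>quot_module M B\<^esub> (B +>\<^bsub>M\<^esub> y) = B +>\<^bsub>M\<^esub> (x \<oplus>\<^bsub>M\<^esub> y)"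
    "x \<in> carrier M \<Longrightarrow> c \<odot>\<^bsub>quot_module M B\<^esub> (B +>\<^bsub>M\<^esub> x) = B +>\<^bsub>M\<^esub> (c \<odot>\<^bsub>M\<^esub> x)"
proof -
  interpret M: module ground M by fact
  interpret B: submodule B ground M by fact
  show "carrier (quot_module M B) = (\<lambda>x. B +>\<^bsub>M\<^esub> x) ` carrier M"
    by (auto simp: quot_module_def A_RCOSETS_def')
  interpret S: abelian_subgroup B M
    by (rule abelian_subgroupI3[OF additive_subgroupI]) (unfold_locales)
  show "(B +>\<^bsub>M\<^esub> x) \<oplus>\<^bsub>quot_module M B\<^esub> (B +>\<^bsub>M\<^esub> y) = B +>\<^bsub>M\<^esub> (x \<oplus>\<^bsub>M\<^esub> y)" if "x \<in> carrier M" "y \<in> carrier M" for x y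
    using S.a_rcos_sum[OF that] by (simp add: quot_module_def)
  show "c \<odot>\<^bsub>quot_module M B\<^esub> (B +>\<^bsub>M\<^esub> x) = B +>\<^bsub>M\<^esub> (c \<odot>\<^bsub>M\<^esub> x)" if x: "x \<in> carrier M" for x
  proof -
    have bM: "b \<in> B \<Longrightarrow> b \<in> carrier M" for b using M.submoduleE(1)[OF B] by blast
    have e: "c \<odot>\<^bsub>M\<^esub> (b \<oplus>\<^bsub>M\<^esub> x) = c \<odot>\<^bsub>M\<^esub> b \<oplus>\<^bsub>M\<^esub> c \<odot>\<^bsub>M\<^esub> x" if "b \<in> B" for b
      using M.smult_r_distr[of c b x] bM[OF that] x by simp
    have "c \<odot>\<^bsub>quot_module M B\<^esub> (B +>\<^bsub>M\<^esub> x) = B <+>\<^bsub>M\<^esub> {c \<odot>\<^bsub>M\<^esub> b \<oplus>\<^bsub>M\<^esub> c \<odot>\<^bsub>M\<^esub> x | b. b \<in> B}"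
      by (simp add: quot_module_def a_r_coset_def' image_UN image_image Setcompr_eq_image UNION_singleton_eq_range e cong: image_cong)
    also have "\<dots> = B +>\<^bsub>M\<^esub> (c \<odot>\<^bsub>M\<^esub> x)"
      by (rule set_add_coset[OF M B]) (use x M.submoduleE(4)[OF B, of c] M.submoduleE(2)[OF B] M.smult_closed[of c x] in auto)
    finally show ?thesis .
  qed
qed

lemma fun_quot:
  fixes N :: "('k::field, 'y, 'z) module_scheme"
  assumes N: "module ground N"
    and Z: "\<And>f i. f \<in> Z \<Longrightarrow> f i \<in> carrier N" "(\<lambda>_. \<zero>\<^bsub>N\<^esub>) \<in> Z" "\<And>f g. f \<in> Z \<Longrightarrow> g \<in> Z \<Longrightarrow> (\<lambda>i. f i \<oplus>\<^bsub>N\<^esub> g i) \<in> Z"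
      "\<And>c f. f \<in> Z \<Longrightarrow> (\<lambda>i. c \<odot>\<^bsub>N\<^esub> f i) \<in> Z"
    and B: "B \<subseteq> Z" "(\<lambda>_. \<zero>\<^bsub>N\<^esub>) \<in> B" "\<And>f g. f \<in> B \<Longrightarrow> g \<in> B \<Longrightarrow> (\<lambda>i. f i \<oplus>\<^bsub>N\<^esub> g i) \<in> B"
      "\<And>c f. f \<in> B \<Longrightarrow> (\<lambda>i. c \<odot>\<^bsub>N\<^esub> f i) \<in> B"
  defines "M \<equiv> fun_module N Z"
  shows "carrier (quot_module M B) = (\<lambda>x. B +>\<^bsub>M\<^esub> x) ` Z"
    "f \<in> Z \<Longrightarrow> g \<in> Z \<Longrightarrow> (B +>\<^bsub>M\<^esub> f) \<oplus>\<^bsub>quot_module M B\<^esub> (B +>\<^bsub>M\<^esub> g) = B +>\<^bsub>M\<^esub> (\<lambda>i. f i \<oplus>\<^bsub>N\<^esub> g i)"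
    "f \<in> Z \<Longrightarrow> c \<odot>\<^bsub>quot_module M B\<^esub> (B +>\<^bsub>M\<^esub> f) = B +>\<^bsub>M\<^esub> (\<lambda>i. c \<odot>\<^bsub>N\<^esub> f i)"
    "f \<in> Z \<Longrightarrow> g \<in> Z \<Longrightarrow> B +>\<^bsub>M\<^esub> f = B +>\<^bsub>M\<^esub> g \<longleftrightarrow> (\<lambda>i. f i \<oplus>\<^bsub>N\<^esub> (-1) \<odot>\<^bsub>N\<^esub> g i) \<in> B"
proof -
  interpret N: module ground N by fact
  have ms: "carrier M = Z" "\<zero>\<^bsub>M\<^esub> = (\<lambda>_. \<zero>\<^bsub>N\<^esub>)" "\<And>f g. f \<oplus>\<^bsub>M\<^esub> g = (\<lambda>i. f i \<oplus>\<^bsub>N\<^esub> g i)" "\<And>c f. c \<odot>\<^bsub>M\<^esub> f = (\<lambda>i. c \<odot>\<^bsub>N\<^esub> f i)"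
    by (simp_all add: M_def fun_module_def)
  have nn: "x \<in> carrier N \<Longrightarrow> 1 \<odot>\<^bsub>N\<^esub> x = x" "x \<in> carrier N \<Longrightarrow> 0 \<odot>\<^bsub>N\<^esub> x = \<zero>\<^bsub>N\<^esub>"
    "x \<in> carrier N \<Longrightarrow> (c + d) \<odot>\<^bsub>N\<^esub> x = c \<odot>\<^bsub>N\<^esub> x \<oplus>\<^bsub>N\<^esub> d \<odot>\<^bsub>N\<^esub> x" "x \<in> carrier N \<Longrightarrow> (c * d) \<odot>\<^bsub>N\<^esub> x = c \<odot>\<^bsub>N\<^esub> (d \<odot>\<^bsub>N\<^esub> x)"
    "x \<in> carrier N \<Longrightarrow> y \<in> carrier N \<Longrightarrow> c \<odot>\<^bsub>N\<^esub> (x \<oplus>\<^bsub>N\<^esub> y) = c \<odot>\<^bsub>N\<^esub> x \<oplus>\<^bsub>N\<^esub> c \<odot>\<^bsub>N\<^esub> y" for c d x y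
    using N.smult_one[of x] N.smult_l_null[of x] N.smult_l_distr[of c d x] N.smult_assoc1[of c d x] N.smult_r_distr[of c x y] by simp_all
  have Mm: "module ground M"
    by (rule module_groundI) (simp_all add: ms Z nn N.M.a_ac)
  have Bm: "submodule B ground M" by (rule submodule_groundI[OF Mm]) (simp_all add: ms B)
  interpret M: module ground M by fact
  show "carrier (quot_module M B) = (\<lambda>x. B +>\<^bsub>M\<^esub> x) ` Z" using quot_module_ops(1)[OF Mm Bm] by (simp add: ms)
  show "(B +>\<^bsub>M\<^esub> f) \<oplus>\<^bsub>quot_module M B\<^esub> (B +>\<^bsub>M\<^esub> g) = B +>\<^bsub>M\<^esub> (\<lambda>i. f i \<oplus>\<^bsub>N\<^esub> g i)" if "f \<in> Z" "g \<in> Z"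
    using quot_module_ops(2)[OF Mm Bm, of f g] that by (simp add: ms)
  show "c \<odot>\<^bsub>quot_module M B\<^esub> (B +>\<^bsub>M\<^esub> f) = B +>\<^bsub>M\<^esub> (\<lambda>i. c \<odot>\<^bsub>N\<^esub> f i)" if "f \<in> Z"
    using quot_module_ops(3)[OF Mm Bm, of f c] that by (simp add: ms)
  show "B +>\<^bsub>M\<^esub> f = B +>\<^bsub>M\<^esub> g \<longleftrightarrow> (\<lambda>i. f i \<oplus>\<^bsub>N\<^esub> (-1) \<odot>\<^bsub>N\<^esub> g i) \<in> B" if f: "f \<in> Z" and g: "g \<in> Z"
  proof -
    have n: "(-1) \<odot>\<^bsub>N\<^esub> x \<oplus>\<^bsub>N\<^esub> x = \<zero>\<^bsub>N\<^esub>" if "x \<in> carrier N" for x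
      using nn(3)[OF that, of "-1" 1] nn(1,2)[OF that] by simp
    have "\<ominus>\<^bsub>M\<^esub> g = (\<lambda>i. (-1) \<odot>\<^bsub>N\<^esub> g i)"
      by (rule M.M.minus_equality) (simp_all add: ms g Z n)
    then have "f \<ominus>\<^bsub>M\<^esub> g = (\<lambda>i. f i \<oplus>\<^bsub>N\<^esub> (-1) \<odot>\<^bsub>N\<^esub> g i)" by (simp add: a_minus_def ms)
    then show ?thesis using coset_eq_iff[OF Mm Bm, of f g] f g by (simp add: ms)
  qed
qed

text \<open>
  The isomorphisms are only available as correspondences between cycles, each determined up to
  boundaries. A linear correspondence that is total on both sides and matches equality of classes descends to
  an isomorphism of the quotients.
\<close>

lemma iso_of_relation:
  fixes M :: "('k, 'x, 'm) module_scheme" and N :: "('k, 'y, 'n) module_scheme"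
  assumes M: "carrier M = q ` Z" and N: "carrier N = q' ` Z'"
    and P: "\<And>x y. P x y \<Longrightarrow> x \<in> Z \<and> y \<in> Z'" "\<And>x. x \<in> Z \<Longrightarrow> \<exists>y. P x y" "\<And>y. y \<in> Z' \<Longrightarrow> \<exists>x. P x y"
    and add: "\<And>x y x' y'. P x y \<Longrightarrow> P x' y' \<Longrightarrow> \<exists>x'' y''. P x'' y'' \<and> q x \<oplus>\<^bsub>M\<^esub> q x' = q x'' \<and> q' y \<oplus>\<^bsub>N\<^esub> q' y' = q' y''"
    and sm: "\<And>c x y. P x y \<Longrightarrow> \<exists>x'' y''. P x'' y'' \<and> c \<odot>\<^bsub>M\<^esub> q x = q x'' \<and> c \<odot>\<^bsub>N\<^esub> q' y = q' y''"
    and eq: "\<And>x y x' y'. P x y \<Longrightarrow> P x' y' \<Longrightarrow> q x = q x' \<longleftrightarrow> q' y = q' y'"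
  shows "\<exists>\<Psi>. linear_iso M N \<Psi> \<and> (\<forall>x y. P x y \<longrightarrow> \<Psi> (q x) = q' y)"
proof -
  define \<Psi> where "\<Psi> X = q' (SOME y. \<exists>x. P x y \<and> q x = X)" for X
  have \<Psi>: "\<Psi> (q x) = q' y" if "P x y" for x y
  proof -
    have "\<exists>x'. P x' (SOME y. \<exists>x'. P x' y \<and> q x' = q x) \<and> q x' = q x"
      by (rule someI[of "\<lambda>y. \<exists>x'. P x' y \<and> q x' = q x" y]) (use that in blast)
    then show ?thesis unfolding \<Psi>_def using eq that by blast
  qed
  have ex: "\<exists>x y. P x y \<and> X = q x" if "X \<in> carrier M" for X using that M P(2) by blast
  have "inj_on \<Psi> (carrier M)"
  proof (rule inj_onI)
    fix X X' assume X: "X \<in> carrier M" "X' \<in> carrier M" "\<Psi> X = \<Psi> X'"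
    obtain x y where 1: "P x y" "X = q x" using ex[OF X(1)] by blast
    obtain x' y' where 2: "P x' y'" "X' = q x'" using ex[OF X(2)] by blast
    show "X = X'" using X(3) 1 2 \<Psi>[OF 1(1)] \<Psi>[OF 2(1)] eq[OF 1(1) 2(1)] by simp
  qed
  moreover have "\<Psi> ` carrier M = carrier N"
  proof
    show "\<Psi> ` carrier M \<subseteq> carrier N"
    proof
      fix Y assume "Y \<in> \<Psi> ` carrier M"
      then obtain x y where "P x y" "Y = \<Psi> (q x)" using ex by blast
      then show "Y \<in> carrier N" using \<Psi> P(1) N by auto
    qed
    show "carrier N \<subseteq> \<Psi> ` carrier M"
    proof
      fix Y assume "Y \<in> carrier N"
      then obtain y where "y \<in> Z'" "Y = q' y" using N by auto
      then obtain x where x: "P x y" using P(3) by blast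
      then have "Y = \<Psi> (q x)" "q x \<in> carrier M" using \<Psi> \<open>Y = q' y\<close> P(1) M by auto
      then show "Y \<in> \<Psi> ` carrier M" by blast
    qed
  qed
  moreover have "\<Psi> (X \<oplus>\<^bsub>M\<^esub> X') = \<Psi> X \<oplus>\<^bsub>N\<^esub> \<Psi> X'" if X: "X \<in> carrier M" "X' \<in> carrier M" for X X'
  proof -
    obtain x y where 1: "P x y" "X = q x" using ex[OF X(1)] by blast
    obtain x' y' where 2: "P x' y'" "X' = q x'" using ex[OF X(2)] by blast
    obtain x'' y'' where "P x'' y''" "q x \<oplus>\<^bsub>M\<^esub> q x' = q x''" "q' y \<oplus>\<^bsub>N\<^esub> q' y' = q' y''" using add[OF 1(1) 2(1)] by blast
    then show ?thesis using \<Psi> 1 2 by simp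
  qed
  moreover have "\<Psi> (c \<odot>\<^bsub>M\<^esub> X) = c \<odot>\<^bsub>N\<^esub> \<Psi> X" if X: "X \<in> carrier M" for c X
  proof -
    obtain x y where 1: "P x y" "X = q x" using ex[OF X(1)] by blast
    obtain x'' y'' where "P x'' y''" "c \<odot>\<^bsub>M\<^esub> q x = q x''" "c \<odot>\<^bsub>N\<^esub> q' y = q' y''" using sm[OF 1(1), of c] by blast
    then show ?thesis using \<Psi> 1 by simp
  qed
  ultimately have "linear_iso M N \<Psi>" unfolding linear_iso_def bij_betw_def by blast
  then show ?thesis using \<Psi> by blast
qed

section \<open>Hochschild cochains\<close>

context derived_rep
begin

lemma E_module: "module ground E"
  by (rule module_groundI) (simp_all add: E_ops E_cl algebra_simps VE.scale_right_distrib VE.scale_left_distrib)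

lemma finsum_E: "finite F \<Longrightarrow> (\<And>i. i \<in> F \<Longrightarrow> f i \<in> carrier E) \<Longrightarrow> finsum E f F = sum f F"
proof (induction F rule: finite_induct)
  case empty
  interpret module ground E by (rule E_module)
  show ?case by (simp add: E_ops)
next
  case (insert i F)
  interpret module ground E by (rule E_module)
  show ?case using insert by (subst M.finsum_insert) (auto simp: E_ops)
qed

lemma Q_iff: "\<phi> \<in> Q m \<longleftrightarrow> \<phi> \<in> cochains sA E m"
proof (induction m arbitrary: \<phi>)
  case 0
  have "(\<forall>as. as \<noteq> [] \<longrightarrow> \<phi> as = 0) \<longleftrightarrow> (\<forall>x xs. \<phi> (x # xs) = 0)" by (metis list.exhaust list.simps(3))
  then show ?case unfolding cochains_def Q.simps(1) multilinear_def by (simp add: Ec_E E_ops)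
next
  case (Suc m)
  show ?case
  proof
    assume q: "\<phi> \<in> Q (Suc m)"
    have c: "(\<lambda>ys. \<phi> (a # ys)) \<in> cochains sA E m" for a using Q_ev[OF q] Suc.IH by blast
    have v: "\<phi> as \<in> carrier E" if "length as = Suc m" for as
      using that c[of "hd as"] by (cases as) (auto simp: cochains_def)
    have z: "\<phi> as = 0" if "length as \<noteq> Suc m" for as
      using that c[of "hd as"] Q_lin(3)[OF q] by (cases as) (auto simp: cochains_def E_ops)
    have "multilinear sA E (Suc m) \<phi>" unfolding multilinear_def
    proof (intro allI impI)
      fix xs ys :: "'a list" assume l: "length xs + length ys + 1 = Suc m"
      show "(\<forall>a b. \<phi> (xs @ (a + b) # ys) = \<phi> (xs @ a # ys) \<oplus>\<^bsub>E\<^esub> \<phi> (xs @ b # ys)) \<and>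
        (\<forall>c a. \<phi> (xs @ sA c a # ys) = c \<odot>\<^bsub>E\<^esub> \<phi> (xs @ a # ys))"
      proof (cases xs)
        case Nil
        then show ?thesis using Q_lin(1,2)[OF q] by (simp add: E_ops)
      next
        case (Cons x xs')
        then show ?thesis using c[of x] l unfolding cochains_def multilinear_def by auto
      qed
    qed
    then show "\<phi> \<in> cochains sA E (Suc m)" unfolding cochains_def using v z by (simp add: E_ops)
  next
    assume q: "\<phi> \<in> cochains sA E (Suc m)"
    have v: "\<And>as. length as = Suc m \<Longrightarrow> \<phi> as \<in> carrier E" and z: "\<And>as. length as \<noteq> Suc m \<Longrightarrow> \<phi> as = 0"
      and l: "\<And>xs ys a b. length xs + length ys + 1 = Suc m \<Longrightarrow> \<phi> (xs @ (a + b) # ys) = \<phi> (xs @ a # ys) + \<phi> (xs @ b # ys)"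
        "\<And>xs ys c a. length xs + length ys + 1 = Suc m \<Longrightarrow> \<phi> (xs @ sA c a # ys) = smE c (\<phi> (xs @ a # ys))"
      using q unfolding cochains_def multilinear_def E_ops by blast+
    have "(\<lambda>ys. \<phi> (a # ys)) \<in> cochains sA E m" for a
      unfolding cochains_def multilinear_def E_ops using v z l[of "a # _"] by auto
    moreover have "\<phi> ((a + b) # ys) = \<phi> (a # ys) + \<phi> (b # ys)" for a b ys
      using l(1)[of "[]" ys a b] z[of "_ # ys"] by (cases "length ys = m") auto
    moreover have "\<phi> (sA c a # ys) = smE c (\<phi> (a # ys))" for c a ys
      using l(2)[of "[]" ys c a] z[of "_ # ys"] by (cases "length ys = m") auto
    ultimately show "\<phi> \<in> Q (Suc m)" unfolding Q.simps(2) using Suc.IH z[of "[]"] by simp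
  qed
qed

lemma Q_len: "q \<in> Q m \<Longrightarrow> length xs \<noteq> m \<Longrightarrow> q xs = 0" and Q_val: "q \<in> Q m \<Longrightarrow> q xs \<in> carrier E"
proof -
  show z: "q \<in> Q m \<Longrightarrow> length xs \<noteq> m \<Longrightarrow> q xs = 0" for xs by (simp add: Q_iff cochains_def E_ops)
  show "q \<in> Q m \<Longrightarrow> q xs \<in> carrier E"
    using z[of xs] E_cl(1) by (cases "length xs = m") (simp_all add: Q_iff cochains_def)
qed

text \<open>
  The right action on cochains was defined to make this true: moving \<open>a\<close> from the right through all arguments
  yields every term of the coboundary except the first.
\<close>

lemma hochschild_diff_inn:
  assumes q: "\<psi> \<in> Q m"
  shows "hochschild_diff E le re m \<psi> = (\<lambda>as. if as = [] then 0 else inn \<psi> (hd as) (tl as))"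
proof (rule ext)
  fix as :: "'a list"
  show "hochschild_diff E le re m \<psi> as = (if as = [] then 0 else inn \<psi> (hd as) (tl as))"
  proof (cases "length as = Suc m")
    case True
    then obtain a ys where as: "as = a # ys" "length ys = m" by (cases as) auto
    have fs: "finsum E (\<lambda>i. smE ((-1) ^ Suc i) (\<psi> (contract i as))) {..<m} = (\<Sum>i<m. smE ((-1) ^ Suc i) (\<psi> (contract i as)))"
      by (rule finsum_E) (simp, intro E_cl(3) Q_val[OF q])
    have "ra re \<psi> a ys = (\<Sum>i<m. smE ((-1) ^ i) (\<psi> (contract i as))) + smE ((-1) ^ m) (re (\<psi> (butlast as)) (last as))"
      using ra_append[of \<psi> a ys "[]"] as by simp
    then show ?thesis using True fs unfolding hochschild_diff_def E_ops as
      by (simp add: inn_def sum_negf)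
  next
    case False
    then show ?thesis using Q_len[OF inn_Q[OF q], of "tl as" "hd as"]
      by (cases as) (auto simp: hochschild_diff_def E_ops)
  qed
qed

text \<open>
  A map from \<open>A\<close> to \<open>p\<close>-cochains as a function of \<open>p + 1\<close> arguments, with the value \<open>0\<close> on the empty list that
  cochains of positive degree are required to take.
\<close>

definition uncurry_hd :: "('a \<Rightarrow> 'a list \<Rightarrow> 'e) \<Rightarrow> 'a list \<Rightarrow> 'e" where
  "uncurry_hd \<theta> as = (if as = [] then 0 else \<theta> (hd as) (tl as))"

lemma uncurry_hd [simp]: "uncurry_hd \<theta> [] = 0" "uncurry_hd \<theta> (a # xs) = \<theta> a xs"
  by (simp_all add: uncurry_hd_def)

lemma uncurry_hd_eqI: "\<phi> [] = 0 \<Longrightarrow> uncurry_hd (\<lambda>a xs. \<phi> (a # xs)) = \<phi>"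
  by (rule ext) (simp add: uncurry_hd_def)

lemma cocycles_derA: "uncurry_hd \<theta> \<in> cocycles sA E le re (Suc p) \<longleftrightarrow> derA p \<theta>"
proof -
  have Q: "uncurry_hd \<theta> \<in> Q (Suc p) \<longleftrightarrow> (\<forall>a. \<theta> a \<in> Q p) \<and> (\<forall>a b xs. \<theta> (a + b) xs = \<theta> a xs + \<theta> b xs) \<and> (\<forall>c a xs. \<theta> (sA c a) xs = smE c (\<theta> a xs))"
    by (simp add: Q.simps(2))
  have "hochschild_diff E le re (Suc p) (uncurry_hd \<theta>) = (\<lambda>_. 0) \<longleftrightarrow> (\<forall>a b xs. \<theta> (a * b) xs = ra re (\<theta> a) b xs + le a (\<theta> b xs))"
    if q: "uncurry_hd \<theta> \<in> Q (Suc p)"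
  proof -
    have i: "inn (uncurry_hd \<theta>) a (b # xs) = le a (\<theta> b xs) - \<theta> (a * b) xs + ra re (\<theta> a) b xs" for a b xs
      by (simp add: inn_def)
    have n: "inn (uncurry_hd \<theta>) a [] = 0" for a using Q_lin(3)[OF inn_Q[OF q]] .
    have "hochschild_diff E le re (Suc p) (uncurry_hd \<theta>) = (\<lambda>_. 0) \<longleftrightarrow> (\<forall>a b xs. inn (uncurry_hd \<theta>) a (b # xs) = 0)"
      unfolding hochschild_diff_inn[OF q] fun_eq_iff
    proof (intro iffI allI)
      fix a b xs assume "\<forall>as. (if as = [] then 0 else inn (uncurry_hd \<theta>) (hd as) (tl as)) = 0"
      from spec[OF this, of "a # b # xs"] show "inn (uncurry_hd \<theta>) a (b # xs) = 0" by simp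
    next
      fix as assume "\<forall>a b xs. inn (uncurry_hd \<theta>) a (b # xs) = 0"
      then show "(if as = [] then 0 else inn (uncurry_hd \<theta>) (hd as) (tl as)) = 0" using n by (cases "tl as") auto
    qed
    also have "\<dots> \<longleftrightarrow> (\<forall>a b xs. \<theta> (a * b) xs = ra re (\<theta> a) b xs + le a (\<theta> b xs))"
      unfolding i by (simp add: algebra_simps) (metis (no_types, opaque_lifting) add.commute)
    finally show ?thesis .
  qed
  then show ?thesis unfolding cocycles_def derA_def using Q by (auto simp: Q_iff[symmetric] E_ops)
qed

lemma cocycle_uncurry:
  assumes "\<phi> \<in> cocycles sA E le re (Suc p)"
  shows "uncurry_hd (\<lambda>a xs. \<phi> (a # xs)) = \<phi>"
  using assms by (intro uncurry_hd_eqI) (simp add: cocycles_def Q_iff[symmetric] Q.simps(2))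

lemma coboundary_iff:
  "uncurry_hd \<theta> \<in> coboundaries sA E le re (Suc m) \<longleftrightarrow> (\<exists>\<psi>\<in>Q m. \<theta> = inn \<psi>)"
proof -
  have e: "uncurry_hd \<theta> = hochschild_diff E le re m \<psi> \<longleftrightarrow> \<theta> = inn \<psi>" if q: "\<psi> \<in> Q m" for \<psi>
  proof
    assume h: "uncurry_hd \<theta> = hochschild_diff E le re m \<psi>"
    have "\<theta> a xs = inn \<psi> a xs" for a xs
      using fun_cong[OF h, of "a # xs"] unfolding hochschild_diff_inn[OF q] by simp
    then show "\<theta> = inn \<psi>" by blast
  qed (simp add: hochschild_diff_inn[OF q] uncurry_hd_def fun_eq_iff)
  have "uncurry_hd \<theta> \<in> coboundaries sA E le re (Suc m) \<longleftrightarrow> (\<exists>\<psi>\<in>Q m. uncurry_hd \<theta> = hochschild_diff E le re m \<psi>)"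
    by (auto simp: coboundaries_def Q_iff image_iff)
  also have "\<dots> \<longleftrightarrow> (\<exists>\<psi>\<in>Q m. \<theta> = inn \<psi>)" by (rule bex_cong[OF refl e])
  finally show ?thesis .
qed

lemma coboundary_uncurry: "\<phi> \<in> coboundaries sA E le re (Suc m) \<Longrightarrow> uncurry_hd (\<lambda>a xs. \<phi> (a # xs)) = \<phi>"
  by (rule uncurry_hd_eqI) (auto simp: coboundaries_def Q_iff[symmetric] hochschild_diff_inn)

end

section \<open>The isomorphisms\<close>

context derived_rep
begin

abbreviation "tcls \<equiv> tangent_class RV \<rho>V"
abbreviation "TS \<equiv> tangent_space RV \<rho>V"
abbreviation "cocyc \<equiv> cocycles sA E le re"
abbreviation "cobdr \<equiv> coboundaries sA E le re"
abbreviation "hcls \<equiv> HH_class sA E le re"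
abbreviation "HH\<^sub>E \<equiv> HH sA E le re"
abbreviation "Der\<^sub>E \<equiv> Der sA E le re"

lemma inn_add: "inn \<psi> a xs + inn \<psi>' a xs = inn (\<lambda>ys. \<psi> ys + \<psi>' ys) a xs"
  by (simp add: inn_def ra_add1 le)

lemma inn_sm: "smE c (inn \<psi> a xs) = inn (\<lambda>ys. smE c (\<psi> ys)) a xs"
  by (simp add: inn_def ra_sm1 le VE.scale_right_diff_distrib)

lemma inn_zero: "inn (\<lambda>_. 0) a xs = 0"
  by (simp add: inn_def)

lemma derA_inn:
  assumes q: "\<psi> \<in> Q p"
  shows "derA p (inn \<psi>)"
proof -
  have f: "inn \<psi> a = (\<lambda>xs. le a (\<psi> xs) - ra re \<psi> a xs)" for a by (rule ext) (simp add: inn_def)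
  have "inn \<psi> (a * b) xs = ra re (inn \<psi> a) b xs + le a (inn \<psi> b xs)" for a b xs
    unfolding f ra_fun by (simp add: le le_neg)
  then show ?thesis unfolding derA_def using inn_Q[OF q]
    by (simp add: inn_def le ra_add2[OF q] ra_sm2[OF q] VE.scale_right_diff_distrib)
qed

lemma rel_cong:
  assumes D: "rel n p D \<theta>" and e: "\<And>x xs. x \<in> carrier R \<Longrightarrow> D' x xs = D x xs"
  shows "rel n p D' \<theta>"
proof -
  have "der (int n - 1) p (\<lambda>_ _. 0)" unfolding tder_def by simp
  then have "bdr (int n) p (\<lambda>x xs. D' x xs - D x xs)" unfolding bdr_def using e by (intro exI[of _ "\<lambda>_ _. 0"]) simp
  from rel_add[OF D rel_of_bdr[OF this]] show ?thesis by simp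
qed

lemma rel_hat_add:
  assumes "D \<in> cycles n'" "D' \<in> cycles n'" "rel n 0 (hat D) \<theta>" "rel n 0 (hat D') \<theta>'"
  shows "rel n 0 (hat (\<lambda>x. D x + D' x)) (\<lambda>a xs. \<theta> a xs + \<theta>' a xs)"
  by (rule rel_cong[OF rel_add[OF assms(3,4)]])
    (use assms(1,2) in \<open>auto simp: cycles_iff intro!: hat_linear linf_der\<close>)

lemma rel_hat_sm:
  assumes "D \<in> cycles n'" "rel n 0 (hat D) \<theta>"
  shows "rel n 0 (hat (\<lambda>x. c * D x)) (\<lambda>a xs. smE c (\<theta> a xs))"
  by (rule rel_cong[OF rel_sm[OF assms(2)]])
    (use assms(1) in \<open>auto simp: cycles_iff intro!: hat_linear(2)[of D D] linf_der\<close>)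

lemma cycles_cl:
  "(\<lambda>_. 0) \<in> cycles n"
  "D \<in> cycles n \<Longrightarrow> D' \<in> cycles n \<Longrightarrow> (\<lambda>x. D x + D' x) \<in> cycles n"
  "D \<in> cycles n \<Longrightarrow> (\<lambda>x. c * D x) \<in> cycles n"
  unfolding cycles_iff using char_der_zero[OF char_rhoV] char_der_plus char_der_scale by auto

lemma boundaries_cl:
  "boundaries n \<subseteq> cycles n"
  "(\<lambda>_. 0) \<in> boundaries n"
  "D \<in> boundaries n \<Longrightarrow> D' \<in> boundaries n \<Longrightarrow> (\<lambda>x. D x + D' x) \<in> boundaries n"
  "D \<in> boundaries n \<Longrightarrow> (\<lambda>x. c * D x) \<in> boundaries n"
proof -
  have RVd: "dga RV" by unfold_locales
  show "boundaries n \<subseteq> cycles n"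
  proof
    fix D assume "D \<in> boundaries n"
    then obtain G where G: "kder (n - 1) G" "D = (\<lambda>x. if x \<in> carrier RV then G (diff RV x) else 0)"
      unfolding boundaries_iff by blast
    have "kder n (G \<circ> diff RV)"
      using coeff_alg.char_der_diff[OF coeff_alg_ground RVd char_rhoV G(1)] by simp
    then have "kder n D" by (rule char_der_cong) (simp_all add: G(2))
    moreover have "G \<zero>\<^bsub>RV\<^esub> = 0" using char_derD(3)[OF G(1), of "\<zero>\<^bsub>RV\<^esub>" 0] by simp
    ultimately show "D \<in> cycles n" unfolding cycles_iff by (simp add: G(2))
  qed
  show "(\<lambda>_. 0) \<in> boundaries n"
    unfolding boundaries_iff using char_der_zero[OF char_rhoV] by (intro exI[of _ "\<lambda>_. 0"]) auto
  show "(\<lambda>x. D x + D' x) \<in> boundaries n"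
    if "D \<in> boundaries n" "D' \<in> boundaries n"
  proof -
    from that(1) obtain G where G: "kder (n - 1) G" "D = (\<lambda>x. if x \<in> carrier RV then G (diff RV x) else 0)"
      unfolding boundaries_iff by blast
    from that(2) obtain G' where "kder (n - 1) G'" "D' = (\<lambda>x. if x \<in> carrier RV then G' (diff RV x) else 0)"
      unfolding boundaries_iff by blast
    with G show ?thesis unfolding boundaries_iff using char_der_plus by (intro exI[of _ "\<lambda>x. G x + G' x"]) auto
  qed
  show "(\<lambda>x. c * D x) \<in> boundaries n" if "D \<in> boundaries n"
  proof -
    from that obtain G where "kder (n - 1) G" "D = (\<lambda>x. if x \<in> carrier RV then G (diff RV x) else 0)"
      unfolding boundaries_iff by blast
    then show ?thesis unfolding boundaries_iff using char_der_scale by (intro exI[of _ "\<lambda>x. c * G x"]) auto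
  qed
qed

lemma tangent_ops:
  fixes n :: nat
  defines "Z \<equiv> cycles (int n)"
  shows "carrier (TS n) = tcls n ` Z"
    "D \<in> Z \<Longrightarrow> D' \<in> Z \<Longrightarrow> tcls n D \<oplus>\<^bsub>TS n\<^esub> tcls n D' = tcls n (\<lambda>x. D x + D' x)"
    "D \<in> Z \<Longrightarrow> c \<odot>\<^bsub>TS n\<^esub> tcls n D = tcls n (\<lambda>x. c * D x)"
    "D \<in> Z \<Longrightarrow> D' \<in> Z \<Longrightarrow> tcls n D = tcls n D' \<longleftrightarrow> bdr (int n) 0 (hat (\<lambda>x. D x + (- 1) * D' x))"
proof -
  have g: "module ground (ground :: ('k, 'k) module)" using module_alg_of[OF vector_space_mult] by (simp add: ground_def)
  note f = fun_quot[where Z = Z and B = "boundaries (int n)", OF g, unfolded ground_simps]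
  have t: "tcls n = (+>\<^bsub>fun_module ground Z\<^esub>) (boundaries (int n))"
    by (rule ext) (simp add: tangent_class_def Z_def)
  have s: "TS n = quot_module (fun_module ground Z) (boundaries (int n))"
    by (simp add: tangent_space_def Z_def)
  have p: "(\<lambda>_. 0) \<in> Z" "\<And>D D'. D \<in> Z \<Longrightarrow> D' \<in> Z \<Longrightarrow> (\<lambda>x. D x + D' x) \<in> Z" "\<And>c D. D \<in> Z \<Longrightarrow> (\<lambda>x. c * D x) \<in> Z"
    "boundaries (int n) \<subseteq> Z" unfolding Z_def by (rule cycles_cl boundaries_cl; assumption?)+
  note b = boundaries_cl(2-4)[where n = "int n"]
  note q = f[OF _ p(1) p(2) p(3) p(4) b]
  show "carrier (TS n) = tcls n ` Z" unfolding s t by (rule q(1)) simp_all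
  show "D \<in> Z \<Longrightarrow> D' \<in> Z \<Longrightarrow> tcls n D \<oplus>\<^bsub>TS n\<^esub> tcls n D' = tcls n (\<lambda>x. D x + D' x)"
    unfolding s t by (rule q(2)) simp_all
  show "D \<in> Z \<Longrightarrow> c \<odot>\<^bsub>TS n\<^esub> tcls n D = tcls n (\<lambda>x. c * D x)"
    unfolding s t by (rule q(3)) simp_all
  show "tcls n D = tcls n D' \<longleftrightarrow> bdr (int n) 0 (hat (\<lambda>x. D x + (- 1) * D' x))"
    if D: "D \<in> Z" "D' \<in> Z"
  proof -
    have "tcls n D = tcls n D' \<longleftrightarrow> (\<lambda>x. D x + (- 1) * D' x) \<in> boundaries (int n)"
      unfolding t by (rule q(4)) (use D in simp_all)
    also have "\<dots> \<longleftrightarrow> bdr (int n) 0 (hat (\<lambda>x. D x + (- 1) * D' x))"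
      by (rule bdr_hat) (use p(2)[OF D(1) p(3)[OF D(2), of "-1"]] in \<open>simp add: Z_def\<close>)
    finally show ?thesis .
  qed
qed

lemma rel_hat_left:
  assumes "D \<in> cycles (int n)"
  shows "\<exists>\<theta>. rel n 0 (hat D) \<theta> \<and> derA n \<theta>"
  using rel_total_left[OF cyc_hat[OF assms]] rel_derA[of n 0] by auto

lemma rel_hat_right:
  assumes "derA n \<theta>"
  shows "\<exists>D\<in>cycles (int n). rel n 0 (hat D) \<theta>"
proof -
  obtain F where F: "rel n 0 F \<theta>" using rel_total_right[of 0 n \<theta>] assms by auto
  obtain D where D: "D \<in> cycles (int n)" "\<forall>x\<in>carrier R. \<forall>xs. hat D x xs = F x xs"
    using hat_onto[OF rel_cyc[OF F]] by blast
  have "rel n 0 (hat D) \<theta>" by (rule rel_cong[OF F]) (simp add: D(2))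
  then show ?thesis using D(1) by blast
qed

lemma section_carrier: "homotopy_section sA R \<epsilon> s \<Longrightarrow> as \<noteq> [] \<Longrightarrow> s as \<in> carrier R"
  unfolding homotopy_section_def using R.gr_carrier by blast

lemma linf_cycle: "D \<in> cycles n \<Longrightarrow> linf RV D"
  by (auto simp: cycles_iff intro: linf_der)

subsection \<open>Degree zero\<close>

text \<open>
  Maps to \<open>E\<close> as maps to 0-cochains, on the side of \<open>A\<close>.
\<close>

definition unary :: "('a \<Rightarrow> 'e) \<Rightarrow> 'a \<Rightarrow> 'a list \<Rightarrow> 'e" where
  "unary \<theta> = (\<lambda>a xs. if xs = [] then \<theta> a else 0)"

lemma unary_inj: "unary \<theta> = unary \<theta>' \<longleftrightarrow> \<theta> = \<theta>'"
proof
  assume e: "unary \<theta> = unary \<theta>'"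
  have "\<theta> a = \<theta>' a" for a using fun_cong[OF fun_cong[OF e, of a], of "[]"] by (simp add: unary_def)
  then show "\<theta> = \<theta>'" by (rule ext)
qed simp

lemma unary_lin:
  "(\<lambda>a xs. unary \<theta> a xs + unary \<theta>' a xs) = unary (\<lambda>a. \<theta> a + \<theta>' a)"
  "(\<lambda>a xs. smE c (unary \<theta> a xs)) = unary (\<lambda>a. smE c (\<theta> a))" "unary (\<lambda>_. 0) = (\<lambda>_ _. 0)"
  by (intro ext; simp add: unary_def)+

lemma derA_0_iff:
  "derA 0 \<theta> \<longleftrightarrow> (\<exists>\<theta>0\<in>carrier (Der\<^sub>E). \<theta> = unary \<theta>0)"
proof -
  have re: "ra re (\<lambda>xs. if xs = [] then e else 0) b xs = (if xs = [] then re e b else 0)" for e b xs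
    by (cases xs) simp_all
  have m: "\<theta>0 \<in> carrier (Der\<^sub>E) \<longleftrightarrow> (\<forall>a. \<theta>0 a \<in> carrier E) \<and> (\<forall>a b. \<theta>0 (a + b) = \<theta>0 a + \<theta>0 b) \<and>
     (\<forall>c a. \<theta>0 (sA c a) = smE c (\<theta>0 a)) \<and> (\<forall>a b. \<theta>0 (a * b) = le a (\<theta>0 b) + re (\<theta>0 a) b)" for \<theta>0
    by (auto simp: Der_def fun_module_def E_ops)
  show ?thesis
  proof
    assume d: "derA 0 \<theta>"
    then have "\<theta> a (x # xs) = 0" for a x xs by (simp add: derA_def)
    then have e: "\<theta> = unary (\<lambda>a. \<theta> a [])" unfolding unary_def by (intro ext) (metis neq_Nil_conv)
    have "(\<lambda>a. \<theta> a []) \<in> carrier (Der\<^sub>E)"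
      unfolding m using d[unfolded derA_def] Q_val[of _ 0] by (simp add: add.commute)
    then show "\<exists>\<theta>0\<in>carrier (Der\<^sub>E). \<theta> = unary \<theta>0" using e by (intro bexI[of _ "\<lambda>a. \<theta> a []"])
  next
    assume "\<exists>\<theta>0\<in>carrier (Der\<^sub>E). \<theta> = unary \<theta>0"
    then obtain \<theta>0 where t: "\<theta>0 \<in> carrier (Der\<^sub>E)" "\<theta> = unary \<theta>0" by blast
    show "derA 0 \<theta>" using t(1) unfolding m t(2) unary_def derA_def Q.simps(1) mem_Collect_eq by (auto simp: Ec_E re add.commute)
  qed
qed

theorem tangent_degree_0:
  "\<exists>\<Psi>. linear_iso (TS 0) (Der\<^sub>E) \<Psi> \<and>
     (\<forall>s. homotopy_section sA R \<epsilon> s \<longrightarrow> (\<forall>D\<in>dg_der_cycles RV \<rho>V Kd 0.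
        restricts_to E \<pi> s 0 D (\<lambda>as. \<Psi> (tcls 0 D) (hd as))))"
proof -
  define P where "P D \<theta>0 \<longleftrightarrow> D \<in> cycles (int 0) \<and> \<theta>0 \<in> carrier (Der\<^sub>E) \<and> rel 0 0 (hat D) (unary \<theta>0)" for D \<theta>0
  have Dadd: "\<theta>0 \<oplus>\<^bsub>Der\<^sub>E\<^esub> \<theta>1 = (\<lambda>a. \<theta>0 a + \<theta>1 a)" "c \<odot>\<^bsub>Der\<^sub>E\<^esub> \<theta>0 = (\<lambda>a. smE c (\<theta>0 a))" for c \<theta>0 \<theta>1
    by (simp_all add: Der_def fun_module_def E_ops)
  have der: "\<theta>0 \<in> carrier (Der\<^sub>E)" if "derA 0 (unary \<theta>0)" for \<theta>0
  proof -
    from that obtain \<theta>1 where "\<theta>1 \<in> carrier (Der\<^sub>E)" "unary \<theta>0 = unary \<theta>1" unfolding derA_0_iff by blast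
    then show ?thesis by (simp add: unary_inj)
  qed
  have add: "P (\<lambda>x. D x + D' x) (\<lambda>a. \<theta>0 a + \<theta>1 a)" if "P D \<theta>0" "P D' \<theta>1" for D D' \<theta>0 \<theta>1
  proof -
    have "rel 0 0 (hat (\<lambda>x. D x + D' x)) (unary (\<lambda>a. \<theta>0 a + \<theta>1 a))"
      using rel_hat_add[of D "int 0" D' 0 "unary \<theta>0" "unary \<theta>1"] that unfolding P_def unary_lin by blast
    moreover from this have "(\<lambda>a. \<theta>0 a + \<theta>1 a) \<in> carrier (Der\<^sub>E)" using rel_derA[of 0 0] by (intro der) simp
    ultimately show ?thesis using that cycles_cl(2)[of D "int 0" D'] unfolding P_def by blast
  qed
  have sm: "P (\<lambda>x. c * D x) (\<lambda>a. smE c (\<theta>0 a))" if "P D \<theta>0" for c D \<theta>0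
  proof -
    have "rel 0 0 (hat (\<lambda>x. c * D x)) (unary (\<lambda>a. smE c (\<theta>0 a)))"
      using rel_hat_sm[of D "int 0" 0 "unary \<theta>0" c] that unfolding P_def unary_lin by blast
    moreover from this have "(\<lambda>a. smE c (\<theta>0 a)) \<in> carrier (Der\<^sub>E)" using rel_derA[of 0 0] by (intro der) simp
    ultimately show ?thesis using that cycles_cl(3)[of D "int 0" c] unfolding P_def by blast
  qed
  have "\<exists>\<Psi>. linear_iso (TS 0) (Der\<^sub>E) \<Psi> \<and> (\<forall>D \<theta>0. P D \<theta>0 \<longrightarrow> \<Psi> (tcls 0 D) = \<theta>0)"
  proof (rule iso_of_relation[where q' = "\<lambda>x. x" and Z' = "carrier (Der\<^sub>E)", OF tangent_ops(1)])
    show "carrier (Der\<^sub>E) = (\<lambda>x. x) ` carrier (Der\<^sub>E)" by simp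
    show "D \<in> cycles (int 0) \<and> \<theta>0 \<in> carrier (Der\<^sub>E)" if "P D \<theta>0" for D \<theta>0
      using that unfolding P_def by blast
    show "\<exists>\<theta>0. P D \<theta>0" if D: "D \<in> cycles (int 0)" for D
    proof -
      obtain \<theta> where t: "rel 0 0 (hat D) \<theta>" "derA 0 \<theta>" using rel_hat_left[OF D] by blast
      then obtain \<theta>0 where "\<theta>0 \<in> carrier (Der\<^sub>E)" "\<theta> = unary \<theta>0" unfolding derA_0_iff by blast
      then show ?thesis using D t(1) unfolding P_def by blast
    qed
    show "\<exists>D. P D \<theta>0" if t: "\<theta>0 \<in> carrier (Der\<^sub>E)" for \<theta>0
    proof -
      have "derA 0 (unary \<theta>0)" unfolding derA_0_iff using t by blast
      from rel_hat_right[OF this] show ?thesis using t unfolding P_def by blast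
    qed
    show "\<exists>D'' \<theta>2. P D'' \<theta>2 \<and> tcls 0 D \<oplus>\<^bsub>TS 0\<^esub> tcls 0 D' = tcls 0 D'' \<and>
        \<theta>0 \<oplus>\<^bsub>Der\<^sub>E\<^esub> \<theta>1 = \<theta>2" if "P D \<theta>0" "P D' \<theta>1" for D \<theta>0 D' \<theta>1
      using add[OF that] tangent_ops(2)[of D 0 D'] that unfolding P_def Dadd by blast
    show "\<exists>D'' \<theta>2. P D'' \<theta>2 \<and> c \<odot>\<^bsub>TS 0\<^esub> tcls 0 D = tcls 0 D'' \<and>
        c \<odot>\<^bsub>Der\<^sub>E\<^esub> \<theta>0 = \<theta>2" if "P D \<theta>0" for c D \<theta>0
      using sm[OF that, of c] tangent_ops(3)[of D 0 c] that unfolding P_def Dadd by blast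
    show "tcls 0 D = tcls 0 D' \<longleftrightarrow> \<theta>0 = \<theta>1" if a: "P D \<theta>0" "P D' \<theta>1" for D \<theta>0 D' \<theta>1
    proof -
      have "P (\<lambda>x. D x + (-1) * D' x) (\<lambda>a. \<theta>0 a + smE (-1) (\<theta>1 a))" by (rule add[OF a(1) sm[OF a(2)]])
      then have "bdr 0 0 (hat (\<lambda>x. D x + (-1) * D' x)) \<longleftrightarrow> unary (\<lambda>a. \<theta>0 a + smE (-1) (\<theta>1 a)) = (\<lambda>_ _. 0)"
        using rel_bdr_iff_0 unfolding P_def by blast
      also have "\<dots> \<longleftrightarrow> \<theta>0 = \<theta>1" unfolding unary_lin(3)[symmetric] unary_inj by (simp add: fun_eq_iff)
      finally show ?thesis using tangent_ops(4)[of D 0 D'] a unfolding P_def by simp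
    qed
  qed
  then obtain \<Psi> where \<Psi>: "linear_iso (TS 0) (Der\<^sub>E) \<Psi>" "\<And>D \<theta>0. P D \<theta>0 \<Longrightarrow> \<Psi> (tcls 0 D) = \<theta>0"
    by blast
  have "restricts_to E \<pi> s 0 D (\<lambda>as. \<Psi> (tcls 0 D) (hd as))"
    if s: "homotopy_section sA R \<epsilon> s" and D: "D \<in> dg_der_cycles RV \<rho>V Kd 0" for s D
    unfolding restricts_to_def
  proof (intro allI impI)
    fix as :: "'a list" assume "length as = Suc 0"
    then obtain a where as: "as = [a]" by (cases as) auto
    have D': "D \<in> cycles (int 0)" using D by simp
    obtain \<theta> where t: "rel 0 0 (hat D) \<theta>" "derA 0 \<theta>" using rel_hat_left[OF D'] by blast
    then obtain \<theta>0 where t0: "\<theta>0 \<in> carrier (Der\<^sub>E)" "\<theta> = unary \<theta>0" unfolding derA_0_iff by blast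
    have "P D \<theta>0" unfolding P_def using D' t(1) t0 by simp
    then have "\<Psi> (tcls 0 D) = \<theta>0" by (rule \<Psi>(2))
    moreover have "hat D (s [a]) [] = \<theta>0 a" using rel_restrict_0[OF t(1) s, of a "[]"] t0(2) by (simp add: unary_def)
    moreover have "\<theta>0 a \<in> carrier E" using t0(1) by (auto simp: Der_def fun_module_def)
    ultimately show "tensor_map E Kd D (\<pi> (s as)) = pure_tensor E Kd (\<Psi> (tcls 0 D) (hd as)) 1"
      using tensor_map_eq_pure[OF linf_cycle[OF D'] section_carrier[OF s]] as by simp
  qed
  then show ?thesis using \<Psi>(1) by blast
qed

subsection \<open>Positive degrees\<close>

lemma uncurry_hd_lin:
  "(\<lambda>as. uncurry_hd \<theta> as + uncurry_hd \<theta>' as) = uncurry_hd (\<lambda>a xs. \<theta> a xs + \<theta>' a xs)"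
  "(\<lambda>as. smE c (uncurry_hd \<theta> as)) = uncurry_hd (\<lambda>a xs. smE c (\<theta> a xs))"
  by (auto simp: uncurry_hd_def fun_eq_iff)

lemma uncurry_hd_zero: "uncurry_hd (\<lambda>_ _. 0) = (\<lambda>_. 0)"
  by (auto simp: uncurry_hd_def fun_eq_iff)

lemma cocycle_obtain:
  assumes "\<phi> \<in> cocyc (Suc p)"
  obtains \<theta> where "\<phi> = uncurry_hd \<theta>" "derA p \<theta>"
  using cocycle_uncurry[OF assms] assms cocycles_derA by metis

lemma coboundary_obtain:
  assumes "\<phi> \<in> cobdr (Suc p)"
  obtains \<psi> where "\<psi> \<in> Q p" "\<phi> = uncurry_hd (inn \<psi>)"
  using coboundary_uncurry[OF assms] assms coboundary_iff by metis

lemma HH_ops: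
  fixes p :: nat
  defines "Z \<equiv> cocyc (Suc p)"
  shows "carrier (HH\<^sub>E (Suc p)) = hcls (Suc p) ` Z"
    "\<phi> \<in> Z \<Longrightarrow> \<phi>' \<in> Z \<Longrightarrow> hcls (Suc p) \<phi> \<oplus>\<^bsub>HH\<^sub>E (Suc p)\<^esub> hcls (Suc p) \<phi>' =
       hcls (Suc p) (\<lambda>as. \<phi> as + \<phi>' as)"
    "\<phi> \<in> Z \<Longrightarrow> c \<odot>\<^bsub>HH\<^sub>E (Suc p)\<^esub> hcls (Suc p) \<phi> = hcls (Suc p) (\<lambda>as. smE c (\<phi> as))"
    "\<phi> \<in> Z \<Longrightarrow> \<phi>' \<in> Z \<Longrightarrow> hcls (Suc p) \<phi> = hcls (Suc p) \<phi>' \<longleftrightarrow>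
       (\<lambda>as. \<phi> as + smE (- 1) (\<phi>' as)) \<in> cobdr (Suc p)"
proof -
  let ?B = "cobdr (Suc p)"
  note f = fun_quot[where Z = Z and B = ?B, OF E_module, unfolded E_ops]
  have t: "hcls (Suc p) = (+>\<^bsub>fun_module E Z\<^esub>) ?B" by (rule ext) (simp add: HH_class_def Z_def)
  have s: "HH\<^sub>E (Suc p) = quot_module (fun_module E Z) ?B" by (simp add: HH_def Z_def)
  have z1: "\<phi> as \<in> carrier E" if "\<phi> \<in> Z" for \<phi> as
  proof -
    have "\<phi> \<in> Q (Suc p)" using that by (simp add: Z_def cocycles_def Q_iff)
    then show ?thesis by (rule Q_val)
  qed
  have z2: "(\<lambda>_. 0) \<in> Z" using derA_0[of p] unfolding Z_def cocycles_derA[symmetric] uncurry_hd_zero .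
  have z3: "(\<lambda>as. \<phi> as + \<phi>' as) \<in> Z" if a: "\<phi> \<in> Z" "\<phi>' \<in> Z" for \<phi> \<phi>'
  proof -
    obtain \<theta> where t: "\<phi> = uncurry_hd \<theta>" "derA p \<theta>" using a(1) unfolding Z_def by (rule cocycle_obtain)
    obtain \<theta>' where t': "\<phi>' = uncurry_hd \<theta>'" "derA p \<theta>'" using a(2) unfolding Z_def by (rule cocycle_obtain)
    show ?thesis unfolding Z_def t(1) t'(1) uncurry_hd_lin cocycles_derA by (rule derA_add[OF t(2) t'(2)])
  qed
  have z4: "(\<lambda>as. smE c (\<phi> as)) \<in> Z" if a: "\<phi> \<in> Z" for c \<phi>
  proof -
    obtain \<theta> where t: "\<phi> = uncurry_hd \<theta>" "derA p \<theta>" using a unfolding Z_def by (rule cocycle_obtain)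
    show ?thesis unfolding Z_def t(1) uncurry_hd_lin cocycles_derA by (rule derA_sm[OF t(2)])
  qed
  have b1: "?B \<subseteq> Z"
  proof
    fix \<phi> assume "\<phi> \<in> ?B"
    then obtain \<psi> where "\<psi> \<in> Q p" "\<phi> = uncurry_hd (inn \<psi>)" by (rule coboundary_obtain)
    then show "\<phi> \<in> Z" unfolding Z_def by (simp add: cocycles_derA derA_inn)
  qed
  have b2: "(\<lambda>_. 0) \<in> ?B"
  proof -
    have "(\<lambda>_ _. 0) = inn (\<lambda>_. 0)" by (intro ext) (simp add: inn_zero)
    then have "uncurry_hd (\<lambda>_ _. 0) \<in> ?B" unfolding coboundary_iff by (intro bexI[of _ "\<lambda>_. 0"]) simp_all
    then show ?thesis unfolding uncurry_hd_zero .
  qed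
  have b3: "(\<lambda>as. \<phi> as + \<phi>' as) \<in> ?B" if a: "\<phi> \<in> ?B" "\<phi>' \<in> ?B" for \<phi> \<phi>'
  proof -
    obtain \<psi> where t: "\<psi> \<in> Q p" "\<phi> = uncurry_hd (inn \<psi>)" using a(1) by (rule coboundary_obtain)
    obtain \<psi>' where t': "\<psi>' \<in> Q p" "\<phi>' = uncurry_hd (inn \<psi>')" using a(2) by (rule coboundary_obtain)
    show ?thesis unfolding t(2) t'(2) uncurry_hd_lin coboundary_iff inn_add using Q_add[OF t(1) t'(1)] by blast
  qed
  have b4: "(\<lambda>as. smE c (\<phi> as)) \<in> ?B" if a: "\<phi> \<in> ?B" for c \<phi>
  proof -
    obtain \<psi> where t: "\<psi> \<in> Q p" "\<phi> = uncurry_hd (inn \<psi>)" using a by (rule coboundary_obtain)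
    show ?thesis unfolding t(2) uncurry_hd_lin coboundary_iff inn_sm using Q_sm[OF t(1)] by blast
  qed
  show "carrier (HH\<^sub>E (Suc p)) = hcls (Suc p) ` Z" unfolding s t by (rule f(1)) (rule z2 b1 b2 | erule z1 | erule (1) z3 b3 | erule z4 b4 | assumption)+
  show "\<phi> \<in> Z \<Longrightarrow> \<phi>' \<in> Z \<Longrightarrow> hcls (Suc p) \<phi> \<oplus>\<^bsub>HH\<^sub>E (Suc p)\<^esub> hcls (Suc p) \<phi>' =
       hcls (Suc p) (\<lambda>as. \<phi> as + \<phi>' as)" unfolding s t by (rule f(2)) (rule z2 b1 b2 | erule z1 | erule (1) z3 b3 | erule z4 b4 | assumption)+
  show "\<phi> \<in> Z \<Longrightarrow> c \<odot>\<^bsub>HH\<^sub>E (Suc p)\<^esub> hcls (Suc p) \<phi> = hcls (Suc p) (\<lambda>as. smE c (\<phi> as))"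
    unfolding s t by (rule f(3)) (rule z2 b1 b2 | erule z1 | erule (1) z3 b3 | erule z4 b4 | assumption)+
  show "\<phi> \<in> Z \<Longrightarrow> \<phi>' \<in> Z \<Longrightarrow> hcls (Suc p) \<phi> = hcls (Suc p) \<phi>' \<longleftrightarrow>
       (\<lambda>as. \<phi> as + smE (- 1) (\<phi>' as)) \<in> ?B" unfolding t by (rule f(4)) (rule z2 b1 b2 | erule z1 | erule (1) z3 b3 | erule z4 b4 | assumption)+
qed

text \<open>
  The sign \<open>csgn n\<close> is absorbed into the correspondence, so that a cycle corresponds to its own restriction along
  a section and not to a multiple of it.
\<close>

theorem tangent_positive_degree:
  assumes n: "n \<ge> 1"
  shows "\<exists>\<Psi>. linear_iso (TS n) (HH\<^sub>E (n + 1)) \<Psi> \<and>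
     (\<forall>s. homotopy_section sA R \<epsilon> s \<longrightarrow> (\<forall>D\<in>cycles (int n).
        \<exists>\<phi>\<in>cocyc (n + 1). restricts_to E \<pi> s n D \<phi> \<and>
          \<Psi> (tcls n D) = hcls (n + 1) \<phi>))"
proof -
  obtain m where m: "n = Suc m" using n by (cases n) auto
  let ?c = "csgn n"
  let ?u = "\<lambda>\<theta>. uncurry_hd (\<lambda>a xs. smE ?c (\<theta> a xs))"
  let ?Z = "cycles (int n)" and ?Z' = "cocyc (Suc n)"
  have cc: "smE ?c (smE ?c x) = x" for x by (simp add: csgn_sq)
  define P where "P D \<phi> \<longleftrightarrow> D \<in> ?Z \<and> (\<exists>\<theta>. rel n 0 (hat D) \<theta> \<and> \<phi> = ?u \<theta>)" for D \<phi>
  have u_cocycle: "?u \<theta> \<in> ?Z'" if "derA n \<theta>" for \<theta> unfolding cocycles_derA by (rule derA_sm[OF that])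
  have PZ: "D \<in> ?Z \<and> \<phi> \<in> ?Z'" if "P D \<phi>" for D \<phi>
    using that u_cocycle rel_derA[of n 0] unfolding P_def by auto
  have add: "P (\<lambda>x. D x + D' x) (\<lambda>as. \<phi> as + \<phi>' as)" if a: "P D \<phi>" "P D' \<phi>'" for D D' \<phi> \<phi>'
  proof -
    obtain \<theta> \<theta>' where t: "D \<in> ?Z" "D' \<in> ?Z" "rel n 0 (hat D) \<theta>" "\<phi> = ?u \<theta>" "rel n 0 (hat D') \<theta>'" "\<phi>' = ?u \<theta>'"
      using a unfolding P_def by blast
    have "(\<lambda>as. \<phi> as + \<phi>' as) = ?u (\<lambda>a xs. \<theta> a xs + \<theta>' a xs)"
      unfolding t uncurry_hd_lin by (simp add: VE.scale_right_distrib)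
    then show ?thesis unfolding P_def using rel_hat_add[OF t(1,2,3,5)] cycles_cl(2)[OF t(1,2)] by blast
  qed
  have sm: "P (\<lambda>x. c * D x) (\<lambda>as. smE c (\<phi> as))" if a: "P D \<phi>" for c D \<phi>
  proof -
    obtain \<theta> where t: "D \<in> ?Z" "rel n 0 (hat D) \<theta>" "\<phi> = ?u \<theta>" using a unfolding P_def by blast
    have "(\<lambda>as. smE c (\<phi> as)) = ?u (\<lambda>a xs. smE c (\<theta> a xs))"
      unfolding t uncurry_hd_lin by (simp add: mult.commute)
    then show ?thesis unfolding P_def using rel_hat_sm[OF t(1,2)] cycles_cl(3)[OF t(1)] by blast
  qed
  have bd: "bdr (int n) 0 (hat D) \<longleftrightarrow> \<phi> \<in> cobdr (Suc n)" if a: "P D \<phi>" for D \<phi>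
  proof -
    obtain \<theta> where t: "rel n 0 (hat D) \<theta>" "\<phi> = ?u \<theta>" using a unfolding P_def by blast
    have "(\<exists>\<psi>\<in>Q n. (\<lambda>a xs. smE ?c (\<theta> a xs)) = inn \<psi>) \<longleftrightarrow> (\<exists>\<psi>\<in>Q n. \<theta> = inn \<psi>)"
    proof
      assume "\<exists>\<psi>\<in>Q n. (\<lambda>a xs. smE ?c (\<theta> a xs)) = inn \<psi>"
      then obtain \<psi> where p: "\<psi> \<in> Q n" "\<And>a xs. smE ?c (\<theta> a xs) = inn \<psi> a xs" by (metis (no_types, lifting))
      have "\<theta> a xs = inn (\<lambda>ys. smE ?c (\<psi> ys)) a xs" for a xs
        using p(2)[of a xs] cc[of "\<theta> a xs"] inn_sm[of ?c \<psi> a xs] by simp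
      then have "\<theta> = inn (\<lambda>ys. smE ?c (\<psi> ys))" by blast
      then show "\<exists>\<psi>\<in>Q n. \<theta> = inn \<psi>" using Q_sm[OF p(1)] by blast
    next
      assume "\<exists>\<psi>\<in>Q n. \<theta> = inn \<psi>"
      then obtain \<psi> where p: "\<psi> \<in> Q n" "\<theta> = inn \<psi>" by blast
      have "(\<lambda>a xs. smE ?c (\<theta> a xs)) = inn (\<lambda>ys. smE ?c (\<psi> ys))" unfolding p(2) inn_sm by blast
      then show "\<exists>\<psi>\<in>Q n. (\<lambda>a xs. smE ?c (\<theta> a xs)) = inn \<psi>" using Q_sm[OF p(1)] by blast
    qed
    then show ?thesis using rel_bdr_iff_Suc[of m 0 "hat D" \<theta>] t(1) unfolding t(2) coboundary_iff m by simp
  qed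
  have "\<exists>\<Psi>. linear_iso (TS n) (HH\<^sub>E (Suc n)) \<Psi> \<and>
      (\<forall>D \<phi>. P D \<phi> \<longrightarrow> \<Psi> (tcls n D) = hcls (Suc n) \<phi>)"
  proof (rule iso_of_relation[OF tangent_ops(1) HH_ops(1) PZ])
    show "\<exists>\<phi>. P D \<phi>" if D: "D \<in> ?Z" for D using rel_hat_left[OF D] D unfolding P_def by blast
    show "\<exists>D. P D \<phi>" if "\<phi> \<in> ?Z'" for \<phi>
    proof -
      from that obtain \<theta> where t: "\<phi> = uncurry_hd \<theta>" "derA n \<theta>" by (rule cocycle_obtain)
      obtain D where "D \<in> ?Z" "rel n 0 (hat D) (\<lambda>a xs. smE ?c (\<theta> a xs))" using rel_hat_right[OF derA_sm[OF t(2)]] by blast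
      moreover have "\<phi> = ?u (\<lambda>a xs. smE ?c (\<theta> a xs))" unfolding t(1) cc ..
      ultimately show ?thesis unfolding P_def by blast
    qed
    fix D \<phi> assume a: "P D \<phi>"
    show "\<exists>D'' \<phi>''. P D'' \<phi>'' \<and> c \<odot>\<^bsub>TS n\<^esub> tcls n D = tcls n D'' \<and>
        c \<odot>\<^bsub>HH\<^sub>E (Suc n)\<^esub> hcls (Suc n) \<phi> = hcls (Suc n) \<phi>''" for c
      using sm[OF a, of c] tangent_ops(3)[of D n c] HH_ops(3)[of \<phi> n c] PZ[OF a] by blast
    fix D' \<phi>' assume a': "P D' \<phi>'"
    show "\<exists>D'' \<phi>''. P D'' \<phi>'' \<and> tcls n D \<oplus>\<^bsub>TS n\<^esub> tcls n D' = tcls n D'' \<and>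
        hcls (Suc n) \<phi> \<oplus>\<^bsub>HH\<^sub>E (Suc n)\<^esub> hcls (Suc n) \<phi>' = hcls (Suc n) \<phi>''"
      using add[OF a a'] tangent_ops(2)[of D n D'] HH_ops(2)[of \<phi> n \<phi>'] PZ[OF a] PZ[OF a'] by blast
    have "tcls n D = tcls n D' \<longleftrightarrow> bdr (int n) 0 (hat (\<lambda>x. D x + (- 1) * D' x))"
      by (rule tangent_ops(4)) (use PZ[OF a] PZ[OF a'] in blast)+
    also have "\<dots> \<longleftrightarrow> (\<lambda>as. \<phi> as + smE (- 1) (\<phi>' as)) \<in> cobdr (Suc n)" by (rule bd[OF add[OF a sm[OF a']]])
    also have "\<dots> \<longleftrightarrow> hcls (Suc n) \<phi> = hcls (Suc n) \<phi>'"
      by (rule HH_ops(4)[symmetric]) (use PZ[OF a] PZ[OF a'] in blast)+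
    finally show "tcls n D = tcls n D' \<longleftrightarrow> hcls (Suc n) \<phi> = hcls (Suc n) \<phi>'" .
  qed
  then obtain \<Psi> where \<Psi>: "linear_iso (TS n) (HH\<^sub>E (Suc n)) \<Psi>"
    "\<And>D \<phi>. P D \<phi> \<Longrightarrow> \<Psi> (tcls n D) = hcls (Suc n) \<phi>" by blast
  have "\<exists>\<phi>\<in>?Z'. restricts_to E \<pi> s n D \<phi> \<and> \<Psi> (tcls n D) = hcls (Suc n) \<phi>"
    if s: "homotopy_section sA R \<epsilon> s" and D: "D \<in> ?Z" for s D
  proof -
    obtain \<theta> where t: "rel n 0 (hat D) \<theta>" "derA n \<theta>" using rel_hat_left[OF D] by blast
    obtain \<psi> where p: "\<psi> \<in> Q n" "\<And>as xs. length as = Suc n \<Longrightarrow>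
        hat D (s as) xs = smE ?c (\<theta> (hd as) (tl as @ xs)) + inn \<psi> (hd as) (tl as @ xs)"
      using rel_restrict_Suc[of m 0 "hat D" \<theta> s, OF _ s] t(1) unfolding m by auto
    let ?\<phi> = "uncurry_hd (\<lambda>a xs. smE ?c (\<theta> a xs) + inn \<psi> a xs)"
    have Z': "?\<phi> \<in> ?Z'" unfolding cocycles_derA by (rule derA_add[OF derA_sm[OF t(2)] derA_inn[OF p(1)]])
    then have Q': "?\<phi> \<in> Q (Suc n)" by (simp add: cocycles_def Q_iff)
    have "restricts_to E \<pi> s n D ?\<phi>" unfolding restricts_to_def
    proof (intro allI impI)
      fix as :: "'a list" assume l: "length as = Suc n"
      then have ne: "as \<noteq> []" by auto
      have "hat D (s as) [] = ?\<phi> as" using p(2)[OF l, of "[]"] ne by (simp add: uncurry_hd_def)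
      then show "tensor_map E Kd D (\<pi> (s as)) = pure_tensor E Kd (?\<phi> as) 1"
        using tensor_map_eq_pure[OF linf_cycle[OF D] section_carrier[OF s ne] Q_val[OF Q']] by simp
    qed
    moreover have "P D (?u \<theta>)" unfolding P_def using D t(1) by blast
    moreover have "hcls (Suc n) (?u \<theta>) = hcls (Suc n) ?\<phi>"
    proof -
      have "inn (\<lambda>ys. - \<psi> ys) a xs = - inn \<psi> a xs" for a xs using inn_sm[of "-1" \<psi> a xs] by simp
      then have "(\<lambda>as. ?u \<theta> as + smE (- 1) (?\<phi> as)) = uncurry_hd (inn (\<lambda>ys. smE (- 1) (\<psi> ys)))"
        by (intro ext) (simp add: uncurry_hd_def)
      also have "\<dots> \<in> cobdr (Suc n)" unfolding coboundary_iff using Q_sm[OF p(1)] by blast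
      finally show ?thesis using HH_ops(4)[OF u_cocycle[OF t(2)] Z'] by simp
    qed
    ultimately show ?thesis using \<Psi>(2)[of D "?u \<theta>"] Z' by auto
  qed
  then show ?thesis using \<Psi>(1) by auto
qed

end

lemma End_alg_derived_rep:
  fixes sA :: "'k::field_char_0 \<Rightarrow> 'a \<Rightarrow> 'a::ring_1"
    and sV :: "'k \<Rightarrow> 'v \<Rightarrow> 'v::ab_group_add"
  assumes A: "k_algebra sA" and V: "vector_space sV" and \<rho>: "representation sA sV \<rho>"
    and R: "cofibrant_resolution R (alg_of sA) \<epsilon>"
    and rep: "represents R (End_alg sV) RV \<pi>" and cor: "corresponds R (End_alg sV) RV \<pi> (\<rho> \<circ> \<epsilon>) \<rho>V"
  shows "derived_rep sA R \<epsilon> (\<lambda>c f v. sV c (f v)) (carrier (End_alg sV)) (lact \<rho>) (ract \<rho>) (End_alg sV) \<rho> RV \<pi> \<rho>V"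
proof -
  interpret V: vector_space sV by fact
  interpret A: vector_space sA using A by (simp add: k_algebra_def)
  have E: "f \<in> carrier (End_alg sV) \<longleftrightarrow> (\<forall>x y. f (x + y) = f x + f y) \<and> (\<forall>c x. f (sV c x) = sV c (f x))" for f
    unfolding End_alg_def linear_iff_module_hom module_hom_iff using V.module_axioms by simp
  have o: "mult (End_alg sV) = (\<circ>)" "one (End_alg sV) = id" "zero (End_alg sV) = 0" "add (End_alg sV) = (+)"
    "smult (End_alg sV) = (\<lambda>c f v. sV c (f v))"
    by (auto simp: End_alg_def fun_eq_iff)
  have r: "\<rho> a \<in> carrier (End_alg sV)" "\<rho> (a + b) = \<rho> a + \<rho> b" "\<rho> (a * b) = \<rho> a \<circ> \<rho> b" "\<rho> 1 = id" "\<rho> (sA c a) = (\<lambda>v. sV c (\<rho> a v))" for a b c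
    using \<rho> unfolding representation_def ring_hom_def by (auto simp: alg_of_def o)
  have rv: "\<rho> a (x + y) = \<rho> a x + \<rho> a y" "\<rho> a (sV c x) = sV c (\<rho> a x)" for a x y c
    using r(1)[of a] unfolding E by blast+
  have vE: "vector_space (\<lambda>c f v. sV c (f v))"
    by unfold_locales (auto simp: fun_eq_iff V.scale_right_distrib V.scale_left_distrib)
  have sm: "sA c a * b = sA c (a * b)" "a * sA c b = sA c (a * b)" for a b c
    using A by (auto simp: k_algebra_def)
  show ?thesis
  proof (intro derived_rep.intro tangent.intro resolution.intro coeff.intro coeff_axioms.intro coeff_alg.intro coeff_alg_axioms.intro
      derived_rep_axioms.intro A R rep cor vE A.vector_space_axioms)
  qed (auto simp: E o r rv sm lact_def ract_def fun_eq_iff V.scale_right_distrib V.scale_left_distrib mult.commute add_ac)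
qed

theorem proposition5p1:
  fixes sA :: "'k::field_char_0 \<Rightarrow> 'a \<Rightarrow> 'a::ring_1"
    and sV :: "'k \<Rightarrow> 'v \<Rightarrow> 'v::ab_group_add"
    and \<rho> :: "'a \<Rightarrow> 'v \<Rightarrow> 'v"
    and R RV :: "('k, 'u) dga"
    and \<epsilon> :: "'u \<Rightarrow> 'a"
    and \<pi> :: "'u \<Rightarrow> (('v \<Rightarrow> 'v) \<times> 'u \<Rightarrow> 'k) set"
    and \<rho>V :: "'u \<Rightarrow> 'k"
  assumes "k_algebra sA"
    and "\<exists>Basis. finite_dimensional_vector_space sV Basis"
    and "\<exists>v::'v. v \<noteq> 0"
    and "representation sA sV \<rho>"
    and "cofibrant_resolution R (alg_of sA) \<epsilon>"
    and "represents R (End_alg sV) RV \<pi>"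
    and "corresponds R (End_alg sV) RV \<pi> (\<rho> \<circ> \<epsilon>) \<rho>V"
  shows "(\<exists>\<Psi>. linear_iso (tangent_space RV \<rho>V 0) (Der sA (End_alg sV) (lact \<rho>) (ract \<rho>)) \<Psi> \<and>
           (\<forall>s. homotopy_section sA R \<epsilon> s \<longrightarrow>
              (\<forall>D\<in>dg_der_cycles RV \<rho>V (in_degree_0 ground) 0.
                 restricts_to (End_alg sV) \<pi> s 0 D (\<lambda>as. \<Psi> (tangent_class RV \<rho>V 0 D) (hd as))))) \<and>
         (\<forall>n\<ge>1. \<exists>\<Psi>. linear_iso (tangent_space RV \<rho>V n)
                       (HH sA (End_alg sV) (lact \<rho>) (ract \<rho>) (n + 1)) \<Psi> \<and>
           (\<forall>s. homotopy_section sA R \<epsilon> s \<longrightarrow>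
              (\<forall>D\<in>dg_der_cycles RV \<rho>V (in_degree_0 ground) (- int n).
                 \<exists>\<phi>\<in>cocycles sA (End_alg sV) (lact \<rho>) (ract \<rho>) (n + 1).
                   restricts_to (End_alg sV) \<pi> s n D \<phi> \<and>
                   \<Psi> (tangent_class RV \<rho>V n D) =
                     HH_class sA (End_alg sV) (lact \<rho>) (ract \<rho>) (n + 1) \<phi>)))"
proof -
  obtain Basis where "finite_dimensional_vector_space sV Basis" using assms(2) by blast
  then interpret V: finite_dimensional_vector_space sV Basis .
  have V: "vector_space sV" by unfold_locales
  interpret derived_rep sA R \<epsilon> "\<lambda>c f v. sV c (f v)" "carrier (End_alg sV)" "lact \<rho>" "ract \<rho>" "End_alg sV" \<rho> RV \<pi> \<rho>V
    by (rule End_alg_derived_rep[OF assms(1) V assms(4-7)])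
  show ?thesis using tangent_degree_0 tangent_positive_degree by blast
qed

end
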